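(* Let $T$ be a string of length $n$ and let $\tau$ be any parameter with $1 \leq \tau \leq n$. Then $T$ can be preprocessed into a data structure supporting $\mathrm{LCE}(i,j)$ queries on $T$ such that the data structure (i) uses $O(n/\sqrt{\tau})$ space and supports queries in $O(\tau)$ time, where the preprocessing of $T$ can be done in $O(n^2/\sqrt{\tau})$ time and $O(n/\sqrt{\tau})$ space; or (ii) uses $O(n/\tau)$ space and supports queries in $O\big(\tau \log(|\mathrm{LCE}(i,j)|/\tau)\big)$ time, where the preprocessing of $T$ can be done in $O(n)$ time and $O(n/\tau)$ space; this solution is randomised (Monte-Carlo): with high probability, all queries are answered correctly; or (iii) uses $O(n/\tau)$ space and supports queries in $O\big(\tau \log(|\mathrm{LCE}(i,j)|/\tau)\big)$ time, where the preprocessing of $T$ can be done in $O(n\log n)$ time and $O(n)$ space; this solution is randomised (Las-Vegas): queries are always answered correctly and the preprocessing time bound is achieved with high probability. All bounds are worst-case unless stated otherwise.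
   Context: For a string $T$ of length $n$ with positions $1,\dots,n$, and indices $i,j$, the longest common extension $\mathrm{LCE}(i,j)$ is the longest common prefix of the suffixes $T[i\ldots n]$ and $T[j\ldots n]$, and $|\mathrm{LCE}(i,j)|$ denotes its length (an LCE query returns this length). The input string $T$ is given in read-only memory and is not counted in the space complexity; space is measured in machine words. "With high probability" means with probability at least $1-1/n^c$ for any constant $c$. *)

theory Defs
  imports "HOL-Probability.Probability" "HOL-Library.Sublist" "HOL-Library.Log_Nat"
begin

section \<open>Longest common extensions\<close>

text \<open>Positions are 1-based, so the suffix of \<open>T\<close> starting at position \<open>i\<close> is \<open>drop (i - 1) T\<close>.\<close>

definition LCE :: "'a list \<Rightarrow> nat \<Rightarrow> nat \<Rightarrow> 'a list" where
  "LCE T i j = longest_common_prefix (drop (i - 1) T) (drop (j - 1) T)"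


section \<open>A word RAM with read-only input\<close>

text \<open>
  Programs are finite texts over registers named by natural numbers. A program mentions only
  finitely many registers, which therefore account for \<open>O(1)\<close> words; they are not part of
  \<open>mem\<close>. There are no procedures, so the control stack of a configuration (below) has
  a height bounded by the nesting depth of the program.

  Operands \<open>x y z\<close> are register names:
  \<open>Const x k\<close> is \<open>x := k\<close>,
  \<open>Op f x y z\<close> is \<open>x := f y z\<close>,
  \<open>Load x y\<close> is \<open>x := mem[y]\<close>,
  \<open>Store x y\<close> is \<open>mem[x] := y\<close>,
  \<open>Input x y\<close> is \<open>x := T[y]\<close>,
  \<open>Rand x\<close> sets \<open>x\<close> to a fresh uniformly random word.
\<close>

datatype binop = Add | Sub | Mul | Div | Mod | And | Or | Xor | Shl | Shr | Eq | Less

datatype com =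
    Skip
  | Const nat nat
  | Op binop nat nat nat
  | Load nat nat
  | Store nat nat
  | Input nat nat
  | Rand nat
  | Seq com com
  | Cond nat com com
  | While nat com

primrec rand_free :: "com \<Rightarrow> bool" where
  "rand_free Skip = True"
| "rand_free (Const x k) = True"
| "rand_free (Op f x y z) = True"
| "rand_free (Load x y) = True"
| "rand_free (Store x y) = True"
| "rand_free (Input x y) = True"
| "rand_free (Rand x) = False"
| "rand_free (Seq c d) = (rand_free c \<and> rand_free d)"
| "rand_free (Cond x c d) = (rand_free c \<and> rand_free d)"
| "rand_free (While x c) = rand_free c"

text \<open>Words of \<open>w\<close> bits are the natural numbers below \<open>2 ^ w\<close>, with wrap-around arithmetic.\<close>

primrec binop_val :: "nat \<Rightarrow> binop \<Rightarrow> nat \<Rightarrow> nat \<Rightarrow> nat" where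
  "binop_val w Add a b = (a + b) mod 2 ^ w"
| "binop_val w Sub a b = (2 ^ w + a - b) mod 2 ^ w"
| "binop_val w Mul a b = (a * b) mod 2 ^ w"
| "binop_val w Div a b = a div b"
| "binop_val w Mod a b = a mod b"
| "binop_val w And a b = Bit_Operations.and a b"
| "binop_val w Or a b = Bit_Operations.or a b"
| "binop_val w Xor a b = Bit_Operations.xor a b"
| "binop_val w Shl a b = push_bit b a mod 2 ^ w"
| "binop_val w Shr a b = drop_bit b a"
| "binop_val w Eq a b = (if a = b then 1 else 0)"
| "binop_val w Less a b = (if a < b then 1 else 0)"

text \<open>
  The working memory is a list of fixed length: this length is the space given to a computation.
\<close>

record state =
  regs :: "nat \<Rightarrow> nat"
  mem :: "nat list"

type_synonym config = "com list \<times> state"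

definition set_reg :: "nat \<Rightarrow> nat \<Rightarrow> state \<Rightarrow> state" where
  "set_reg x v s = s\<lparr>regs := (regs s)(x := v)\<rparr>"

text \<open>
  One unit of time. A configuration is a stack of commands still to be executed together with a
  state; it has halted when the stack is empty. A memory access beyond the available space, or an
  input access outside the positions \<open>1, \<dots>, length T\<close>, blocks forever, so a
  computation that halts has respected its space bound.
\<close>

fun step :: "nat \<Rightarrow> nat list \<Rightarrow> config \<Rightarrow> config pmf" where
  "step w T ([], s) = return_pmf ([], s)"
| "step w T (Skip # k, s) = return_pmf (k, s)"
| "step w T (Const x v # k, s) = return_pmf (k, set_reg x (v mod 2 ^ w) s)"
| "step w T (Op f x y z # k, s) =
     return_pmf (k, set_reg x (binop_val w f (regs s y) (regs s z)) s)"
| "step w T (Load x y # k, s) = return_pmf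
     (if regs s y < length (mem s) then (k, set_reg x (mem s ! regs s y) s)
      else (Load x y # k, s))"
| "step w T (Store x y # k, s) = return_pmf
     (if regs s x < length (mem s) then (k, s\<lparr>mem := (mem s)[regs s x := regs s y]\<rparr>)
      else (Store x y # k, s))"
| "step w T (Input x y # k, s) = return_pmf
     (if regs s y \<in> {1..length T} then (k, set_reg x (T ! (regs s y - 1)) s)
      else (Input x y # k, s))"
| "step w T (Rand x # k, s) = map_pmf (\<lambda>v. (k, set_reg x v s)) (pmf_of_set {..<2 ^ w})"
| "step w T (Seq c d # k, s) = return_pmf (c # d # k, s)"
| "step w T (Cond x c d # k, s) = return_pmf ((if regs s x \<noteq> 0 then c else d) # k, s)"
| "step w T (While x c # k, s) = return_pmf
     (if regs s x \<noteq> 0 then c # While x c # k else k, s)"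

definition run :: "nat \<Rightarrow> nat list \<Rightarrow> nat \<Rightarrow> config \<Rightarrow> config pmf" where
  "run w T t c = ((\<lambda>p. bind_pmf p (step w T)) ^^ t) (return_pmf c)"

definition halted :: "config \<Rightarrow> bool" where
  "halted c \<longleftrightarrow> fst c = []"

definition memory :: "config \<Rightarrow> nat list" where
  "memory c = mem (snd c)"

text \<open>Arguments are passed in the registers \<open>0, 1, \<dots>\<close>; all other registers are \<open>0\<close>.\<close>

definition start :: "com \<Rightarrow> nat list \<Rightarrow> nat list \<Rightarrow> config" where
  "start P args M =
     ([P], \<lparr>regs = (\<lambda>x. if x < length args then args ! x else 0), mem = M\<rparr>)"


section \<open>Preprocessing and queries\<close>

text \<open>Machine words have \<open>\<kappa>\<close> times as many bits as the binary representation of \<open>n\<close>.\<close>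

definition word_bits :: "nat \<Rightarrow> nat \<Rightarrow> nat" where
  "word_bits \<kappa> n = \<kappa> * floorlog 2 n"

text \<open>Strings of length \<open>n\<close> over an integer alphabet of size \<open>n\<close> to the power \<open>O(1)\<close>.\<close>

definition texts :: "nat \<Rightarrow> nat list set" where
  "texts \<sigma> = {T. set T \<subseteq> {..<2 ^ (\<sigma> * floorlog 2 (length T))}}"

text \<open>Distribution of the configuration after \<open>t\<close> steps of preprocessing in \<open>S\<close> words, initially \<open>0\<close>.\<close>

definition preprocess ::
    "nat \<Rightarrow> nat list \<Rightarrow> nat \<Rightarrow> com \<Rightarrow> nat \<Rightarrow> nat \<Rightarrow> config pmf" where
  "preprocess w T \<tau> P S t = run w T t (start P [length T, \<tau>] (replicate S 0))"

text \<open>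
  On the data structure \<open>D\<close>, the query program halts within \<open>t\<close> steps and returns \<open>r\<close> in
  register \<open>0\<close>. It works in the space occupied by \<open>D\<close>, and leaves \<open>D\<close>
  intact for subsequent queries.
\<close>

definition answers ::
    "nat \<Rightarrow> nat list \<Rightarrow> nat \<Rightarrow> com \<Rightarrow> nat list \<Rightarrow> nat \<Rightarrow> nat \<Rightarrow> nat \<Rightarrow> nat \<Rightarrow> bool" where
  "answers w T \<tau> Q D i j t r \<longleftrightarrow>
     (\<forall>c \<in> set_pmf (run w T t (start Q [length T, \<tau>, i, j] D)).
        halted c \<and> regs (snd c) 0 = r \<and> memory c = D)"

text \<open>
  Logarithms in time bounds are at least \<open>1\<close>; in particular the factor \<open>log (|LCE(i,j)| / \<tau>)\<close>
  is read as \<open>1\<close> when the extension is shorter than \<open>2 * \<tau>\<close>.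
\<close>

definition lg :: "real \<Rightarrow> real" where
  "lg x = max 1 (log 2 x)"

abbreviation nfloor :: "real \<Rightarrow> nat" where
  "nfloor x \<equiv> nat \<lfloor>x\<rfloor>"

end

theory Submission
  imports Defs "HOL-Number_Theory.Cong" "HOL-Real_Asymp.Real_Asymp"
begin

text \<open>
  Programs are written in a small structured language that is compiled to the RAM, with a weakest
  precondition calculus counting RAM steps; a randomised run is a deterministic run on a tape of random words.

  Parts (ii) and (iii) use Karp-Rabin fingerprints. The fingerprints of every \<open>t\<close>-th prefix are stored,
  where \<open>t\<close> is the power of two with \<open>t \<le> \<tau> < 2 * t\<close>, so the fingerprint of a substring is
  obtained by reading \<open>O(t)\<close> letters. A query doubles the length of the compared substrings, starting from
  \<open>t\<close>, until they differ, then halves it, and compares the last letters directly. The modulus is a product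
  of a constant number of independent random primes of about \<open>3/2 * log n\<close> bits, found by trial division; each
  prime is bad for a fixed pair of substrings with probability about \<open>1 / sqrt n\<close>, so a large enough constant makes
  the error probability polynomially small. For (iii) the fingerprints of the lengths \<open>1, 2, 4, \<dots>\<close>
  are sorted, and neighbours with the same fingerprint must have halves with the same fingerprints: by induction on
  the length, fingerprints that pass this test never collide. Fresh primes are drawn until the test succeeds.

  For (i) let \<open>s\<close> be the rounded down square root of \<open>\<tau>\<close>. A difference cover of period \<open>s * s\<close>
  samples \<open>O(n / s)\<close> suffixes such that any two positions have a common shift below \<open>s * s\<close> into the
  sample; a query reads letters up to this shift and is then answered by a range minimum of the LCP array of
  the sampled suffixes. Sampled suffixes are inserted one by one into the sorted list, in time \<open>O(n)\<close> each.
\<close>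

text \<open>Several obstacles shape the development. The RAM wraps around, so programs are verified
  over unbounded numbers and every bound below \<open>2 ^ w\<close> is a proof obligation; the word
  length factor \<open>\<kappa>\<close> is chosen to pay for all of them. In (ii) preprocessing must
  be linear in the worst case, which rules out one large prime found by trial division: the small
  primes cost only about \<open>n powr (3/4)\<close> divisions up to logarithmic factors, and the
  number of tries is fixed in advance, an unsuccessful draw contributing the factor 1. The failure
  estimate is asymptotic, so texts shorter than a constant \<open>N\<^sub>0\<close> get no table and
  their queries compare letters. In (iii) the loop need not terminate, while correctness is claimed
  for every halted configuration at every time; hence correctness rests on the verification alone,
  and only the running time on the absence of collisions. The sampling step is a power of two so
  that the lengths compared by a query are among the verified ones.\<close>

declare One_nat_def [simp del] add_2_eq_Suc [simp del] add_2_eq_Suc' [simp del]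

section \<open>Random tapes\<close>

fun rand_reg :: "config \<Rightarrow> nat option" where
  "rand_reg (Rand x # k, s) = Some x"
| "rand_reg _ = None"

text \<open>Steps other than \<open>Rand\<close> are point masses, and \<open>the_elem\<close>
  extracts their successor. A \<open>Rand\<close> on an exhausted tape falls into the default
  branch, where the result is unspecified for \<open>w > 0\<close>; the statements below avoid that
  case by long enough tapes or by programs without \<open>Rand\<close>.\<close>

definition dstep :: "nat \<Rightarrow> nat list \<Rightarrow> config \<times> nat list \<Rightarrow> config \<times> nat list" where
  "dstep w T p = (case (rand_reg (fst p), snd p) of
      (Some x, u # us) \<Rightarrow> ((tl (fst (fst p)), set_reg x u (snd (fst p))), us)
    | _ \<Rightarrow> (the_elem (set_pmf (step w T (fst p))), snd p))"

lemma the_elem_return_pmf [simp]: "the_elem (set_pmf (return_pmf x)) = x"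
  by simp

lemma dstep_simps [simp]:
  "dstep w T (([], s), us) = (([], s), us)"
  "dstep w T ((Skip # k, s), us) = ((k, s), us)"
  "dstep w T ((Const x v # k, s), us) = ((k, set_reg x (v mod 2 ^ w) s), us)"
  "dstep w T ((Op f x y z # k, s), us) =
     ((k, set_reg x (binop_val w f (regs s y) (regs s z)) s), us)"
  "dstep w T ((Load x y # k, s), us) =
     (if regs s y < length (mem s) then (k, set_reg x (mem s ! regs s y) s)
      else (Load x y # k, s), us)"
  "dstep w T ((Store x y # k, s), us) =
     (if regs s x < length (mem s) then (k, s\<lparr>mem := (mem s)[regs s x := regs s y]\<rparr>)
      else (Store x y # k, s), us)"
  "dstep w T ((Input x y # k, s), us) =
     (if regs s y \<in> {1..length T} then (k, set_reg x (T ! (regs s y - 1)) s)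
      else (Input x y # k, s), us)"
  "dstep w T ((Rand x # k, s), u # us) = ((k, set_reg x u s), us)"
  "dstep w T ((Seq c d # k, s), us) = ((c # d # k, s), us)"
  "dstep w T ((Cond x c d # k, s), us) = (((if regs s x \<noteq> 0 then c else d) # k, s), us)"
  "dstep w T ((While x c # k, s), us) =
     ((if regs s x \<noteq> 0 then c # While x c # k else k, s), us)"
  by (simp_all add: dstep_def split: list.splits)

lemma run_0 [simp]: "run w T 0 c = return_pmf c"
  by (simp add: run_def)

lemma run_Suc: "run w T (Suc t) c = bind_pmf (step w T c) (run w T t)"
proof -
  have *: "((\<lambda>p. bind_pmf p (step w T)) ^^ t) p = bind_pmf p (run w T t)" for p
    by (induction t) (simp_all add: run_def bind_return_pmf' bind_assoc_pmf)
  show ?thesis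
    unfolding run_def[of w T "Suc t"] funpow_Suc_right o_apply bind_return_pmf using *[of "step w T c"] .
qed

abbreviation words :: "nat \<Rightarrow> nat \<Rightarrow> nat list pmf" where
  "words w N \<equiv> replicate_pmf N (pmf_of_set {..<2 ^ w})"

lemma dstep_pow_Suc: "(dstep w T ^^ Suc t) p = (dstep w T ^^ t) (dstep w T p)"
  by (simp only: funpow_Suc_right o_apply)

text \<open>A step reads at most one word, so \<open>N \<ge> t\<close> words suffice for
  \<open>t\<close> steps and the unread words integrate out. A \<open>Rand\<close> step binds the
  head of the tape and the induction continues on the remaining \<open>M\<close> words; any other
  step leaves the tape alone.\<close>

lemma run_words:
  "t \<le> N \<Longrightarrow> run w T t c = map_pmf (\<lambda>us. fst ((dstep w T ^^ t) (c, us))) (words w N)"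
proof (induction t arbitrary: c N)
  case 0
  then show ?case by simp
next
  case (Suc t)
  obtain cs s where c: "c = (cs, s)" by (cases c)
  show ?case
  proof (cases "\<exists>x k. cs = Rand x # k")
    case True
    then obtain x k where cs: "cs = Rand x # k" by blast
    obtain M where N: "N = Suc M" using Suc.prems by (cases N) auto
    have "t \<le> M" using Suc.prems N by simp
    from Suc.IH[OF this] show ?thesis
      unfolding run_Suc dstep_pow_Suc c cs N
      by (simp add: map_pmf_def bind_assoc_pmf bind_return_pmf)
  next
    case False
    then obtain c' where c': "step w T c = return_pmf c'"
      by (cases "(w, T, c)" rule: step.cases) (auto simp: c)
    have "rand_reg c = None"
      using False by (cases c rule: rand_reg.cases) (auto simp: c)
    then have "dstep w T (c, us) = (c', us)" for us
      using c' by (simp add: dstep_def)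
    then show ?thesis
      using Suc.prems unfolding run_Suc dstep_pow_Suc c'
      by (simp add: bind_return_pmf Suc.IH[of N])
  qed
qed

lemma dstep_halted: "(dstep w T ^^ t) (([], s), us) = (([], s), us)"
  by (induction t) auto

lemma dstep_append:
  assumes "us \<noteq> []"
  shows "dstep w T (c, us @ vs) = (fst (dstep w T (c, us)), snd (dstep w T (c, us)) @ vs)"
    and "length us \<le> length (snd (dstep w T (c, us))) + 1"
  using assms by (cases us; auto simp: dstep_def split: option.splits)+

text \<open>Since a step consumes at most one word, the tape \<open>us\<close> is still nonempty
  before each of the first \<open>t\<close> steps, so the words \<open>vs\<close> behind it are
  never inspected. The bound on the remaining length carries the induction.\<close>

lemma dstep_append_tape:
  assumes "t \<le> length us"
  shows "(dstep w T ^^ t) (c, us @ vs) =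
     (fst ((dstep w T ^^ t) (c, us)), snd ((dstep w T ^^ t) (c, us)) @ vs)"
    and "length us \<le> length (snd ((dstep w T ^^ t) (c, us))) + t"
proof -
  have "(dstep w T ^^ t) (c, us @ vs) =
     (fst ((dstep w T ^^ t) (c, us)), snd ((dstep w T ^^ t) (c, us)) @ vs) \<and>
    length us \<le> length (snd ((dstep w T ^^ t) (c, us))) + t"
    using assms
  proof (induction t)
    case (Suc t)
    obtain d us' where *: "(dstep w T ^^ t) (c, us) = (d, us')"
      by (metis prod.exhaust)
    have "us' \<noteq> []" using Suc * by auto
    then show ?case using Suc * dstep_append[of us' w T d] by auto
  qed simp
  then show "(dstep w T ^^ t) (c, us @ vs) =
     (fst ((dstep w T ^^ t) (c, us)), snd ((dstep w T ^^ t) (c, us)) @ vs)"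
    "length us \<le> length (snd ((dstep w T ^^ t) (c, us))) + t" by auto
qed


section \<open>A structured language over the word RAM\<close>

datatype exp =
    N nat
  | V nat
  | Bop binop exp exp
  | Ld nat exp
  | Inp exp

datatype hcom =
    SKIP
  | Asg nat exp (infix "::=" 62)
  | Sto nat exp exp
  | Rnd nat
  | HSeq hcom hcom (infixr ";;" 60)
  | HIf exp hcom hcom ("IF _ THEN _ ELSE _" [0, 61, 61] 61)
  | HWhile exp hcom ("WHILE _ DO _" [0, 61] 61)

abbreviation (input) add_exp (infixl "\<^bold>+" 75) where "a \<^bold>+ b \<equiv> Bop Add a b"
abbreviation (input) sub_exp (infixl "\<^bold>-" 75) where "a \<^bold>- b \<equiv> Bop Sub a b"
abbreviation (input) mul_exp (infixl "\<^bold>*" 80) where "a \<^bold>* b \<equiv> Bop Mul a b"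
abbreviation (input) div_exp (infixl "\<^bold>'/" 80) where "a \<^bold>/ b \<equiv> Bop Div a b"
abbreviation (input) mod_exp (infixl "\<^bold>%" 80) where "a \<^bold>% b \<equiv> Bop Mod a b"
abbreviation (input) less_exp (infix "\<^bold><" 70) where "a \<^bold>< b \<equiv> Bop Less a b"
abbreviation (input) eq_exp (infix "\<^bold>=" 70) where "a \<^bold>= b \<equiv> Bop Eq a b"
abbreviation (input) or_exp (infixl "\<^bold>|" 65) where "a \<^bold>| b \<equiv> Bop Or a b"
abbreviation (input) and_exp (infixl "\<^bold>&" 67) where "a \<^bold>& b \<equiv> Bop And a b"

record st =
  vars :: "nat \<Rightarrow> nat"
  arrs :: "nat \<Rightarrow> nat \<Rightarrow> nat"
  tape :: "nat list"
  clk :: nat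

primrec opv :: "binop \<Rightarrow> nat \<Rightarrow> nat \<Rightarrow> nat" where
  "opv Add a b = a + b"
| "opv Sub a b = a - b"
| "opv Mul a b = a * b"
| "opv Div a b = a div b"
| "opv Mod a b = a mod b"
| "opv And a b = Bit_Operations.and a b"
| "opv Or a b = Bit_Operations.or a b"
| "opv Xor a b = Bit_Operations.xor a b"
| "opv Shl a b = a * 2 ^ b"
| "opv Shr a b = a div 2 ^ b"
| "opv Eq a b = (if a = b then 1 else 0)"
| "opv Less a b = (if a < b then 1 else 0)"

text \<open>The side condition under which the wrap-around operation agrees with the unbounded
  \<open>opv\<close>. Subtraction demands \<open>b \<le> a\<close>, so truncation at 0 never occurs
  in a verified program.\<close>

primrec opok :: "nat \<Rightarrow> binop \<Rightarrow> nat \<Rightarrow> nat \<Rightarrow> bool" where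
  "opok w Add a b = (a + b < 2 ^ w)"
| "opok w Sub a b = (b \<le> a \<and> a < 2 ^ w)"
| "opok w Mul a b = (a * b < 2 ^ w)"
| "opok w Div a b = True"
| "opok w Mod a b = True"
| "opok w And a b = True"
| "opok w Or a b = True"
| "opok w Xor a b = True"
| "opok w Shl a b = (a * 2 ^ b < 2 ^ w)"
| "opok w Shr a b = True"
| "opok w Eq a b = True"
| "opok w Less a b = True"

lemma binop_val_opv: "opok w f a b \<Longrightarrow> binop_val w f a b = opv f a b"
proof (cases f)
  case Sub
  assume *: "opok w f a b"
  then have "2 ^ w + a - b = 2 ^ w + (a - b)" using Sub by simp
  with * Sub have "binop_val w f a b = (2 ^ w + (a - b)) mod 2 ^ w"
    by simp
  also have "\<dots> = (a - b) mod 2 ^ w" by (rule mod_add_self1)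
  finally show ?thesis using * Sub by (simp add: less_imp_diff_less)
qed (simp_all add: push_bit_eq_mult drop_bit_eq_div)

text \<open>Registers from 100 on hold intermediate values of compiled expressions.\<close>

abbreviation TMP :: nat where "TMP \<equiv> 100"

text \<open>
  The \<open>K\<close> arrays of a program are interleaved: cell \<open>i\<close> of array \<open>a\<close> is the memory word \<open>K * i + a\<close>.
  No base addresses are needed, at the cost of reserving the same length for every array.
\<close>

primrec comp :: "nat \<Rightarrow> exp \<Rightarrow> nat \<Rightarrow> com" where
  "comp K (N k) d = Const d k"
| "comp K (V x) d = Op Or d x x"
| "comp K (Bop f a b) d = Seq (comp K a d) (Seq (comp K b (d + 1)) (Op f d d (d + 1)))"
| "comp K (Ld a e) d = Seq (comp K e d) (Seq (Const (d + 1) K) (Seq (Op Mul d d (d + 1))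
     (Seq (Const (d + 1) a) (Seq (Op Add d d (d + 1)) (Load d d)))))"
| "comp K (Inp e) d = Seq (comp K e d) (Seq (Const (d + 1) 1) (Seq (Op Add d d (d + 1)) (Input d d)))"

text \<open>Exact numbers of RAM steps, including one step for each \<open>Seq\<close> in the
  compiled code.\<close>

primrec ecost :: "exp \<Rightarrow> nat" where
  "ecost (N k) = 1"
| "ecost (V x) = 1"
| "ecost (Bop f a b) = ecost a + ecost b + 3"
| "ecost (Ld a e) = ecost e + 10"
| "ecost (Inp e) = ecost e + 6"

text \<open>\<open>Or\<close> of a register with itself is the register move of this machine. A loop
  tests a register, so its guard is evaluated once before the loop and again at the end of each
  iteration.\<close>

primrec compile :: "nat \<Rightarrow> hcom \<Rightarrow> com" where
  "compile K SKIP = Skip"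
| "compile K (x ::= e) = Seq (comp K e TMP) (Op Or x TMP TMP)"
| "compile K (Sto a e v) = Seq (comp K e TMP) (Seq (Const (TMP + 1) K) (Seq (Op Mul TMP TMP (TMP + 1))
     (Seq (Const (TMP + 1) a) (Seq (Op Add TMP TMP (TMP + 1))
     (Seq (comp K v (TMP + 1)) (Store TMP (TMP + 1)))))))"
| "compile K (Rnd x) = Rand x"
| "compile K (c ;; d) = Seq (compile K c) (compile K d)"
| "compile K (IF b THEN c ELSE d) = Seq (comp K b TMP) (Cond TMP (compile K c) (compile K d))"
| "compile K (WHILE b DO c) = Seq (comp K b TMP) (While TMP (Seq (compile K c) (comp K b TMP)))"

lemma rand_free_comp [simp]: "rand_free (comp K e d)"
  by (induction e arbitrary: d) auto

text \<open>Quantifying over the rest \<open>k\<close> of the command stack makes such runs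
  composable inside any context.\<close>

definition reach :: "nat \<Rightarrow> nat list \<Rightarrow> com \<Rightarrow> state \<times> nat list \<Rightarrow> nat \<Rightarrow> state \<times> nat list \<Rightarrow> bool" where
  "reach w T c p t q \<longleftrightarrow>
     (\<forall>k. (dstep w T ^^ t) ((c # k, fst p), snd p) = ((k, fst q), snd q))"

lemma reach_Seq:
  assumes "reach w T c p t q" "reach w T d q u r"
  shows "reach w T (Seq c d) p (t + u + 1) r"
proof -
  have "(dstep w T ^^ (u + (t + 1))) ((Seq c d # k, fst p), snd p) = ((k, fst r), snd r)" for k
    using assms unfolding reach_def funpow_add
    by (simp add: funpow_add One_nat_def)
  then show ?thesis unfolding reach_def by (simp add: add.commute add.left_commute)
qed

lemma reach_cost: "reach w T c p t q \<Longrightarrow> t = u \<Longrightarrow> reach w T c p u q"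
  by simp

lemma reach_1: "(\<And>k. dstep w T ((c # k, fst p), snd p) = ((k, fst q), snd q)) \<Longrightarrow> reach w T c p 1 q"
  by (simp add: reach_def One_nat_def)

text \<open>All \<open>K\<close> arrays have length \<open>S\<close>.\<close>

locale machine =
  fixes w :: nat and T :: "nat list" and K S :: nat
  assumes arrays_fit: "K * S < 2 ^ w"
    and text_fits: "length T < 2 ^ w"
    and word_size: "10 \<le> w"
begin

text \<open>This is the purpose of the bound \<open>10 \<le> w\<close>: numerals below 1024 in the
  programs never overflow, whatever the length of the text.\<close>

lemma const_fits: "(k::nat) < 1024 \<Longrightarrow> k < 2 ^ w"
  using power_increasing[OF word_size, of "2::nat"] by simp

lemma const_fits_simps [simp]:
  "1 < (2::nat) ^ w" "numeral k < (1024::nat) \<Longrightarrow> numeral k < (2::nat) ^ w"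
  using const_fits[of 1] const_fits[of "numeral k"] by simp_all

section \<open>Timed semantics and weakest preconditions\<close>

primrec ev :: "exp \<Rightarrow> st \<Rightarrow> nat" where
  "ev (N k) \<sigma> = k"
| "ev (V x) \<sigma> = vars \<sigma> x"
| "ev (Bop f a b) \<sigma> = opv f (ev a \<sigma>) (ev b \<sigma>)"
| "ev (Ld a e) \<sigma> = arrs \<sigma> a (ev e \<sigma>)"
| "ev (Inp e) \<sigma> = T ! ev e \<sigma>"

text \<open>\<open>Inp\<close> is 0-based at this level and the compiled code adds 1, hence the test
  \<open>ev e \<sigma> < length T\<close>. Source variables must lie below \<open>TMP\<close>, where
  intermediate values begin.\<close>

primrec ok :: "exp \<Rightarrow> st \<Rightarrow> bool" where
  "ok (N k) \<sigma> \<longleftrightarrow> k < 2 ^ w"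
| "ok (V x) \<sigma> \<longleftrightarrow> x < TMP"
| "ok (Bop f a b) \<sigma> \<longleftrightarrow> ok a \<sigma> \<and> ok b \<sigma> \<and> opok w f (ev a \<sigma>) (ev b \<sigma>)"
| "ok (Ld a e) \<sigma> \<longleftrightarrow> ok e \<sigma> \<and> a < K \<and> ev e \<sigma> < S"
| "ok (Inp e) \<sigma> \<longleftrightarrow> ok e \<sigma> \<and> ev e \<sigma> < length T"

abbreviation tick :: "nat \<Rightarrow> st \<Rightarrow> st" where
  "tick t \<sigma> \<equiv> \<sigma>\<lparr>clk := clk \<sigma> + t\<rparr>"

text \<open>The clock counts the steps of the compiled program exactly: the tick of
  \<open>;;\<close> is the unfolding of \<open>Seq\<close>, and the 2 added to a guard pays for a
  \<open>Seq\<close> and the branch. There is no rule for overflow, invalid addresses or an empty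
  tape, so the existence of a derivation already includes termination and all safety
  conditions.\<close>

inductive big :: "hcom \<Rightarrow> st \<Rightarrow> st \<Rightarrow> bool" where
  SKIP: "big SKIP \<sigma> (tick 1 \<sigma>)"
| Asg: "x < TMP \<Longrightarrow> ok e \<sigma> \<Longrightarrow>
    big (x ::= e) \<sigma> (\<sigma>\<lparr>vars := (vars \<sigma>)(x := ev e \<sigma>), clk := clk \<sigma> + (ecost e + 2)\<rparr>)"
| Sto: "ok e \<sigma> \<Longrightarrow> ok v \<sigma> \<Longrightarrow> a < K \<Longrightarrow> ev e \<sigma> < S \<Longrightarrow>
    big (Sto a e v) \<sigma> (\<sigma>\<lparr>arrs := (arrs \<sigma>)(a := (arrs \<sigma> a)(ev e \<sigma> := ev v \<sigma>)),
      clk := clk \<sigma> + (ecost e + ecost v + 11)\<rparr>)"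
| Rnd: "x < TMP \<Longrightarrow> tape \<sigma> = u # us \<Longrightarrow>
    big (Rnd x) \<sigma> (\<sigma>\<lparr>vars := (vars \<sigma>)(x := u), tape := us, clk := clk \<sigma> + 1\<rparr>)"
| HSeq: "big c (tick 1 \<sigma>) \<sigma>1 \<Longrightarrow> big d \<sigma>1 \<sigma>2 \<Longrightarrow> big (c ;; d) \<sigma> \<sigma>2"
| IfT: "ok b \<sigma> \<Longrightarrow> ev b \<sigma> \<noteq> 0 \<Longrightarrow> big c (tick (ecost b + 2) \<sigma>) \<sigma>1 \<Longrightarrow> big (IF b THEN c ELSE d) \<sigma> \<sigma>1"
| IfF: "ok b \<sigma> \<Longrightarrow> ev b \<sigma> = 0 \<Longrightarrow> big d (tick (ecost b + 2) \<sigma>) \<sigma>1 \<Longrightarrow> big (IF b THEN c ELSE d) \<sigma> \<sigma>1"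
| WhF: "ok b \<sigma> \<Longrightarrow> ev b \<sigma> = 0 \<Longrightarrow> big (WHILE b DO c) \<sigma> (tick (ecost b + 2) \<sigma>)"
| WhT: "ok b \<sigma> \<Longrightarrow> ev b \<sigma> \<noteq> 0 \<Longrightarrow> big c (tick (ecost b + 2) \<sigma>) \<sigma>1 \<Longrightarrow>
    big (WHILE b DO c) \<sigma>1 \<sigma>2 \<Longrightarrow> big (WHILE b DO c) \<sigma> \<sigma>2"

definition wp :: "hcom \<Rightarrow> (st \<Rightarrow> bool) \<Rightarrow> st \<Rightarrow> bool" where
  "wp c Q \<sigma> \<longleftrightarrow> (\<exists>\<sigma>'. big c \<sigma> \<sigma>' \<and> Q \<sigma>')"

inductive_cases SKIP_E: "big SKIP \<sigma> \<sigma>'"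
inductive_cases Asg_E: "big (x ::= e) \<sigma> \<sigma>'"
inductive_cases Sto_E: "big (Sto a e v) \<sigma> \<sigma>'"
inductive_cases Rnd_E: "big (Rnd x) \<sigma> \<sigma>'"
inductive_cases HSeq_E: "big (c ;; d) \<sigma> \<sigma>'"
inductive_cases HIf_E: "big (IF b THEN c ELSE d) \<sigma> \<sigma>'"

lemma wp_SKIP: "wp SKIP Q \<sigma> = Q (tick 1 \<sigma>)"
  unfolding wp_def by (auto elim: SKIP_E intro: big.SKIP)

lemma wp_Asg: "wp (x ::= e) Q \<sigma> \<longleftrightarrow> x < TMP \<and> ok e \<sigma> \<and>
    Q (\<sigma>\<lparr>vars := (vars \<sigma>)(x := ev e \<sigma>), clk := clk \<sigma> + (ecost e + 2)\<rparr>)"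
  unfolding wp_def by (auto elim: Asg_E intro: big.Asg)

lemma wp_Sto: "wp (Sto a e v) Q \<sigma> \<longleftrightarrow> ok e \<sigma> \<and> ok v \<sigma> \<and> a < K \<and> ev e \<sigma> < S \<and>
    Q (\<sigma>\<lparr>arrs := (arrs \<sigma>)(a := (arrs \<sigma> a)(ev e \<sigma> := ev v \<sigma>)),
      clk := clk \<sigma> + (ecost e + ecost v + 11)\<rparr>)"
  unfolding wp_def by (auto elim: Sto_E intro: big.Sto)

lemma wp_Rnd: "wp (Rnd x) Q \<sigma> \<longleftrightarrow> x < TMP \<and> (\<exists>u us. tape \<sigma> = u # us \<and>
    Q (\<sigma>\<lparr>vars := (vars \<sigma>)(x := u), tape := us, clk := clk \<sigma> + 1\<rparr>))"
  unfolding wp_def by (auto elim: Rnd_E intro: big.Rnd)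

lemma wp_HSeq: "wp (c ;; d) Q \<sigma> = wp c (wp d Q) (tick 1 \<sigma>)"
  unfolding wp_def by (metis HSeq_E big.HSeq)

lemma wp_HIf: "wp (IF b THEN c ELSE d) Q \<sigma> \<longleftrightarrow> ok b \<sigma> \<and>
    (if ev b \<sigma> \<noteq> 0 then wp c Q (tick (ecost b + 2) \<sigma>) else wp d Q (tick (ecost b + 2) \<sigma>))"
proof (cases "ev b \<sigma> = 0")
  case True
  then show ?thesis unfolding wp_def by (auto elim: HIf_E intro: big.IfF)
next
  case False
  then show ?thesis unfolding wp_def by (auto elim: HIf_E intro: big.IfT)
qed

lemmas wp_simps = wp_SKIP wp_Asg wp_Sto wp_Rnd wp_HSeq wp_HIf

lemma wp_mono: "wp c Q \<sigma> \<Longrightarrow> (\<And>\<sigma>'. Q \<sigma>' \<Longrightarrow> R \<sigma>') \<Longrightarrow> wp c R \<sigma>"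
  unfolding wp_def by blast

lemma wp_while_unfold:
  assumes "ok b \<sigma>"
    and "ev b \<sigma> \<noteq> 0 \<Longrightarrow> wp c (wp (WHILE b DO c) Q) (tick (ecost b + 2) \<sigma>)"
    and "ev b \<sigma> = 0 \<Longrightarrow> Q (tick (ecost b + 2) \<sigma>)"
  shows "wp (WHILE b DO c) Q \<sigma>"
  using assms unfolding wp_def by (metis big.WhF big.WhT)

lemma wp_while:
  fixes m :: "st \<Rightarrow> nat"
  assumes "I \<sigma>"
    and "\<And>\<sigma>. I \<sigma> \<Longrightarrow> ok b \<sigma>"
    and "\<And>\<sigma>. I \<sigma> \<Longrightarrow> ev b \<sigma> \<noteq> 0 \<Longrightarrow> wp c (\<lambda>\<sigma>'. I \<sigma>' \<and> m \<sigma>' < m \<sigma>) (tick (ecost b + 2) \<sigma>)"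
    and "\<And>\<sigma>. I \<sigma> \<Longrightarrow> ev b \<sigma> = 0 \<Longrightarrow> Q (tick (ecost b + 2) \<sigma>)"
  shows "wp (WHILE b DO c) Q \<sigma>"
  using assms(1)
proof (induction "m \<sigma>" arbitrary: \<sigma> rule: less_induct)
  case less
  show ?case
  proof (rule wp_while_unfold)
    show "ok b \<sigma>" using less assms(2) by blast
    show "Q (tick (ecost b + 2) \<sigma>)" if "ev b \<sigma> = 0" using that less assms(4) by blast
    assume "ev b \<sigma> \<noteq> 0"
    then have "wp c (\<lambda>\<sigma>'. I \<sigma>' \<and> m \<sigma>' < m \<sigma>) (tick (ecost b + 2) \<sigma>)"
      using less assms(3) by blast
    then show "wp c (wp (WHILE b DO c) Q) (tick (ecost b + 2) \<sigma>)"
      by (rule wp_mono) (use less in blast)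
  qed
qed

section \<open>Correctness of the compiler\<close>

definition rel :: "nat \<Rightarrow> st \<Rightarrow> state \<times> nat list \<Rightarrow> bool" where
  "rel ml \<sigma> p \<longleftrightarrow> snd p = tape \<sigma> \<and> (\<forall>x<TMP. regs (fst p) x = vars \<sigma> x) \<and>
     mem (fst p) = map (\<lambda>x. arrs \<sigma> (x mod K) (x div K)) [0..<ml]"

lemma address:
  assumes "a < K" "i < S"
  shows "K * i + a < K * S" "(K * i + a) mod K = a" "(K * i + a) div K = i" "K < 2 ^ w"
    "a < 2 ^ w" "K * i < 2 ^ w" "K * i + a < 2 ^ w"
proof -
  have "K * i + a < K * (i + 1)" using assms by (simp add: algebra_simps)
  also have "\<dots> \<le> K * S" using assms by (intro mult_le_mono) auto
  finally show 1: "K * i + a < K * S" .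
  then show "K * i + a < 2 ^ w" "K * i < 2 ^ w" using arrays_fit by linarith+
  have "K * 1 \<le> K * S" using assms by (intro mult_le_mono) auto
  then show "K < 2 ^ w" using arrays_fit by linarith
  then show "a < 2 ^ w" using assms by linarith
qed (use assms in auto)

lemma comp_correct:
  assumes "K * S \<le> ml" "rel ml \<sigma> (s, us)" "ok e \<sigma>" "TMP \<le> d"
  shows "\<exists>s'. reach w T (comp K e d) (s, us) (ecost e) (s', us) \<and> mem s' = mem s \<and>
    regs s' d = ev e \<sigma> \<and> (\<forall>x<d. regs s' x = regs s x)"
  using assms(2-)
proof (induction e arbitrary: s d)
  case (N k)
  then show ?case
    by (intro exI[of _ "set_reg d k s"]) (auto intro!: reach_1 simp: set_reg_def)
next
  case (V x)
  then show ?case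
    by (intro exI[of _ "set_reg d (vars \<sigma> x) s"]) (auto intro!: reach_1 simp: set_reg_def rel_def)
next
  case (Bop f a b)
  from Bop.IH(1)[of s d] Bop.prems obtain s1 where
    s1: "reach w T (comp K a d) (s, us) (ecost a) (s1, us)" "mem s1 = mem s"
      "regs s1 d = ev a \<sigma>" "\<forall>x<d. regs s1 x = regs s x" by auto
  have "rel ml \<sigma> (s1, us)" using Bop.prems s1 by (auto simp: rel_def)
  from Bop.IH(2)[OF this, of "d + 1"] Bop.prems obtain s2 where
    s2: "reach w T (comp K b (d + 1)) (s1, us) (ecost b) (s2, us)" "mem s2 = mem s1"
      "regs s2 (d + 1) = ev b \<sigma>" "\<forall>x<d+1. regs s2 x = regs s1 x" by auto
  define s3 where "s3 = set_reg d (opv f (ev a \<sigma>) (ev b \<sigma>)) s2"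
  have "reach w T (Op f d d (d + 1)) (s2, us) 1 (s3, us)"
    using Bop.prems s1 s2 by (intro reach_1) (auto simp: s3_def binop_val_opv)
  note r = reach_Seq[OF s1(1) reach_Seq[OF s2(1) this]]
  have "reach w T (comp K (Bop f a b) d) (s, us) (ecost (Bop f a b)) (s3, us)"
    using r by (auto elim!: reach_cost)
  then show ?case using s1 s2 by (intro exI[of _ s3]) (auto simp: s3_def set_reg_def)
next
  case (Ld a e)
  from Ld.IH[of s d] Ld.prems obtain s1 where
    s1: "reach w T (comp K e d) (s, us) (ecost e) (s1, us)" "mem s1 = mem s"
      "regs s1 d = ev e \<sigma>" "\<forall>x<d. regs s1 x = regs s x" by auto
  have a: "a < K" "ev e \<sigma> < S" using Ld.prems by auto
  define v where "v = ev e \<sigma>"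
  define s2 where "s2 = set_reg (d + 1) K s1"
  define s3 where "s3 = set_reg d (K * v) s2"
  define s4 where "s4 = set_reg (d + 1) a s3"
  define s5 where "s5 = set_reg d (K * v + a) s4"
  define s6 where "s6 = set_reg d (arrs \<sigma> a v) s5"
  note defs = s2_def s3_def s4_def s5_def s6_def set_reg_def
  note adr = address[OF a(1) a(2), folded v_def]
  have m: "K * v + a < length (mem s1)" "mem s1 ! (K * v + a) = arrs \<sigma> a v"
    using Ld.prems(1) s1(2) adr assms(1) by (auto simp: rel_def)
  have r: "reach w T (Const (d + 1) K) (s1, us) 1 (s2, us)"
    "reach w T (Op Mul d d (d + 1)) (s2, us) 1 (s3, us)"
    "reach w T (Const (d + 1) a) (s3, us) 1 (s4, us)"
    "reach w T (Op Add d d (d + 1)) (s4, us) 1 (s5, us)"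
    "reach w T (Load d d) (s5, us) 1 (s6, us)"
    using adr m s1 by (auto intro!: reach_1 simp: defs v_def mult.commute)
  note r' = reach_Seq[OF s1(1) reach_Seq[OF r(1) reach_Seq[OF r(2) reach_Seq[OF r(3) reach_Seq[OF r(4,5)]]]]]
  have "reach w T (comp K (Ld a e) d) (s, us) (ecost (Ld a e)) (s6, us)"
    using r' by (auto elim!: reach_cost)
  then show ?case using s1 by (intro exI[of _ s6]) (auto simp: defs v_def)
next
  case (Inp e)
  from Inp.IH[of s d] Inp.prems obtain s1 where
    s1: "reach w T (comp K e d) (s, us) (ecost e) (s1, us)" "mem s1 = mem s"
      "regs s1 d = ev e \<sigma>" "\<forall>x<d. regs s1 x = regs s x" by auto
  have a: "ev e \<sigma> < length T" "1 < (2::nat) ^ w" using Inp.prems by auto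
  define v where "v = ev e \<sigma>"
  define s2 where "s2 = set_reg (d + 1) 1 s1"
  define s3 where "s3 = set_reg d (v + 1) s2"
  define s4 where "s4 = set_reg d (T ! v) s3"
  note defs = s2_def s3_def s4_def set_reg_def
  have r: "reach w T (Const (d + 1) 1) (s1, us) 1 (s2, us)"
    "reach w T (Op Add d d (d + 1)) (s2, us) 1 (s3, us)"
    "reach w T (Input d d) (s3, us) 1 (s4, us)"
    using a s1 text_fits by (auto intro!: reach_1 simp: defs v_def)
  note r' = reach_Seq[OF s1(1) reach_Seq[OF r(1) reach_Seq[OF r(2,3)]]]
  have "reach w T (comp K (Inp e) d) (s, us) (ecost (Inp e)) (s4, us)"
    using r' by (auto elim!: reach_cost)
  then show ?case using s1 by (intro exI[of _ s4]) (auto simp: defs v_def)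
qed

text \<open>The strict increase of the clock belongs to the induction: durations are differences of
  natural numbers, which add up only if none is truncated, and the loop case needs a first step to
  remove from the run of the next iteration.\<close>

lemma compile_correct:
  assumes "big c \<sigma> \<sigma>'" "K * S \<le> ml" "rel ml \<sigma> p"
  shows "clk \<sigma> < clk \<sigma>' \<and> (\<exists>q. reach w T (compile K c) p (clk \<sigma>' - clk \<sigma>) q \<and> rel ml \<sigma>' q)"
  using assms(1,3)
proof (induction arbitrary: p)
  case (SKIP \<sigma>)
  then show ?case by (intro conjI exI[of _ p]) (auto intro!: reach_1 simp: rel_def)
next
  case (Asg x e \<sigma>)
  obtain s us where p: "p = (s, us)" by (cases p)
  from comp_correct[OF assms(2) Asg(3)[unfolded p] Asg(2) order.refl] obtain s1 where
    s1: "reach w T (comp K e TMP) (s, us) (ecost e) (s1, us)" "mem s1 = mem s"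
      "regs s1 TMP = ev e \<sigma>" "\<forall>x<TMP. regs s1 x = regs s x" by auto
  define s2 where "s2 = set_reg x (ev e \<sigma>) s1"
  have "reach w T (Op Or x TMP TMP) (s1, us) 1 (s2, us)"
    using s1 by (auto intro!: reach_1 simp: s2_def)
  from reach_Seq[OF s1(1) this]
  have "reach w T (compile K (x ::= e)) (s, us) (ecost e + 2) (s2, us)"
    by (auto elim!: reach_cost)
  then show ?case
    using s1 Asg by (intro conjI exI[of _ "(s2, us)"]) (auto simp: p s2_def set_reg_def rel_def)
next
  case (Sto e \<sigma> v a)
  obtain s us where p: "p = (s, us)" by (cases p)
  from comp_correct[OF assms(2) Sto(5)[unfolded p] Sto(1) order.refl] obtain s1 where
    s1: "reach w T (comp K e TMP) (s, us) (ecost e) (s1, us)" "mem s1 = mem s"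
      "regs s1 TMP = ev e \<sigma>" "\<forall>x<TMP. regs s1 x = regs s x" by auto
  define i where "i = ev e \<sigma>"
  define s2 where "s2 = set_reg (TMP + 1) K s1"
  define s3 where "s3 = set_reg TMP (K * i) s2"
  define s4 where "s4 = set_reg (TMP + 1) a s3"
  define s5 where "s5 = set_reg TMP (K * i + a) s4"
  note defs = s2_def s3_def s4_def s5_def set_reg_def
  note adr = address[OF Sto(3,4), folded i_def]
  have r: "reach w T (Const (TMP + 1) K) (s1, us) 1 (s2, us)"
    "reach w T (Op Mul TMP TMP (TMP + 1)) (s2, us) 1 (s3, us)"
    "reach w T (Const (TMP + 1) a) (s3, us) 1 (s4, us)"
    "reach w T (Op Add TMP TMP (TMP + 1)) (s4, us) 1 (s5, us)"
    using adr s1 by (auto intro!: reach_1 simp: defs i_def mult.commute)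
  have "rel ml \<sigma> (s5, us)" using Sto(5) s1 by (auto simp: rel_def defs p)
  from comp_correct[OF assms(2) this Sto(2), of "TMP + 1"] obtain s6 where
    s6: "reach w T (comp K v (TMP + 1)) (s5, us) (ecost v) (s6, us)" "mem s6 = mem s5"
      "regs s6 (TMP + 1) = ev v \<sigma>" "\<forall>x<TMP+1. regs s6 x = regs s5 x" by auto
  define s7 where "s7 = s6\<lparr>mem := (mem s6)[K * i + a := ev v \<sigma>]\<rparr>"
  have t: "regs s6 TMP = K * i + a" using s6 by (simp add: defs)
  have "K * i + a < length (mem s6)"
    using Sto(5) s1 s6 adr assms(2) by (auto simp: rel_def defs p)
  then have "reach w T (Store TMP (TMP + 1)) (s6, us) 1 (s7, us)"
    using t s6 by (auto intro!: reach_1 simp: s7_def)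
  note r' = reach_Seq[OF s1(1) reach_Seq[OF r(1) reach_Seq[OF r(2) reach_Seq[OF r(3)
        reach_Seq[OF r(4) reach_Seq[OF s6(1) this]]]]]]
  have "rel ml (\<sigma>\<lparr>arrs := (arrs \<sigma>)(a := (arrs \<sigma> a)(i := ev v \<sigma>)), clk := c\<rparr>) (s7, us)" for c
  proof -
    have "mem s7 = map (\<lambda>x. ((arrs \<sigma>)(a := (arrs \<sigma> a)(i := ev v \<sigma>))) (x mod K) (x div K)) [0..<ml]"
    proof (rule nth_equalityI)
      fix x assume x: "x < length (mem s7)"
      have "x = K * i + a \<longleftrightarrow> x mod K = a \<and> x div K = i"
        using adr(2,3) by (metis mult_div_mod_eq)
      then show "mem s7 ! x = map (\<lambda>x. ((arrs \<sigma>)(a := (arrs \<sigma> a)(i := ev v \<sigma>))) (x mod K) (x div K)) [0..<ml] ! x"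
        using x Sto(5) s1 s6 by (auto simp: rel_def p s7_def defs nth_list_update)
    qed (use Sto(5) s1 s6 in \<open>auto simp: rel_def p s7_def defs\<close>)
    then show ?thesis using Sto(5) s1 s6 by (auto simp: rel_def p s7_def defs)
  qed
  moreover have "reach w T (compile K (Sto a e v)) (s, us) (ecost e + ecost v + 11) (s7, us)"
    using r' by (auto elim!: reach_cost)
  ultimately show ?case
    by (intro conjI exI[of _ "(s7, us)"]) (auto simp: p i_def)
next
  case (Rnd x \<sigma> u us)
  then show ?case
    by (cases p) (auto intro!: exI[of _ "(set_reg x u (fst p), us)"] reach_1 simp: rel_def set_reg_def)
next
  case (HSeq c \<sigma> \<sigma>1 d \<sigma>2)
  have "rel ml (tick 1 \<sigma>) p" using HSeq by (simp add: rel_def)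
  from HSeq.IH(1)[OF this] obtain q where
    q: "reach w T (compile K c) p (clk \<sigma>1 - (clk \<sigma> + 1)) q" "rel ml \<sigma>1 q" "clk \<sigma> + 1 < clk \<sigma>1" by auto
  from HSeq.IH(2)[OF q(2)] obtain r where
    r: "reach w T (compile K d) q (clk \<sigma>2 - clk \<sigma>1) r" "rel ml \<sigma>2 r" "clk \<sigma>1 < clk \<sigma>2" by auto
  have "clk \<sigma>1 - (clk \<sigma> + 1) + (clk \<sigma>2 - clk \<sigma>1) + 1 = clk \<sigma>2 - clk \<sigma>" using q r by linarith
  with reach_Seq[OF q(1) r(1)] r(2,3) q(3) show ?case
    by (auto simp del: split_paired_Ex)
next
  case (IfT b \<sigma> c \<sigma>1 d)
  obtain s us where p: "p = (s, us)" by (cases p)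
  from comp_correct[OF assms(2) IfT.prems[unfolded p] IfT(1) order.refl] obtain s1 where
    s1: "reach w T (comp K b TMP) (s, us) (ecost b) (s1, us)" "mem s1 = mem s"
      "regs s1 TMP = ev b \<sigma>" "\<forall>x<TMP. regs s1 x = regs s x" by auto
  have "rel ml (tick (ecost b + 2) \<sigma>) (s1, us)" using IfT.prems s1 by (auto simp: rel_def p)
  from IfT.IH[OF this] obtain q where
    q: "reach w T (compile K c) (s1, us) (clk \<sigma>1 - (clk \<sigma> + (ecost b + 2))) q" "rel ml \<sigma>1 q"
      "clk \<sigma> + (ecost b + 2) < clk \<sigma>1" by auto
  have "reach w T (Cond TMP (compile K c) (compile K d)) (s1, us) (Suc (clk \<sigma>1 - (clk \<sigma> + (ecost b + 2)))) q"
    using q(1) s1(3) IfT(2) by (auto simp: reach_def dstep_pow_Suc simp del: funpow.simps)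
  note r = reach_Seq[OF s1(1) this]
  have "ecost b + Suc (clk \<sigma>1 - (clk \<sigma> + (ecost b + 2))) + 1 = clk \<sigma>1 - clk \<sigma>" using q by linarith
  from reach_cost[OF r this] have "reach w T (compile K (IF b THEN c ELSE d)) p (clk \<sigma>1 - clk \<sigma>) q"
    by (simp only: p compile.simps)
  then show ?case using q(2,3) by (auto simp del: split_paired_Ex)
next
  case (IfF b \<sigma> d \<sigma>1 c)
  obtain s us where p: "p = (s, us)" by (cases p)
  from comp_correct[OF assms(2) IfF.prems[unfolded p] IfF(1) order.refl] obtain s1 where
    s1: "reach w T (comp K b TMP) (s, us) (ecost b) (s1, us)" "mem s1 = mem s"
      "regs s1 TMP = ev b \<sigma>" "\<forall>x<TMP. regs s1 x = regs s x" by auto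
  have "rel ml (tick (ecost b + 2) \<sigma>) (s1, us)" using IfF.prems s1 by (auto simp: rel_def p)
  from IfF.IH[OF this] obtain q where
    q: "reach w T (compile K d) (s1, us) (clk \<sigma>1 - (clk \<sigma> + (ecost b + 2))) q" "rel ml \<sigma>1 q"
      "clk \<sigma> + (ecost b + 2) < clk \<sigma>1" by auto
  have "reach w T (Cond TMP (compile K c) (compile K d)) (s1, us) (Suc (clk \<sigma>1 - (clk \<sigma> + (ecost b + 2)))) q"
    using q(1) s1(3) IfF(2) by (auto simp: reach_def dstep_pow_Suc simp del: funpow.simps)
  note r = reach_Seq[OF s1(1) this]
  have "ecost b + Suc (clk \<sigma>1 - (clk \<sigma> + (ecost b + 2))) + 1 = clk \<sigma>1 - clk \<sigma>" using q by linarith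
  from reach_cost[OF r this] have "reach w T (compile K (IF b THEN c ELSE d)) p (clk \<sigma>1 - clk \<sigma>) q"
    by (simp only: p compile.simps)
  then show ?case using q(2,3) by (auto simp del: split_paired_Ex)
next
  case (WhF b \<sigma> c)
  obtain s us where p: "p = (s, us)" by (cases p)
  from comp_correct[OF assms(2) WhF(3)[unfolded p] WhF(1) order.refl] obtain s1 where
    s1: "reach w T (comp K b TMP) (s, us) (ecost b) (s1, us)" "mem s1 = mem s"
      "regs s1 TMP = ev b \<sigma>" "\<forall>x<TMP. regs s1 x = regs s x" by auto
  have "reach w T (While TMP (Seq (compile K c) (comp K b TMP))) (s1, us) 1 (s1, us)"
    using s1 WhF by (auto intro!: reach_1)
  from reach_Seq[OF s1(1) this]
  have "reach w T (compile K (WHILE b DO c)) (s, us) (ecost b + 2) (s1, us)"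
    by (auto elim!: reach_cost)
  then show ?case
    using WhF s1 by (intro conjI exI[of _ "(s1, us)"]) (auto simp: p rel_def)
next
  case (WhT b \<sigma> c \<sigma>1 \<sigma>2)
  obtain s us where p: "p = (s, us)" by (cases p)
  from comp_correct[OF assms(2) WhT.prems[unfolded p] WhT.hyps(1) order.refl] obtain s1 where
    s1: "reach w T (comp K b TMP) (s, us) (ecost b) (s1, us)" "mem s1 = mem s"
      "regs s1 TMP = ev b \<sigma>" "\<forall>x<TMP. regs s1 x = regs s x" by auto
  have "rel ml (tick (ecost b + 2) \<sigma>) (s1, us)" using WhT.prems s1 by (auto simp: rel_def p)
  from WhT.IH(1)[OF this] obtain q where
    q: "reach w T (compile K c) (s1, us) (clk \<sigma>1 - (clk \<sigma> + (ecost b + 2))) q" "rel ml \<sigma>1 q"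
      "clk \<sigma> + (ecost b + 2) < clk \<sigma>1" by auto
  from WhT.IH(2)[OF q(2)] obtain r where
    r: "reach w T (compile K (WHILE b DO c)) q (clk \<sigma>2 - clk \<sigma>1) r" "rel ml \<sigma>2 r" "clk \<sigma>1 < clk \<sigma>2" by auto
  let ?W = "While TMP (Seq (compile K c) (comp K b TMP))"
  \<comment> \<open>The run \<open>r\<close> of the whole loop begins by unfolding the outer
    \<open>Seq\<close>. Inside the running loop this step is absent, but the \<open>Seq\<close> of
    the body costs one instead, so the totals agree.\<close>
  obtain t where t: "clk \<sigma>2 - clk \<sigma>1 = Suc t" using r(3) by (metis Suc_diff_Suc)
  have r': "(dstep w T ^^ t) ((comp K b TMP # ?W # k, fst q), snd q) = ((k, fst r), snd r)" for k
    using r(1) unfolding t reach_def dstep_pow_Suc by simp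
  have q': "(dstep w T ^^ (clk \<sigma>1 - (clk \<sigma> + (ecost b + 2)))) ((compile K c # k, s1), us) = ((k, fst q), snd q)" for k
    using q(1) by (simp add: reach_def)
  have "reach w T ?W (s1, us) (t + (clk \<sigma>1 - (clk \<sigma> + (ecost b + 2))) + 2) r"
    unfolding reach_def
  proof
    fix k
    have "(dstep w T ^^ 2) ((?W # k, s1), us) = ((compile K c # comp K b TMP # ?W # k, s1), us)"
      using s1(3) WhT.hyps(2) by (simp add: numeral_2_eq_2)
    then show "(dstep w T ^^ (t + (clk \<sigma>1 - (clk \<sigma> + (ecost b + 2))) + 2)) ((?W # k, fst (s1, us)), snd (s1, us)) =
        ((k, fst r), snd r)"
      by (simp only: funpow_add o_apply q' r' fst_conv snd_conv)
  qed
  from reach_Seq[OF s1(1) this]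
  have "reach w T (compile K (WHILE b DO c)) p (ecost b + (t + (clk \<sigma>1 - (clk \<sigma> + (ecost b + 2))) + 2) + 1) r"
    by (simp add: p)
  moreover have "ecost b + (t + (clk \<sigma>1 - (clk \<sigma> + (ecost b + 2))) + 2) + 1 = clk \<sigma>2 - clk \<sigma>"
    using q r t by linarith
  ultimately show ?case using q(3) r(2,3) by (auto simp del: split_paired_Ex)
qed

text \<open>A halted configuration is a fixed point of the step function, so the outcome holds at
  every later time as well.\<close>

lemma wp_run:
  assumes "wp c Q \<sigma>" "K * S \<le> ml" "rel ml \<sigma> (s, us)"
  shows "\<exists>\<sigma>' s'. Q \<sigma>' \<and> clk \<sigma> \<le> clk \<sigma>' \<and> rel ml \<sigma>' (s', tape \<sigma>') \<and>
    (\<forall>t \<ge> clk \<sigma>' - clk \<sigma>. (dstep w T ^^ t) (([compile K c], s), us) = (([], s'), tape \<sigma>'))"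
proof -
  from assms(1) obtain \<sigma>' where \<sigma>': "big c \<sigma> \<sigma>'" "Q \<sigma>'" by (auto simp: wp_def)
  from compile_correct[OF \<sigma>'(1) assms(2,3)] obtain q where
    q: "reach w T (compile K c) (s, us) (clk \<sigma>' - clk \<sigma>) q" "rel ml \<sigma>' q" "clk \<sigma> < clk \<sigma>'" by auto
  have "(dstep w T ^^ t) (([compile K c], s), us) = (([], fst q), tape \<sigma>')" if "t \<ge> clk \<sigma>' - clk \<sigma>" for t
  proof -
    have "t = (t - (clk \<sigma>' - clk \<sigma>)) + (clk \<sigma>' - clk \<sigma>)" using that by simp
    moreover have "(dstep w T ^^ (clk \<sigma>' - clk \<sigma>)) (([compile K c], s), us) = (([], fst q), snd q)"
      using q(1) by (simp add: reach_def)
    ultimately have "(dstep w T ^^ t) (([compile K c], s), us) =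
        (dstep w T ^^ (t - (clk \<sigma>' - clk \<sigma>))) (([], fst q), snd q)"
      by (metis funpow_add o_apply)
    then show ?thesis using q(2) by (simp add: dstep_halted rel_def)
  qed
  with q \<sigma>' show ?thesis by (intro exI[of _ \<sigma>'] exI[of _ "fst q"]) (auto simp: rel_def)
qed

end

section \<open>Frame conditions on registers and arrays\<close>

definition agree :: "'a set \<Rightarrow> ('a \<Rightarrow> 'b) \<Rightarrow> ('a \<Rightarrow> 'b) \<Rightarrow> bool" where
  "agree X f g \<longleftrightarrow> (\<forall>x. x \<notin> X \<longrightarrow> g x = f x)"

lemma agree_refl [simp]: "agree X f f"
  by (simp add: agree_def)

lemma agree_upd [simp]: "x \<in> X \<Longrightarrow> agree X f (g(x := v)) = agree X f g"
  by (auto simp: agree_def)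

lemma agreeD: "agree X f g \<Longrightarrow> x \<notin> X \<Longrightarrow> g x = f x"
  by (simp add: agree_def)

lemma agree_2D: "agree {a, b} f g \<Longrightarrow> g = f(a := g a, b := g b)"
  by (auto simp: agree_def)

lemma agree_trans: "agree X f g \<Longrightarrow> agree Y g h \<Longrightarrow> X \<union> Y \<subseteq> Z \<Longrightarrow> agree Z f h"
  unfolding agree_def by (metis UnCI subsetD)

lemma if_1_0_simps [simp]:
  "((if P then 1 else 0) = (0::nat)) = (\<not> P)" "(0 < (if P then 1 else (0::nat))) = P"
  by auto


section \<open>Longest common extensions\<close>

definition lce :: "nat list \<Rightarrow> nat \<Rightarrow> nat \<Rightarrow> nat" where
  "lce T a b = length (longest_common_prefix (drop a T) (drop b T))"

definition matches :: "nat list \<Rightarrow> nat \<Rightarrow> nat \<Rightarrow> nat \<Rightarrow> bool" where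
  "matches T a b l \<longleftrightarrow> a + l \<le> length T \<and> b + l \<le> length T \<and> (\<forall>m<l. T ! (a + m) = T ! (b + m))"

lemma matches_take:
  assumes "a + l \<le> length T" "b + l \<le> length T"
  shows "matches T a b l \<longleftrightarrow> take l (drop a T) = take l (drop b T)"
  using assms by (auto simp: matches_def list_eq_iff_nth_eq)

text \<open>From here on \<open>lce\<close> is handled through this equivalence, as the largest
  length for which the two substrings match.\<close>

lemma matches_lce_iff:
  assumes "a \<le> length T" "b \<le> length T"
  shows "matches T a b l \<longleftrightarrow> l \<le> lce T a b"
proof
  let ?p = "longest_common_prefix (drop a T) (drop b T)"
  have p: "prefix ?p (drop a T)" "prefix ?p (drop b T)"
    by (simp_all add: longest_common_prefix_prefix1 longest_common_prefix_prefix2)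
  {
    assume l: "l \<le> lce T a b"
    have "lce T a b \<le> length T - a" "lce T a b \<le> length T - b"
      using p[THEN prefix_length_le] by (auto simp: lce_def)
    moreover have "take l xs = take l ?p" if "prefix ?p xs" for xs
      using that l by (auto simp: prefix_def lce_def)
    then have "take l (drop a T) = take l ?p" "take l (drop b T) = take l ?p"
      using p by blast+
    ultimately show "matches T a b l" using l assms by (subst matches_take) auto
  }
  assume m: "matches T a b l"
  then have "take l (drop a T) = take l (drop b T)" "l \<le> length (drop a T)"
    using matches_take by (auto simp: matches_def)
  then have "prefix (take l (drop a T)) ?p"
    by (intro longest_common_prefix_max_prefix) (auto simp: take_is_prefix, metis take_is_prefix)
  then show "l \<le> lce T a b"
    using \<open>l \<le> length (drop a T)\<close> prefix_length_le by (fastforce simp: lce_def)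
qed

lemma lce_eqI:
  assumes "matches T a b l" "a + l < length T \<Longrightarrow> b + l < length T \<Longrightarrow> T ! (a + l) \<noteq> T ! (b + l)"
  shows "lce T a b = l"
proof -
  have "a \<le> length T" "b \<le> length T" using assms by (auto simp: matches_def)
  note * = matches_lce_iff[OF this]
  have "\<not> matches T a b (l + 1)" using assms by (auto simp: matches_def intro!: exI[of _ l])
  with assms * show ?thesis by (metis Suc_eq_plus1 le_antisym not_less_eq_eq)
qed

lemma lce_le: "a \<le> length T \<Longrightarrow> b \<le> length T \<Longrightarrow> a + lce T a b \<le> length T \<and> b + lce T a b \<le> length T"
  using matches_lce_iff[of a T b "lce T a b"] by (auto simp: matches_def)

lemma matches_add:
  "matches T a b (l + m) \<longleftrightarrow> matches T a b l \<and> matches T (a + l) (b + l) m"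
proof -
  have "(\<forall>x<l + m. P x) \<longleftrightarrow> (\<forall>x<l. P x) \<and> (\<forall>x<m. P (l + x))" for P :: "nat \<Rightarrow> bool"
    by (metis add_less_cancel_left add_diff_inverse_nat trans_less_add1)
  then show ?thesis by (auto simp: matches_def ac_simps)
qed

lemma length_LCE: "length (LCE T i j) = lce T (i - 1) (j - 1)"
  by (simp add: LCE_def lce_def)


section \<open>Fingerprints\<close>

text \<open>The string as a number in base \<open>B\<close>, first letter most significant,
  evaluated by Horner's rule. Its residue modulo \<open>q\<close> is the Karp-Rabin
  fingerprint.\<close>

definition hval :: "nat \<Rightarrow> nat list \<Rightarrow> nat" where
  "hval B xs = foldl (\<lambda>h c. h * B + c) 0 xs"

lemma hval_Nil [simp]: "hval B [] = 0"
  by (simp add: hval_def)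

lemma hval_snoc [simp]: "hval B (xs @ [c]) = hval B xs * B + c"
  by (simp add: hval_def)

lemma hval_append: "hval B (xs @ ys) = hval B xs * B ^ length ys + hval B ys"
proof (induction ys rule: rev_induct)
  case (snoc y ys)
  then show ?case
    unfolding append_assoc[symmetric] hval_snoc by (simp add: algebra_simps)
qed simp

lemma hval_less: "set xs \<subseteq> {..<B} \<Longrightarrow> hval B xs < B ^ length xs"
proof (induction xs rule: rev_induct)
  case (snoc x xs)
  then have "(hval B xs + 1) * B \<le> B ^ length xs * B" by (intro mult_le_mono1) simp
  with snoc show ?case by (simp add: algebra_simps)
qed simp

lemma hval_inj:
  "length xs = length ys \<Longrightarrow> set xs \<subseteq> {..<B} \<Longrightarrow> set ys \<subseteq> {..<B} \<Longrightarrow>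
     hval B xs = hval B ys \<Longrightarrow> xs = ys"
proof (induction xs arbitrary: ys rule: rev_induct)
  case (snoc x xs)
  then obtain zs z where ys: "ys = zs @ [z]"
    by (metis length_append_singleton length_greater_0_conv rev_exhaust zero_less_Suc)
  have *: "(h * B + c) div B = h" "(h * B + c) mod B = c" if "c < B" for h c
    using that by auto
  have "x < B" "z < B" "hval B xs * B + x = hval B zs * B + z" using snoc ys by auto
  then have "hval B xs = hval B zs" "x = z" using * by metis+
  then show ?case using snoc ys by auto
qed simp

definition pval :: "nat \<Rightarrow> nat list \<Rightarrow> nat \<Rightarrow> nat" where
  "pval B T x = hval B (take x T)"

definition sval :: "nat \<Rightarrow> nat list \<Rightarrow> nat \<Rightarrow> nat \<Rightarrow> nat" where
  "sval B T x l = hval B (take l (drop x T))"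

lemma pval_0 [simp]: "pval B T 0 = 0"
  by (simp add: pval_def)

lemma pval_Suc: "x < length T \<Longrightarrow> pval B T (x + 1) = pval B T x * B + T ! x"
  using take_Suc_conv_app_nth[of x T] by (simp add: pval_def Suc_eq_plus1[symmetric] del: Suc_eq_plus1)

lemma pval_add: "x + l \<le> length T \<Longrightarrow> pval B T (x + l) = pval B T x * B ^ l + sval B T x l"
  by (simp add: pval_def sval_def take_add hval_append)

lemma sval_eq_iff:
  assumes "set T \<subseteq> {..<B}" "x + l \<le> length T" "y + l \<le> length T"
  shows "sval B T x l = sval B T y l \<longleftrightarrow> matches T x y l"
proof -
  have "set (take l (drop z T)) \<subseteq> {..<B}" for z
    using assms(1) by (meson set_drop_subset set_take_subset subset_trans)
  then show ?thesis
    using assms hval_inj[of "take l (drop x T)" "take l (drop y T)" B]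
    by (auto simp: sval_def matches_take)
qed

text \<open>Comparing fingerprints of substrings from those of prefixes, without subtractions.\<close>

lemma cross_cong:
  assumes "x + l \<le> length T" "y + l \<le> length T"
  shows "(pval B T (x + l) mod q + (pval B T y mod q) * (B ^ l mod q)) mod q =
         (pval B T (y + l) mod q + (pval B T x mod q) * (B ^ l mod q)) mod q \<longleftrightarrow>
         [sval B T x l = sval B T y l] (mod q)"
proof -
  \<comment> \<open>Adding the product for the other position to each side makes the shifted prefix
    terms common: both sides become \<open>?e\<close> plus the value of the substring, and
    \<open>?e\<close> cancels.\<close>
  let ?e = "pval B T x * B ^ l + pval B T y * B ^ l"
  have *: "(a mod q + (b mod q) * (c mod q)) mod q = (a + b * c) mod q" for a b c :: nat
  proof -
    have "(a mod q + (b mod q) * (c mod q)) mod q = (a + (b mod q) * (c mod q) mod q) mod q"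
      by (simp only: mod_add_left_eq mod_add_right_eq)
    also have "\<dots> = (a + b * c mod q) mod q" by (simp only: mod_mult_eq)
    finally show ?thesis by (simp only: mod_add_right_eq)
  qed
  have "(pval B T (x + l) mod q + (pval B T y mod q) * (B ^ l mod q)) mod q = (?e + sval B T x l) mod q"
    "(pval B T (y + l) mod q + (pval B T x mod q) * (B ^ l mod q)) mod q = (?e + sval B T y l) mod q"
    unfolding * pval_add[OF assms(1)] pval_add[OF assms(2)] by (simp_all only: ac_simps)
  then show ?thesis
    using cong_add_lcancel_nat[of ?e "sval B T x l" "sval B T y l" q] by (simp add: cong_def)
qed


section \<open>Queries with fingerprints\<close>

text \<open>The base \<open>B\<close> bounds the letters, so distinct strings of equal length have
  distinct values before reduction modulo \<open>q\<close>. An array of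
  \<open>length T div t + 3\<close> cells has room for all samples and also for the three parameters
  stored in array 0.\<close>

locale hashing = machine +
  fixes B q t :: nat
  assumes letters: "set T \<subseteq> {..<B}"
    and q_pos: "0 < q" and t_pos: "0 < t"
    and arith_fits: "q * B + B < 2 ^ w" "q * q + q < 2 ^ w" "4 * length T + 4 * t + 4 < 2 ^ w"
    and three_arrays: "2 < K"
    and arrays_long: "length T div t + 3 \<le> S"
begin

text \<open>Array 0 keeps the parameters for the query program. The powers of \<open>B\<close> are
  stored only at multiples of \<open>t\<close> because every compared length is such a
  multiple.\<close>

definition hash_table :: "(nat \<Rightarrow> nat \<Rightarrow> nat) \<Rightarrow> bool" where
  "hash_table A \<longleftrightarrow> A 0 0 = q \<and> A 0 1 = t \<and> A 0 2 = B \<and>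
     (\<forall>x. x * t \<le> length T \<longrightarrow> A 1 x = pval B T (x * t) mod q \<and> A 2 x = B ^ (x * t) mod q)"

lemma hash_step: "x < length T \<Longrightarrow> (pval B T x mod q * B + T ! x) mod q = pval B T (x + 1) mod q"
proof -
  assume "x < length T"
  have "(pval B T x mod q * B + T ! x) mod q = (pval B T x mod q * B mod q + T ! x) mod q"
    by (simp only: mod_add_left_eq)
  also have "\<dots> = (pval B T x * B mod q + T ! x) mod q"
    by (simp only: mod_mult_left_eq)
  finally show ?thesis
    using \<open>x < length T\<close> by (simp only: mod_add_left_eq pval_Suc)
qed

lemma modmul_fits: "h < q \<Longrightarrow> c < B \<Longrightarrow> h * B + c < 2 ^ w"
proof -
  assume "h < q" "c < B"
  then have "h * B + c \<le> q * B + B" by (intro add_mono mult_le_mono) auto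
  then show ?thesis using arith_fits by linarith
qed

lemma modmul_fits': "h < q \<Longrightarrow> h * B < 2 ^ w"
  using modmul_fits[of h 0] letters q_pos arith_fits(1)
  by (cases "B = 0") auto

lemma letter_less: "x < length T \<Longrightarrow> T ! x < B"
  using letters nth_mem by blast

end

definition prefix_hash :: hcom where
  "prefix_hash = (21 ::= Ld 1 (V 20 \<^bold>/ V 5);; 22 ::= V 20 \<^bold>- V 20 \<^bold>% V 5;;
     WHILE V 22 \<^bold>< V 20 DO (21 ::= (V 21 \<^bold>* V 7 \<^bold>+ Inp (V 22)) \<^bold>% V 6;; 22 ::= V 22 \<^bold>+ N 1))"

context hashing
begin

lemma wp_prefix_hash:
  assumes "hash_table (arrs \<sigma>)" "vars \<sigma> 5 = t" "vars \<sigma> 6 = q" "vars \<sigma> 7 = B" "vars \<sigma> 20 = x"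
    "x \<le> length T"
    and Q: "\<And>u c. c \<le> clk \<sigma> + 50 + 50 * t \<Longrightarrow>
      Q (\<sigma>\<lparr>vars := (vars \<sigma>)(21 := pval B T x mod q, 22 := u), clk := c\<rparr>)"
  shows "wp prefix_hash Q \<sigma>"
proof -
  define x0 where "x0 = x - x mod t"
  have x0: "x0 = x div t * t" by (simp add: x0_def minus_mod_eq_div_mult)
  have "x mod t < t" "x mod t \<le> x" using t_pos by simp_all
  then have x0': "x0 \<le> x" "x < x0 + t" by (simp_all add: x0_def)
  have S: "x div t < S" using div_le_mono[OF assms(6), of t] arrays_long by linarith
  have ht: "arrs \<sigma> 1 (x div t) = pval B T x0 mod q"
    using assms(1,6) x0'(1) unfolding hash_table_def x0 by (meson le_trans)
  define I where "I = (\<lambda>\<sigma>'::st. agree {21, 22} (vars \<sigma>) (vars \<sigma>') \<and> arrs \<sigma>' = arrs \<sigma> \<and> tape \<sigma>' = tape \<sigma> \<and>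
     x0 \<le> vars \<sigma>' 22 \<and> vars \<sigma>' 22 \<le> x \<and> vars \<sigma>' 21 = pval B T (vars \<sigma>' 22) mod q \<and>
     clk \<sigma>' + 40 * x0 \<le> clk \<sigma> + 40 + 40 * vars \<sigma>' 22)"
  have K: "1 < K" "x < 2 ^ w" using three_arrays text_fits assms(6) by linarith+
  show ?thesis
    unfolding prefix_hash_def
    apply (simp add: wp_simps assms S x0_def[symmetric] K)
    apply (rule wp_while[where I = I and m = "\<lambda>\<sigma>. x - vars \<sigma> 22"])
    subgoal using x0' by (simp add: I_def ht)
    subgoal by (simp add: I_def)
    subgoal premises p for \<sigma>'
    proof -
      have "agree {21, 22} (vars \<sigma>) (vars \<sigma>')" using p(1) by (simp add: I_def)
      note r = agreeD[OF this]
      show ?thesis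
        using p assms(1-6) letter_less[of "vars \<sigma>' 22"] q_pos K
        by (auto simp add: I_def wp_simps hash_step modmul_fits modmul_fits' r)
    qed
    subgoal premises p for \<sigma>'
    proof -
      have a: "agree {21, 22} (vars \<sigma>) (vars \<sigma>')" using p(1) by (simp add: I_def)
      have "vars \<sigma>' 22 = x" using p assms(5) agreeD[OF a] by (simp add: I_def)
      moreover from this have "vars \<sigma>' = (vars \<sigma>)(21 := pval B T x mod q, 22 := x)"
        using agree_2D[OF a] p(1) by (simp add: I_def)
      ultimately show ?thesis
        using Q[of "clk \<sigma>' + (ecost (V 22 \<^bold>< V 20) + 2)" x] p x0'
        by (cases \<sigma>, cases \<sigma>') (simp add: I_def)
    qed
    done
qed

end

text \<open>Registers 10 and 11 hold the two positions, 12 the length matched so far, 13 the length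
  to try, 14 the verdict; registers 4 to 7 hold the text length, \<open>t\<close>, \<open>q\<close>
  and \<open>B\<close>. A range exceeding the text counts as unequal.\<close>

definition check :: hcom where
  "check = (14 ::= N 0;; 15 ::= V 10 \<^bold>+ V 12;; 16 ::= V 11 \<^bold>+ V 12;;
     IF V 15 \<^bold>+ V 13 \<^bold>< V 4 \<^bold>+ N 1 THEN
       IF V 16 \<^bold>+ V 13 \<^bold>< V 4 \<^bold>+ N 1 THEN (
         20 ::= V 15 \<^bold>+ V 13;; prefix_hash;; 17 ::= V 21;;
         20 ::= V 16;; prefix_hash;; 18 ::= V 21;;
         20 ::= V 16 \<^bold>+ V 13;; prefix_hash;; 19 ::= V 21;;
         20 ::= V 15;; prefix_hash;; 23 ::= Ld 2 (V 13 \<^bold>/ V 5);;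
         14 ::= ((V 17 \<^bold>+ V 18 \<^bold>* V 23) \<^bold>% V 6 \<^bold>= (V 19 \<^bold>+ V 21 \<^bold>* V 23) \<^bold>% V 6))
       ELSE SKIP
     ELSE SKIP)"

context hashing
begin

lemma modmul_fits2: "h < q \<Longrightarrow> g < q \<Longrightarrow> e < q \<Longrightarrow> h + g * e < 2 ^ w \<and> g * e < 2 ^ w"
proof -
  assume "h < q" "g < q" "e < q"
  then have "h + g * e \<le> q + q * q" by (intro add_mono mult_le_mono) auto
  then show ?thesis using arith_fits by linarith
qed

abbreviation fp_eq :: "nat \<Rightarrow> nat \<Rightarrow> nat \<Rightarrow> bool" where
  "fp_eq x y l \<equiv> x + l \<le> length T \<and> y + l \<le> length T \<and> [sval B T x l = sval B T y l] (mod q)"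

text \<open>The table is demanded only for \<open>t \<le> length T\<close>. Otherwise the positive
  multiple \<open>l\<close> of \<open>t\<close> exceeds the text, the range tests reject, and no
  array is read; this lets short texts run the same code without a table.\<close>

lemma wp_check:
  assumes h: "t \<le> length T \<Longrightarrow> hash_table (arrs \<sigma>) \<and> vars \<sigma> 7 = B"
    and v: "vars \<sigma> 4 = length T" "vars \<sigma> 5 = t" "vars \<sigma> 6 = q" "vars \<sigma> 10 = a"
      "vars \<sigma> 11 = b" "vars \<sigma> 12 = r" "vars \<sigma> 13 = l"
    and b: "a + r \<le> length T" "b + r \<le> length T" "t dvd l" "0 < l" "l \<le> 2 * length T + 2 * t"
    and Q: "\<And>f c. agree {14..23} (vars \<sigma>) f \<Longrightarrow> f 14 = (if fp_eq (a + r) (b + r) l then 1 else 0) \<Longrightarrow>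
      c \<le> clk \<sigma> + 500 + 200 * t \<Longrightarrow> Q (\<sigma>\<lparr>vars := f, clk := c\<rparr>)"
  shows "wp check Q \<sigma>"
proof (cases "a + r + l \<le> length T \<and> b + r + l \<le> length T")
  case False
  show ?thesis
    unfolding check_def using b arith_fits False
    by (auto simp add: wp_simps v intro!: Q)
next
  case True
  have f: "a + r + l < 2 ^ w" "b + r + l < 2 ^ w" "length T + 1 < 2 ^ w" "a + r < 2 ^ w" "b + r < 2 ^ w"
    "a + r + l < length T + 1" "b + r + l < length T + 1"
    using True arith_fits by linarith+
  have "t \<le> length T" using b True by (meson add_leE dvd_imp_le le_trans)
  note v = v h[OF this, THEN conjunct2] and h = h[OF this, THEN conjunct1]
  have l: "l div t < S" "l div t * t = l" "1 < K" "2 < K"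
    using div_le_mono[of l "length T" t] True arrays_long b three_arrays by auto
  then have P: "arrs \<sigma> 2 (l div t) = B ^ l mod q"
    using h True unfolding hash_table_def by (metis add_leE)
  note fits = modmul_fits2[OF mod_less_divisor mod_less_divisor mod_less_divisor, OF q_pos q_pos q_pos]
  show ?thesis
    unfolding check_def
    apply (simp add: wp_simps v b f True)
    apply (rule wp_prefix_hash[where x = "a + r + l"]; (simp add: h v b f True)?)
    apply (simp add: wp_simps v b f True)
    apply (rule wp_prefix_hash[where x = "b + r"]; (simp add: h v b f True)?)
    apply (simp add: wp_simps v b f True)
    apply (rule wp_prefix_hash[where x = "b + r + l"]; (simp add: h v b f True)?)
    apply (simp add: wp_simps v b f True)
    apply (rule wp_prefix_hash[where x = "a + r"]; (simp add: h v b f True)?)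
    apply (simp add: wp_simps v b f True l P fits)
    apply (intro conjI impI Q; simp add: cross_cong True)
    done
qed

end

text \<open>Register 24 is 1 while the length doubles and 0 once a comparison has failed and the
  length halves. The loop ends when the length drops below \<open>t\<close>.\<close>

definition fp_loop :: hcom where
  "fp_loop = (12 ::= N 0;; 13 ::= V 5;; 24 ::= N 1;;
     WHILE V 5 \<^bold>< V 13 \<^bold>+ N 1 DO (
       check;;
       IF V 14 THEN 12 ::= V 12 \<^bold>+ V 13 ELSE 24 ::= N 0;;
       IF V 24 THEN 13 ::= V 13 \<^bold>* N 2 ELSE 13 ::= V 13 \<^bold>/ N 2))"

definition char_loop :: hcom where
  "char_loop = (25 ::= V 5;;
     WHILE V 25 DO (
       14 ::= N 0;; 15 ::= V 10 \<^bold>+ V 12;; 16 ::= V 11 \<^bold>+ V 12;;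
       IF V 15 \<^bold>< V 4 THEN IF V 16 \<^bold>< V 4 THEN 14 ::= (Inp (V 15) \<^bold>= Inp (V 16)) ELSE SKIP ELSE SKIP;;
       IF V 14 THEN (12 ::= V 12 \<^bold>+ N 1;; 25 ::= V 25 \<^bold>- N 1) ELSE 25 ::= N 0))"

context hashing
begin

definition faithful :: bool where
  "faithful \<longleftrightarrow> (\<forall>x y e. fp_eq x y (t * 2 ^ e) \<longrightarrow> matches T x y (t * 2 ^ e))"

text \<open>The error is one-sided: matching substrings have equal values and hence congruent ones,
  so a negative comparison is right for every modulus. Only positive answers depend on
  \<open>faithful\<close>.\<close>

lemma lce_less_if_not_fp_eq:
  assumes "a + r \<le> length T" "b + r \<le> length T" "\<not> fp_eq (a + r) (b + r) l"
  shows "lce T a b < r + l"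
proof (rule ccontr)
  assume "\<not> lce T a b < r + l"
  then have "matches T a b (r + l)" using assms(1,2) by (subst matches_lce_iff) auto
  then have "matches T (a + r) (b + r) l" by (simp add: matches_add)
  moreover from this have "sval B T (a + r) l = sval B T (b + r) l"
    using sval_eq_iff[OF letters] by (auto simp: matches_def)
  ultimately have "fp_eq (a + r) (b + r) l" by (simp add: matches_def cong_refl)
  with assms show False by blast
qed

text \<open>\<open>E\<close> is the number of successful doublings. The bound
  \<open>t * 2 ^ E \<le> f 12 + t\<close> relates it to the returned length without assuming
  \<open>faithful\<close>, so the running time is controlled even when the answer is wrong.\<close>

lemma wp_fp_loop:
  assumes h: "t \<le> length T \<Longrightarrow> hash_table (arrs \<sigma>) \<and> vars \<sigma> 7 = B"
    and v: "vars \<sigma> 4 = length T" "vars \<sigma> 5 = t" "vars \<sigma> 6 = q" "vars \<sigma> 10 = a"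
      "vars \<sigma> 11 = b"
    and b: "a \<le> length T" "b \<le> length T"
    and Q: "\<And>f c E. agree {12..24} (vars \<sigma>) f \<Longrightarrow> a + f 12 \<le> length T \<Longrightarrow> b + f 12 \<le> length T \<Longrightarrow>
      (faithful \<Longrightarrow> matches T a b (f 12) \<and> lce T a b < f 12 + t) \<Longrightarrow>
      t * 2 ^ E \<le> f 12 + t \<Longrightarrow>
      c \<le> clk \<sigma> + 50 + (2 * E + 2) * (600 + 200 * t) \<Longrightarrow> Q (\<sigma>\<lparr>vars := f, clk := c\<rparr>)"
  shows "wp fp_loop Q \<sigma>"
proof -
  define C where "C = 600 + 200 * t"
  \<comment> \<open>After \<open>e\<close> successes the matched length is
    \<open>t + 2 * t + 4 * t + ...\<close> with \<open>e\<close> summands, that is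
    \<open>t * 2 ^ e - t\<close>.\<close>
  define up where "up = (\<lambda>\<sigma>'::st. \<exists>e. vars \<sigma>' 13 = t * 2 ^ e \<and> vars \<sigma>' 12 + t = t * 2 ^ e \<and>
     clk \<sigma>' \<le> clk \<sigma> + 30 + e * C)"
  \<comment> \<open>The current length is half of \<open>t * 2 ^ e\<close>, and for a faithful
    modulus the extension ends less than \<open>t * 2 ^ e\<close> beyond the matched part. The
    budget of \<open>2 * E + 1\<close> rounds is spent as \<open>e\<close> falls from
    \<open>E\<close> to 0.\<close>
  define down where "down = (\<lambda>\<sigma>'::st. \<exists>e E. e \<le> E \<and> vars \<sigma>' 13 = t * 2 ^ e div 2 \<and>
     t * 2 ^ E \<le> vars \<sigma>' 12 + t \<and> clk \<sigma>' + e * C \<le> clk \<sigma> + 30 + (2 * E + 1) * C \<and>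
     (faithful \<longrightarrow> lce T a b < vars \<sigma>' 12 + t * 2 ^ e))"
  define I where "I = (\<lambda>\<sigma>'::st. agree {12..24} (vars \<sigma>) (vars \<sigma>') \<and> arrs \<sigma>' = arrs \<sigma> \<and> tape \<sigma>' = tape \<sigma> \<and>
     a + vars \<sigma>' 12 \<le> length T \<and> b + vars \<sigma>' 12 \<le> length T \<and> vars \<sigma>' 13 \<le> length T + t \<and>
     (faithful \<longrightarrow> matches T a b (vars \<sigma>' 12)) \<and> (if vars \<sigma>' 24 \<noteq> 0 then up \<sigma>' else down \<sigma>'))"
  \<comment> \<open>The first branch exceeds every value of the second, since register 13 stays at
    most \<open>length T + t\<close>; so switching from doubling to halving also decreases the
    measure.\<close>
  define \<mu> where "\<mu> = (\<lambda>\<sigma>::st. if vars \<sigma> 24 \<noteq> 0 then 3 * length T + 3 * t + 3 - vars \<sigma> 12 else vars \<sigma> 13)"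
  show ?thesis
    unfolding fp_loop_def
    apply (simp add: wp_simps v)
    apply (rule wp_while[where I = I and m = \<mu>])
    subgoal
      using b by (auto simp: I_def up_def v matches_def intro!: exI[of _ 0])
    subgoal using arith_fits by (auto simp: I_def)
    subgoal premises p for \<sigma>'
    proof -
      define r where "r = vars \<sigma>' 12"
      define l where "l = vars \<sigma>' 13"
      note I = p(1)[unfolded I_def]
      note ag = agreeD[OF I[THEN conjunct1]]
      have tl: "t \<le> l" using p(2) v ag by (simp add: l_def)
      \<comment> \<open>While halving, \<open>t \<le> l\<close> excludes the exponent 0, as
        \<open>t div 2 < t\<close>; so the division by 2 is exact.\<close>
      have e: "\<exists>e. l = t * 2 ^ e"
      proof (cases "vars \<sigma>' 24 = 0")
        case True
        then obtain e where "l = t * 2 ^ e div 2" using I by (auto simp: down_def l_def)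
        then show ?thesis using tl t_pos by (cases e) (auto simp: One_nat_def)
      qed (use I in \<open>auto simp: up_def l_def\<close>)
      have I2: "arrs \<sigma>' = arrs \<sigma>" "tape \<sigma>' = tape \<sigma>" using I by auto
      have l0: "0 < l" "l < 2 ^ w" "l * 2 < 2 ^ w" "r + l < 2 ^ w"
        using tl t_pos I arith_fits by (auto simp: l_def r_def)
      have \<mu>: "r \<le> length T" "l \<le> length T + t" "l div 2 \<le> length T + t" using I by (auto simp: l_def r_def)
      show ?thesis
        apply (simp add: wp_simps)
        apply (rule wp_check[where a = a and b = b and r = r and l = l])
        using h v ag I e tl t_pos apply (auto simp: r_def l_def)[13]
        subgoal premises q for f c
        proof -
          note ag' = agreeD[OF q(1)]
          have ag2: "agree {12..24} (vars \<sigma>) f"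
            using agree_trans[OF I[THEN conjunct1] q(1)[simplified], of "{12..24}"] by simp
          have c: "c + C \<le> clk \<sigma>' + 2 * C - 70" "70 \<le> C" using q(3) by (auto simp: C_def)
          have fv: "f 12 = r" "f 13 = l" "f 24 = vars \<sigma>' 24" by (simp_all add: ag' r_def l_def)
          show ?thesis
          proof (cases "fp_eq (a + r) (b + r) l")
            case True
            have m: "faithful \<longrightarrow> matches T a b (r + l)"
              using True I e by (auto simp: matches_add faithful_def r_def)
            show ?thesis
            proof (cases "vars \<sigma>' 24 = 0")
              case up: False
              then obtain e where "l = t * 2 ^ e" "r + t = t * 2 ^ e" "clk \<sigma>' \<le> clk \<sigma> + 30 + e * C"
                using I by (auto simp: up_def r_def l_def)
              then have "r + l + t = t * 2 ^ Suc e" "l * 2 = t * 2 ^ Suc e"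
                "c + 70 \<le> clk \<sigma> + 30 + Suc e * C" "l * 2 \<le> length T + t"
                using c True by auto
              moreover from this have "up s" if "vars s 13 = l * 2" "vars s 12 = r + l" "clk s \<le> c + 70" for s
                unfolding up_def using that by (intro exI[of _ "Suc e"]) linarith
              ultimately show ?thesis
                using True m I2 \<mu> l0
                by (simp add: wp_simps fv q(2) up I_def \<mu>_def ag2 r_def[symmetric]) linarith
            next
              case dn: True
              then obtain e E where "e \<le> E" "l = t * 2 ^ e div 2" "t * 2 ^ E \<le> r + t"
                "clk \<sigma>' + e * C \<le> clk \<sigma> + 30 + (2 * E + 1) * C"
                "faithful \<longrightarrow> lce T a b < r + t * 2 ^ e"
                using I by (auto simp: down_def r_def l_def)
              moreover from this tl t_pos obtain e' where "e = Suc e'"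
                by (cases e) auto
              ultimately have "down s" if "vars s 13 = l div 2" "vars s 12 = r + l" "clk s \<le> c + 70" for s
                unfolding down_def using that c by (intro exI[of _ e'] exI[of _ E]) auto
              then show ?thesis
                using True m I2 \<mu> l0
                by (simp add: wp_simps fv q(2) dn I_def \<mu>_def ag2 l_def[symmetric])
            qed
          next
            case False
            have f14: "f 14 = 0" using q(2) False by simp
            have Ir: "a + r \<le> length T" "b + r \<le> length T" "faithful \<longrightarrow> matches T a b r"
              using I by (auto simp: r_def)
            have lt: "lce T a b < r + l" using lce_less_if_not_fp_eq[OF _ _ False] I by (auto simp: r_def)
            have "down s" if s: "vars s 13 = l div 2" "vars s 12 = r" "clk s \<le> c + 70" for s
            proof (cases "vars \<sigma>' 24 = 0")
              case dn: True
              then obtain e E where "e \<le> E" "l = t * 2 ^ e div 2" "t * 2 ^ E \<le> r + t"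
                "clk \<sigma>' + e * C \<le> clk \<sigma> + 30 + (2 * E + 1) * C"
                using I by (auto simp: down_def r_def l_def)
              moreover from this tl t_pos obtain e' where "e = Suc e'"
                by (cases e) auto
              ultimately show ?thesis
                unfolding down_def using c lt s by (intro exI[of _ e'] exI[of _ E]) auto
            next
              case up: False
              then obtain e where "l = t * 2 ^ e" "r + t = t * 2 ^ e" "clk \<sigma>' \<le> clk \<sigma> + 30 + e * C"
                using I by (auto simp: up_def r_def l_def)
              then show ?thesis
                unfolding down_def using c lt s by (intro exI[of _ e] exI[of _ e]) (auto simp: algebra_simps)
            qed
            then show ?thesis
              using I2 \<mu> l0 Ir
              by (auto simp add: wp_simps fv f14 I_def \<mu>_def ag2 l_def[symmetric] r_def[symmetric])
          qed
        qed
        done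
    qed
    subgoal premises p for \<sigma>'
    proof -
      note I = p(1)[unfolded I_def]
      note ag = agreeD[OF I[THEN conjunct1]]
      have lt: "vars \<sigma>' 13 < t" using p(2) v by (simp add: ag)
      have "vars \<sigma>' 24 = 0"
      proof (rule ccontr)
        assume "vars \<sigma>' 24 \<noteq> 0"
        then obtain e where "vars \<sigma>' 13 = t * 2 ^ e" using I by (auto simp: up_def)
        with lt show False by simp
      qed
      then obtain e E where e: "e \<le> E" "vars \<sigma>' 13 = t * 2 ^ e div 2"
        "t * 2 ^ E \<le> vars \<sigma>' 12 + t" "clk \<sigma>' + e * C \<le> clk \<sigma> + 30 + (2 * E + 1) * C"
        "faithful \<longrightarrow> lce T a b < vars \<sigma>' 12 + t * 2 ^ e"
        using I by (auto simp: down_def)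
      have "e = 0" using lt e(2) by (cases e) auto
      have "\<sigma>' = \<sigma>\<lparr>vars := vars \<sigma>', clk := clk \<sigma>'\<rparr>" using I by (cases \<sigma>; cases \<sigma>') auto
      then show ?thesis
        using Q[of "vars \<sigma>'" E "clk \<sigma>' + (ecost (V 5 \<^bold>< V 13 \<^bold>+ N 1) + 2)"] I e \<open>e = 0\<close>
        by (cases \<sigma>; cases \<sigma>') (auto simp: C_def algebra_simps)
    qed
    done
qed

text \<open>At most \<open>t\<close> letters are compared, whatever the fingerprints did. If the
  extension ends less than \<open>t\<close> letters beyond \<open>r\<close>, the loop must have
  stopped at a true mismatch or at the end of the text.\<close>

lemma wp_char_loop:
  assumes v: "vars \<sigma> 4 = length T" "vars \<sigma> 5 = t" "vars \<sigma> 10 = a" "vars \<sigma> 11 = b" "vars \<sigma> 12 = r"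
    and b: "a + r \<le> length T" "b + r \<le> length T"
    and Q: "\<And>f c. agree {12..25} (vars \<sigma>) f \<Longrightarrow> r \<le> f 12 \<Longrightarrow> a + f 12 \<le> length T \<Longrightarrow> b + f 12 \<le> length T \<Longrightarrow>
      (matches T a b r \<Longrightarrow> lce T a b < r + t \<Longrightarrow> f 12 = lce T a b) \<Longrightarrow>
      c \<le> clk \<sigma> + 50 + 200 * t \<Longrightarrow> Q (\<sigma>\<lparr>vars := f, clk := c\<rparr>)"
  shows "wp char_loop Q \<sigma>"
proof -
  define stop where "stop = (\<lambda>x. a + x = length T \<or> b + x = length T \<or>
     a + x < length T \<and> b + x < length T \<and> T ! (a + x) \<noteq> T ! (b + x))"
  define I where "I = (\<lambda>\<sigma>'::st. agree {12..25} (vars \<sigma>) (vars \<sigma>') \<and> arrs \<sigma>' = arrs \<sigma> \<and> tape \<sigma>' = tape \<sigma> \<and>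
     r \<le> vars \<sigma>' 12 \<and> a + vars \<sigma>' 12 \<le> length T \<and> b + vars \<sigma>' 12 \<le> length T \<and> vars \<sigma>' 25 \<le> t \<and>
     (matches T a b r \<longrightarrow> matches T a b (vars \<sigma>' 12)) \<and>
     (vars \<sigma>' 12 + vars \<sigma>' 25 = r + t \<or> vars \<sigma>' 25 = 0 \<and> stop (vars \<sigma>' 12)) \<and>
     clk \<sigma>' + 200 * vars \<sigma>' 25 \<le> clk \<sigma> + 30 + 200 * t)"
  show ?thesis
    unfolding char_loop_def
    apply (simp add: wp_simps v)
    apply (rule wp_while[where I = I and m = "\<lambda>s. vars s 25"])
    subgoal using b by (simp add: I_def v)
    subgoal by (simp add: I_def)
    subgoal premises p for \<sigma>'
    proof -
      note I = p(1)[unfolded I_def]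
      define x where "x = vars \<sigma>' 12"
      note ag = agreeD[OF I[THEN conjunct1]]
      have I2: "arrs \<sigma>' = arrs \<sigma>" "tape \<sigma>' = tape \<sigma>" "r \<le> x" "a + x \<le> length T" "b + x \<le> length T"
        "matches T a b r \<longrightarrow> matches T a b x" "x + vars \<sigma>' 25 = r + t" "0 < vars \<sigma>' 25" "vars \<sigma>' 25 \<le> t"
        "clk \<sigma>' + 200 * vars \<sigma>' 25 \<le> clk \<sigma> + 30 + 200 * t"
        using I p(2) by (auto simp: x_def)
      have f: "a + x < 2 ^ w" "b + x < 2 ^ w" "vars \<sigma>' 25 < 2 ^ w" "x + 1 < 2 ^ w"
        using I2 arith_fits by linarith+
      show ?thesis
      proof (cases "stop x")
        case True
        then show ?thesis
          using I2 I[THEN conjunct1] f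
          by (auto simp add: wp_simps I_def x_def[symmetric] ag v stop_def)
      next
        case False
        then have m: "matches T a b r \<longrightarrow> matches T a b (x + 1)"
          using I2 by (auto simp: matches_add) (auto simp: matches_def stop_def)
        from False have "a + x < length T" "b + x < length T" "T ! (a + x) = T ! (b + x)"
          using I2 by (auto simp: stop_def)
        moreover obtain y where "vars \<sigma>' 25 = y + 1" using I2 by (metis less_imp_Suc_add add_0 Suc_eq_plus1)
        ultimately show ?thesis
          using m I2 I[THEN conjunct1] f
          by (simp add: wp_simps I_def x_def[symmetric] ag v)
      qed
    qed
    subgoal premises p for \<sigma>'
    proof -
      note I = p(1)[unfolded I_def]
      have "vars \<sigma>' 12 = lce T a b" if m: "matches T a b r" "lce T a b < r + t"
      proof -
        have m: "matches T a b (vars \<sigma>' 12)" "a \<le> length T" "b \<le> length T" using m I b by auto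
        then have "vars \<sigma>' 12 < r + t" using that(2) matches_lce_iff by fastforce
        then have "stop (vars \<sigma>' 12)" using I p(2) by auto
        then show ?thesis
          using m(1) by (intro lce_eqI[symmetric]) (auto simp: stop_def)
      qed
      then show ?thesis
        using Q[of "vars \<sigma>'" "clk \<sigma>' + (ecost (V 25) + 2)"] I p(2)
        by (cases \<sigma>; cases \<sigma>') auto
    qed
    done
qed

end

text \<open>For a short text \<open>t\<close> is set to the text length plus 1: the first comparison
  is then out of range, halving ends the search at once, and the letter loop determines the whole
  extension.\<close>

definition query :: "nat \<Rightarrow> hcom" where
  "query N\<^sub>0 = (4 ::= V 0;; 10 ::= V 2 \<^bold>- N 1;; 11 ::= V 3 \<^bold>- N 1;;
     IF V 4 \<^bold>< N N\<^sub>0 THEN (5 ::= V 4 \<^bold>+ N 1;; 6 ::= N 1;; 7 ::= N 1)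
     ELSE (6 ::= Ld 0 (N 0);; 5 ::= Ld 0 (N 1);; 7 ::= Ld 0 (N 2));;
     fp_loop;; char_loop;; 0 ::= V 12)"

context hashing
begin

lemma wp_query_loops:
  assumes h: "t \<le> length T \<Longrightarrow> hash_table (arrs \<sigma>) \<and> vars \<sigma> 7 = B"
    and v: "vars \<sigma> 4 = length T" "vars \<sigma> 5 = t" "vars \<sigma> 6 = q" "vars \<sigma> 10 = a"
      "vars \<sigma> 11 = b"
    and b: "a \<le> length T" "b \<le> length T"
    and Q: "\<And>f c E. (faithful \<Longrightarrow> f 0 = lce T a b) \<Longrightarrow> f 0 \<le> length T \<Longrightarrow>
      t * 2 ^ E \<le> f 0 + t \<Longrightarrow>
      c \<le> clk \<sigma> + 150 + 200 * t + (2 * E + 2) * (600 + 200 * t) \<Longrightarrow> Q (\<sigma>\<lparr>vars := f, clk := c\<rparr>)"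
  shows "wp fp_loop (wp (char_loop;; 0 ::= V 12) Q) \<sigma>"
  apply (rule wp_fp_loop[where a = a and b = b])
  using h v b apply simp_all[8]
  subgoal premises p for f c E
    apply (simp add: wp_simps)
    apply (rule wp_char_loop[where a = a and b = b and r = "f 12"])
    using p v apply (simp_all add: agreeD[OF p(1)[simplified]])[7]
    subgoal premises q for f' c'
      apply (simp add: wp_simps)
      apply (rule Q[where E = E])
      using p q
      apply auto
      done
    done
  done

lemma wp_query:
  assumes v: "vars \<sigma> 0 = length T" "vars \<sigma> 2 = a + 1" "vars \<sigma> 3 = b + 1"
    and b: "a < length T" "b < length T" "N\<^sub>0 < 2 ^ w"
    and small: "length T < N\<^sub>0 \<Longrightarrow> q = 1 \<and> t = length T + 1"
    and large: "N\<^sub>0 \<le> length T \<Longrightarrow> hash_table (arrs \<sigma>)"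
    and Q: "\<And>f c E. (faithful \<Longrightarrow> f 0 = lce T a b) \<Longrightarrow> f 0 \<le> length T \<Longrightarrow>
      t * 2 ^ E \<le> f 0 + t \<Longrightarrow>
      c \<le> clk \<sigma> + 300 + 200 * t + (2 * E + 2) * (600 + 200 * t) \<Longrightarrow> Q (\<sigma>\<lparr>vars := f, clk := c\<rparr>)"
  shows "wp (query N\<^sub>0) Q \<sigma>"
proof -
  have f: "a + 1 < 2 ^ w" "b + 1 < 2 ^ w" "length T + 1 < 2 ^ w" using b arith_fits by linarith+
  show ?thesis
  proof (cases "length T < N\<^sub>0")
    case True
    show ?thesis
      unfolding query_def
      apply (simp add: wp_simps v b f True)
      apply (rule wp_query_loops[where a = a and b = b])
      using b small True apply simp_all[8]
      subgoal premises p for f c E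
        using Q[where f = f and c = c and E = E] p by simp
      done
  next
    case False
    note h = large[OF False[unfolded not_less]]
    show ?thesis
      unfolding query_def using three_arrays arrays_long
      apply (simp add: wp_simps v b f False)
      apply (rule wp_query_loops[where a = a and b = b])
      using b h apply (simp_all add: hash_table_def)[8]
      subgoal premises p for f c E
        using Q[where f = f and c = c and E = E] p by simp
      done
  qed
qed

end

section \<open>Building the hash table\<close>

text \<open>Registers 30 and 31 run through the prefix fingerprints and the powers of
  \<open>B\<close>. The initial power is reduced as well, since a modulus without any prime factor
  is 1 and then the residue is 0.\<close>

definition build :: hcom where
  "build = (Sto 0 (N 0) (V 6);; Sto 0 (N 1) (V 5);; Sto 0 (N 2) (V 7);;
     Sto 1 (N 0) (N 0);; Sto 2 (N 0) (N 1 \<^bold>% V 6);;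
     30 ::= N 0;; 31 ::= N 1 \<^bold>% V 6;; 32 ::= N 0;;
     WHILE V 32 \<^bold>< V 4 DO (
       30 ::= (V 30 \<^bold>* V 7 \<^bold>+ Inp (V 32)) \<^bold>% V 6;;
       31 ::= V 31 \<^bold>* V 7 \<^bold>% V 6;;
       32 ::= V 32 \<^bold>+ N 1;;
       IF V 32 \<^bold>% V 5 THEN SKIP
       ELSE (Sto 1 (V 32 \<^bold>/ V 5) (V 30);; Sto 2 (V 32 \<^bold>/ V 5) (V 31))))"

context hashing
begin

lemma wp_build:
  assumes v: "vars \<sigma> 4 = length T" "vars \<sigma> 5 = t" "vars \<sigma> 6 = q" "vars \<sigma> 7 = B"
    and Q: "\<And>f A c. agree {30..32} (vars \<sigma>) f \<Longrightarrow> agree {0, 1, 2} (arrs \<sigma>) A \<Longrightarrow> hash_table A \<Longrightarrow>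
      c \<le> clk \<sigma> + 200 + 200 * length T \<Longrightarrow> Q (\<sigma>\<lparr>vars := f, arrs := A, clk := c\<rparr>)"
  shows "wp build Q \<sigma>"
proof -
  define I where "I = (\<lambda>\<sigma>'::st. agree {30..32} (vars \<sigma>) (vars \<sigma>') \<and> agree {0, 1, 2} (arrs \<sigma>) (arrs \<sigma>') \<and>
     tape \<sigma>' = tape \<sigma> \<and> vars \<sigma>' 32 \<le> length T \<and> vars \<sigma>' 30 = pval B T (vars \<sigma>' 32) mod q \<and>
     vars \<sigma>' 31 = B ^ vars \<sigma>' 32 mod q \<and>
     arrs \<sigma>' 0 0 = q \<and> arrs \<sigma>' 0 1 = t \<and> arrs \<sigma>' 0 2 = B \<and>
     (\<forall>x. x * t \<le> vars \<sigma>' 32 \<longrightarrow> arrs \<sigma>' 1 x = pval B T (x * t) mod q \<and> arrs \<sigma>' 2 x = B ^ (x * t) mod q) \<and>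
     clk \<sigma>' \<le> clk \<sigma> + 150 + 200 * vars \<sigma>' 32)"
  have K: "0 < K" "1 < K" "2 < K" "0 < S" "1 < S" "2 < S" using three_arrays arrays_long by linarith+
  show ?thesis
    unfolding build_def
    apply (simp add: wp_simps v K)
    apply (rule wp_while[where I = I and m = "\<lambda>s. length T - vars s 32"])
    subgoal using t_pos by (simp add: I_def)
    subgoal by (simp add: I_def)
    subgoal premises p for \<sigma>'
    proof -
      note I = p(1)[unfolded I_def]
      note ag = agreeD[OF I[THEN conjunct1]]
      define y where "y = vars \<sigma>' 32"
      have y: "y < length T" using p(2) v by (simp add: ag y_def)
      have I2: "vars \<sigma>' 30 = pval B T y mod q" "vars \<sigma>' 31 = B ^ y mod q"
        "\<And>x. x * t \<le> y \<Longrightarrow> arrs \<sigma>' 1 x = pval B T (x * t) mod q \<and> arrs \<sigma>' 2 x = B ^ (x * t) mod q"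
        "agree {0, 1, 2} (arrs \<sigma>) (arrs \<sigma>')" "tape \<sigma>' = tape \<sigma>"
        "arrs \<sigma>' 0 0 = q" "arrs \<sigma>' 0 1 = t" "arrs \<sigma>' 0 2 = B"
        "clk \<sigma>' \<le> clk \<sigma> + 150 + 200 * y"
        using I by (auto simp: y_def)
      have m: "B ^ y mod q * B mod q = B ^ (y + 1) mod q"
        by (simp add: mod_mult_left_eq mod_mult_right_eq mult.commute power_add)
      have S: "(y + 1) div t < S" using div_le_mono[of "y + 1" "length T" t] y arrays_long by linarith
      have f: "y + 1 < 2 ^ w" "y + 1 \<le> length T" using y arith_fits by linarith+
      have x1: "x * t \<le> y" if "x * t \<le> y + 1" "(y + 1) mod t \<noteq> 0" for x
        using that by (metis Suc_eq_plus1 le_SucE mod_mult_self2_is_0)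
      have x2: "x * t \<le> y" if "x * t \<le> y + 1" "x \<noteq> (y + 1) div t" for x
        using that t_pos by (metis Suc_eq_plus1 div_mult_self_is_m le_SucE)
      show ?thesis
      proof (cases "(y + 1) mod t = 0")
        case False
        then show ?thesis
          using I[THEN conjunct1] I2 f x1 q_pos
          by (simp add: wp_simps I_def ag v y_def[symmetric] y hash_step m modmul_fits modmul_fits' letter_less)
      next
        case True
        then have "(y + 1) div t * t = y + 1" by auto
        with True show ?thesis
          using I[THEN conjunct1] I2 f x2 q_pos S K
          by (auto simp add: wp_simps I_def ag v y_def[symmetric] y hash_step m modmul_fits modmul_fits' letter_less)
      qed
    qed
    subgoal premises p for \<sigma>'
    proof -
      note I = p(1)[unfolded I_def]
      note ag = agreeD[OF I[THEN conjunct1]]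
      have "vars \<sigma>' 32 = length T" using p(2) v I by (simp add: ag)
      then have "hash_table (arrs \<sigma>')" using I by (auto simp: hash_table_def)
      then show ?thesis
        using Q[of "vars \<sigma>'" "arrs \<sigma>'" "clk \<sigma>' + (ecost (V 32 \<^bold>< V 4) + 2)"] I
        by (cases \<sigma>; cases \<sigma>') auto
    qed
    done
qed

end


section \<open>Random moduli\<close>

definition bitlength :: hcom where
  "bitlength = (11 ::= N 0;; WHILE V 10 DO (11 ::= V 11 \<^bold>+ N 1;; 10 ::= V 10 \<^bold>/ N 2))"

definition power_below :: hcom where
  "power_below = (5 ::= N 1;; WHILE V 5 \<^bold>+ V 5 \<^bold>< V 1 \<^bold>+ N 1 DO 5 ::= V 5 \<^bold>+ V 5)"

definition test_prime :: hcom where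
  "test_prime = (21 ::= (N 1 \<^bold>< V 20);; 22 ::= N 2;;
     WHILE V 22 \<^bold>* V 22 \<^bold>< V 20 \<^bold>+ N 1 DO (
       IF V 20 \<^bold>% V 22 THEN SKIP ELSE 21 ::= N 0;;
       22 ::= V 22 \<^bold>+ N 1))"

text \<open>The number of tries in register 26 is fixed beforehand, so the time is bounded on every
  tape; the last prime found is kept, and 1 if there is none.\<close>

definition pick_prime :: hcom where
  "pick_prime = (23 ::= N 1;; 24 ::= V 26;;
     WHILE V 24 DO (
       Rnd 20;; 20 ::= V 20 \<^bold>% V 9;; test_prime;;
       IF V 21 THEN 23 ::= V 20 ELSE SKIP;;
       24 ::= V 24 \<^bold>- N 1))"

definition pick_modulus :: "nat \<Rightarrow> hcom" where
  "pick_modulus c = (6 ::= N 1;; 25 ::= N c;;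
     WHILE V 25 DO (pick_prime;; 6 ::= V 6 \<^bold>* V 23;; 25 ::= V 25 \<^bold>- N 1))"

text \<open>The value 1 for a draw without primes divides every number, so in the probability
  estimates such a draw counts as a bad one.\<close>

definition picked :: "nat \<Rightarrow> nat list \<Rightarrow> nat" where
  "picked M us = foldl (\<lambda>p u. if prime (u mod M) then u mod M else p) 1 us"

primrec modulus :: "nat \<Rightarrow> nat \<Rightarrow> nat \<Rightarrow> nat list \<Rightarrow> nat" where
  "modulus M R 0 us = 1"
| "modulus M R (Suc c) us = picked M (take R us) * modulus M R c (drop R us)"

lemma picked_snoc: "picked M (us @ [u]) = (if prime (u mod M) then u mod M else picked M us)"
  by (simp add: picked_def)

lemma picked_cases: "picked M us = 1 \<or> (\<exists>u \<in> set us. picked M us = u mod M \<and> prime (u mod M))"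
proof -
  let ?f = "\<lambda>p u. if prime (u mod M) then u mod M else p"
  have "foldl ?f p us = p \<or> (\<exists>u \<in> set us. foldl ?f p us = u mod M \<and> prime (u mod M))" for p
  proof (induction us arbitrary: p)
    case (Cons a us)
    then show ?case using Cons[of "?f p a"] by (cases "prime (a mod M)") auto
  qed simp
  then show ?thesis by (simp add: picked_def)
qed

lemma picked_bounds: "0 < M \<Longrightarrow> 1 \<le> picked M us \<and> picked M us \<le> M"
  using picked_cases[of M us] by (auto dest: prime_ge_1_nat simp: less_imp_le)

lemma modulus_bounds: "0 < M \<Longrightarrow> 1 \<le> modulus M R c us \<and> modulus M R c us \<le> M ^ c"
proof (induction c arbitrary: us)
  case (Suc c)
  then have "1 * 1 \<le> picked M (take R us) * modulus M R c (drop R us)"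
    "picked M (take R us) * modulus M R c (drop R us) \<le> M * M ^ c"
    using picked_bounds[of M "take R us"] by (intro mult_le_mono; blast)+
  then show ?case by simp
qed simp

lemma prime_trial_division:
  "prime (r::nat) \<longleftrightarrow> 1 < r \<and> (\<forall>d. 2 \<le> d \<and> d * d \<le> r \<longrightarrow> \<not> d dvd r)"
proof
  assume "prime r"
  then have "1 < r" by (rule prime_gt_1_nat)
  moreover have "\<not> d dvd r" if "2 \<le> d" "d * d \<le> r" for d
  proof
    assume "d dvd r"
    then have "d = r" using \<open>prime r\<close> that by (auto simp: prime_nat_iff)
    with that show False by simp
  qed
  ultimately show "1 < r \<and> (\<forall>d. 2 \<le> d \<and> d * d \<le> r \<longrightarrow> \<not> d dvd r)" by blast
next
  assume r: "1 < r \<and> (\<forall>d. 2 \<le> d \<and> d * d \<le> r \<longrightarrow> \<not> d dvd r)"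
  show "prime r"
  proof (rule ccontr)
    assume "\<not> prime r"
    then obtain d where d: "d dvd r" "d \<noteq> 1" "d \<noteq> r" using r by (auto simp: prime_nat_iff)
    then obtain e where e: "r = d * e" by blast
    then have "2 \<le> d" "2 \<le> e" using r d by (cases d; cases e; force)+
    moreover have "d * d \<le> r \<or> e * e \<le> r" using e by (metis mult_le_mono1 mult_le_mono2 nat_le_linear)
    ultimately show False using r d e by (metis dvd_triv_right)
  qed
qed

lemma floorlog_half: "0 < x \<Longrightarrow> floorlog 2 x = floorlog 2 (x div 2) + 1"
  by (subst compute_floorlog) simp

lemma floorlog_le_self: "floorlog 2 x \<le> x"
  using floorlog_leI[of x 2 x] less_exp[of x] by simp

context machine
begin

lemma wp_bitlength:
  assumes "vars \<sigma> 10 < 2 ^ w"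
    and Q: "\<And>c. c \<le> clk \<sigma> + 20 + 50 * floorlog 2 (vars \<sigma> 10) \<Longrightarrow>
      Q (\<sigma>\<lparr>vars := (vars \<sigma>)(10 := 0, 11 := floorlog 2 (vars \<sigma> 10)), clk := c\<rparr>)"
  shows "wp bitlength Q \<sigma>"
proof -
  define I where "I = (\<lambda>\<sigma>'::st. agree {10, 11} (vars \<sigma>) (vars \<sigma>') \<and> arrs \<sigma>' = arrs \<sigma> \<and> tape \<sigma>' = tape \<sigma> \<and>
    vars \<sigma>' 10 < 2 ^ w \<and> floorlog 2 (vars \<sigma> 10) = vars \<sigma>' 11 + floorlog 2 (vars \<sigma>' 10) \<and>
     clk \<sigma>' \<le> clk \<sigma> + 15 + 50 * vars \<sigma>' 11)"
  have w: "vars \<sigma> 10 + 1 \<le> 2 ^ w" using assms(1) by simp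
  show ?thesis
    unfolding bitlength_def
    apply (simp add: wp_simps)
    apply (rule wp_while[where I = I and m = "\<lambda>s. vars s 10"])
    subgoal using assms(1) by (simp add: I_def)
    subgoal by (simp add: I_def)
    subgoal premises p for \<sigma>'
    proof -
      have *: "floorlog 2 (vars \<sigma>' 10) = floorlog 2 (vars \<sigma>' 10 div 2) + 1"
        using p(2) by (intro floorlog_half) simp
      then have "vars \<sigma>' 11 + 1 \<le> vars \<sigma> 10"
        using p(1) floorlog_le_self[of "vars \<sigma> 10"] by (simp add: I_def)
      with * p w show ?thesis by (auto simp: I_def wp_simps)
    qed
    subgoal premises p for \<sigma>'
    proof -
      have "vars \<sigma>' 10 = 0" using p(2) by simp
      moreover from this have "vars \<sigma>' 11 = floorlog 2 (vars \<sigma> 10)"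
        using p(1) by (simp add: I_def floorlog_eq_zero_iff)
      moreover from calculation have "vars \<sigma>' = (vars \<sigma>)(10 := 0, 11 := floorlog 2 (vars \<sigma> 10))"
        using p(1) agree_2D[of 10 11 "vars \<sigma>" "vars \<sigma>'"] by (simp add: I_def)
      ultimately show ?thesis
        using Q[of "clk \<sigma>' + (ecost (V 10) + 2)"] p(1)
        by (cases \<sigma>; cases \<sigma>') (simp add: I_def)
    qed
    done
qed

lemma wp_power_below:
  assumes "1 \<le> vars \<sigma> 1" "2 * vars \<sigma> 1 + 1 < 2 ^ w"
    and Q: "\<And>a c. 2 ^ a \<le> vars \<sigma> 1 \<Longrightarrow> vars \<sigma> 1 < 2 * 2 ^ a \<Longrightarrow> c \<le> clk \<sigma> + 30 + 30 * vars \<sigma> 1 \<Longrightarrow>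
      Q (\<sigma>\<lparr>vars := (vars \<sigma>)(5 := 2 ^ a), clk := c\<rparr>)"
  shows "wp power_below Q \<sigma>"
proof -
  define I where "I = (\<lambda>\<sigma>'::st. agree {5} (vars \<sigma>) (vars \<sigma>') \<and> arrs \<sigma>' = arrs \<sigma> \<and> tape \<sigma>' = tape \<sigma> \<and>
    (\<exists>a. vars \<sigma>' 5 = 2 ^ a) \<and> vars \<sigma>' 5 \<le> vars \<sigma> 1 \<and> clk \<sigma>' \<le> clk \<sigma> + 15 + 30 * (vars \<sigma>' 5 - 1))"
  show ?thesis
    unfolding power_below_def
    apply (simp add: wp_simps)
    apply (rule wp_while[where I = I and m = "\<lambda>s. vars \<sigma> 1 - vars s 5"])
    subgoal using assms(1) by (auto simp: I_def intro!: exI[of _ 0])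
    subgoal using assms(2) by (auto simp: I_def agree_def)
    subgoal premises p for \<sigma>'
    proof -
      define x where "x = vars \<sigma>' 5"
      obtain a where a: "x = 2 ^ a" using p(1) by (auto simp: I_def x_def)
      have x: "1 \<le> x" "\<exists>b. x + x = 2 ^ b" unfolding a by (auto intro!: exI[of _ "Suc a"])
      have ag: "vars \<sigma>' 1 = vars \<sigma> 1" using p(1) by (auto simp: I_def agree_def)
      have I2: "agree {5} (vars \<sigma>) (vars \<sigma>')" "arrs \<sigma>' = arrs \<sigma>" "tape \<sigma>' = tape \<sigma>"
        "clk \<sigma>' \<le> clk \<sigma> + 15 + 30 * (x - 1)" "x + x < vars \<sigma> 1 + 1"
        using p ag by (simp_all add: I_def x_def)
      show ?thesis
        using I2 x assms(2)
        by (simp add: I_def wp_simps x_def[symmetric] ag) linarith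
    qed
    subgoal premises p for \<sigma>'
    proof -
      obtain a where a: "vars \<sigma>' 5 = 2 ^ a" using p(1) by (auto simp: I_def)
      have ag: "vars \<sigma>' 1 = vars \<sigma> 1" using p(1) by (auto simp: I_def agree_def)
      have "vars \<sigma>' = (vars \<sigma>)(5 := 2 ^ a)" using p(1) a by (auto simp: I_def agree_def)
      moreover have "clk \<sigma>' + 15 \<le> clk \<sigma> + 30 + 30 * vars \<sigma> 1" "2 ^ a \<le> vars \<sigma> 1" "vars \<sigma> 1 < 2 * 2 ^ a"
        "arrs \<sigma>' = arrs \<sigma>" "tape \<sigma>' = tape \<sigma>"
        using p a ag by (auto simp: I_def)
      ultimately show ?thesis
        using Q[of a "clk \<sigma>' + (ecost (V 5 \<^bold>+ V 5 \<^bold>< V 1 \<^bold>+ N 1) + 2)"]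
        by (cases \<sigma>; cases \<sigma>') simp
    qed
    done
qed

lemma wp_test_prime:
  assumes D: "vars \<sigma> 20 < D * D" "(D + 2) * (D + 2) < 2 ^ w"
    and Q: "\<And>d c. c \<le> clk \<sigma> + 100 + 50 * D \<Longrightarrow>
      Q (\<sigma>\<lparr>vars := (vars \<sigma>)(21 := if prime (vars \<sigma> 20) then 1 else 0, 22 := d), clk := c\<rparr>)"
  shows "wp test_prime Q \<sigma>"
proof -
  define r where "r = vars \<sigma> 20"
  define I where "I = (\<lambda>\<sigma>'::st. agree {21, 22} (vars \<sigma>) (vars \<sigma>') \<and> arrs \<sigma>' = arrs \<sigma> \<and> tape \<sigma>' = tape \<sigma> \<and>
    2 \<le> vars \<sigma>' 22 \<and> vars \<sigma>' 22 \<le> D + 2 \<and> (\<forall>e. 2 \<le> e \<and> e < vars \<sigma>' 22 \<longrightarrow> e * e \<le> r) \<and>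
    vars \<sigma>' 21 = (if 1 < r \<and> (\<forall>e. 2 \<le> e \<and> e < vars \<sigma>' 22 \<longrightarrow> \<not> e dvd r) then 1 else 0) \<and>
    clk \<sigma>' \<le> clk \<sigma> + 30 + 50 * (vars \<sigma>' 22 - 2))"
  have dd: "D * D + 1 < 2 ^ w" "\<And>d. d \<le> D + 2 \<Longrightarrow> d * d < 2 ^ w" "D + 3 < 2 ^ w"
    using D(2) mult_le_mono[of _ "D + 2" _ "D + 2"] by (auto simp: algebra_simps intro: le_less_trans)
  show ?thesis
    unfolding test_prime_def
    apply (simp add: wp_simps split del: if_split)
    apply (rule wp_while[where I = I and m = "\<lambda>s. D + 3 - vars s 22"])
    subgoal by (auto simp: I_def r_def)
    subgoal using dd D(1) by (auto simp: I_def agree_def)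
    subgoal premises p for \<sigma>'
    proof -
      note I = p(1)[unfolded I_def]
      note ag = agreeD[OF I[THEN conjunct1]]
      define d where "d = vars \<sigma>' 22"
      have d: "d * d \<le> r" using p(2) by (simp add: d_def r_def ag)
      then have "d * d < D * D" using D(1) r_def by linarith
      then have dD: "d < D" by (metis mult_le_mono not_le)
      have *: "(\<forall>e. 2 \<le> e \<and> e < d + 1 \<longrightarrow> \<not> e dvd r) \<longleftrightarrow> (\<forall>e. 2 \<le> e \<and> e < d \<longrightarrow> \<not> e dvd r) \<and> \<not> d dvd r"
        using I by (auto simp: d_def less_Suc_eq) (metis Suc_eq_plus1 less_SucE)+
      have sq: "\<forall>e. 2 \<le> e \<and> e < d + 1 \<longrightarrow> e * e \<le> r"
        using I d by (metis d_def Suc_eq_plus1 less_SucE)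
      have I2: "arrs \<sigma>' = arrs \<sigma>" "tape \<sigma>' = tape \<sigma>" "2 \<le> d"
        "vars \<sigma>' 21 = (if 1 < r \<and> (\<forall>e. 2 \<le> e \<and> e < d \<longrightarrow> \<not> e dvd r) then 1 else 0)"
        "clk \<sigma>' \<le> clk \<sigma> + 30 + 50 * (d - 2)"
        using I by (simp_all add: d_def)
      show ?thesis
      proof (cases "d dvd r")
        case True
        then show ?thesis using I2 I[THEN conjunct1] dD dd(3) sq
          by (auto simp add: wp_simps I_def d_def[symmetric] ag r_def[symmetric] *)
      next
        case False
        then have "r mod d \<noteq> 0" by (simp add: dvd_eq_mod_eq_0)
        with False show ?thesis using I2 I[THEN conjunct1] dD dd(3) sq
          by (auto simp add: wp_simps I_def d_def[symmetric] ag r_def[symmetric] *)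
      qed
    qed
    subgoal premises p for \<sigma>'
    proof -
      note I = p(1)[unfolded I_def]
      note ag = agreeD[OF I[THEN conjunct1]]
      have d: "r < vars \<sigma>' 22 * vars \<sigma>' 22" using p(2) by (simp add: r_def ag)
      have "e < vars \<sigma>' 22" if "e * e \<le> r" for e
        using d that by (metis le_less_trans mult_le_mono not_le)
      then have "(\<forall>e. 2 \<le> e \<and> e < vars \<sigma>' 22 \<longrightarrow> \<not> e dvd r) \<longleftrightarrow> (\<forall>e. 2 \<le> e \<and> e * e \<le> r \<longrightarrow> \<not> e dvd r)"
        using I by blast
      then have "vars \<sigma>' 21 = (if prime r then 1 else 0)"
        using I unfolding prime_trial_division[of r] by simp
      then have "vars \<sigma>' = (vars \<sigma>)(21 := if prime (vars \<sigma> 20) then 1 else 0, 22 := vars \<sigma>' 22)"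
        using I agree_2D[of 21 22 "vars \<sigma>" "vars \<sigma>'"] by (simp add: r_def)
      moreover have "clk \<sigma>' + 15 \<le> clk \<sigma> + 100 + 50 * D" using I by auto
      ultimately show ?thesis
        using Q[of "clk \<sigma>' + (ecost (V 22 \<^bold>* V 22 \<^bold>< V 20 \<^bold>+ N 1) + 2)" "vars \<sigma>' 22"] I
        by (cases \<sigma>; cases \<sigma>') simp
    qed
    done
qed

lemma wp_pick_prime:
  assumes v: "vars \<sigma> 9 = M" "vars \<sigma> 26 = length us" "tape \<sigma> = us @ ws"
    and D: "0 < M" "M \<le> D * D" "(D + 2) * (D + 2) < 2 ^ w" "length us < 2 ^ w"
    and Q: "\<And>f c. agree {20..24} (vars \<sigma>) f \<Longrightarrow> f 23 = picked M us \<Longrightarrow>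
      c \<le> clk \<sigma> + 50 + length us * (200 + 50 * D) \<Longrightarrow> Q (\<sigma>\<lparr>vars := f, tape := ws, clk := c\<rparr>)"
  shows "wp pick_prime Q \<sigma>"
proof -
  define C where "C = 200 + 50 * D"
  define I where "I = (\<lambda>\<sigma>'::st. agree {20..24} (vars \<sigma>) (vars \<sigma>') \<and> arrs \<sigma>' = arrs \<sigma> \<and>
    (\<exists>us1 us2. us = us1 @ us2 \<and> tape \<sigma>' = us2 @ ws \<and> vars \<sigma>' 24 = length us2 \<and> vars \<sigma>' 23 = picked M us1) \<and>
    clk \<sigma>' + vars \<sigma>' 24 * C \<le> clk \<sigma> + 30 + length us * C)"
  show ?thesis
    unfolding pick_prime_def
    apply (simp add: wp_simps)
    apply (rule wp_while[where I = I and m = "\<lambda>s. vars s 24"])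
    subgoal by (auto simp: I_def v picked_def intro!: exI[of _ "[]"])
    subgoal by (simp add: I_def)
    subgoal premises p for \<sigma>'
    proof -
      note I = p(1)[unfolded I_def]
      note ag = agreeD[OF I[THEN conjunct1]]
      obtain us1 us2' where *: "us = us1 @ us2'" "tape \<sigma>' = us2' @ ws" "vars \<sigma>' 24 = length us2'"
        "vars \<sigma>' 23 = picked M us1" using I by blast
      then obtain u us2 where us2: "us2' = u # us2" using p(2) by (cases us2') auto
      have I2: "arrs \<sigma>' = arrs \<sigma>" "clk \<sigma>' + C + length us2 * C \<le> clk \<sigma> + 30 + length us * C"
        using I * us2 by auto
      have l: "Suc (length us2) < 2 ^ w" using D(4) * us2 by simp
      have u: "u mod M < D * D" using D by (meson less_le_trans mod_less_divisor)
      have fin: "I s" if "agree {20..24} (vars \<sigma>) (vars s)" "arrs s = arrs \<sigma>" "tape s = us2 @ ws"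
        "vars s 24 = length us2" "vars s 23 = picked M (us1 @ [u])" "clk s \<le> clk \<sigma>' + C" for s
        using that I2 * us2 unfolding I_def by (auto intro!: exI[of _ "us1 @ [u]"])
      show ?thesis
        using I2(1) *(2-4) I[THEN conjunct1] l
        apply (simp add: wp_simps us2 ag v)
        apply (rule wp_test_prime[where D = D])
        subgoal using u by simp
        subgoal using D by simp
        subgoal for d c
          by (auto simp add: wp_simps picked_snoc C_def intro!: fin)
        done
    qed
    subgoal premises p for \<sigma>'
    proof -
      note I = p(1)[unfolded I_def]
      have "vars \<sigma>' 23 = picked M us" "tape \<sigma>' = ws" using I p(2) by auto
      then show ?thesis
        using Q[of "vars \<sigma>'" "clk \<sigma>' + (ecost (V 24) + 2)"] I
        by (cases \<sigma>; cases \<sigma>') (auto simp: C_def)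
    qed
    done
qed

lemma wp_pick_modulus:
  assumes v: "vars \<sigma> 9 = M" "vars \<sigma> 26 = R" "tape \<sigma> = us @ ws" "length us = R * k"
    and D: "0 < M" "M \<le> D * D" "(D + 2) * (D + 2) < 2 ^ w" "R < 2 ^ w" "k < 2 ^ w" "M ^ k < 2 ^ w"
    and Q: "\<And>f c. agree ({20..25} \<union> {6}) (vars \<sigma>) f \<Longrightarrow> f 6 = modulus M R k us \<Longrightarrow>
      c \<le> clk \<sigma> + 50 + k * (100 + R * (200 + 50 * D)) \<Longrightarrow> Q (\<sigma>\<lparr>vars := f, tape := ws, clk := c\<rparr>)"
  shows "wp (pick_modulus k) Q \<sigma>"
proof -
  define C where "C = 100 + R * (200 + 50 * D)"
  define I where "I = (\<lambda>\<sigma>'::st. agree ({20..25} \<union> {6}) (vars \<sigma>) (vars \<sigma>') \<and> arrs \<sigma>' = arrs \<sigma> \<and>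
    (\<exists>us2. tape \<sigma>' = us2 @ ws \<and> length us2 = R * vars \<sigma>' 25 \<and>
       vars \<sigma>' 6 * modulus M R (vars \<sigma>' 25) us2 = modulus M R k us) \<and>
    vars \<sigma>' 25 \<le> k \<and> clk \<sigma>' + vars \<sigma>' 25 * C \<le> clk \<sigma> + 30 + k * C)"
  show ?thesis
    unfolding pick_modulus_def
    apply (simp add: wp_simps D)
    apply (rule wp_while[where I = I and m = "\<lambda>s. vars s 25"])
    subgoal by (auto simp: I_def v)
    subgoal by (simp add: I_def)
    subgoal premises p for \<sigma>'
    proof -
      note I = p(1)[unfolded I_def]
      note ag = agreeD[OF I[THEN conjunct1]]
      obtain us2 where *: "tape \<sigma>' = us2 @ ws" "length us2 = R * vars \<sigma>' 25"
       "vars \<sigma>' 6 * modulus M R (vars \<sigma>' 25) us2 = modulus M R k us"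
        using I by blast
      obtain m where m: "vars \<sigma>' 25 = Suc m" using p(2) by (cases "vars \<sigma>' 25") auto
      define us3 where "us3 = drop R us2"
      have us2: "us2 = take R us2 @ us3" "length (take R us2) = R" "length us3 = R * m"
        using * m by (auto simp: us3_def)
      have I2: "arrs \<sigma>' = arrs \<sigma>" "clk \<sigma>' + C + m * C \<le> clk \<sigma> + 30 + k * C"
        using I m by auto
      have e: "vars \<sigma>' 6 * picked M (take R us2) * modulus M R m us3 = modulus M R k us"
        using * m by (simp add: us3_def)
      \<comment> \<open>The factors still to come are at least 1, so every partial product is at
        most the final modulus, which is at most \<open>M ^ k\<close>.\<close>
      have "vars \<sigma>' 6 * picked M (take R us2) * 1 \<le> vars \<sigma>' 6 * picked M (take R us2) * modulus M R m us3"
        using modulus_bounds[OF D(1)] by (intro mult_le_mono) auto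
      then have "vars \<sigma>' 6 * picked M (take R us2) \<le> M ^ k"
        using e modulus_bounds[OF D(1), of R k us] by linarith
      then have b: "vars \<sigma>' 6 * picked M (take R us2) < 2 ^ w" using D by linarith
      have mk: "Suc m < 2 ^ w" "Suc m \<le> k" using I m D(5) by auto
      have fin: "I s" if "agree ({20..25} \<union> {6}) (vars \<sigma>) (vars s)" "arrs s = arrs \<sigma>" "tape s = us3 @ ws"
        "vars s 25 = m" "vars s 6 = vars \<sigma>' 6 * picked M (take R us2)" "clk s \<le> clk \<sigma>' + C" for s
        using that I2 us2(3) e mk unfolding I_def by auto
      show ?thesis
        apply (simp add: wp_simps)
        apply (rule wp_pick_prime[where us = "take R us2" and ws = "us3 @ ws" and M = M and D = D])
        using v ag * us2 D apply (simp_all add: append.assoc[symmetric] del: append.assoc)[7]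
        subgoal premises q for f c
        proof -
          note ag' = agreeD[OF q(1)[simplified]]
          have "agree ({20..25} \<union> {6}) (vars \<sigma>) f"
            by (rule agree_trans[OF I[THEN conjunct1] q(1)[simplified]]) auto
          then show ?thesis
            using q(2,3) b m mk us2(2) I2
            by (auto simp add: wp_simps ag' C_def algebra_simps intro!: fin)
        qed
        done
    qed
    subgoal premises p for \<sigma>'
    proof -
      note I = p(1)[unfolded I_def]
      have "vars \<sigma>' 6 = modulus M R k us" "tape \<sigma>' = ws" using I p(2) by auto
      then show ?thesis
        using Q[of "vars \<sigma>'" "clk \<sigma>' + (ecost (V 25) + 2)"] I
        by (cases \<sigma>; cases \<sigma>') (auto simp: C_def)
    qed
    done
qed

end

section \<open>Radix sort\<close>

definition bucket_pass :: "('a \<Rightarrow> nat) \<Rightarrow> nat \<Rightarrow> 'a list \<Rightarrow> 'a list" where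
  "bucket_pass d W xs = concat (map (\<lambda>v. filter (\<lambda>i. d i = v) xs) [0..<W])"

lemma set_bucket_pass: "(\<And>i. i \<in> set xs \<Longrightarrow> d i < W) \<Longrightarrow> set (bucket_pass d W xs) = set xs"
  by (auto simp: bucket_pass_def)

lemma distinct_bucket_pass: "distinct xs \<Longrightarrow> distinct (bucket_pass d W xs)"
  by (induction W) (auto simp: bucket_pass_def)

text \<open>The induction step of least significant digit radix sort: the buckets are ordered by the
  digit \<open>d\<close>, and within a bucket stability preserves the order by the old key, which
  then decides.\<close>

lemma sorted_bucket_pass:
  assumes "sorted_wrt (\<lambda>i j. key i \<le> key j) xs"
    and "\<And>i j. d i < d j \<Longrightarrow> key' i \<le> key' j"
    and "\<And>i j. d i = d j \<Longrightarrow> key i \<le> key j \<Longrightarrow> (key' i :: nat) \<le> key' j"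
  shows "sorted_wrt (\<lambda>i j. key' i \<le> key' j) (bucket_pass d W xs)"
proof (induction W)
  case (Suc W)
  have "sorted_wrt (\<lambda>i j. key i \<le> key j) (filter (\<lambda>i. d i = W) xs)"
    using assms(1) by (rule sorted_wrt_filter)
  then have "sorted_wrt (\<lambda>i j. key' i \<le> key' j) (filter (\<lambda>i. d i = W) xs)"
    by (rule sorted_wrt_mono_rel[rotated]) (auto intro: assms(3))
  with Suc show ?case
    by (auto simp: bucket_pass_def sorted_wrt_append intro: assms(2))
qed (simp add: bucket_pass_def)

text \<open>A residue modulo \<open>B ^ (p + 1)\<close> is its digit at place \<open>p\<close>
  followed by the residue modulo \<open>B ^ p\<close>, so the comparison is lexicographic in these
  two.\<close>

lemma digit_order:
  fixes a b :: nat
  assumes "a div B ^ p mod B < b div B ^ p mod B \<or>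
    a div B ^ p mod B = b div B ^ p mod B \<and> a mod B ^ p \<le> b mod B ^ p"
    and "0 < B"
  shows "a mod B ^ (p + 1) \<le> b mod B ^ (p + 1)"
proof -
  have *: "c mod B ^ (p + 1) = B ^ p * (c div B ^ p mod B) + c mod B ^ p" for c
    unfolding power_add power_one_right by (rule mod_mult2_eq)
  show ?thesis
  proof (cases "a div B ^ p mod B = b div B ^ p mod B")
    case True
    then show ?thesis using assms * by auto
  next
    case False
    then have "a div B ^ p mod B + 1 \<le> b div B ^ p mod B" using assms by auto
    then have "B ^ p * (a div B ^ p mod B + 1) \<le> B ^ p * (b div B ^ p mod B)" by (rule mult_le_mono2)
    moreover have "a mod B ^ p \<le> B ^ p" using assms(2) by (simp add: less_imp_le)
    ultimately show ?thesis using * by (simp add: algebra_simps)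
  qed
qed

text \<open>Linked lists with links shifted by one, so that 0 terminates a list.\<close>

fun chain :: "(nat \<Rightarrow> nat) \<Rightarrow> nat \<Rightarrow> nat list \<Rightarrow> bool" where
  "chain nx p [] \<longleftrightarrow> p = 0"
| "chain nx p (i # is) \<longleftrightarrow> p = i + 1 \<and> chain nx (nx i) is"

lemma chain_upd: "i \<notin> set is \<Longrightarrow> chain (nx(i := z)) p is = chain nx p is"
  by (induction "is" arbitrary: p) auto

definition stores :: "(nat \<Rightarrow> nat) \<Rightarrow> nat list \<Rightarrow> bool" where
  "stores A xs \<longleftrightarrow> (\<forall>x<length xs. A x = xs ! x)"

text \<open>
  Array 3 holds the keys and array 5 the order of positions; 6 and 7 hold the heads and links of the buckets.
  The current digit has base \<open>V 48\<close> and is at bit \<open>V 45\<close>. Prepending to the buckets from right to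
  left makes a pass stable.
\<close>

definition radix_pass :: hcom where
  "radix_pass =
    (47 ::= N 0;; WHILE V 47 \<^bold>< V 48 \<^bold>+ N 1 DO (Sto 6 (V 47) (N 0);; 47 ::= V 47 \<^bold>+ N 1);;
     47 ::= V 40;;
     WHILE V 47 DO (47 ::= V 47 \<^bold>- N 1;; 49 ::= Ld 5 (V 47);;
       50 ::= Bop Shr (Ld 3 (V 49)) (V 45) \<^bold>% V 48;;
       Sto 7 (V 49) (Ld 6 (V 50));; Sto 6 (V 50) (V 49 \<^bold>+ N 1));;
     47 ::= N 0;; 51 ::= N 0;; 49 ::= Ld 6 (N 0);;
     WHILE V 47 \<^bold>< V 48 DO
       IF V 49 THEN (49 ::= V 49 \<^bold>- N 1;; Sto 5 (V 51) (V 49);; 51 ::= V 51 \<^bold>+ N 1;; 49 ::= Ld 7 (V 49))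
       ELSE (47 ::= V 47 \<^bold>+ N 1;; 49 ::= Ld 6 (V 47)))"

context machine
begin

lemma wp_radix_pass:
  assumes v: "vars \<sigma> 40 = m" "vars \<sigma> 48 = W" "vars \<sigma> 45 = p"
    and xs: "stores (arrs \<sigma> 5) xs" "length xs = m" "distinct xs" "set xs = {..<m}"
    and F: "\<And>i. i < m \<Longrightarrow> arrs \<sigma> 3 i = F i"
    and b: "0 < W" "W < S" "m \<le> S" "7 < K" "W + 1 < 2 ^ w" "m + 1 < 2 ^ w"
    and Q: "\<And>f A c. agree {47, 49, 50, 51} (vars \<sigma>) f \<Longrightarrow> agree {5, 6, 7} (arrs \<sigma>) A \<Longrightarrow>
      stores (A 5) (bucket_pass (\<lambda>i. F i div 2 ^ p mod W) W xs) \<Longrightarrow>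
      c \<le> clk \<sigma> + 300 + 250 * m + 200 * W \<Longrightarrow> Q (\<sigma>\<lparr>vars := f, arrs := A, clk := c\<rparr>)"
  shows "wp radix_pass Q \<sigma>"
proof -
  define d where "d = (\<lambda>i. F i div 2 ^ p mod W)"
  define bk where "bk = (\<lambda>ys v. filter (\<lambda>i. d i = v) ys)"
  have K: "3 < K" "5 < K" "6 < K" "7 < K" using b by linarith+
  have dW: "d i < W" for i using b by (simp add: d_def)
  define I1 where "I1 = (\<lambda>\<sigma>'::st. agree {47, 49, 50, 51} (vars \<sigma>) (vars \<sigma>') \<and> agree {6} (arrs \<sigma>) (arrs \<sigma>') \<and>
    tape \<sigma>' = tape \<sigma> \<and> vars \<sigma>' 47 \<le> W + 1 \<and> (\<forall>v<vars \<sigma>' 47. arrs \<sigma>' 6 v = 0) \<and>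
    clk \<sigma>' \<le> clk \<sigma> + 20 + 50 * vars \<sigma>' 47)"
  define I2 where "I2 = (\<lambda>\<sigma>'::st. agree {47, 49, 50, 51} (vars \<sigma>) (vars \<sigma>') \<and> agree {6, 7} (arrs \<sigma>) (arrs \<sigma>') \<and>
    tape \<sigma>' = tape \<sigma> \<and> vars \<sigma>' 47 \<le> m \<and>
    (\<forall>v\<le>W. chain (arrs \<sigma>' 7) (arrs \<sigma>' 6 v) (bk (drop (vars \<sigma>' 47) xs) v)) \<and>
    clk \<sigma>' + 150 * vars \<sigma>' 47 \<le> clk \<sigma> + 100 + 50 * W + 150 * m)"
  \<comment> \<open>\<open>ys\<close> is the output so far and \<open>zs\<close> the unread rest of
    the current bucket. Bucket \<open>W\<close> is an empty sentinel: its head is read after the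
    last real bucket, but no digit equals \<open>W\<close>. Array 5 may be overwritten because the
    buckets are linked through array 7.\<close>
  define I3 where "I3 = (\<lambda>\<sigma>'::st. agree {47, 49, 50, 51} (vars \<sigma>) (vars \<sigma>') \<and> agree {5, 6, 7} (arrs \<sigma>) (arrs \<sigma>') \<and>
    tape \<sigma>' = tape \<sigma> \<and> vars \<sigma>' 47 \<le> W \<and>
    (\<forall>v\<le>W. chain (arrs \<sigma>' 7) (arrs \<sigma>' 6 v) (bk xs v)) \<and>
    (\<exists>ys zs. stores (arrs \<sigma>' 5) ys \<and> vars \<sigma>' 51 = length ys \<and> chain (arrs \<sigma>' 7) (vars \<sigma>' 49) zs \<and>
      (vars \<sigma>' 47 = W \<longrightarrow> zs = []) \<and> ys @ zs @ concat (map (bk xs) [vars \<sigma>' 47 + 1..<W + 1]) = bucket_pass d (W + 1) xs) \<and>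
    clk \<sigma>' \<le> clk \<sigma> + 200 + 50 * W + 150 * m + 100 * vars \<sigma>' 47 + 60 * vars \<sigma>' 51)"
  show ?thesis
    unfolding radix_pass_def
    apply (simp add: wp_simps)
    apply (rule wp_while[where I = I1 and m = "\<lambda>s. W + 1 - vars s 47"])
    subgoal by (simp add: I1_def)
    subgoal using b v by (simp add: I1_def agree_def)
    subgoal premises p for \<sigma>'
      using p(2) p(1)[unfolded I1_def] b v K agreeD[OF p(1)[unfolded I1_def, THEN conjunct1]]
      by (auto simp add: wp_simps I1_def less_Suc_eq)
    subgoal premises p1 for s1
    proof -
      note I1 = p1(1)[unfolded I1_def]
      note ag1 = agreeD[OF I1[THEN conjunct1]]
      have "vars s1 47 = W + 1" using p1(2) I1 v by (simp add: ag1)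
      then have heads: "\<forall>v\<le>W. arrs s1 6 v = 0" "clk s1 \<le> clk \<sigma> + 70 + 50 * W"
        using I1 by auto
      show ?thesis
        apply (simp add: wp_simps)
        apply (rule wp_while[where I = I2 and m = "\<lambda>s. vars s 47"])
        subgoal
          using I1 heads xs(2) v agree_trans[of "{6}" "arrs \<sigma>" "arrs s1" "{6}" _ "{6,7}"]
          by (auto simp: I2_def bk_def ag1)
        subgoal by (simp add: I2_def)
        subgoal premises p2 for \<sigma>'
        proof -
          note I2 = p2(1)[unfolded I2_def]
          note ag2 = agreeD[OF I2[THEN conjunct1]] agreeD[OF I2[THEN conjunct2, THEN conjunct1]]
          obtain x where x: "vars \<sigma>' 47 = Suc x" using p2(2) by (cases "vars \<sigma>' 47") auto
          define i where "i = xs ! x"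
          have xm: "x < m" using I2 x by simp
          have dr: "drop x xs = i # drop (Suc x) xs" using xm xs(2) by (simp add: Cons_nth_drop_Suc i_def)
          have "distinct (drop x xs)" using xs(3) by simp
          then have notin: "i \<notin> set (drop (Suc x) xs)" using dr by simp
          have im: "i < m" using xm xs(2,4) nth_mem[of x xs] by (auto simp: i_def)
          have ld: "arrs \<sigma>' 5 x = i" "arrs \<sigma>' 3 i = F i" "arrs \<sigma>' 3 i div 2 ^ p mod W = d i"
            using xm xs(1,2) F[OF im] by (simp_all add: ag2 stores_def i_def d_def)
          have dS: "d i < S" using dW[of i] b by simp
          have "x < S" "i < S" "x + 1 < 2 ^ w" "i + 1 < 2 ^ w" using xm im b by simp_all
          then show ?thesis
            using I2 x ld K b v im dS notin xm
            by (auto simp add: wp_simps I2_def ag2 dr bk_def chain_upd)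
        qed
        subgoal premises p2 for s2
        proof -
          note I2 = p2(1)[unfolded I2_def]
          have s247: "vars s2 47 = 0" using p2(2) by simp
          then have ch: "\<forall>v\<le>W. chain (arrs s2 7) (arrs s2 6 v) (bk xs v)"
            "clk s2 \<le> clk \<sigma> + 100 + 50 * W + 150 * m" using I2 by auto
          note ag2 = agreeD[OF I2[THEN conjunct1]]
          have fin: "bucket_pass d (W + 1) xs = bucket_pass d W xs"
            using dW by (auto simp: bucket_pass_def filter_empty_conv less_imp_neq simp flip: Suc_eq_plus1)
          have bkW: "bk xs W = []" using dW by (auto simp: bk_def filter_empty_conv less_imp_neq)
          have len: "length (bucket_pass d W xs) = m"
            using distinct_card[OF distinct_bucket_pass[OF xs(3)], of d W] set_bucket_pass[of xs d W] dW xs(4)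
            by simp
          have elem: "set (bucket_pass d W xs) = {..<m}" using set_bucket_pass[of xs d W] dW xs(4) by simp
          show ?thesis
            using less_trans[OF b(1,2)]
            apply (simp add: wp_simps K)
            apply (thin_tac "0 < S")
            apply (rule wp_while[where I = I3 and m = "\<lambda>s. W + 1 + m - (vars s 47 + vars s 51)"])
            subgoal
            proof -
              have "bk xs 0 @ concat (map (bk xs) [1..<W + 1]) = bucket_pass d (W + 1) xs"
                by (simp add: bucket_pass_def bk_def upt_conv_Cons flip: One_nat_def)
              then show ?thesis using I2 ch b
                using agree_trans[of "{6, 7}" "arrs \<sigma>" "arrs s2" "{6}" "arrs s2" "{5,6,7}"]
                by (auto simp: I3_def stores_def intro!: exI[of _ "[]"] exI[of _ "bk xs 0"])
            qed
            subgoal using b v by (simp add: I3_def agree_def)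
            subgoal premises p3 for \<sigma>'
            proof -
              note I3 = p3(1)[unfolded I3_def]
              note ag3 = agreeD[OF I3[THEN conjunct1]] agreeD[OF I3[THEN conjunct2, THEN conjunct1]]
              obtain ys zs where *: "stores (arrs \<sigma>' 5) ys" "vars \<sigma>' 51 = length ys"
                "chain (arrs \<sigma>' 7) (vars \<sigma>' 49) zs"
                "ys @ zs @ concat (map (bk xs) [vars \<sigma>' 47 + 1..<W + 1]) = bucket_pass d W xs"
                using I3 fin by auto
              have lm: "length ys + length zs \<le> m"
                using arg_cong[OF *(4), of length] len by simp
              have vW: "vars \<sigma>' 47 < W" using p3(2) v by (simp add: ag3)
              show ?thesis
              proof (cases zs)
                case Nil
                then have "vars \<sigma>' 49 = 0" using * by simp
                have "[vars \<sigma>' 47 + 1..<W + 1] = (vars \<sigma>' 47 + 1) # [vars \<sigma>' 47 + 1 + 1..<W + 1]"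
                  using vW upt_conv_Cons[of "vars \<sigma>' 47 + 1" "W + 1"] by (simp add: Suc_eq_plus1)
                then have "ys @ bk xs (vars \<sigma>' 47 + 1) @ concat (map (bk xs) [vars \<sigma>' 47 + 1 + 1..<W + 1]) = bucket_pass d (W + 1) xs"
                  using * Nil fin by simp
                moreover have "chain (arrs \<sigma>' 7) (arrs \<sigma>' 6 (vars \<sigma>' 47 + 1)) (bk xs (vars \<sigma>' 47 + 1))"
                  using I3 vW by simp
                ultimately have fin: "I3 s" if "vars s = (vars \<sigma>')(47 := vars \<sigma>' 47 + 1, 49 := arrs \<sigma>' 6 (vars \<sigma>' 47 + 1))"
                  "arrs s = arrs \<sigma>'" "tape s = tape \<sigma>'" "clk s \<le> clk \<sigma>' + 50" for s
                  using I3 *(1,2) vW that bkW unfolding I3_def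
                  by (intro conjI exI[of _ ys] exI[of _ "bk xs (vars \<sigma>' 47 + 1)"]) auto
                show ?thesis
                  using *(2) vW \<open>vars \<sigma>' 49 = 0\<close> K b lm
                  by (auto simp add: wp_simps intro!: fin)
              next
                case (Cons i zs')
                have "i \<in> set (bucket_pass d W xs)" using *(4) Cons by (metis Un_iff list.set_intros(1) set_append)
                then have im: "i < m" using elem by simp
                have *: "vars \<sigma>' 49 = i + 1" "chain (arrs \<sigma>' 7) (arrs \<sigma>' 7 i) zs'" "stores (arrs \<sigma>' 5) ys"
                  "vars \<sigma>' 51 = length ys"
                  "(ys @ [i]) @ zs' @ concat (map (bk xs) [vars \<sigma>' 47 + 1..<W + 1]) = bucket_pass d (W + 1) xs"
                  using * Cons fin by simp_all
                have "stores ((arrs \<sigma>' 5)(length ys := i)) (ys @ [i])"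
                  using *(3) by (auto simp: stores_def nth_append)
                then have fin: "I3 s" if "vars s = (vars \<sigma>')(51 := length ys + 1, 49 := arrs \<sigma>' 7 i)"
                  "arrs s = (arrs \<sigma>')(5 := (arrs \<sigma>' 5)(length ys := i))" "tape s = tape \<sigma>'" "clk s \<le> clk \<sigma>' + 60" for s
                  using I3 *(2,4,5) vW that unfolding I3_def
                  by (intro conjI exI[of _ "ys @ [i]"] exI[of _ zs']) auto
                show ?thesis
                  using *(1,4) vW K b lm im Cons
                  by (auto simp add: wp_simps intro!: fin)
              qed
            qed
            subgoal premises p3 for s3
            proof -
              note I3 = p3(1)[unfolded I3_def]
              note ag3 = agreeD[OF I3[THEN conjunct1]]
              have "vars s3 47 = W" using p3(2) I3 v by (simp add: ag3)
              then obtain ys zs where *: "stores (arrs s3 5) ys" "vars s3 51 = length ys"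
                "ys = bucket_pass d W xs"
                using I3 fin by auto
              then have "clk s3 + 20 \<le> clk \<sigma> + 300 + 250 * m + 200 * W" "stores (arrs s3 5) (bucket_pass d W xs)"
                using I3 len \<open>vars s3 47 = W\<close> by auto
              then show ?thesis
                using Q[of "vars s3" "arrs s3" "clk s3 + (ecost (V 47 \<^bold>< V 48) + 2)"] I3
                by (cases \<sigma>; cases s3) (simp add: d_def)
            qed
            done
        qed
        done
    qed
    done
qed

end

definition radix_sort :: "nat \<Rightarrow> hcom" where
  "radix_sort k =
    (47 ::= N 0;; WHILE V 47 \<^bold>< V 40 DO (Sto 5 (V 47) (V 47);; 47 ::= V 47 \<^bold>+ N 1);;
     45 ::= N 0;; 46 ::= N k;;
     WHILE V 46 DO (radix_pass;; 45 ::= V 45 \<^bold>+ V 8;; 46 ::= V 46 \<^bold>- N 1))"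

context machine
begin

lemma wp_radix_sort:
  assumes v: "vars \<sigma> 40 = m" "vars \<sigma> 48 = 2 ^ L" "vars \<sigma> 8 = L"
    and F: "\<And>i. i < m \<Longrightarrow> arrs \<sigma> 3 i = F i" "\<And>i. i < m \<Longrightarrow> F i < (2 ^ L) ^ k"
    and b: "2 ^ L < S" "m \<le> S" "7 < K" "(2::nat) ^ L + 1 < 2 ^ w" "m + 1 < 2 ^ w" "k < 2 ^ w" "L * k < 2 ^ w"
    and Q: "\<And>f A c xs. agree {45, 46, 47, 49, 50, 51} (vars \<sigma>) f \<Longrightarrow> agree {5, 6, 7} (arrs \<sigma>) A \<Longrightarrow>
      stores (A 5) xs \<Longrightarrow> length xs = m \<Longrightarrow> set xs = {..<m} \<Longrightarrow> sorted_wrt (\<lambda>i j. F i \<le> F j) xs \<Longrightarrow>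
      c \<le> clk \<sigma> + 100 + (k + 1) * (400 + 250 * m + 200 * 2 ^ L) \<Longrightarrow> Q (\<sigma>\<lparr>vars := f, arrs := A, clk := c\<rparr>)"
  shows "wp (radix_sort k) Q \<sigma>"
proof -
  define C where "C = 400 + 250 * m + 200 * (2::nat) ^ L"
  let ?X = "{45, 46, 47, 49, 50, 51} :: nat set"
  define I1 where "I1 = (\<lambda>\<sigma>'::st. agree ?X (vars \<sigma>) (vars \<sigma>') \<and> agree {5, 6, 7} (arrs \<sigma>) (arrs \<sigma>') \<and>
    tape \<sigma>' = tape \<sigma> \<and> vars \<sigma>' 47 \<le> m \<and> (\<forall>x<vars \<sigma>' 47. arrs \<sigma>' 5 x = x) \<and>
    clk \<sigma>' \<le> clk \<sigma> + 20 + 50 * vars \<sigma>' 47)"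
  \<comment> \<open>After \<open>k - vars \<sigma>' 46\<close> passes the order is sorted by that
    many low digits in base \<open>2 ^ L\<close>.\<close>
  define I2 where "I2 = (\<lambda>\<sigma>'::st. agree ?X (vars \<sigma>) (vars \<sigma>') \<and> agree {5, 6, 7} (arrs \<sigma>) (arrs \<sigma>') \<and>
    tape \<sigma>' = tape \<sigma> \<and> vars \<sigma>' 46 \<le> k \<and> vars \<sigma>' 45 = L * (k - vars \<sigma>' 46) \<and>
    (\<exists>xs. stores (arrs \<sigma>' 5) xs \<and> length xs = m \<and> distinct xs \<and> set xs = {..<m} \<and>
       sorted_wrt (\<lambda>i j. F i mod (2 ^ L) ^ (k - vars \<sigma>' 46) \<le> F j mod (2 ^ L) ^ (k - vars \<sigma>' 46)) xs) \<and>
    clk \<sigma>' + vars \<sigma>' 46 * C \<le> clk \<sigma> + 80 + 50 * m + k * C)"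
  have K: "3 < K" "5 < K" "6 < K" "7 < K" using b by linarith+
  show ?thesis
    unfolding radix_sort_def
    apply (simp add: wp_simps)
    apply (rule wp_while[where I = I1 and m = "\<lambda>s. m - vars s 47"])
    subgoal by (simp add: I1_def)
    subgoal by (simp add: I1_def)
    subgoal premises p for \<sigma>'
      using p(2) p(1)[unfolded I1_def] b v K agreeD[OF p(1)[unfolded I1_def, THEN conjunct1]]
      by (auto simp add: wp_simps I1_def less_Suc_eq)
    subgoal premises p1 for s1
    proof -
      note I1 = p1(1)[unfolded I1_def]
      note ag1 = agreeD[OF I1[THEN conjunct1]]
      have "vars s1 47 = m" using p1(2) I1 v by (simp add: ag1)
      then have "stores (arrs s1 5) [0..<m]" "clk s1 + 30 \<le> clk \<sigma> + 80 + 50 * m"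
        using I1 by (auto simp: stores_def)
      then have I2: "I2 s" if "vars s = (vars s1)(45 := 0, 46 := k)" "arrs s = arrs s1" "tape s = tape s1"
        "clk s \<le> clk s1 + 30" for s
        using that I1 unfolding I2_def
        by (intro conjI exI[of _ "[0..<m]"]) (auto simp: lessThan_atLeast0)
      show ?thesis
        using b
        apply (simp add: wp_simps)
        apply (rule wp_while[where I = I2 and m = "\<lambda>s. vars s 46"])
        subgoal by (rule I2) auto
        subgoal by (simp add: I2_def)
        subgoal premises p2 for \<sigma>'
        proof -
          have "I2 \<sigma>'" "0 < vars \<sigma>' 46" using p2 by auto
          note I2 = this(1)[unfolded I2_def]
          note ag2 = agreeD[OF I2[THEN conjunct1]] agreeD[OF I2[THEN conjunct2, THEN conjunct1]]
          obtain y where y: "vars \<sigma>' 46 = Suc y" using \<open>0 < vars \<sigma>' 46\<close> by (cases "vars \<sigma>' 46") auto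
          define p where "p = k - Suc y"
          have py: "k - y = p + 1" "y < k" "Suc y \<le> k" using I2 y by (auto simp: p_def)
          obtain xs where xs: "stores (arrs \<sigma>' 5) xs" "length xs = m" "distinct xs" "set xs = {..<m}"
            "sorted_wrt (\<lambda>i j. F i mod (2 ^ L) ^ p \<le> F j mod (2 ^ L) ^ p) xs"
            using I2 y unfolding p_def by auto
          let ?xs = "bucket_pass (\<lambda>i. F i div 2 ^ (L * p) mod 2 ^ L) (2 ^ L) xs"
          have xs': "distinct ?xs" "set ?xs = {..<m}"
            using distinct_bucket_pass[OF xs(3)]
              set_bucket_pass[of xs "\<lambda>i. F i div 2 ^ (L * p) mod 2 ^ L" "2 ^ L"] xs(4) by simp_all
          have len: "length ?xs = m" using distinct_card[OF xs'(1)] xs'(2) by simp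
          have srt: "sorted_wrt (\<lambda>i j. F i mod (2 ^ L) ^ (p + 1) \<le> F j mod (2 ^ L) ^ (p + 1)) ?xs"
            using xs(5) by (rule sorted_bucket_pass) (rule digit_order, auto simp: power_mult)+
          have Lp: "L * p + L = L * (p + 1)" "L * (p + 1) \<le> L * k"
            using py by (simp add: algebra_simps, intro mult_le_mono2, linarith)
          have ck: "clk \<sigma>' + C + y * C \<le> clk \<sigma> + 80 + 50 * m + k * C" using I2 y by simp
          have fin: "I2 s" if s: "agree ?X (vars \<sigma>) (vars s)" "agree {5, 6, 7} (arrs \<sigma>) (arrs s)"
            "tape s = tape \<sigma>" "stores (arrs s 5) ?xs" "vars s 46 = y" "vars s 45 = L * p + L"
            "clk s \<le> clk \<sigma>' + C" for s
            unfolding I2_def s(5) py(1)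
          proof (intro conjI exI[of _ ?xs])
            show "clk s + y * C \<le> clk \<sigma> + 80 + 50 * m + k * C" using ck s(7) by linarith
          qed (use s len srt xs' Lp py in simp_all)
          have ov: "L * p + L < 2 ^ w" using Lp b by linarith
          show ?thesis
            apply (simp add: wp_simps)
            apply (rule wp_radix_pass[where m = m and W = "2 ^ L" and p = "L * p" and xs = xs and F = F])
            using v xs b F y I2 apply (simp_all add: ag2 p_def)[14]
            subgoal premises q for f A c
            proof -
              note ag' = agreeD[OF q(1)[simplified]]
              have "agree ?X (vars \<sigma>) f"
                by (rule agree_trans[OF I2[THEN conjunct1] q(1)[simplified]]) auto
              moreover have "agree {5, 6, 7} (arrs \<sigma>) A"
                by (rule agree_trans[OF I2[THEN conjunct2, THEN conjunct1] q(2)[simplified]]) auto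
              moreover have "f 45 = L * p" "f 8 = L" "f 46 = Suc y" "Suc y < 2 ^ w"
                using I2 y v py b(6) by (simp_all add: ag' ag2 p_def)
              moreover have "tape \<sigma>' = tape \<sigma>" "c + 50 \<le> clk \<sigma>' + C" using q(4) I2 by (simp_all add: C_def)
              ultimately show ?thesis
                using q(3) ov by (simp add: wp_simps y fin)
            qed
            done
        qed
        subgoal premises p2 for \<sigma>'
        proof -
          have "I2 \<sigma>'" "vars \<sigma>' 46 = 0" using p2 by auto
          note I2' = this(1)[unfolded I2_def]
          have I2: "agree ?X (vars \<sigma>) (vars \<sigma>')" "agree {5, 6, 7} (arrs \<sigma>) (arrs \<sigma>')" "tape \<sigma>' = tape \<sigma>"
            "clk \<sigma>' \<le> clk \<sigma> + 80 + 50 * m + k * C"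
            using I2' \<open>vars \<sigma>' 46 = 0\<close> by auto
          obtain xs where xs: "stores (arrs \<sigma>' 5) xs" "length xs = m" "set xs = {..<m}"
            "sorted_wrt (\<lambda>i j. F i mod (2 ^ L) ^ k \<le> F j mod (2 ^ L) ^ k) xs"
            using I2' \<open>vars \<sigma>' 46 = 0\<close> by auto
          have "sorted_wrt (\<lambda>i j. F i \<le> F j) xs"
            using xs(4) by (rule sorted_wrt_mono_rel[rotated]) (use F(2) xs(3) in auto)
          moreover have "clk \<sigma>' + 3 \<le> clk \<sigma> + 100 + (k + 1) * C" using I2(4) by (simp add: C_def algebra_simps)
          ultimately show ?thesis
            using Q[of "vars \<sigma>'" "arrs \<sigma>'" xs "clk \<sigma>' + (ecost (V 46) + 2)"] I2(1-3) xs(1-3)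
            unfolding C_def by (cases \<sigma>; cases \<sigma>') simp
        qed
        done
    qed
    done
qed

end


section \<open>Verifying fingerprints\<close>

definition check_adjacent :: hcom where
  "check_adjacent = (52 ::= N 1;;
     WHILE V 52 \<^bold>< V 40 DO (
       53 ::= Ld 5 (V 52 \<^bold>- N 1);; 54 ::= Ld 5 (V 52);;
       IF Ld 3 (V 53) \<^bold>= Ld 3 (V 54) THEN
         IF Ld 4 (V 53) \<^bold>= Ld 4 (V 54) THEN
           IF Ld 4 (V 53 \<^bold>+ V 42) \<^bold>= Ld 4 (V 54 \<^bold>+ V 42) THEN SKIP ELSE 44 ::= N 0
         ELSE 44 ::= N 0
       ELSE SKIP;;
       52 ::= V 52 \<^bold>+ N 1))"

text \<open>In a sorted list equal keys form a contiguous run, so an equivalence that holds between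
  neighbours with equal keys spreads over the run by transitivity. This reduces a test of all pairs
  to linearly many.\<close>

lemma sorted_adjacent:
  fixes F :: "nat \<Rightarrow> nat" and E :: "nat \<Rightarrow> nat \<Rightarrow> bool"
  assumes "sorted_wrt (\<lambda>i j. F i \<le> F j) xs"
    and refl: "\<And>i. E i i" and sym: "\<And>i j. E i j \<Longrightarrow> E j i" and trans: "\<And>i j k. E i j \<Longrightarrow> E j k \<Longrightarrow> E i k"
  shows "(\<forall>y. y + 1 < length xs \<longrightarrow> F (xs ! y) = F (xs ! (y + 1)) \<longrightarrow> E (xs ! y) (xs ! (y + 1))) \<longleftrightarrow>
    (\<forall>i\<in>set xs. \<forall>j\<in>set xs. F i = F j \<longrightarrow> E i j)"
proof
  assume adj: "\<forall>y. y + 1 < length xs \<longrightarrow> F (xs ! y) = F (xs ! (y + 1)) \<longrightarrow> E (xs ! y) (xs ! (y + 1))"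
  have le: "F (xs ! y) \<le> F (xs ! z)" if "y \<le> z" "z < length xs" for y z
    using sorted_wrt_nth_less[OF assms(1), of y z] that by (cases "y = z") auto
  have *: "E (xs ! y) (xs ! (y + d))" if "y + d < length xs" "F (xs ! y) = F (xs ! (y + d))" for y d
    using that
  proof (induction d)
    case (Suc d)
    have "F (xs ! y) \<le> F (xs ! (y + d))" "F (xs ! (y + d)) \<le> F (xs ! (y + Suc d))"
      using Suc.prems by (intro le; simp)+
    then have "F (xs ! y) = F (xs ! (y + d))" "F (xs ! (y + d)) = F (xs ! (y + d + 1))"
      using Suc.prems by (simp_all add: One_nat_def)
    then show ?case
      using Suc adj[rule_format, of "y + d"] trans by (simp add: One_nat_def)
  qed (simp add: refl)
  show "\<forall>i\<in>set xs. \<forall>j\<in>set xs. F i = F j \<longrightarrow> E i j"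
  proof (intro ballI impI)
    fix i j assume "i \<in> set xs" "j \<in> set xs" "F i = F j"
    then obtain y z where yz: "xs ! y = i" "xs ! z = j" "y < length xs" "z < length xs"
      by (metis in_set_conv_nth)
    show "E i j"
    proof (cases "y \<le> z")
      case True
      then show ?thesis using *[of y "z - y"] yz \<open>F i = F j\<close> by simp
    next
      case False
      then show ?thesis using *[of z "y - z"] yz \<open>F i = F j\<close> by (simp add: sym)
    qed
  qed
qed auto

context machine
begin

lemma wp_check_adjacent:
  assumes v: "vars \<sigma> 40 = m" "vars \<sigma> 42 = h" "vars \<sigma> 44 \<le> 1"
    and xs: "stores (arrs \<sigma> 5) xs" "length xs = m" "set xs = {..<m}" "sorted_wrt (\<lambda>i j. F i \<le> F j) xs"
    and F: "\<And>i. i < m \<Longrightarrow> arrs \<sigma> 3 i = F i"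
    and b: "m + h \<le> S" "7 < K" "m + h + 1 < 2 ^ w"
    and Q: "\<And>f c. agree {44, 52, 53, 54} (vars \<sigma>) f \<Longrightarrow>
      f 44 = (if vars \<sigma> 44 = 1 \<and> (\<forall>i<m. \<forall>j<m. F i = F j \<longrightarrow>
        arrs \<sigma> 4 i = arrs \<sigma> 4 j \<and> arrs \<sigma> 4 (i + h) = arrs \<sigma> 4 (j + h)) then 1 else 0) \<Longrightarrow>
      c \<le> clk \<sigma> + 50 + 250 * m \<Longrightarrow> Q (\<sigma>\<lparr>vars := f, clk := c\<rparr>)"
  shows "wp check_adjacent Q \<sigma>"
proof -
  define E where "E = (\<lambda>i j. arrs \<sigma> 4 i = arrs \<sigma> 4 j \<and> arrs \<sigma> 4 (i + h) = arrs \<sigma> 4 (j + h))"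
  define adj_ok where "adj_ok = (\<lambda>y. F (xs ! y) = F (xs ! (y + 1)) \<longrightarrow> E (xs ! y) (xs ! (y + 1)))"
  define I where "I = (\<lambda>\<sigma>'::st. agree {44, 52, 53, 54} (vars \<sigma>) (vars \<sigma>') \<and> arrs \<sigma>' = arrs \<sigma> \<and>
    tape \<sigma>' = tape \<sigma> \<and> 1 \<le> vars \<sigma>' 52 \<and> (vars \<sigma>' 52 \<le> m \<or> vars \<sigma>' 52 = 1) \<and>
    vars \<sigma>' 44 = (if vars \<sigma> 44 = 1 \<and> (\<forall>y. y + 1 < vars \<sigma>' 52 \<longrightarrow> adj_ok y) then 1 else 0) \<and>
    clk \<sigma>' + 250 \<le> clk \<sigma> + 30 + 250 * vars \<sigma>' 52)"
  have K: "3 < K" "4 < K" "5 < K" using b by linarith+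
  show ?thesis
    unfolding check_adjacent_def
    apply (simp add: wp_simps)
    apply (rule wp_while[where I = I and m = "\<lambda>s. m - vars s 52"])
    subgoal using v(3) by (auto simp: I_def)
    subgoal by (simp add: I_def)
    subgoal premises p for \<sigma>'
    proof -
      note I = p(1)[unfolded I_def]
      note ag = agreeD[OF I[THEN conjunct1]]
      obtain y where y: "vars \<sigma>' 52 = y + 1" using I by (metis le_add_diff_inverse2)
      have ym: "y + 1 < m" using p(2) y v by (simp add: ag)
      define i where "i = xs ! y"
      define j where "j = xs ! (y + 1)"
      have ij: "i < m" "j < m" using ym xs(2,3) nth_mem[of y xs] nth_mem[of "y + 1" xs] by (auto simp: i_def j_def)
      have ld: "arrs \<sigma> 5 y = i" "arrs \<sigma> 5 (y + 1) = j" "arrs \<sigma> 3 i = F i" "arrs \<sigma> 3 j = F j"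
        using xs(1,2) ym F ij by (auto simp: stores_def i_def j_def)
      have st: "y < S" "y + 1 < S" "i < S" "j < S" "i + h < S" "j + h < S" "i + h < 2 ^ w" "j + h < 2 ^ w" "y + 1 < 2 ^ w" "y + 1 + 1 < 2 ^ w"
        using ym ij b by linarith+
      have fy: "adj_ok y \<longleftrightarrow> (F i = F j \<longrightarrow> arrs \<sigma> 4 i = arrs \<sigma> 4 j \<and> arrs \<sigma> 4 (i + h) = arrs \<sigma> 4 (j + h))"
        by (simp add: adj_ok_def E_def i_def j_def)
      have al: "(\<forall>z. z + 1 < y + 1 + 1 \<longrightarrow> adj_ok z) \<longleftrightarrow> (\<forall>z. z + 1 < y + 1 \<longrightarrow> adj_ok z) \<and> adj_ok y"
        by (metis Suc_eq_plus1 less_Suc_eq Suc_less_eq)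
      have I2: "arrs \<sigma>' = arrs \<sigma>" "tape \<sigma>' = tape \<sigma>" "agree {44, 52, 53, 54} (vars \<sigma>) (vars \<sigma>')"
        "vars \<sigma>' 44 = (if vars \<sigma> 44 = 1 \<and> (\<forall>z. z + 1 < y + 1 \<longrightarrow> adj_ok z) then 1 else 0)"
        "clk \<sigma>' \<le> clk \<sigma> + 30 + 250 * y" using I y by auto
      have fin: "I s" if "agree {44, 52, 53, 54} (vars \<sigma>) (vars s)" "arrs s = arrs \<sigma>" "tape s = tape \<sigma>"
        "vars s 52 = y + 1 + 1" "vars s 44 = (if adj_ok y then vars \<sigma>' 44 else 0)" "clk s \<le> clk \<sigma>' + 250" for s
        using that I2(4,5) ym al unfolding I_def by auto
      show ?thesis
        using I2(1-3) st K ym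
        by (auto simp add: wp_simps y ld ag v fy intro!: fin)
    qed
    subgoal premises p for \<sigma>'
    proof -
      note I = p(1)[unfolded I_def]
      note ag = agreeD[OF I[THEN conjunct1]]
      have "m \<le> vars \<sigma>' 52" using p(2) v by (simp add: ag)
      then have "vars \<sigma>' 52 = m \<or> m = 0 \<and> vars \<sigma>' 52 = 1" using I by auto
      then have "(\<forall>y. y + 1 < vars \<sigma>' 52 \<longrightarrow> adj_ok y) \<longleftrightarrow> (\<forall>y. y + 1 < m \<longrightarrow> adj_ok y)" by auto
      also have "\<dots> \<longleftrightarrow> (\<forall>i<m. \<forall>j<m. F i = F j \<longrightarrow> E i j)"
        using sorted_adjacent[OF xs(4), of E] xs(2,3) by (auto simp: adj_ok_def E_def)
      finally have "vars \<sigma>' 44 = (if vars \<sigma> 44 = 1 \<and> (\<forall>i<m. \<forall>j<m. F i = F j \<longrightarrow> E i j) then 1 else 0)"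
        using I by simp
      moreover have "clk \<sigma>' + 10 \<le> clk \<sigma> + 50 + 250 * m"
        using I \<open>vars \<sigma>' 52 = m \<or> m = 0 \<and> vars \<sigma>' 52 = 1\<close> by auto
      ultimately show ?thesis
        using Q[of "vars \<sigma>'" "clk \<sigma>' + (ecost (V 52 \<^bold>< V 40) + 2)"] I
        unfolding E_def by (cases \<sigma>; cases \<sigma>') simp
    qed
    done
qed

end

text \<open>
  Arrays 3 and 4 hold the fingerprints of all substrings of length \<open>V 41\<close> and of length \<open>V 42\<close>,
  half of it; for length 1, array 4 holds the letters themselves.
\<close>

definition level_step :: hcom where
  "level_step = (47 ::= N 0;;
     WHILE V 47 \<^bold>< V 40 DO (
       Sto 4 (V 47) (Ld 3 (V 47));;
       IF V 47 \<^bold>+ V 41 \<^bold>+ V 41 \<^bold>< V 4 \<^bold>+ N 1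
       THEN Sto 3 (V 47) ((Ld 3 (V 47 \<^bold>+ V 41) \<^bold>+ Ld 4 (V 47) \<^bold>* V 43) \<^bold>% V 6) ELSE SKIP;;
       47 ::= V 47 \<^bold>+ N 1);;
     42 ::= V 41;; 41 ::= V 41 \<^bold>+ V 41;; 43 ::= V 43 \<^bold>* V 43 \<^bold>% V 6)"

definition fill_levels :: hcom where
  "fill_levels = (47 ::= N 0;;
     WHILE V 47 \<^bold>< V 4 DO (
       Sto 4 (V 47) (Inp (V 47));; Sto 3 (V 47) (Inp (V 47) \<^bold>% V 6);; 47 ::= V 47 \<^bold>+ N 1))"

definition verify :: "nat \<Rightarrow> hcom" where
  "verify k = (48 ::= Bop Shl (N 1) (V 8);; fill_levels;;
     41 ::= N 1;; 42 ::= N 0;; 43 ::= V 7 \<^bold>% V 6;; 44 ::= N 1;;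
     WHILE V 41 \<^bold>< V 4 \<^bold>+ N 1 DO (
       40 ::= V 4 \<^bold>+ N 1 \<^bold>- V 41;; radix_sort k;; check_adjacent;; level_step))"

lemma mod_add_mult:
  fixes a b c q :: nat
  shows "(a mod q + (b mod q) * (c mod q)) mod q = (a + b * c) mod q"
proof -
  have "(a mod q + (b mod q) * (c mod q)) mod q = (a + (b mod q) * (c mod q) mod q) mod q"
    by (simp only: mod_add_left_eq mod_add_right_eq)
  also have "\<dots> = (a + b * c mod q) mod q" by (simp only: mod_mult_eq)
  finally show ?thesis by (simp only: mod_add_right_eq)
qed

lemma sval_add:
  assumes "x + l + m \<le> length T"
  shows "sval B T x (l + m) = sval B T (x + l) m + sval B T x l * B ^ m"
  using assms by (simp add: sval_def take_add hval_append add.commute)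

lemma sval_1: "x < length T \<Longrightarrow> sval B T x 1 = T ! x"
  by (simp add: sval_def take_Suc One_nat_def hd_drop_conv_nth hval_def)

context hashing
begin

lemma wp_level_step:
  assumes v: "vars \<sigma> 4 = length T" "vars \<sigma> 6 = q" "vars \<sigma> 40 = length T + 1 - l" "vars \<sigma> 41 = l"
      "vars \<sigma> 43 = B ^ l mod q"
    and F: "\<And>i. i + l \<le> length T \<Longrightarrow> arrs \<sigma> 3 i = sval B T i l mod q"
    and b: "l \<le> length T" "length T \<le> S" "7 < K" "0 < l"
    and Q: "\<And>f A c. agree {41, 42, 43, 47} (vars \<sigma>) f \<Longrightarrow> agree {3, 4} (arrs \<sigma>) A \<Longrightarrow>
      f 41 = l + l \<Longrightarrow> f 42 = l \<Longrightarrow> f 43 = B ^ (l + l) mod q \<Longrightarrow>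
      (\<And>i. i + l \<le> length T \<Longrightarrow> A 4 i = sval B T i l mod q) \<Longrightarrow>
      (\<And>i. i + (l + l) \<le> length T \<Longrightarrow> A 3 i = sval B T i (l + l) mod q) \<Longrightarrow>
      c \<le> clk \<sigma> + 100 + 200 * length T \<Longrightarrow> Q (\<sigma>\<lparr>vars := f, arrs := A, clk := c\<rparr>)"
  shows "wp level_step Q \<sigma>"
proof -
  \<comment> \<open>Array 3 is overwritten from left to right. The new value at \<open>x\<close>
    uses the old one at \<open>x + l\<close>, which lies ahead because \<open>0 < l\<close>; hence
    the clause on positions not yet reached.\<close>
  define I where "I = (\<lambda>\<sigma>'::st. agree {47} (vars \<sigma>) (vars \<sigma>') \<and> agree {3, 4} (arrs \<sigma>) (arrs \<sigma>') \<and>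
    tape \<sigma>' = tape \<sigma> \<and> vars \<sigma>' 47 + l \<le> length T + 1 \<and>
    (\<forall>i<vars \<sigma>' 47. arrs \<sigma>' 4 i = sval B T i l mod q) \<and>
    (\<forall>i<vars \<sigma>' 47. i + (l + l) \<le> length T \<longrightarrow> arrs \<sigma>' 3 i = sval B T i (l + l) mod q) \<and>
    (\<forall>i\<ge>vars \<sigma>' 47. i + l \<le> length T \<longrightarrow> arrs \<sigma>' 3 i = sval B T i l mod q) \<and>
    clk \<sigma>' \<le> clk \<sigma> + 30 + 200 * vars \<sigma>' 47)"
  have K: "3 < K" "4 < K" using b by linarith+
  show ?thesis
    unfolding level_step_def
    apply (simp add: wp_simps)
    apply (rule wp_while[where I = I and m = "\<lambda>s. length T - vars s 47"])
    subgoal using F b by (auto simp: I_def)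
    subgoal by (simp add: I_def)
    subgoal premises p for \<sigma>'
    proof -
      note I = p(1)[unfolded I_def]
      note ag = agreeD[OF I[THEN conjunct1]] agreeD[OF I[THEN conjunct2, THEN conjunct1]]
      define x where "x = vars \<sigma>' 47"
      have x: "x + l \<le> length T" using p(2) v b by (simp add: ag x_def)
      have xS: "x < S" "x + l < 2 ^ w" "x + 1 < 2 ^ w" "length T + 1 < 2 ^ w" "x + l + l < 2 ^ w"
        using x b arith_fits by linarith+
      have I2: "agree {47} (vars \<sigma>) (vars \<sigma>')" "agree {3, 4} (arrs \<sigma>) (arrs \<sigma>')"
        "tape \<sigma>' = tape \<sigma>" "\<forall>i<x. arrs \<sigma>' 4 i = sval B T i l mod q"
        "\<forall>i<x. i + (l + l) \<le> length T \<longrightarrow> arrs \<sigma>' 3 i = sval B T i (l + l) mod q"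
        "\<forall>i\<ge>x. i + l \<le> length T \<longrightarrow> arrs \<sigma>' 3 i = sval B T i l mod q"
        "clk \<sigma>' \<le> clk \<sigma> + 30 + 200 * x" using I by (auto simp: x_def)
      have F3: "arrs \<sigma>' 3 x = sval B T x l mod q" using I2 x by simp
      show ?thesis
      proof (cases "x + l + l \<le> length T")
        case True
        have "arrs \<sigma>' 3 (x + l) = sval B T (x + l) l mod q" "x + l < S" using I2 True b by simp_all
        then show ?thesis
          using True I2 x xS K F3 modmul_fits2[of "sval B T (x + l) l mod q" "sval B T x l mod q" "B ^ l mod q"] q_pos b(4)
          by (auto simp add: wp_simps I_def x_def[symmetric] ag v mod_add_mult sval_add less_Suc_eq)
      next
        case False
        then show ?thesis
          using I2 x xS K F3
          by (auto simp add: wp_simps I_def x_def[symmetric] ag v less_Suc_eq)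
      qed
    qed
    subgoal premises p for \<sigma>'
    proof -
      note I = p(1)[unfolded I_def]
      note ag = agreeD[OF I[THEN conjunct1]]
      have "length T + 1 - l \<le> vars \<sigma>' 47" using p(2) v by (simp add: ag)
      moreover have "vars \<sigma>' 47 + l \<le> length T + 1" using I by blast
      ultimately have x: "vars \<sigma>' 47 = length T + 1 - l" by linarith
      have m: "B ^ l mod q * (B ^ l mod q) mod q = B ^ (l + l) mod q"
        by (simp add: mod_mult_eq power_add)
      have "clk \<sigma>' + 50 \<le> clk \<sigma> + 100 + 200 * length T" using I x b(1,4) by auto
      moreover have "agree {41, 42, 43, 47} (vars \<sigma>) (vars \<sigma>')"
        using I by (auto simp: agree_def)
      moreover have "\<And>i. i + l \<le> length T \<Longrightarrow> arrs \<sigma>' 4 i = sval B T i l mod q"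
        "\<And>i. i + (l + l) \<le> length T \<Longrightarrow> arrs \<sigma>' 3 i = sval B T i (l + l) mod q"
        using I x b by simp_all
      ultimately have Q': "Q (\<sigma>\<lparr>vars := (vars \<sigma>')(42 := l, 41 := l + l, 43 := B ^ (l + l) mod q), arrs := arrs \<sigma>', clk := c\<rparr>)"
        if "c \<le> clk \<sigma>' + 50" for c
        using that I by (intro Q) auto
      have "l + l < 2 ^ w" "B ^ l mod q * (B ^ l mod q) < 2 ^ w"
        using b arith_fits modmul_fits2[of 0 "B ^ l mod q" "B ^ l mod q"] q_pos by auto
      then show ?thesis
        using I Q'[of "30 + clk \<sigma>'"] v
        apply (simp add: wp_simps ag m)
        apply (cases \<sigma>; cases \<sigma>')
        apply simp
        done
    qed
    done
qed

definition level_ok :: "nat \<Rightarrow> bool" where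
  "level_ok e \<longleftrightarrow> (\<forall>x y. fp_eq x y (2 ^ e) \<longrightarrow> matches T x y (2 ^ e))"

lemma wp_fill_levels:
  assumes v: "vars \<sigma> 4 = length T" "vars \<sigma> 6 = q"
    and b: "length T \<le> S" "7 < K"
    and Q: "\<And>f A c. agree {47} (vars \<sigma>) f \<Longrightarrow> agree {3, 4} (arrs \<sigma>) A \<Longrightarrow>
      (\<And>i. i < length T \<Longrightarrow> A 4 i = T ! i) \<Longrightarrow> (\<And>i. i < length T \<Longrightarrow> A 3 i = T ! i mod q) \<Longrightarrow>
      c \<le> clk \<sigma> + 50 + 100 * length T \<Longrightarrow> Q (\<sigma>\<lparr>vars := f, arrs := A, clk := c\<rparr>)"
  shows "wp fill_levels Q \<sigma>"
proof -
  define I where "I = (\<lambda>\<sigma>'::st. agree {47} (vars \<sigma>) (vars \<sigma>') \<and> agree {3, 4} (arrs \<sigma>) (arrs \<sigma>') \<and>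
    tape \<sigma>' = tape \<sigma> \<and> vars \<sigma>' 47 \<le> length T \<and>
    (\<forall>i<vars \<sigma>' 47. arrs \<sigma>' 4 i = T ! i \<and> arrs \<sigma>' 3 i = T ! i mod q) \<and>
    clk \<sigma>' \<le> clk \<sigma> + 30 + 100 * vars \<sigma>' 47)"
  have K: "3 < K" "4 < K" using b by linarith+
  show ?thesis
    unfolding fill_levels_def
    apply (simp add: wp_simps)
    apply (rule wp_while[where I = I and m = "\<lambda>s. length T - vars s 47"])
    subgoal by (auto simp: I_def)
    subgoal by (simp add: I_def)
    subgoal premises p for \<sigma>'
      using p(2) p(1)[unfolded I_def] b v K text_fits agreeD[OF p(1)[unfolded I_def, THEN conjunct1]]
      by (auto simp add: wp_simps I_def less_Suc_eq)
    subgoal premises p for \<sigma>'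
    proof -
      note I = p(1)[unfolded I_def]
      note ag = agreeD[OF I[THEN conjunct1]]
      have "vars \<sigma>' 47 = length T" using p(2) v I by (simp add: ag)
      then show ?thesis
        using Q[of "vars \<sigma>'" "arrs \<sigma>'" "clk \<sigma>' + (ecost (V 47 \<^bold>< V 4) + 2)"] I
        by (cases \<sigma>; cases \<sigma>') simp
    qed
    done
qed

text \<open>If the previous level is correct, comparing the fingerprints of both halves is the same
  as comparing the substrings themselves, so equal fingerprints with equal halves are true matches.
  For \<open>e = 0\<close> the function \<open>G\<close> gives the letters and \<open>h = 0\<close>,
  so both comparisons coincide.\<close>

lemma level_ok_iff:
  fixes G :: "nat \<Rightarrow> nat"
  assumes F: "\<And>i. i + 2 ^ e \<le> length T \<Longrightarrow> F i = sval B T i (2 ^ e) mod q"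
    and G: "e = 0 \<Longrightarrow> h = 0 \<and> (\<forall>i<length T. G i = T ! i)"
      "e \<noteq> 0 \<Longrightarrow> h = 2 ^ (e - 1) \<and> (\<forall>i. i + h \<le> length T \<longrightarrow> G i = sval B T i h mod q)"
    and prev: "e \<noteq> 0 \<Longrightarrow> level_ok (e - 1)"
    and m: "m + 2 ^ e = length T + 1"
  shows "(\<forall>i<m. \<forall>j<m. F i = F j \<longrightarrow> G i = G j \<and> G (i + h) = G (j + h)) \<longleftrightarrow> level_ok e"
proof -
  have Fe: "F i = F j \<longleftrightarrow> fp_eq i j (2 ^ e)" if "i < m" "j < m" for i j
    using that m by (auto simp: F cong_def)
  have G': "G i = G j \<and> G (i + h) = G (j + h) \<longleftrightarrow> matches T i j (2 ^ e)" if "i < m" "j < m" for i j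
  proof (cases "e = 0")
    case True
    then show ?thesis using G(1) that m by (auto simp: matches_def)
  next
    case False
    then have h: "h = 2 ^ (e - 1)" and e: "2 ^ e = h + h"
      using G(2) by (auto simp flip: power_Suc mult_2)
    have b: "i + h + h \<le> length T" "j + h + h \<le> length T" using that m e by linarith+
    have *: "G x = G y \<longleftrightarrow> matches T x y h" if that: "x + h \<le> length T" "y + h \<le> length T" for x y
    proof -
      have "G x = G y \<longleftrightarrow> fp_eq x y h" using that G(2) False by (auto simp: cong_def)
      also have "\<dots> \<longleftrightarrow> matches T x y h"
        using prev[OF False] sval_eq_iff[OF letters that] that unfolding level_ok_def h[symmetric]
        by (metis cong_refl)
      finally show ?thesis .
    qed
    show ?thesis using * b unfolding e matches_add by simp
  qed
  show ?thesis
  proof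
    assume "\<forall>i<m. \<forall>j<m. F i = F j \<longrightarrow> G i = G j \<and> G (i + h) = G (j + h)"
    note cond = this
    show "level_ok e"
      unfolding level_ok_def
    proof (intro allI impI)
      fix x y assume fp: "fp_eq x y (2 ^ e)"
      then have "x < m" "y < m" using m by linarith+
      then show "matches T x y (2 ^ e)" using cond Fe G' fp by blast
    qed
  next
    assume "level_ok e"
    then show "\<forall>i<m. \<forall>j<m. F i = F j \<longrightarrow> G i = G j \<and> G (i + h) = G (j + h)"
      using Fe G' unfolding level_ok_def by blast
  qed
qed

lemma wp_verify:
  assumes v: "vars \<sigma> 4 = length T" "vars \<sigma> 6 = q" "vars \<sigma> 7 = B" "vars \<sigma> 8 = L"
    and b: "length T < 2 ^ L" "2 ^ L < S" "7 < K" "(2::nat) ^ L + 1 < 2 ^ w" "k < 2 ^ w" "L * k < 2 ^ w"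
      "q \<le> (2 ^ L) ^ k"
    and Q: "\<And>f A c. agree {40..54} (vars \<sigma>) f \<Longrightarrow> agree {3..7} (arrs \<sigma>) A \<Longrightarrow>
      f 44 = (if \<forall>e. level_ok e then 1 else 0) \<Longrightarrow>
      c \<le> clk \<sigma> + 300 + 100 * length T + L * (k + 3) * (1000 + 700 * 2 ^ L) \<Longrightarrow>
      Q (\<sigma>\<lparr>vars := f, arrs := A, clk := c\<rparr>)"
  shows "wp (verify k) Q \<sigma>"
proof -
  define C where "C = (k + 3) * (1000 + 700 * (2::nat) ^ L)"
  define J where "J = (\<lambda>e (\<sigma>'::st). e \<le> L \<and> vars \<sigma>' 41 = 2 ^ e \<and> vars \<sigma>' 43 = B ^ (2 ^ e) mod q \<and>
      (\<forall>i. i + 2 ^ e \<le> length T \<longrightarrow> arrs \<sigma>' 3 i = sval B T i (2 ^ e) mod q) \<and>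
      (e = 0 \<longrightarrow> vars \<sigma>' 42 = 0 \<and> (\<forall>i<length T. arrs \<sigma>' 4 i = T ! i)) \<and>
      (e \<noteq> 0 \<longrightarrow> vars \<sigma>' 42 = 2 ^ (e - 1) \<and>
        (\<forall>i. i + vars \<sigma>' 42 \<le> length T \<longrightarrow> arrs \<sigma>' 4 i = sval B T i (vars \<sigma>' 42) mod q)) \<and>
      vars \<sigma>' 44 = (if \<forall>e'<e. level_ok e' then 1 else 0) \<and>
      clk \<sigma>' \<le> clk \<sigma> + 200 + 100 * length T + e * C)"
  define I where "I = (\<lambda>\<sigma>'::st. agree {40..54} (vars \<sigma>) (vars \<sigma>') \<and> agree {3..7} (arrs \<sigma>) (arrs \<sigma>') \<and>
    tape \<sigma>' = tape \<sigma> \<and> vars \<sigma>' 48 = 2 ^ L \<and> (\<exists>e. J e \<sigma>'))"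
  have Sn: "length T \<le> S" "length T + 2 < 2 ^ w" "2 ^ L < (2::nat) ^ w" using b arith_fits by linarith+
  show ?thesis
    unfolding verify_def
    apply (simp add: wp_simps v Sn)
    apply (rule wp_fill_levels)
    using v Sn b apply simp_all[4]
    subgoal premises pf for f0 A0 c0
    proof -
      have a0: "agree {40..54} (vars \<sigma>) f0"
        by (rule agree_trans[OF _ pf(1)[simplified], of "{48}"]) (auto simp: agree_def)
      have A0: "agree {3..7} (arrs \<sigma>) A0"
        using pf(2) by (auto simp: agree_def)
      note ag0 = agreeD[OF a0] agreeD[OF pf(1)[simplified]]
      show ?thesis
      apply (simp add: wp_simps v ag0)
      apply (rule wp_while[where I = I and m = "\<lambda>s. 2 * length T + 2 - vars s 41"])
      subgoal
        unfolding I_def J_def using a0 A0 pf(3-5)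
        by (intro conjI exI[of _ 0]) (simp_all add: v ag0 sval_1)
      subgoal using Sn v by (auto simp add: I_def agree_def)
      subgoal premises p for \<sigma>'
      proof -
        note I = p(1)[unfolded I_def]
        note ag = agreeD[OF I[THEN conjunct1]] agreeD[OF I[THEN conjunct2, THEN conjunct1]]
        define l where "l = vars \<sigma>' 41"
        obtain e where "J e \<sigma>'" using I by blast
        note J = this[unfolded J_def]
        have e: "e \<le> L" "l = 2 ^ e" "vars \<sigma>' 43 = B ^ l mod q" using J by (simp_all add: l_def)
        have F: "\<And>i. i + l \<le> length T \<Longrightarrow> arrs \<sigma>' 3 i = sval B T i l mod q" using J e(2) by blast
        have G: "e = 0 \<longrightarrow> vars \<sigma>' 42 = 0 \<and> (\<forall>i<length T. arrs \<sigma>' 4 i = T ! i)"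
            "e \<noteq> 0 \<longrightarrow> vars \<sigma>' 42 = 2 ^ (e - 1) \<and>
              (\<forall>i. i + vars \<sigma>' 42 \<le> length T \<longrightarrow> arrs \<sigma>' 4 i = sval B T i (vars \<sigma>' 42) mod q)"
          and ok: "vars \<sigma>' 44 = (if \<forall>e'<e. level_ok e' then 1 else 0)"
          and ck: "clk \<sigma>' \<le> clk \<sigma> + 200 + 100 * length T + e * C"
          using J by blast+
        have ln: "l \<le> length T" using p(2) v by (simp add: ag l_def)
        have "e < L" using ln b(1) e(2) by (metis le_less_trans nat_power_less_imp_less pos2)
        define m where "m = length T + 1 - l"
        have l0: "0 < l" using e by simp
        have m: "m + l = length T + 1" "m \<le> length T" using ln l0 by (simp_all add: m_def)
        have h: "vars \<sigma>' 42 \<le> l" using G e(2) by (cases "e = 0") auto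
        have mh: "m + vars \<sigma>' 42 \<le> S" "m + vars \<sigma>' 42 + 1 < 2 ^ w" using h m Sn b by linarith+
        have ov: "length T + 1 < 2 ^ w" "l \<le> length T + 1" using Sn ln by linarith+
        have l41: "vars \<sigma>' 41 = l" by (simp add: l_def)
        have v4: "vars \<sigma>' 4 = length T" "vars \<sigma>' 8 = L" "vars \<sigma>' 48 = 2 ^ L" "vars \<sigma>' 6 = q"
          using v I by (simp_all add: ag)
        let ?F = "\<lambda>i. sval B T i l mod q"
        have Fq: "?F i < (2 ^ L) ^ k" for i
          using b(7) q_pos by (meson less_le_trans mod_less_divisor)
        \<comment> \<open>The test decides level \<open>e\<close> only if all lower levels passed.
          Otherwise the flag in register 44 is already 0 and stays 0, whatever the test
          reports.\<close>
        have lok: "(\<forall>i<m. \<forall>j<m. ?F i = ?F j \<longrightarrow> arrs \<sigma>' 4 i = arrs \<sigma>' 4 j \<and>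
            arrs \<sigma>' 4 (i + vars \<sigma>' 42) = arrs \<sigma>' 4 (j + vars \<sigma>' 42)) \<longleftrightarrow> level_ok e" if "\<forall>e'<e. level_ok e'"
          using that G m e(2) by (intro level_ok_iff) auto
        have fin: "I s" if "agree {40..54} (vars \<sigma>) (vars s)" "agree {3..7} (arrs \<sigma>) (arrs s)" "tape s = tape \<sigma>"
          "vars s 48 = 2 ^ L" "vars s 41 = l + l" "vars s 42 = l" "vars s 43 = B ^ (l + l) mod q"
          "\<And>i. i + l \<le> length T \<Longrightarrow> arrs s 4 i = sval B T i l mod q"
          "\<And>i. i + (l + l) \<le> length T \<Longrightarrow> arrs s 3 i = sval B T i (l + l) mod q"
          "vars s 44 = (if vars \<sigma>' 44 = 1 \<and> (\<forall>i<m. \<forall>j<m. ?F i = ?F j \<longrightarrow> arrs \<sigma>' 4 i = arrs \<sigma>' 4 j \<and>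
            arrs \<sigma>' 4 (i + vars \<sigma>' 42) = arrs \<sigma>' 4 (j + vars \<sigma>' 42)) then 1 else 0)"
          "clk s \<le> clk \<sigma>' + C" for s
        proof -
          have e2: "2 ^ (e + 1) = l + l" by (simp add: e(2) power_add)
          have "vars s 44 = (if \<forall>e'<e + 1. level_ok e' then 1 else 0)"
          proof -
            have "(\<forall>e'<e + 1. level_ok e') \<longleftrightarrow> (\<forall>e'<e. level_ok e') \<and> level_ok e"
              by (metis Suc_eq_plus1 less_Suc_eq)
            then show ?thesis using that(10) ok lok by auto
          qed
          moreover have "clk s \<le> clk \<sigma> + 200 + 100 * length T + (e + 1) * C" using ck that(11) by (simp add: algebra_simps)
          ultimately have "J (e + 1) s"
            unfolding J_def e2 using \<open>e < L\<close> that(5-9) e(2) by simp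
          then show ?thesis using that unfolding I_def by blast
        qed
        show ?thesis
          apply (simp add: wp_simps v4 l41 m_def[symmetric] ov)
          apply (rule wp_radix_sort[where m = m and L = L and F = ?F])
          using v4 b m F Fq Sn apply simp_all[12]
          subgoal premises q for f A c xs
          proof -
            note agq = agreeD[OF q(1)[simplified]] agreeD[OF q(2)[simplified]]
            show ?thesis
              apply (simp add: wp_simps)
              apply (rule wp_check_adjacent[where m = m and h = "vars \<sigma>' 42" and xs = xs and F = ?F])
              using q(3-6) mh b m F ok apply (simp_all add: agq)[11]
              subgoal premises r for f2 c2
              proof -
                note agr = agreeD[OF r(1)[simplified]]
                have f2: "f2 4 = length T" "f2 6 = q" "f2 40 = length T + 1 - l" "f2 41 = l" "f2 43 = B ^ l mod q"
                  using v4 l41 e(3) m(1) by (simp_all add: agr agq)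
                have a2: "agree {40..54} (vars \<sigma>) f2"
                proof -
                  have "agree {40..54} (vars \<sigma>') f"
                    using q(1) by (auto simp: agree_def)
                  moreover have "agree {40..54} f f2" using r(1) by (auto simp: agree_def)
                  ultimately show ?thesis using I by (auto simp: agree_def)
                qed
                have A2: "agree {3..7} (arrs \<sigma>) A" using I q(2) by (auto simp: agree_def)
                have c2: "c2 + 400 + 200 * length T \<le> clk \<sigma>' + C"
                proof -
                  have W: "length T \<le> 2 ^ L" "m \<le> 2 ^ L" using b(1) m by linarith+
                  define Z :: nat where "Z = 1000 + 700 * 2 ^ L"
                  define P where "P = (k + 1) * (400 + 250 * m + 200 * 2 ^ L)"
                  define P' where "P' = (k + 1) * Z"
                  have "P \<le> P'"
                    unfolding P_def P'_def Z_def using W by (intro mult_le_mono2) linarith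
                  moreover have "c \<le> clk \<sigma>' + 124 + P" using q(7) by (simp add: P_def)
                  moreover have "c2 \<le> c + 80 + 250 * m" using r(3) by simp
                  moreover have "C = P' + 2 * Z"
                    by (simp add: C_def P'_def Z_def algebra_simps)
                  moreover have "2000 + 1400 * 2 ^ L \<le> 2 * Z" by (simp add: Z_def)
                  ultimately show ?thesis using W by linarith
                qed
                show ?thesis
                  apply (rule wp_level_step[where l = l])
                  using f2 F ln Sn b l0 apply (simp_all add: agq)[10]
                  subgoal premises u for f3 A3 c3
                  proof -
                    note agu = agreeD[OF u(1)[simplified]] agreeD[OF u(2)[simplified]]
                    have "agree {40..54} (vars \<sigma>) f3" using a2 u(1) by (auto simp: agree_def)
                    moreover have "agree {3..7} (arrs \<sigma>) A3" using A2 u(2) by (auto simp: agree_def)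
                    moreover have "f3 48 = 2 ^ L" "f3 44 = f2 44" "vars \<sigma>' 44 = f 44"
                      using v4 by (simp_all add: agu agr agq)
                    moreover have "2 * length T + 2 - (l + l) < 2 * length T + 2 - l" using ln l0 by linarith
                    moreover have "c3 \<le> clk \<sigma>' + C" using u(8) c2 by simp
                    moreover have "A 4 = arrs \<sigma>' 4" by (simp add: agq)
                    ultimately show ?thesis
                      using u(3-7) r(2) I l41 by (simp add: fin)
                  qed
                  done
              qed
              done
          qed
          done
      qed
      subgoal premises p for \<sigma>'
      proof -
        note I = p(1)[unfolded I_def]
        note ag = agreeD[OF I[THEN conjunct1]]
        obtain e where e: "e \<le> L" "vars \<sigma>' 41 = 2 ^ e"
          "vars \<sigma>' 44 = (if \<forall>e'<e. level_ok e' then 1 else 0)"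
          "clk \<sigma>' \<le> clk \<sigma> + 200 + 100 * length T + e * C" using I unfolding J_def by blast
        have "length T < 2 ^ e" using p(2) v e(2) by (simp add: ag)
        \<comment> \<open>No substring of such a length fits into the text, so these levels hold
          vacuously.\<close>
        have "level_ok e'" if "\<not> e' < e" for e'
        proof -
          have "(2::nat) ^ e \<le> 2 ^ e'" using that by (intro power_increasing) auto
          then have "length T < 2 ^ e'" using \<open>length T < 2 ^ e\<close> by linarith
          then show ?thesis by (simp add: level_ok_def)
        qed
        then have "vars \<sigma>' 44 = (if \<forall>e. level_ok e then 1 else 0)"
          using e(3) by (metis (full_types))
        moreover have "e * C \<le> L * C" using e(1) by (rule mult_le_mono1)
        then have "clk \<sigma>' + 11 \<le> clk \<sigma> + 300 + 100 * length T + L * (k + 3) * (1000 + 700 * 2 ^ L)"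
          using e(4) unfolding C_def mult.assoc by linarith
        ultimately show ?thesis
          using Q[of "vars \<sigma>'" "arrs \<sigma>'" "clk \<sigma>' + (ecost (V 41 \<^bold>< V 4 \<^bold>+ N 1) + 2)"] I
          by (cases \<sigma>; cases \<sigma>') simp
      qed
      done
    qed
    done
qed

end

section \<open>Counting primes\<close>

lemma real_quotient_Ints_dvd:
  assumes "real a / real b \<in> \<int>" "0 < b"
  shows "b dvd a"
proof -
  obtain z where "real a / real b = of_int z" using assms(1) by (auto elim: Ints_cases)
  then have "real_of_int (int a) = real_of_int (z * int b)" using assms(2) by (simp add: field_simps)
  then have "int a = z * int b" by (simp only: of_int_eq_iff)
  then show ?thesis by (metis dvd_triv_right int_dvd_int_iff)
qed

text \<open>
  The entries of the Leibniz harmonic triangle are \<open>1 / (k * (n choose k))\<close>. Each of them is the difference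
  of two neighbours, ultimately of reciprocals of \<open>1, \<dots>, n\<close>.
\<close>

lemma mult_binomial_dvd:
  assumes "\<And>i. 1 \<le> i \<Longrightarrow> i \<le> n \<Longrightarrow> i dvd m" "1 \<le> k" "k \<le> n"
  shows "k * (n choose k) dvd m"
proof -
  have "real m / real (k * (n choose k)) \<in> \<int>"
    using assms
  proof (induction "n" arbitrary: k)
    case (Suc n)
    note D = Suc.prems(1)
    have IH: "real m / real (k * (n choose k)) \<in> \<int>" if "1 \<le> k" "k \<le> n" for k
      using Suc.IH D that by simp
    \<comment> \<open>Row \<open>Suc n\<close> of the triangle is traversed from its right end,
      where the entry is \<open>1 / Suc n\<close>, towards smaller \<open>k\<close>.\<close>
    have *: "real m / real ((Suc n - d) * (Suc n choose (Suc n - d))) \<in> \<int>" if "d \<le> n" for d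
      using that
    proof (induction d)
      case 0
      obtain c where "m = Suc n * c" using D[of "Suc n"] by (auto elim: dvdE)
      then have "real m / real (Suc n) = real c"
        by (metis nonzero_mult_div_cancel_left of_nat_mult of_nat_neq_0)
      then show ?case by simp
    next
      case (Suc d)
      define k where "k = n - d"
      have k: "1 \<le> k" "k \<le> n" "Suc n - Suc d = k" "Suc n - d = Suc k" using Suc.prems by (auto simp: k_def)
      define a where "a = real (n choose k)"
      define b where "b = real (Suc n choose k)"
      define c where "c = real (Suc n choose Suc k)"
      have a: "a > 0" "b > 0" "c > 0" using k by (simp_all add: a_def b_def c_def zero_less_binomial del: binomial_Suc_Suc)
      have 1: "real (Suc k) * c = real (Suc n) * a"
        unfolding a_def c_def of_nat_mult[symmetric] using Suc_times_binomial_eq[of n k] by (simp add: mult.commute)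
      have "(Suc n - k) * (Suc n choose k) = Suc n * (n choose k)"
        using binomial_absorb_comp[of "Suc n" k] by simp
      then have 2: "(real (Suc n) - real k) * b = real (Suc n) * a"
        unfolding a_def b_def using k by (metis of_nat_diff of_nat_mult le_SucI)
      \<comment> \<open>The recurrence of the triangle: an entry is the one above it minus its right
        neighbour in the same row.\<close>
      have "real m / (real k * b) = real m / (real k * a) - real m / (real (Suc k) * c)"
      proof -
        have b': "b = real (Suc n) * a / (real (Suc n) - real k)" using 2 k by (simp add: field_simps)
        have "real k > 0" "real (Suc n) - real k > 0" using k by simp_all
        then show ?thesis unfolding 1 b' using a
          by (simp add: divide_simps) (simp add: algebra_simps)
      qed
      moreover have "real m / (real k * a) \<in> \<int>"
        unfolding a_def of_nat_mult[symmetric] using IH k by simp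
      moreover have "real m / (real (Suc k) * c) \<in> \<int>"
      proof -
        have "real m / real (Suc k * (Suc n choose Suc k)) \<in> \<int>"
          using Suc.IH Suc.prems unfolding k(4) by simp
        then show ?thesis unfolding of_nat_mult c_def .
      qed
      ultimately show ?case unfolding k b_def by simp
    qed
    show ?case using *[of "Suc n - k"] Suc.prems by simp
  qed simp
  moreover have "0 < k * (n choose k)" using assms by simp
  ultimately show ?thesis by (rule real_quotient_Ints_dvd)
qed

text \<open>The exponent of \<open>p\<close> in a least common multiple is the largest exponent
  among the numbers, so this prime power is 1 or divides one of them.\<close>

lemma prime_power_Lcm_le:
  assumes "prime (p::nat)"
  shows "p ^ multiplicity p (Lcm {1..n}) \<le> max 1 n"
proof (induction n)
  case (Suc n)
  have "Lcm {1..Suc n} = lcm (Suc n) (Lcm {1..n})" by (simp add: atLeastAtMostSuc_conv)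
  moreover have "Lcm {1..n} \<noteq> 0" by (auto simp: Lcm_0_iff)
  ultimately have *: "multiplicity p (Lcm {1..Suc n}) = max (multiplicity p (Suc n)) (multiplicity p (Lcm {1..n}))"
    by (simp add: multiplicity_lcm assms)
  have "p ^ multiplicity p (Suc n) \<le> Suc n" by (intro dvd_imp_le multiplicity_dvd) simp
  with Suc show ?case unfolding * by (auto simp: max_def split: if_splits)
qed simp

text \<open>The factorisation has at most one prime power for each prime up to \<open>n\<close>, and
  each prime power is at most \<open>n\<close>.\<close>

lemma Lcm_le_power_primes: "Lcm {1..n::nat} \<le> n ^ card {p. prime p \<and> p \<le> n}"
proof (cases "n = 0")
  case False
  let ?L = "Lcm {1..n}"
  have "?L \<noteq> 0" by (auto simp: Lcm_0_iff)
  have sub: "prime_factors ?L \<subseteq> {p. prime p \<and> p \<le> n}"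
  proof
    fix p assume p: "p \<in> prime_factors ?L"
    then have "multiplicity p ?L \<noteq> 0" by (simp add: prime_factors_multiplicity)
    then have "p ^ 1 \<le> p ^ multiplicity p ?L"
      using p by (intro power_increasing) (auto simp: Suc_le_eq One_nat_def intro: prime_gt_0_nat)
    also have "\<dots> \<le> n" using prime_power_Lcm_le[of p n] p False by auto
    finally show "p \<in> {p. prime p \<and> p \<le> n}" using p by auto
  qed
  have "?L = (\<Prod>p\<in>prime_factors ?L. p ^ multiplicity p ?L)"
    using prod_prime_factors[OF \<open>?L \<noteq> 0\<close>] by simp
  also have "\<dots> \<le> (\<Prod>p\<in>prime_factors ?L. n)"
    using prime_power_Lcm_le[of _ n] False by (intro prod_mono) auto
  also have "\<dots> = n ^ card (prime_factors ?L)" by simp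
  also have "\<dots> \<le> n ^ card {p. prime p \<and> p \<le> n}"
    using False sub by (intro power_increasing card_mono) auto
  finally show ?thesis .
next
  case True
  then have "{p::nat. prime p \<and> p \<le> n} = {}" by auto
  then show ?thesis unfolding \<open>_ = {}\<close> using True by simp
qed

lemma two_power_le_binomial: "2 ^ m \<le> (2 * m choose m)"
proof (induction m)
  case (Suc m)
  have "2 * Suc m = Suc (2 * m + 1)" by simp
  then have "(2 * Suc m choose Suc m) = (2 * m + 1 choose m) + (2 * m + 1 choose Suc m)"
    by (simp only: binomial_Suc_Suc)
  moreover have "(n choose k) \<le> (n + 1 choose k)" "(n choose k) \<le> (n + 1 choose Suc k)" for n k
    by (cases k; simp flip: Suc_eq_plus1)+
  then have "(2 * m choose m) \<le> (2 * m + 1 choose m)" "(2 * m choose m) \<le> (2 * m + 1 choose Suc m)"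
    by blast+
  ultimately show ?case using Suc by simp
qed simp

text \<open>A lower bound of Chebyshev type: with \<open>M = 2 ^ (k - 1)\<close>, the number
  \<open>M * (2 * M choose M)\<close> divides the least common multiple of 1 to
  \<open>2 * M\<close>, which in turn is at most \<open>2 ^ k\<close> raised to the number of
  primes.\<close>

lemma primes_below_power:
  assumes "2 \<le> k"
  shows "2 ^ k \<le> 2 * k * card {p. prime p \<and> p < (2::nat) ^ k}"
proof -
  define M :: nat where "M = 2 ^ (k - 1)"
  have M: "2 * M = 2 ^ k" "1 \<le> M" using assms by (simp_all add: M_def flip: power_Suc)
  \<comment> \<open>For \<open>k \<ge> 2\<close> the endpoint is composite, so counting primes up to
    \<open>2 ^ k\<close> or strictly below it is the same.\<close>
  have "\<not> prime ((2::nat) ^ k)" using assms by (simp add: prime_power_iff)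
  then have e: "{p. prime p \<and> p \<le> (2::nat) ^ k} = {p. prime p \<and> p < (2::nat) ^ k}"
    by (auto simp: le_less)
  have "M * (2 * M choose M) dvd Lcm {1..2 * M}"
    using M by (intro mult_binomial_dvd) auto
  moreover have "Lcm {1..2 * M} \<noteq> 0" using Lcm_0_iff[of "{1..2 * M}"] by auto
  then have "0 < Lcm {1..2 * M}" by (metis neq0_conv)
  ultimately have "M * (2 * M choose M) \<le> Lcm {1..2 * M}" by (rule dvd_imp_le)
  moreover have "1 * 2 ^ M \<le> M * (2 * M choose M)"
    using M(2) two_power_le_binomial[of M] by (rule mult_le_mono)
  ultimately have "2 ^ M \<le> Lcm {1..2 * M}" by simp
  also have "\<dots> \<le> (2 ^ k) ^ card {p. prime p \<and> p < (2::nat) ^ k}"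
    using Lcm_le_power_primes[of "2 * M"] unfolding M e .
  finally have "(2::nat) ^ M \<le> 2 ^ (k * card {p. prime p \<and> p < (2::nat) ^ k})"
    by (simp add: power_mult)
  then have "M \<le> k * card {p. prime p \<and> p < (2::nat) ^ k}" by simp
  then show ?thesis using M by simp
qed

text \<open>Each distinct prime factor contributes at least a factor 2 to \<open>x\<close>.\<close>

lemma card_prime_divisors:
  assumes "0 < (x::nat)" "x < 2 ^ s"
  shows "card {p. prime p \<and> p dvd x} \<le> s"
proof -
  have "2 ^ card (prime_factors x) = (\<Prod>p\<in>prime_factors x. 2::nat)" by simp
  also have "\<dots> \<le> (\<Prod>p\<in>prime_factors x. p ^ multiplicity p x)"
  proof (intro prod_mono conjI)
    fix p assume p: "p \<in> prime_factors x"
    then have "multiplicity p x \<noteq> 0" by (simp add: prime_factors_multiplicity)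
    moreover have "2 \<le> p" using p by (auto intro: prime_ge_2_nat)
    ultimately have "2 * 1 \<le> p * p ^ (multiplicity p x - 1)" by (intro mult_le_mono) auto
    also have "\<dots> = p ^ multiplicity p x"
      using \<open>multiplicity p x \<noteq> 0\<close> by (simp add: power_eq_if)
    finally show "2 \<le> p ^ multiplicity p x" by simp
  qed simp
  also have "\<dots> = x" using prod_prime_factors[of x] assms by simp
  finally have "(2::nat) ^ card (prime_factors x) < 2 ^ s" using assms by linarith
  then have "card (prime_factors x) \<le> s" by (simp add: less_imp_le nat_power_less_imp_less)
  moreover have "{p. prime p \<and> p dvd x} = prime_factors x"
    using assms by (auto simp: prime_factors_dvd)
  ultimately show ?thesis by simp
qed


section \<open>Random moduli are faithful with high probability\<close>

abbreviation word :: "nat \<Rightarrow> nat pmf" where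
  "word w \<equiv> pmf_of_set {..<2 ^ w}"

lemma card_residues:
  assumes "A \<subseteq> {..<M}"
  shows "card {u \<in> {..<M * c}. u mod M \<in> A} = card A * c"
proof (cases "M = 0")
  case False
  have "bij_betw (\<lambda>(a, i). a + M * i) (A \<times> {..<c}) {u \<in> {..<M * c}. u mod M \<in> A}"
  proof (rule bij_betw_byWitness[where f' = "\<lambda>u. (u mod M, u div M)"])
    show "\<forall>x\<in>A \<times> {..<c}. (\<lambda>u. (u mod M, u div M)) ((\<lambda>(a, i). a + M * i) x) = x"
      using assms by auto
    show "\<forall>u\<in>{u \<in> {..<M * c}. u mod M \<in> A}. (\<lambda>(a, i). a + M * i) (u mod M, u div M) = u"
      by auto
    show "(\<lambda>(a, i). a + M * i) ` (A \<times> {..<c}) \<subseteq> {u \<in> {..<M * c}. u mod M \<in> A}"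
    proof -
      have "a + M * i < M * c" if "a < M" "i < c" for a i
      proof -
        have "M * (i + 1) \<le> M * c" using that by (intro mult_le_mono2) simp
        then show ?thesis using that by (simp add: algebra_simps)
      qed
      then show ?thesis using assms by auto
    qed
    show "(\<lambda>u. (u mod M, u div M)) ` {u \<in> {..<M * c}. u mod M \<in> A} \<subseteq> A \<times> {..<c}"
      by (auto simp: less_mult_imp_div_less mult.commute)
  qed
  then show ?thesis by (simp add: bij_betw_same_card[symmetric] card_cartesian_product)
qed (use assms in auto)

text \<open>Since \<open>2 ^ k\<close> divides \<open>2 ^ w\<close>, the residue of a uniform word
  is exactly uniform; this is the benefit of drawing candidates below a power of two.\<close>

lemma prob_word_mod:
  assumes "A \<subseteq> {..<2 ^ k}" "k \<le> w"
  shows "measure_pmf.prob (word w) {u. u mod 2 ^ k \<in> A} = card A / 2 ^ k"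
proof -
  have e: "(2::nat) ^ w = 2 ^ k * 2 ^ (w - k)" using assms(2) by (simp flip: power_add)
  have "{..<2 ^ w} \<inter> {u. u mod 2 ^ k \<in> A} = {u \<in> {..<2 ^ k * 2 ^ (w - k)}. u mod 2 ^ k \<in> A}"
    using e by auto
  then have "card ({..<2 ^ w} \<inter> {u. u mod 2 ^ k \<in> A}) = card A * 2 ^ (w - k)"
    using card_residues[OF assms(1)] by simp
  then show ?thesis
    using e by (simp add: measure_pmf_of_set lessThan_empty_iff)
qed

lemma prob_replicate_all:
  fixes p :: "'a :: countable pmf"
  shows "measure_pmf.prob (replicate_pmf n p) {us. \<forall>u\<in>set us. u \<in> A} = measure_pmf.prob p A ^ n"
proof (induction n)
  case (Suc n)
  have r: "replicate_pmf (Suc n) p = map_pmf (\<lambda>(u, us). u # us) (pair_pmf p (replicate_pmf n p))"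
    by (simp add: pair_pmf_def map_pmf_def bind_assoc_pmf bind_return_pmf)
  have v: "(\<lambda>(u, us). u # us) -` {us. \<forall>u\<in>set us. u \<in> A} = A \<times> {us. \<forall>u\<in>set us. u \<in> A}"
    by auto
  show ?case
    unfolding r measure_map_pmf v
    by (subst measure_pmf_prob_product) (simp_all add: Suc)
qed simp

lemma prob_replicate_some:
  fixes p :: "'a :: countable pmf"
  shows "measure_pmf.prob (replicate_pmf n p) {us. \<exists>u\<in>set us. u \<in> A} \<le> n * measure_pmf.prob p A"
proof (induction n)
  case (Suc n)
  let ?P = "pair_pmf p (replicate_pmf n p)"
  have r: "replicate_pmf (Suc n) p = map_pmf (\<lambda>(u, us). u # us) ?P"
    by (simp add: pair_pmf_def map_pmf_def bind_assoc_pmf bind_return_pmf)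
  have v: "(\<lambda>(u, us). u # us) -` {us. \<exists>u\<in>set us. u \<in> A} =
      (fst -` A) \<union> (snd -` {us. \<exists>u\<in>set us. u \<in> A})"
    by auto
  have "measure_pmf.prob ?P ((fst -` A) \<union> (snd -` {us. \<exists>u\<in>set us. u \<in> A}))
      \<le> measure_pmf.prob ?P (fst -` A) + measure_pmf.prob ?P (snd -` {us. \<exists>u\<in>set us. u \<in> A})"
    by (rule measure_Un_le) auto
  also have "\<dots> = measure_pmf.prob p A + measure_pmf.prob (replicate_pmf n p) {us. \<exists>u\<in>set us. u \<in> A}"
    by (metis map_fst_pair_pmf map_snd_pair_pmf measure_map_pmf)
  also have "\<dots> \<le> Suc n * measure_pmf.prob p A" using Suc by (simp add: algebra_simps)
  finally show ?case unfolding r measure_map_pmf v .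
qed simp

lemma picked_neq_1: "u \<in> set us \<Longrightarrow> prime (u mod M) \<Longrightarrow> picked M us \<noteq> 1"
  by (induction us rule: rev_induct) (auto simp: picked_snoc)

text \<open>A draw fails on \<open>x\<close> if it contains no prime at all or some prime divisor of \<open>x\<close>.\<close>

lemma prob_picked_dvd:
  fixes x :: nat
  assumes "2 \<le> k" "k \<le> w" "0 < x" "x < 2 ^ s"
  shows "measure_pmf.prob (words w R) {us. picked (2 ^ k) us dvd x} \<le> (1 - 1 / (2 * k)) ^ R + R * (s / 2 ^ k)"
proof -
  let ?M = "(2::nat) ^ k"
  define P where "P = {r. prime r \<and> r < ?M}"
  define A where "A = {..<?M} - P"
  define D where "D = {r. prime r \<and> r dvd x} \<inter> {..<?M}"
  have fin: "finite {r. prime r \<and> r dvd x}"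
    using assms(3) by (intro finite_subset[OF _ finite_divisors_nat[of x]]) auto
  have cD: "card D \<le> s"
    using card_mono[OF fin, of D] card_prime_divisors[OF assms(3,4)] by (auto simp: D_def)
  have cP: "real (2 ^ k) \<le> 2 * k * card P"
    using primes_below_power[OF assms(1)] unfolding P_def by (metis of_nat_le_iff of_nat_mult of_nat_numeral)
  have PM: "P \<subseteq> {..<?M}" by (auto simp: P_def)
  have cA: "real (card A) = 2 ^ k - real (card P)"
    using card_Diff_subset[OF _ PM] card_mono[OF _ PM] finite_subset[OF PM]
    by (simp add: A_def of_nat_diff)
  \<comment> \<open>If no try hits a prime divisor of \<open>x\<close>, the picked value can only be
    the default 1, and then no try was prime at all.\<close>
  have "{us. picked ?M us dvd x} \<subseteq>
    {us. \<forall>u\<in>set us. u \<in> {u. u mod ?M \<in> A}} \<union> {us. \<exists>u\<in>set us. u \<in> {u. u mod ?M \<in> D}}"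
  proof clarify
    fix us u
    assume d: "picked ?M us dvd x" and n: "\<not> (\<exists>u\<in>set us. u \<in> {u. u mod ?M \<in> D})" and u: "u \<in> set us"
    show "u mod ?M \<in> A"
    proof (rule ccontr)
      assume "u mod ?M \<notin> A"
      then have "prime (u mod ?M)" by (auto simp: A_def P_def)
      then have "picked ?M us \<noteq> 1"
        using u by (rule picked_neq_1[rotated])
      then show False using picked_cases[of ?M us] d n by (auto simp: D_def)
    qed
  qed
  then have "measure_pmf.prob (words w R) {us. picked ?M us dvd x} \<le>
     measure_pmf.prob (words w R) ({us. \<forall>u\<in>set us. u \<in> {u. u mod ?M \<in> A}} \<union> {us. \<exists>u\<in>set us. u \<in> {u. u mod ?M \<in> D}})"
    by (intro measure_pmf.finite_measure_mono) auto
  also have "\<dots> \<le> measure_pmf.prob (words w R) {us. \<forall>u\<in>set us. u \<in> {u. u mod ?M \<in> A}}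
      + measure_pmf.prob (words w R) {us. \<exists>u\<in>set us. u \<in> {u. u mod ?M \<in> D}}"
    by (rule measure_Un_le) auto
  also have "\<dots> \<le> measure_pmf.prob (word w) {u. u mod ?M \<in> A} ^ R + R * measure_pmf.prob (word w) {u. u mod ?M \<in> D}"
    unfolding prob_replicate_all using prob_replicate_some by (intro add_left_mono)
  also have "\<dots> = (card A / 2 ^ k) ^ R + R * (card D / 2 ^ k)"
    using prob_word_mod[of A k w] prob_word_mod[of D k w] assms(2) by (simp add: A_def D_def)
  also have "\<dots> \<le> (1 - 1 / (2 * k)) ^ R + R * (s / 2 ^ k)"
  proof (intro add_mono power_mono mult_left_mono divide_right_mono)
    show "card A / 2 ^ k \<le> 1 - 1 / (2 * k)"
    proof -
      have "2 * real k * card A = 2 * real k * 2 ^ k - 2 * real k * card P" by (simp add: cA algebra_simps)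
      then have "2 * real k * card A + 2 ^ k \<le> 2 * real k * 2 ^ k" using cP by simp
      then show ?thesis using assms(1) by (simp add: field_simps)
    qed
  qed (use cD in auto)
  finally show ?thesis by simp
qed

text \<open>If the product divides \<open>x\<close>, so does each of its factors, and the factors
  come from disjoint, independent parts of the tape. Repeated primes do no harm to this
  argument.\<close>

lemma prob_modulus_dvd:
  fixes x :: nat and \<epsilon> :: real
  assumes "measure_pmf.prob (words w R) {us. picked M us dvd x} \<le> \<epsilon>"
  shows "measure_pmf.prob (words w (R * c)) {us. modulus M R c us dvd x} \<le> \<epsilon> ^ c"
proof (induction c)
  case (Suc c)
  let ?P = "pair_pmf (words w R) (words w (R * c))"
  have "words w (R * Suc c) = words w (R + R * c)" by simp
  also have "\<dots> = map_pmf (\<lambda>(xs, ys). xs @ ys) ?P"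
    unfolding replicate_pmf_distrib
    by (simp add: pair_pmf_def map_pmf_def bind_assoc_pmf bind_return_pmf)
  finally have r: "words w (R * Suc c) = map_pmf (\<lambda>(xs, ys). xs @ ys) ?P" .
  have "measure_pmf.prob (words w (R * Suc c)) {us. modulus M R (Suc c) us dvd x} =
      measure_pmf.prob ?P {(xs, ys). modulus M R (Suc c) (xs @ ys) dvd x}"
    unfolding r measure_map_pmf by (simp add: vimage_def case_prod_beta' del: modulus.simps)
  also have "\<dots> \<le> measure_pmf.prob ?P ({xs. picked M xs dvd x} \<times> {ys. modulus M R c ys dvd x})"
  proof (rule measure_pmf.finite_measure_mono_AE)
    \<comment> \<open>Almost surely \<open>xs\<close> has length \<open>R\<close>, so
      \<open>take R\<close> and \<open>drop R\<close> split the concatenation where it was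
      joined.\<close>
    show "AE p in ?P. p \<in> {(xs, ys). modulus M R (Suc c) (xs @ ys) dvd x} \<longrightarrow>
        p \<in> {xs. picked M xs dvd x} \<times> {ys. modulus M R c ys dvd x}"
      by (auto simp: AE_measure_pmf_iff set_replicate_pmf intro: dvd_mult_left dvd_mult_right)
  qed auto
  also have "\<dots> \<le> \<epsilon> * \<epsilon> ^ c"
    using assms Suc by (subst measure_pmf_prob_product) (auto intro!: mult_mono order_trans[OF measure_nonneg])
  finally show ?case by simp
qed simp

text \<open>All lengths are covered, so one event serves the search lengths for every
  \<open>\<tau>\<close> and all levels of the verification.\<close>

definition collision_free :: "nat \<Rightarrow> nat list \<Rightarrow> nat \<Rightarrow> bool" where
  "collision_free B T q \<longleftrightarrow> (\<forall>x y l. x + l \<le> length T \<longrightarrow> y + l \<le> length T \<longrightarrow>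
     [sval B T x l = sval B T y l] (mod q) \<longrightarrow> matches T x y l)"

text \<open>A union bound over at most \<open>length T ^ 3\<close> triples: a collision means that
  the modulus divides the nonzero difference of two substring values, a number below
  \<open>2 ^ (b * length T)\<close> that does not depend on the tape.\<close>

lemma prob_not_collision_free:
  fixes \<epsilon> :: real
  assumes B: "set T \<subseteq> {..<2 ^ b}"
    and \<epsilon>: "\<And>x. 0 < x \<Longrightarrow> x < 2 ^ (b * length T) \<Longrightarrow>
      measure_pmf.prob (words w (R * c)) {us. modulus M R c us dvd x} \<le> \<epsilon>"
    and "0 \<le> \<epsilon>"
  shows "measure_pmf.prob (words w (R * c)) {us. \<not> collision_free (2 ^ b) T (modulus M R c us)}
    \<le> length T ^ 3 * \<epsilon>"
proof -
  let ?n = "length T" and ?B = "(2::nat) ^ b"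
  define d where "d = (\<lambda>(x, y, l). nat \<bar>int (sval ?B T x l) - int (sval ?B T y l)\<bar>)"
  define X where "X = {z \<in> {..<?n} \<times> {..<?n} \<times> {1..?n}. 0 < d z \<and> d z < 2 ^ (b * ?n)}"
  have X: "finite X" "card X \<le> ?n ^ 3"
  proof -
    have "X \<subseteq> {..<?n} \<times> {..<?n} \<times> {1..?n}" by (auto simp: X_def)
    from card_mono[OF _ this] finite_subset[OF this] show "finite X" "card X \<le> ?n ^ 3"
      by (simp_all add: card_cartesian_product power3_eq_cube)
  qed
  have sub: "{us. \<not> collision_free ?B T (modulus M R c us)} \<subseteq> (\<Union>z\<in>X. {us. modulus M R c us dvd d z})"
  proof
    fix us assume "us \<in> {us. \<not> collision_free ?B T (modulus M R c us)}"
    then obtain x y l where *: "x + l \<le> ?n" "y + l \<le> ?n" "\<not> matches T x y l"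
      "[sval ?B T x l = sval ?B T y l] (mod modulus M R c us)" by (auto simp: collision_free_def)
    then have "l \<noteq> 0" by (auto simp: matches_def)
    have neq: "sval ?B T x l \<noteq> sval ?B T y l" using sval_eq_iff[OF B *(1,2)] *(3) by simp
    have bound: "sval ?B T z l < 2 ^ (b * ?n)" if "z + l \<le> ?n" for z
    proof -
      have "set (take l (drop z T)) \<subseteq> {..<?B}"
        using B by (meson set_drop_subset set_take_subset subset_trans)
      moreover have "length (take l (drop z T)) = l" using that by simp
      ultimately have "sval ?B T z l < ?B ^ l" using hval_less unfolding sval_def by metis
      also have "\<dots> \<le> ?B ^ ?n" using that by (intro power_increasing) auto
      finally show ?thesis by (simp add: power_mult)
    qed
    have "nat \<bar>int u - int v\<bar> < N" if "u < N" "v < N" for u v N :: nat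
      using that by linarith
    then have "d (x, y, l) < 2 ^ (b * ?n)" using bound[OF *(1)] bound[OF *(2)] by (simp only: d_def prod.case)
    then have "(x, y, l) \<in> X" using * \<open>l \<noteq> 0\<close> neq by (auto simp: X_def d_def)
    moreover have "int (modulus M R c us) dvd int (sval ?B T x l) - int (sval ?B T y l)"
      using *(4) by (metis cong_iff_dvd_diff cong_int_iff)
    then have "modulus M R c us dvd d (x, y, l)" by (simp add: d_def flip: int_dvd_int_iff)
    ultimately show "us \<in> (\<Union>z\<in>X. {us. modulus M R c us dvd d z})" by blast
  qed
  have "measure_pmf.prob (words w (R * c)) {us. \<not> collision_free ?B T (modulus M R c us)}
    \<le> measure_pmf.prob (words w (R * c)) (\<Union>z\<in>X. {us. modulus M R c us dvd d z})"
    using sub by (intro measure_pmf.finite_measure_mono) auto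
  also have "\<dots> \<le> (\<Sum>z\<in>X. measure_pmf.prob (words w (R * c)) {us. modulus M R c us dvd d z})"
    using X by (intro measure_UNION_le) auto
  also have "\<dots> \<le> (\<Sum>z\<in>X. \<epsilon>)" using \<epsilon> by (intro sum_mono) (auto simp: X_def)
  also have "\<dots> \<le> ?n ^ 3 * \<epsilon>"
    using X(2) assms(3) by (simp add: mult_right_mono flip: of_nat_power)
  finally show ?thesis .
qed

section \<open>Size of the primes and failure probability of one prime\<close>

definition prime_bits :: "nat \<Rightarrow> nat" where
  "prime_bits L = L + L div 2"

text \<open>A candidate is prime with probability at least \<open>1 / (2 * prime_bits L)\<close>, so
  this many tries all fail with probability at most \<open>exp (- L)\<close>.\<close>

definition tries :: "nat \<Rightarrow> nat" where
  "tries L = 2 * prime_bits L * L"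

text \<open>Bounds the probability that one draw is useless: all tries miss the primes, or some try
  hits one of the at most \<open>\<sigma> * L * 2 ^ L\<close> prime divisors of the
  difference.\<close>

definition miss :: "nat \<Rightarrow> nat \<Rightarrow> real" where
  "miss \<sigma> L = (1 - 1 / (2 * prime_bits L)) ^ tries L + tries L * (\<sigma> * L * 2 ^ L / 2 ^ prime_bits L)"

lemma miss_nonneg: "1 \<le> L \<Longrightarrow> 0 \<le> miss \<sigma> L"
  by (auto simp: miss_def prime_bits_def intro!: add_nonneg_nonneg mult_nonneg_nonneg zero_le_power)

lemma miss_le:
  assumes "1 \<le> L"
  shows "miss \<sigma> L \<le> exp (- real L) + 4 * \<sigma> * real L ^ 3 * 2 powr (- (real L - 1) / 2)"
proof -
  let ?k = "prime_bits L"
  have k: "1 \<le> ?k" "?k \<le> 2 * L" using assms by (auto simp: prime_bits_def)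
  have "(1 - 1 / (2 * real ?k)) ^ tries L \<le> exp (- (1 / (2 * real ?k))) ^ tries L"
    using exp_ge_add_one_self[of "- (1 / (2 * real ?k))"] k by (intro power_mono) (auto simp: field_simps)
  also have "\<dots> = exp (- real L)"
    using k by (simp add: tries_def flip: exp_of_nat_mult)
  finally have 1: "(1 - 1 / (2 * real ?k)) ^ tries L \<le> exp (- real L)" .
  have "(2::real) ^ L / 2 ^ ?k = 2 powr (- real (L div 2))"
    by (simp add: prime_bits_def power_add powr_minus powr_realpow field_simps)
  also have "\<dots> \<le> 2 powr (- (real L - 1) / 2)"
  proof (intro powr_mono)
    have "real L \<le> real (2 * (L div 2) + 1)" unfolding of_nat_le_iff by presburger
    then show "- real (L div 2) \<le> - (real L - 1) / 2" by simp
  qed simp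
  finally have 2: "(2::real) ^ L / 2 ^ ?k \<le> 2 powr (- (real L - 1) / 2)" .
  have "tries L * (\<sigma> * L * 2 ^ L / 2 ^ ?k) = real (tries L * \<sigma> * L) * (2 ^ L / 2 ^ ?k)" by simp
  also have "\<dots> \<le> real (4 * \<sigma> * L ^ 3) * 2 powr (- (real L - 1) / 2)"
  proof (intro mult_mono 2)
    have "tries L \<le> 2 * (2 * L) * L" using k by (simp add: tries_def)
    then have "tries L * (\<sigma> * L) \<le> 2 * (2 * L) * L * (\<sigma> * L)" by (rule mult_le_mono1)
    also have "\<dots> = 4 * \<sigma> * L ^ 3" by (simp add: power3_eq_cube)
    finally show "real (tries L * \<sigma> * L) \<le> real (4 * \<sigma> * L ^ 3)" by (simp add: mult.assoc flip: of_nat_mult)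
  qed auto
  finally show ?thesis using 1 by (simp add: miss_def)
qed

lemma eventually_miss_le: "eventually (\<lambda>L. miss \<sigma> L ^ 8 \<le> 1 / 2 ^ L) sequentially"
proof -
  \<comment> \<open>The true decay is about \<open>2 powr (- L / 2)\<close> up to a polynomial;
    weakening the exponent to \<open>- L / 8\<close> absorbs the polynomial, and 8 primes then give
    \<open>1 / 2 ^ L\<close>. Writing \<open>\<sigma> + 1\<close> keeps the coefficient
    positive.\<close>
  have "eventually (\<lambda>L::nat. exp (- real L) + 4 * (real \<sigma> + 1) * real L ^ 3 * 2 powr (- (real L - 1) / 2) \<le> 2 powr (- real L / 8)) sequentially"
    by real_asymp
  then show ?thesis
    using eventually_ge_at_top[of 1]
  proof eventually_elim
    case (elim L)
    have "4 * real \<sigma> * real L ^ 3 * 2 powr (- (real L - 1) / 2) \<le> 4 * (real \<sigma> + 1) * real L ^ 3 * 2 powr (- (real L - 1) / 2)"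
      by (intro mult_right_mono) auto
    then have "miss \<sigma> L \<le> 2 powr (- real L / 8)" using miss_le[of L \<sigma>] elim by linarith
    then have "miss \<sigma> L ^ 8 \<le> (2 powr (- real L / 8)) ^ 8"
      using miss_nonneg[of L \<sigma>] elim by (intro power_mono) auto
    also have "\<dots> = 1 / 2 ^ L" by (simp add: powr_power powr_minus powr_realpow field_simps)
    finally show ?case .
  qed
qed

text \<open>The number \<open>8 * (g + 4)\<close> of primes makes up for the \<open>n ^ 3\<close> comparisons and for the exponent \<open>g\<close>.\<close>

lemma collision_free_whp:
  fixes \<gamma> :: real
  assumes "\<gamma> \<le> g" "miss \<sigma> L ^ 8 \<le> 1 / 2 ^ L" "L = floorlog 2 (length T)" "2 \<le> L" "prime_bits L \<le> w"
    and T: "set T \<subseteq> {..<2 ^ (\<sigma> * L)}"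
  shows "measure_pmf.prob (words w (tries L * (8 * (g + 4))))
      {us. collision_free (2 ^ (\<sigma> * L)) T (modulus (2 ^ prime_bits L) (tries L) (8 * (g + 4)) us)}
    \<ge> 1 - 1 / length T powr \<gamma> \<and>
    measure_pmf.prob (words w (tries L * (8 * (g + 4))))
      {us. collision_free (2 ^ (\<sigma> * L)) T (modulus (2 ^ prime_bits L) (tries L) (8 * (g + 4)) us)} \<ge> 1 / 2"
proof -
  let ?k = "prime_bits L" and ?c = "8 * (g + 4)" and ?n = "length T"
  let ?S = "{us. collision_free (2 ^ (\<sigma> * L)) T (modulus (2 ^ ?k) (tries L) ?c us)}"
  have n: "?n < 2 ^ L" "1 \<le> ?n"
  proof -
    have "?n \<noteq> 0" using assms(3,4) by (intro notI) (simp add: floorlog_def)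
    then show "1 \<le> ?n" "?n < 2 ^ L" using floorlog_bounds[of ?n 2] assms(3) by (linarith, simp)
  qed
  have k: "2 \<le> ?k" using assms(4) by (simp add: prime_bits_def)
  have "measure_pmf.prob (words w (tries L)) {us. picked (2 ^ ?k) us dvd x} \<le> miss \<sigma> L"
    if x: "0 < x" "x < 2 ^ (\<sigma> * L * ?n)" for x
  proof -
    have "real (\<sigma> * L * ?n) / 2 ^ ?k \<le> \<sigma> * L * 2 ^ L / 2 ^ ?k"
    proof (intro divide_right_mono)
      have "\<sigma> * L * ?n \<le> \<sigma> * L * 2 ^ L" using n by (intro mult_le_mono2) simp
      then show "real (\<sigma> * L * ?n) \<le> real (\<sigma> * L * 2 ^ L)" by (simp only: of_nat_le_iff)
    qed simp
    then have "tries L * (real (\<sigma> * L * ?n) / 2 ^ ?k) \<le> tries L * (\<sigma> * L * 2 ^ L / 2 ^ ?k)"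
      by (intro mult_left_mono) auto
    then show ?thesis
      using prob_picked_dvd[OF k assms(5) x, of "tries L"]
      unfolding miss_def of_nat_mult of_nat_power of_nat_numeral by linarith
  qed
  then have "measure_pmf.prob (words w (tries L * ?c)) {us. modulus (2 ^ ?k) (tries L) ?c us dvd x} \<le> miss \<sigma> L ^ ?c"
    if "0 < x" "x < 2 ^ (\<sigma> * L * ?n)" for x
    using that by (intro prob_modulus_dvd) auto
  then have "measure_pmf.prob (words w (tries L * ?c)) (- ?S) \<le> ?n ^ 3 * miss \<sigma> L ^ ?c"
    unfolding Compl_eq mem_Collect_eq using miss_nonneg[of L \<sigma>] assms(4)
    by (intro prob_not_collision_free[OF T]) auto
  also have "miss \<sigma> L ^ ?c \<le> (1 / 2 ^ L) ^ (g + 4)"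
    unfolding power_mult using assms(2) miss_nonneg[of L \<sigma>] assms(4) by (intro power_mono) auto
  also have "real (?n ^ 3) * (1 / 2 ^ L) ^ (g + 4) \<le> (2 ^ L) ^ 3 * (1 / 2 ^ L) ^ (g + 4)"
  proof (intro mult_right_mono)
    have "?n ^ 3 \<le> (2 ^ L) ^ 3" using n by (intro power_mono) auto
    then show "real (?n ^ 3) \<le> (2 ^ L) ^ 3" by (metis of_nat_le_iff of_nat_numeral of_nat_power)
  qed auto
  also have "\<dots> = 1 / (2 ^ L) ^ (g + 1)"
  proof -
    define X :: real where "X = 2 ^ L"
    have "X > 0" by (simp add: X_def)
    moreover have "g + 4 = 3 + (g + 1)" by simp
    ultimately have "X ^ 3 * (1 / X) ^ (g + 4) = 1 / X ^ (g + 1)"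
      by (simp only: power_add power_one_over) simp
    then show ?thesis by (simp add: X_def)
  qed
  finally have P: "measure_pmf.prob (words w (tries L * ?c)) (- ?S) \<le> 1 / (2 ^ L) ^ (g + 1)"
    by (simp add: mult_left_mono)
  have "real ?n powr \<gamma> \<le> real ?n powr (real g + 1)" using n assms(1) by (intro powr_mono) auto
  also have "\<dots> \<le> (2 ^ L) powr (real g + 1)"
  proof (intro powr_mono2)
    have "real ?n \<le> real (2 ^ L)" using n(1) by (intro of_nat_mono) simp
    then show "real ?n \<le> 2 ^ L" by simp
  qed auto
  also have "\<dots> = (2 ^ L) ^ (g + 1)" using powr_realpow[of "2 ^ L" "g + 1"] by (simp add: add.commute)
  finally have "1 / (2 ^ L) ^ (g + 1) \<le> 1 / real ?n powr \<gamma>"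
    using n by (intro divide_left_mono mult_pos_pos) auto
  moreover have "1 * 1 \<le> L * (g + 1)" using assms(4) by (intro mult_le_mono) auto
  then have "(2::real) ^ 1 \<le> (2 ^ L) ^ (g + 1)"
    unfolding power_mult[symmetric] by (intro power_increasing) auto
  then have "1 / (2 ^ L) ^ (g + 1) \<le> (1 / 2 :: real)" by (simp add: field_simps)
  moreover have "measure_pmf.prob (words w (tries L * ?c)) ?S = 1 - measure_pmf.prob (words w (tries L * ?c)) (- ?S)"
    by (simp add: measure_pmf.prob_compl[of ?S, simplified] Compl_eq_Diff_UNIV)
  ultimately show ?thesis using P by linarith
qed

section \<open>The randomised data structures\<close>

definition hash_setup :: "nat \<Rightarrow> hcom" where
  "hash_setup s = (4 ::= V 0;; 10 ::= V 0;; bitlength;; 8 ::= V 11;; power_below;;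
     7 ::= Bop Shl (N 1) (N s \<^bold>* V 8);;
     33 ::= V 8 \<^bold>+ V 8 \<^bold>/ N 2;; 9 ::= Bop Shl (N 1) (V 33);; 26 ::= N 2 \<^bold>* V 33 \<^bold>* V 8)"

definition monte_carlo :: "nat \<Rightarrow> nat \<Rightarrow> nat \<Rightarrow> hcom" where
  "monte_carlo s c N\<^sub>0 = (IF V 0 \<^bold>< N N\<^sub>0 THEN SKIP ELSE (hash_setup s;; pick_modulus c;; build))"

text \<open>A prime has at most \<open>2 * L\<close> bits, so residues modulo a product of
  \<open>c\<close> primes fit into \<open>2 * c\<close> digits of \<open>L\<close> bits, the number
  of passes given to the radix sort.\<close>

definition las_vegas_loop :: "nat \<Rightarrow> hcom" where
  "las_vegas_loop c = (WHILE V 44 \<^bold>= N 0 DO ((pick_modulus c;; build);; verify (2 * c)))"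

definition las_vegas :: "nat \<Rightarrow> nat \<Rightarrow> nat \<Rightarrow> hcom" where
  "las_vegas s c N\<^sub>0 = (IF V 0 \<^bold>< N N\<^sub>0 THEN SKIP
     ELSE (hash_setup s;; 44 ::= N 0;; las_vegas_loop c))"

text \<open>Half of the bits of a prime, rounded up, so that trial divisors up to
  \<open>2 ^ root_bits L\<close> suffice.\<close>

definition root_bits :: "nat \<Rightarrow> nat" where
  "root_bits L = (prime_bits L + 1) div 2"

definition prime_cost :: "nat \<Rightarrow> nat" where
  "prime_cost L = tries L * (200 + 50 * 2 ^ root_bits L)"

text \<open>A prime costs \<open>O(L ^ 2)\<close> tries of about \<open>2 powr (3 * L / 4)\<close>
  divisions each, which is of smaller order than \<open>2 ^ L\<close>; boundedness of the null
  sequence \<open>h\<close> yields the constant.\<close>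

lemma prime_cost_linear: "\<exists>A. \<forall>L\<ge>1. prime_cost L \<le> A * 2 ^ L"
proof -
  define h where "h = (\<lambda>L::nat. 4 * real L ^ 2 * (200 + 50 * 2 powr (3 * real L / 4 + 1 / 2)) / 2 powr real L)"
  have "h \<longlonglongrightarrow> 0" unfolding h_def by real_asymp
  then have "Bseq h" by (rule convergent_imp_Bseq[OF convergentI])
  then obtain A where A: "\<And>L. norm (h L) \<le> A" by (meson BseqE)
  have "prime_cost L \<le> nat \<lceil>A\<rceil> * 2 ^ L" if "1 \<le> L" for L
  proof -
    have "tries L \<le> 2 * (2 * L) * L" unfolding tries_def prime_bits_def by (intro mult_le_mono) auto
    then have "real (tries L) \<le> real (4 * L ^ 2)" by (simp add: power2_eq_square flip: of_nat_mult)
    moreover have "(2::real) ^ root_bits L \<le> 2 powr (3 * real L / 4 + 1 / 2)"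
    proof -
      have "4 * root_bits L \<le> 3 * L + 2" unfolding root_bits_def prime_bits_def by presburger
      then have "real (4 * root_bits L) \<le> real (3 * L + 2)" by (simp only: of_nat_le_iff)
      then have "real (root_bits L) \<le> 3 * real L / 4 + 1 / 2" by simp
      then have "2 powr real (root_bits L) \<le> 2 powr (3 * real L / 4 + 1 / 2)" by (intro powr_mono) auto
      then show ?thesis by (simp add: powr_realpow)
    qed
    ultimately have "real (prime_cost L) \<le> h L * 2 powr real L"
      unfolding prime_cost_def h_def by (auto intro!: mult_mono)
    also have "\<dots> \<le> real (nat \<lceil>A\<rceil>) * 2 powr real L"
      using A[of L] by (intro mult_right_mono) (auto simp: abs_le_iff intro: order_trans real_nat_ceiling_ge)
    also have "\<dots> = real (nat \<lceil>A\<rceil> * 2 ^ L)" by (simp add: powr_realpow)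
    finally show ?thesis by (simp only: of_nat_le_iff)
  qed
  then show ?thesis by blast
qed

text \<open>The summands of \<open>\<kappa>\<close> pay for the overflow conditions:
  \<open>4 * c\<close> for products of two residues, \<open>s\<close> for the factor
  \<open>B\<close>, \<open>N\<^sub>0\<close> for the threshold as a program constant, and 30 for
  constant factors and the minimal word size.\<close>

locale fp_params =
  fixes T :: "nat list" and \<tau> s c N\<^sub>0 \<kappa> w L :: nat
  assumes T: "T \<in> texts s" and \<tau>: "1 \<le> \<tau>" "\<tau> \<le> length T"
    and w: "w = \<kappa> * L" "L = floorlog 2 (length T)" and \<kappa>: "\<kappa> = 4 * c + s + N\<^sub>0 + 30"
begin

abbreviation n :: nat where "n \<equiv> length T"
abbreviation B :: nat where "B \<equiv> 2 ^ (s * L)"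

lemma n: "1 \<le> n" "n < 2 ^ L" "2 ^ L \<le> 2 * n" "1 \<le> L"
proof -
  show "1 \<le> n" using \<tau> by simp
  then have "n \<noteq> 0" by linarith
  then have L: "L \<noteq> 0" using w by (simp add: floorlog_eq_zero_iff)
  then show "1 \<le> L" by linarith
  have b: "2 ^ (L - 1) \<le> n" "n < 2 ^ L" using floorlog_bounds[of n 2] \<open>n \<noteq> 0\<close> w by auto
  then show "n < 2 ^ L" by simp
  have "(2::nat) ^ L = 2 * 2 ^ (L - 1)" using L by (simp add: power_eq_if)
  with b show "2 ^ L \<le> 2 * n" by simp
qed

text \<open>As \<open>L \<ge> 1\<close>, each unit of \<open>\<kappa>\<close> is worth at least one
  bit, so 20 units accommodate the factor \<open>k < 2 ^ 20\<close>.\<close>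

lemma fits: "(k::nat) < 2 ^ 20 \<Longrightarrow> j + 20 \<le> \<kappa> \<Longrightarrow> k * 2 ^ (j * L) < 2 ^ w"
proof -
  assume k: "k < 2 ^ 20" and j: "j + 20 \<le> \<kappa>"
  have "20 + j * L \<le> (j + 20) * L" using n(4) by (simp add: algebra_simps)
  also have "\<dots> \<le> w" unfolding w(1) using j by (rule mult_le_mono1)
  finally have "(2::nat) ^ (20 + j * L) \<le> 2 ^ w" by (rule power_increasing) simp
  moreover have "k * 2 ^ (j * L) < 2 ^ 20 * 2 ^ (j * L)" using k by (rule mult_less_mono1) simp
  ultimately show ?thesis unfolding power_add by (rule less_le_trans[rotated])
qed

lemma fits_L: "(k::nat) < 2 ^ 20 \<Longrightarrow> k * 2 ^ L < 2 ^ w"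
  using fits[of k 1] \<kappa> by simp

lemma \<kappa>_le_w: "\<kappa> \<le> w"
  using mult_le_mono2[OF n(4), of \<kappa>] w(1) by simp

lemma param_fits: "x \<le> \<kappa> \<Longrightarrow> x < 2 ^ w"
  using less_exp[of w] \<kappa>_le_w by linarith

lemma w10: "10 \<le> w"
  using \<kappa>_le_w \<kappa> by simp

lemma machine: "8 * S < 2 ^ w \<Longrightarrow> machine w T 8 S"
proof unfold_locales
  have "1 * 2 ^ L < (2::nat) ^ w" by (rule fits_L) simp
  then show "n < 2 ^ w" using n(2) by linarith
qed (use w10 in auto)

lemma letters: "set T \<subseteq> {..<B}"
  using T w(2) by (simp add: texts_def)

lemma hashing:
  assumes "0 < q" "q \<le> 2 ^ (2 * c * L)" "0 < t" "t \<le> n + 1" "n div t + 3 \<le> S" "8 * S < 2 ^ w"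
  shows "hashing w T 8 S B q t"
proof -
  interpret machine w T 8 S by (rule machine[OF assms(6)])
  show ?thesis
  proof
    show "set T \<subseteq> {..<B}" by (rule letters)
    have "q * B \<le> 2 ^ (2 * c * L) * 2 ^ (s * L)" using assms(2) by (rule mult_le_mono1)
    then have "q * B \<le> 2 ^ ((2 * c + s) * L)" by (simp add: algebra_simps power_add)
    moreover have "(2::nat) * 2 ^ ((2 * c + s) * L) < 2 ^ w" by (rule fits) (simp_all add: \<kappa>)
    moreover have "B \<le> q * B" using assms(1) by simp
    ultimately show "q * B + B < 2 ^ w" by linarith
    have "q * q \<le> 2 ^ (2 * c * L) * 2 ^ (2 * c * L)" using assms(2) by (intro mult_le_mono)
    then have "q * q \<le> 2 ^ ((4 * c) * L)" by (simp add: algebra_simps flip: power_add)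
    moreover have "(2::nat) * 2 ^ ((4 * c) * L) < 2 ^ w" by (rule fits) (simp_all add: \<kappa>)
    moreover have "q \<le> q * q" using assms(1) by simp
    ultimately show "q * q + q < 2 ^ w" by linarith
    show "4 * n + 4 * t + 4 < 2 ^ w" using assms(4) n fits_L[of 16] by simp
  qed (use assms in auto)
qed

definition ready :: "nat \<Rightarrow> (nat \<Rightarrow> nat) \<Rightarrow> bool" where
  "ready t f \<longleftrightarrow> f 4 = n \<and> f 5 = t \<and> f 7 = B \<and> f 8 = L \<and> f 9 = 2 ^ prime_bits L \<and> f 26 = tries L"

lemma root: "root_bits L \<le> L" "prime_bits L \<le> 2 * root_bits L" "prime_bits L \<le> 2 * L"
  using n(4) unfolding root_bits_def prime_bits_def by presburger+

lemma tries_le: "tries L \<le> 4 * 2 ^ (2 * L)"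
proof -
  have "tries L \<le> 2 * (2 * L) * L" unfolding tries_def using root by (intro mult_le_mono) auto
  also have "\<dots> = 4 * (L * L)" by simp
  also have "\<dots> \<le> 4 * (2 ^ L * 2 ^ L)" using less_exp[of L] by (intro mult_le_mono) auto
  finally show ?thesis by (simp add: mult_2 power_add)
qed

lemma wp_hash_setup:
  assumes S: "8 * S < 2 ^ w" and v: "vars \<sigma> 0 = n" "vars \<sigma> 1 = \<tau>"
    and Q: "\<And>f a c'. 2 ^ a \<le> \<tau> \<Longrightarrow> \<tau> < 2 * 2 ^ a \<Longrightarrow> ready (2 ^ a) f \<Longrightarrow>
      c' \<le> clk \<sigma> + 200 + 50 * L + 30 * \<tau> \<Longrightarrow> Q (\<sigma>\<lparr>vars := f, clk := c'\<rparr>)"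
  shows "machine.wp w T 8 S (hash_setup s) Q \<sigma>"
proof -
  interpret machine w T 8 S by (rule machine[OF S])
  have nw: "n < 2 ^ w" by (rule text_fits)
  have sL: "s * L < 2 ^ w" "L + L div 2 < 2 ^ w" "2 * (L + L div 2) < 2 ^ w"
  proof -
    have "s * L \<le> \<kappa> * L" using \<kappa> by (intro mult_le_mono1) simp
    then show "s * L < 2 ^ w" using less_exp[of w] w(1) by linarith
    have "4 * L \<le> \<kappa> * L" using \<kappa> by (intro mult_le_mono1) simp
    then have "4 * L < 2 ^ w" using less_exp[of w] w(1) by linarith
    moreover have "2 * (L + L div 2) \<le> 2 * (2 * L)" using root(3) by (intro mult_le_mono2) (simp add: prime_bits_def)
    ultimately show "2 * (L + L div 2) < 2 ^ w" by linarith
    then show "L + L div 2 < 2 ^ w" by (rule le_less_trans[rotated]) simp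
  qed
  have B': "B < 2 ^ w" using fits[of 1 s] \<kappa> by simp
  have k: "2 ^ (L + L div 2) < (2::nat) ^ w"
  proof -
    have "(2::nat) ^ (L + L div 2) \<le> 2 ^ (2 * L)" using root by (intro power_increasing) (auto simp: prime_bits_def)
    then show ?thesis using fits[of 1 2] \<kappa> by simp
  qed
  have tr: "2 * (L + L div 2) * L < 2 ^ w"
    using tries_le fits[of 4 2] \<kappa> by (simp add: tries_def prime_bits_def)
  show ?thesis
    unfolding hash_setup_def
    apply (simp add: wp_simps)
    apply (rule wp_bitlength)
    subgoal using nw v by simp
    apply (simp add: wp_simps v w(2)[symmetric])
    apply (rule wp_power_below)
    subgoal using \<tau> v by simp
    subgoal using \<tau> v n fits_L[of 4] by simp
    subgoal for c1 a c2
      using sL B' k tr param_fits[of s] \<kappa>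
      apply (simp add: wp_simps v)
      apply (rule Q[of a])
         apply (simp_all add: ready_def prime_bits_def tries_def)
      done
    done
qed

definition fp_modulus :: "nat list \<Rightarrow> nat" where
  "fp_modulus us = modulus (2 ^ prime_bits L) (tries L) c us"

lemma fp_modulus: "0 < fp_modulus us" "fp_modulus us \<le> 2 ^ (2 * c * L)"
proof -
  have *: "1 \<le> fp_modulus us \<and> fp_modulus us \<le> (2 ^ prime_bits L) ^ c"
    unfolding fp_modulus_def by (rule modulus_bounds) simp
  then show "0 < fp_modulus us" by linarith
  have "prime_bits L * c \<le> (2 * L) * c" using root by (intro mult_le_mono1)
  then have "(2::nat) ^ (prime_bits L * c) \<le> 2 ^ (2 * c * L)" by (intro power_increasing) (simp_all add: algebra_simps)
  with * show "fp_modulus us \<le> 2 ^ (2 * c * L)" by (simp add: power_mult)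
qed

lemma wp_pick_build:
  assumes S: "8 * S < 2 ^ w" "n div t + 3 \<le> S" and t: "0 < t" "t \<le> \<tau>"
    and v: "ready t (vars \<sigma>)" "tape \<sigma> = us @ ws" "length us = tries L * c"
    and Q: "\<And>f A c'. agree ({20..25} \<union> {6} \<union> {30..32}) (vars \<sigma>) f \<Longrightarrow> f 6 = fp_modulus us \<Longrightarrow>
      hashing.hash_table T B (fp_modulus us) t A \<Longrightarrow> c' \<le> clk \<sigma> + 300 + c * (100 + prime_cost L) + 200 * n \<Longrightarrow>
      Q (\<sigma>\<lparr>vars := f, arrs := A, tape := ws, clk := c'\<rparr>)"
  shows "machine.wp w T 8 S (pick_modulus c) (machine.wp w T 8 S build Q) \<sigma>"
proof -
  interpret hashing w T 8 S B "fp_modulus us" t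
    using fp_modulus S t \<tau> by (intro hashing) auto
  note vv = v(1)[unfolded ready_def]
  have D: "2 ^ prime_bits L \<le> 2 ^ root_bits L * (2::nat) ^ root_bits L"
    unfolding power_add[symmetric] using root by (intro power_increasing) auto
  have D2: "(2 ^ root_bits L + 2) * (2 ^ root_bits L + 2) < (2::nat) ^ w"
  proof -
    have "(2::nat) ^ root_bits L \<le> 2 ^ L" using root by (intro power_increasing) auto
    moreover have "(2::nat) \<le> 2 * 2 ^ L" by simp
    ultimately have "2 ^ root_bits L + 2 \<le> 3 * (2::nat) ^ L" by linarith
    then have "(2 ^ root_bits L + 2) * (2 ^ root_bits L + 2) \<le> (3 * (2::nat) ^ L) * (3 * 2 ^ L)"
      by (intro mult_le_mono)
    also have "\<dots> = 9 * 2 ^ (2 * L)" by (simp add: mult_2 power_add)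
    also have "\<dots> < 2 ^ w" by (rule fits) (simp_all add: \<kappa>)
    finally show ?thesis .
  qed
  have tf: "tries L < 2 ^ w" using tries_le fits[of 4 2] \<kappa> by simp
  have Mc: "(2 ^ prime_bits L) ^ c < (2::nat) ^ w"
  proof -
    have "prime_bits L * c \<le> (2 * c) * L" using mult_le_mono1[OF root(3), of c] by (simp add: algebra_simps)
    then have "(2::nat) ^ (prime_bits L * c) \<le> 2 ^ ((2 * c) * L)" by (intro power_increasing) auto
    also have "\<dots> < 2 ^ w" using fits[of 1 "2 * c"] \<kappa> by simp
    finally show ?thesis by (simp add: power_mult)
  qed
  show ?thesis
    apply (rule wp_pick_modulus[where M = "2 ^ prime_bits L" and R = "tries L" and us = us and ws = ws and D = "2 ^ root_bits L"])
    using v vv D D2 tf Mc param_fits[of c] \<kappa> apply simp_all[10]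
    subgoal premises p for f c1
    proof -
      note ag = agreeD[OF p(1)]
      show ?thesis
        apply (rule wp_build)
        using p(2) vv apply (simp_all add: ag fp_modulus_def)[4]
        subgoal premises q for f' A c2
        proof -
          have "agree ({20..25} \<union> {6} \<union> {30..32}) (vars \<sigma>) f'"
            using q(1) p(1) by (auto simp: agree_def)
          moreover have "f' 6 = fp_modulus us" using q(1) p(2) by (simp add: agree_def fp_modulus_def)
          moreover have "c2 \<le> clk \<sigma> + 300 + c * (100 + prime_cost L) + 200 * n"
            using q(4) p(3) by (simp add: prime_cost_def)
          ultimately have "Q (\<sigma>\<lparr>vars := f', arrs := A, tape := ws, clk := c2\<rparr>)" using Q q(3) by blast
          then show ?thesis by (cases \<sigma>) simp
        qed
        done
    qed
    done
qed

text \<open>Rounding \<open>\<tau>\<close> down to a power of two loses less than a factor 2, so the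
  number of samples at most about doubles.\<close>

lemma div_sampling: "\<tau> < 2 * t \<Longrightarrow> n div t \<le> 2 * (n div \<tau>) + 1"
proof -
  assume t: "\<tau> < 2 * t"
  have "n < (n div \<tau> + 1) * \<tau>" using \<tau> dividend_less_div_times[of \<tau> n] by (simp add: algebra_simps)
  also have "\<dots> \<le> (n div \<tau> + 1) * (2 * t)" using t by (intro mult_le_mono2) simp
  finally have "n div t < 2 * (n div \<tau> + 1)"
    by (intro less_mult_imp_div_less) (simp add: algebra_simps)
  then show ?thesis by simp
qed

definition table_ok :: "nat \<Rightarrow> (nat \<Rightarrow> nat \<Rightarrow> nat) \<Rightarrow> bool" where
  "table_ok q A \<longleftrightarrow> n < N\<^sub>0 \<or> (\<exists>a. 2 ^ a \<le> \<tau> \<and> \<tau> < 2 * 2 ^ a \<and> hashing.hash_table T B q (2 ^ a) A)"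

lemma wp_monte_carlo:
  assumes S: "8 * S < 2 ^ w" "2 * (n div \<tau>) + 5 \<le> S"
    and v: "vars \<sigma> 0 = n" "vars \<sigma> 1 = \<tau>" "tape \<sigma> = us @ ws" "length us = tries L * c"
  shows "machine.wp w T 8 S (monte_carlo s c N\<^sub>0) (\<lambda>\<sigma>'. table_ok (fp_modulus us) (arrs \<sigma>') \<and>
    clk \<sigma>' \<le> clk \<sigma> + 600 + 50 * L + 230 * n + c * (100 + prime_cost L)) \<sigma>"
proof -
  interpret machine w T 8 S by (rule machine[OF S(1)])
  show ?thesis
  proof (cases "n < N\<^sub>0")
    case True
    then show ?thesis
      unfolding monte_carlo_def using param_fits[of "N\<^sub>0"] \<kappa> by (simp add: wp_simps v table_ok_def)
  next
    case False
    have N: "N\<^sub>0 < 2 ^ w" using param_fits[of "N\<^sub>0"] \<kappa> by simp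
    show ?thesis
      unfolding monte_carlo_def
      apply (simp add: wp_simps v N False)
      apply (rule wp_hash_setup[OF S(1)])
      using v apply simp_all[2]
      subgoal premises p for f a c1
      proof -
        have St: "n div 2 ^ a + 3 \<le> S"
          using div_sampling[OF p(2)] S(2) by linarith
        show ?thesis
          apply (simp add: wp_simps)
          apply (rule wp_pick_build[OF S(1) St, of _ us ws])
          using p v apply simp_all[5]
          subgoal premises q for f' A c'
            using p q \<tau> by (auto simp: table_ok_def)
          done
      qed
      done
  qed
qed

definition verified :: "nat \<Rightarrow> (nat \<Rightarrow> nat \<Rightarrow> nat) \<Rightarrow> bool" where
  "verified t A \<longleftrightarrow> (\<exists>q. 0 < q \<and> q \<le> 2 ^ (2 * c * L) \<and> hashing.hash_table T B q t A \<and>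
     hashing.faithful T B q t)"

definition attempt_time :: nat where
  "attempt_time = 700 + c * (100 + prime_cost L) + 300 * n + L * (2 * c + 3) * (1000 + 700 * 2 ^ L)"

definition chunk :: "nat \<Rightarrow> nat list \<Rightarrow> nat list" where
  "chunk i us = take (tries L * c) (drop (i * (tries L * c)) us)"

text \<open>Termination is claimed only for tapes with a collision-free modulus among the first
  \<open>m\<close> attempts, each consuming one chunk. The loop may stop earlier with another
  modulus; that one has then passed all levels, and this is all that \<open>verified\<close>
  asserts.\<close>

lemma wp_las_vegas_loop:
  assumes S: "8 * S < 2 ^ w" "2 * 2 ^ L + 5 \<le> S" and t: "t = 2 ^ a" "t \<le> \<tau>" "n div t + 3 \<le> S"
    and v: "ready t (vars \<sigma>)" "vars \<sigma> 44 = 0" "tape \<sigma> = us" "m * (tries L * c) \<le> length us"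
    and good: "\<exists>i<m. collision_free B T (fp_modulus (chunk i us))"
  shows "machine.wp w T 8 S (las_vegas_loop c) (\<lambda>\<sigma>'. verified t (arrs \<sigma>') \<and>
    clk \<sigma>' \<le> clk \<sigma> + 50 + m * attempt_time) \<sigma>"
  using v good
proof (induction m arbitrary: \<sigma> us)
  case (Suc m)
  interpret machine w T 8 S by (rule machine[OF S(1)])
  define xs where "xs = take (tries L * c) us"
  define ws where "ws = drop (tries L * c) us"
  have us: "us = xs @ ws" "length xs = tries L * c" "m * (tries L * c) \<le> length ws"
    using Suc.prems(4) by (auto simp: xs_def ws_def)
  have xs: "chunk 0 us = xs" "\<And>i. chunk (Suc i) us = chunk i ws"
    by (simp_all add: chunk_def xs_def ws_def add.commute)
  interpret hashing w T 8 S B "fp_modulus xs" t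
    using fp_modulus S t \<tau> by (intro hashing) auto
  have W: "2 ^ L < S" "(2::nat) ^ L + 1 < 2 ^ w" "2 * c < 2 ^ w" "L * (2 * c) < 2 ^ w"
    "fp_modulus xs \<le> (2 ^ L) ^ (2 * c)"
  proof -
    show "2 ^ L < S" using S(2) by simp
    have "2 * 2 ^ L < (2::nat) ^ w" by (rule fits_L) simp
    moreover have "1 < (2::nat) ^ L" using n(4) by simp
    ultimately show "(2::nat) ^ L + 1 < 2 ^ w" by linarith
    show "2 * c < 2 ^ w" using param_fits[of "2 * c"] \<kappa> by simp
    have "L * (2 * c) \<le> \<kappa> * L" using \<kappa> mult_le_mono1[of "2 * c" \<kappa> L] by (simp add: mult.commute)
    then show "L * (2 * c) < 2 ^ w" using less_exp[of w] w(1) by linarith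
    show "fp_modulus xs \<le> (2 ^ L) ^ (2 * c)" using fp_modulus(2)[of xs] by (simp add: ac_simps flip: power_mult)
  qed
  have vv: "vars \<sigma> 4 = n" "vars \<sigma> 7 = B" "vars \<sigma> 8 = L" "vars \<sigma> 5 = t"
    using Suc.prems(1) by (auto simp: ready_def)
  show ?case
    unfolding las_vegas_loop_def
    apply (rule wp_while_unfold)
      apply simp
    subgoal
      apply (simp add: wp_simps)
      apply (thin_tac "_ = _")
      apply (rule wp_pick_build[OF S(1) t(3) _ t(2), of _ xs ws])
      using t(1) Suc.prems us apply simp_all[4]
      subgoal premises p for f A c1
      proof -
        note ag = agreeD[OF p(1)[simplified]]
        show ?thesis
          apply (rule wp_verify[where L = L])
          using vv p(2) n(2) W apply (simp_all add: ag)[11]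
          subgoal premises q for f' A' c2
          proof -
            have f'4: "agree ({20..25} \<union> {6} \<union> {30..32} \<union> {40..54}) (vars \<sigma>) f'"
              using q(1) p(1) by (auto simp: agree_def)
            note ag' = agreeD[OF f'4]
            have ck: "c2 \<le> clk \<sigma> + attempt_time - 40" "40 \<le> attempt_time"
              using q(4) p(4) by (simp_all add: attempt_time_def)
            have ht: "hash_table A'" using p(3) q(2) by (simp add: hash_table_def agree_def)
            show ?thesis
            proof (cases "\<forall>e. level_ok e")
              case True
              have "faithful"
                unfolding faithful_def
              proof (intro allI impI, unfold t(1))
                fix x y e assume "fp_eq x y (2 ^ a * 2 ^ e)"
                then show "matches T x y (2 ^ a * 2 ^ e)"
                  using True[rule_format, of "a + e"] unfolding level_ok_def power_add by blast
              qed
              then have "verified t A'"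
                using ht fp_modulus unfolding verified_def by blast
              then show ?thesis
                apply (intro wp_while_unfold)
                  apply simp
                using True q(3) ck
                 apply simp_all
                done
            next
              case False
              have "\<not> collision_free B T (fp_modulus (chunk 0 us))"
              proof
                assume "collision_free B T (fp_modulus (chunk 0 us))"
                then have "level_ok e" for e
                  unfolding level_ok_def collision_free_def xs by blast
                with False show False by blast
              qed
              then have "\<exists>i<m. collision_free B T (fp_modulus (chunk i ws))"
                using Suc.prems(5) xs(2) by (metis less_Suc_eq_0_disj)
              moreover have "ready t f'" using Suc.prems(1) unfolding ready_def by (simp add: ag')
              ultimately show ?thesis
                apply (intro wp_mono[OF Suc.IH[of _ ws, unfolded las_vegas_loop_def]])
                using us(3) False q(3) ck
                     apply simp_all
                apply linarith
                done
            qed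
          qed
          done
      qed
      done
    subgoal using Suc.prems(2) by simp
    done
qed simp

end

section \<open>From the structured language to the word RAM\<close>

lemma dstep_rand_free:
  assumes "\<forall>x\<in>set (fst c). rand_free x"
  shows "\<exists>c'. step w T c = return_pmf c' \<and> (\<forall>us. dstep w T (c, us) = (c', us)) \<and> (\<forall>x\<in>set (fst c'). rand_free x)"
proof -
  obtain c' where c': "step w T c = return_pmf c'" "\<forall>x\<in>set (fst c'). rand_free x"
    using assms by (cases "(w, T, c)" rule: step.cases) auto
  have "rand_reg c = None" using assms by (cases c rule: rand_reg.cases) auto
  with c' show ?thesis by (auto simp: dstep_def)
qed

lemma run_rand_free:
  "\<forall>x\<in>set (fst c). rand_free x \<Longrightarrow> run w T t c = return_pmf (fst ((dstep w T ^^ t) (c, [])))"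
proof (induction t arbitrary: c)
  case (Suc t)
  from dstep_rand_free[OF Suc.prems, of w T] obtain c' where
    c': "step w T c = return_pmf c'" "\<forall>us. dstep w T (c, us) = (c', us)" "\<forall>x\<in>set (fst c'). rand_free x"
    by blast
  then show ?case
    unfolding run_Suc dstep_pow_Suc using Suc.IH by (simp add: bind_return_pmf)
qed simp

definition init :: "nat list \<Rightarrow> (nat \<Rightarrow> nat \<Rightarrow> nat) \<Rightarrow> nat list \<Rightarrow> st" where
  "init args A us = \<lparr>vars = (\<lambda>x. if x < length args then args ! x else 0), arrs = A, tape = us, clk = 0\<rparr>"

text \<open>The memory may be longer than the part used by the arrays; the surplus cells are
  described by the same table, so that an unchanged table means an unchanged memory.\<close>

definition layout :: "nat \<Rightarrow> nat \<Rightarrow> (nat \<Rightarrow> nat \<Rightarrow> nat) \<Rightarrow> nat list" where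
  "layout K m A = map (\<lambda>x. A (x mod K) (x div K)) [0..<m]"

lemma layout_zero: "layout K m (\<lambda>_ _. 0) = replicate m 0"
  by (auto simp: layout_def intro: nth_equalityI)

lemma take_layout: "k \<le> m \<Longrightarrow> take k (layout K m A) = layout K k A"
  by (simp add: layout_def take_map)

context machine
begin

lemma wp_start:
  assumes "wp p Q (init args A us)" "K * S \<le> m" "\<And>\<sigma>'. Q \<sigma>' \<Longrightarrow> clk \<sigma>' \<le> t"
  shows "\<exists>\<sigma>' s'. Q \<sigma>' \<and> (dstep w T ^^ t) (start (compile K p) args (layout K m A), us) = (([], s'), tape \<sigma>') \<and>
    regs s' 0 = vars \<sigma>' 0 \<and> mem s' = layout K m (arrs \<sigma>')"
proof -
  let ?s = "\<lparr>regs = (\<lambda>x. if x < length args then args ! x else 0), mem = layout K m A\<rparr>"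
  have "rel m (init args A us) (?s, us)" by (simp add: rel_def init_def layout_def)
  from wp_run[OF assms(1,2) this] obtain \<sigma>' s' where
    *: "Q \<sigma>'" "rel m \<sigma>' (s', tape \<sigma>')"
    "\<forall>t \<ge> clk \<sigma>' - clk (init args A us). (dstep w T ^^ t) (([compile K p], ?s), us) = (([], s'), tape \<sigma>')" by blast
  have "clk \<sigma>' - clk (init args A us) \<le> t" using assms(3)[OF *(1)] by simp
  with * show ?thesis
    by (intro exI[of _ \<sigma>'] exI[of _ s']) (auto simp: start_def rel_def layout_def)
qed

lemma wp_answers:
  assumes "wp p (\<lambda>\<sigma>'. vars \<sigma>' 0 = r \<and> arrs \<sigma>' = A \<and> clk \<sigma>' \<le> t) (init [length T, \<tau>, i, j] A [])"
    and "K * S \<le> m" "rand_free (compile K p)"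
  shows "answers w T \<tau> (compile K p) (layout K m A) i j t r"
proof -
  from wp_start[OF assms(1,2), of t] obtain s' us' where
    "(dstep w T ^^ t) (start (compile K p) [length T, \<tau>, i, j] (layout K m A), []) = (([], s'), us')"
    "regs s' 0 = r" "mem s' = layout K m A" by auto
  moreover have "\<forall>x\<in>set (fst (start (compile K p) [length T, \<tau>, i, j] (layout K m A))). rand_free x"
    using assms(3) by (simp add: start_def)
  ultimately show ?thesis
    unfolding answers_def by (subst run_rand_free) (simp_all add: halted_def memory_def)
qed

end

text \<open>For \<open>E \<ge> 2\<close> the hypotheses give
  \<open>2 ^ (E - 2) \<le> r / \<tau>\<close>: of the slack 4, one factor 2 absorbs the summand
  \<open>t\<close> and the other the rounding of \<open>\<tau>\<close> to \<open>t\<close>. Smaller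
  \<open>E\<close> are covered by the lower bound 1 on \<open>lg\<close>.\<close>

lemma query_time:
  fixes t \<tau> E r :: nat
  assumes "t \<le> \<tau>" "\<tau> < 2 * t" "t * 2 ^ E \<le> r + t"
  shows "real (300 + 200 * t + (2 * E + 2) * (600 + 200 * t)) \<le> 7000 * (real \<tau> * lg (r / \<tau>))"
proof -
  have \<tau>: "1 \<le> \<tau>" "0 < t" using assms by auto
  have lg1: "1 \<le> lg (r / \<tau>)" by (simp add: lg_def)
  have E: "real E + 1 \<le> 4 * lg (r / \<tau>)"
  proof (cases "E < 2")
    case True
    then show ?thesis using lg1 by simp
  next
    case False
    then have e: "(2::nat) ^ E = 4 * 2 ^ (E - 2)"
      using power_add[of "2::nat" 2 "E - 2"] by simp
    have "t * 1 \<le> t * 2 ^ (E - 2)" by (intro mult_le_mono2) simp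
    moreover have "t * 2 ^ E = 4 * (t * 2 ^ (E - 2))" unfolding e by simp
    ultimately have "2 * (t * 2 ^ (E - 2)) \<le> r" using assms(3) by linarith
    then have "2 * t * 2 ^ (E - 2) \<le> r" by simp
    moreover have "\<tau> * 2 ^ (E - 2) \<le> 2 * t * 2 ^ (E - 2)" using assms(2) by (intro mult_le_mono1) simp
    ultimately have "\<tau> * 2 ^ (E - 2) \<le> r" by linarith
    then have "real (\<tau> * 2 ^ (E - 2)) \<le> real r" by (simp only: of_nat_le_iff)
    then have "2 ^ (E - 2) \<le> r / \<tau>" using \<tau> by (simp add: field_simps)
    then have "log 2 (2 ^ (E - 2)) \<le> log 2 (r / \<tau>)" by (intro log_mono) auto
    then have "real (E - 2) \<le> lg (r / \<tau>)" by (simp add: lg_def)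
    then show ?thesis using lg1 False by (simp add: of_nat_diff)
  qed
  have "real (300 + 200 * t + (2 * E + 2) * (600 + 200 * t)) \<le> 500 * real \<tau> + 1600 * real \<tau> * (real E + 1)"
  proof -
    have "300 + 200 * t \<le> 500 * \<tau>" "600 + 200 * t \<le> 800 * \<tau>" using assms(1) \<tau> by linarith+
    then have "300 + 200 * t + (2 * E + 2) * (600 + 200 * t) \<le> 500 * \<tau> + (2 * E + 2) * (800 * \<tau>)"
      by (intro add_mono mult_le_mono2)
    then have "real (300 + 200 * t + (2 * E + 2) * (600 + 200 * t)) \<le> real (500 * \<tau> + (2 * E + 2) * (800 * \<tau>))"
      by (simp only: of_nat_le_iff)
    then show ?thesis by (simp add: algebra_simps)
  qed
  also have "\<dots> \<le> 500 * real \<tau> * lg (r / \<tau>) + 1600 * real \<tau> * (4 * lg (r / \<tau>))"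
    using lg1 E mult_left_mono[OF lg1, of "500 * real \<tau>"] by (intro add_mono mult_left_mono) auto
  also have "\<dots> \<le> 7000 * (real \<tau> * lg (r / \<tau>))" using lg1 by simp
  finally show ?thesis .
qed

context fp_params
begin

text \<open>The number 7000 comes from \<open>query_time\<close>; the second summand bounds the time
  of a query on a text shorter than \<open>N\<^sub>0\<close>, including the letter loop over the
  whole text.\<close>

definition query_const :: real where
  "query_const = 7000 + 600 * (real N\<^sub>0 + 4)"

lemma space: "8 * (2 * (n div \<tau>) + 5) < 2 ^ w"
proof -
  have "8 * (2 * x + 5) \<le> 16 * 2 ^ L + 40 * 2 ^ L" if "x \<le> n" for x
  proof -
    have "16 * x + 40 \<le> 16 * 2 ^ L + 40 * 2 ^ L" using n that by linarith
    then show ?thesis by simp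
  qed
  from this[OF div_le_dividend] have "8 * (2 * (n div \<tau>) + 5) \<le> 16 * 2 ^ L + 40 * 2 ^ L" .
  also have "\<dots> = 56 * 2 ^ L" by simp
  also have "\<dots> < 2 ^ w" by (rule fits_L) simp
  finally show ?thesis .
qed

lemma wp_query_table:
  assumes v: "vars \<sigma> 0 = n" "vars \<sigma> 2 = a + 1" "vars \<sigma> 3 = b + 1" "a < n" "b < n" "clk \<sigma> = 0"
    and large: "N\<^sub>0 \<le> n \<Longrightarrow> t \<le> \<tau> \<and> \<tau> < 2 * t \<and> 0 < q \<and> q \<le> 2 ^ (2 * c * L) \<and>
      hashing.hash_table T B q t (arrs \<sigma>)"
  shows "machine.wp w T 8 (2 * (n div \<tau>) + 5) (query N\<^sub>0) (\<lambda>\<sigma>'. vars \<sigma>' 0 \<le> n \<and> arrs \<sigma>' = arrs \<sigma> \<and>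
    real (clk \<sigma>') \<le> query_const * (real \<tau> * lg (vars \<sigma>' 0 / \<tau>)) \<and>
    ((N\<^sub>0 \<le> n \<longrightarrow> hashing.faithful T B q t) \<longrightarrow> vars \<sigma>' 0 = lce T a b)) \<sigma>"
proof -
  let ?S = "2 * (n div \<tau>) + 5"
  have q1: "query_const \<ge> 7000" "query_const \<ge> 600 * (real N\<^sub>0 + 4)" by (simp_all add: query_const_def)
  have lg1: "1 \<le> lg (r / \<tau>)" for r :: nat by (simp add: lg_def)
  have \<tau>lg: "1 * 1 \<le> real \<tau> * lg (r / \<tau>)" for r :: nat
    using lg1 \<tau> by (intro mult_mono) auto
  show ?thesis
  proof (cases "N\<^sub>0 \<le> n")
    case True
    note large = large[OF True]
    interpret hashing w T 8 ?S B q t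
      using large \<tau> space div_sampling[of t] by (intro hashing) auto
    show ?thesis
    proof (rule wp_query[OF v(1,2,3,4,5)])
      show "N\<^sub>0 < 2 ^ w" using param_fits[of N\<^sub>0] \<kappa> by simp
      fix f :: "nat \<Rightarrow> nat" and c' E
      assume *: "faithful \<Longrightarrow> f 0 = lce T a b" "f 0 \<le> n" "t * 2 ^ E \<le> f 0 + t"
        "c' \<le> clk \<sigma> + 300 + 200 * t + (2 * E + 2) * (600 + 200 * t)"
      have "real c' \<le> real (300 + 200 * t + (2 * E + 2) * (600 + 200 * t))"
        using *(4) v(6) unfolding of_nat_le_iff by simp
      also have "\<dots> \<le> 7000 * (real \<tau> * lg (f 0 / \<tau>))"
        using large *(3) by (intro query_time) auto
      also have "\<dots> \<le> query_const * (real \<tau> * lg (f 0 / \<tau>))"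
        using q1 \<tau>lg[of "f 0"] by (intro mult_right_mono) auto
      finally have "real c' \<le> query_const * (real \<tau> * lg (f 0 / \<tau>))" .
      with * True show "vars (\<sigma>\<lparr>vars := f, clk := c'\<rparr>) 0 \<le> n \<and> arrs (\<sigma>\<lparr>vars := f, clk := c'\<rparr>) = arrs \<sigma> \<and>
        real (clk (\<sigma>\<lparr>vars := f, clk := c'\<rparr>)) \<le> query_const * (real \<tau> * lg (vars (\<sigma>\<lparr>vars := f, clk := c'\<rparr>) 0 / \<tau>)) \<and>
        ((N\<^sub>0 \<le> n \<longrightarrow> faithful) \<longrightarrow> vars (\<sigma>\<lparr>vars := f, clk := c'\<rparr>) 0 = lce T a b)" by simp
    qed (use True large in auto)
  next
    case False
    interpret hashing w T 8 ?S B 1 "n + 1"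
      using space by (intro hashing) auto
    have "n < (n + 1) * 2 ^ e" for e
    proof -
      have "n < (n + 1) * 1" by simp
      also have "\<dots> \<le> (n + 1) * 2 ^ e" by (intro mult_le_mono2) simp
      finally show ?thesis .
    qed
    then have fth: "faithful" unfolding faithful_def by (meson add_leE leD)
    show ?thesis
    proof (rule wp_query[OF v(1,2,3,4,5)])
      show "N\<^sub>0 < 2 ^ w" using param_fits[of N\<^sub>0] \<kappa> by simp
      fix f :: "nat \<Rightarrow> nat" and c' E
      assume *: "faithful \<Longrightarrow> f 0 = lce T a b" "f 0 \<le> n" "(n + 1) * 2 ^ E \<le> f 0 + (n + 1)"
        "c' \<le> clk \<sigma> + 300 + 200 * (n + 1) + (2 * E + 2) * (600 + 200 * (n + 1))"
      \<comment> \<open>With \<open>n + 1\<close> as sampling step, a successful doubling would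
        force a result of at least \<open>n + 1\<close>.\<close>
      have "E = 0"
      proof (rule ccontr)
        assume "E \<noteq> 0"
        then have "(2::nat) ^ 1 \<le> 2 ^ E" by (intro power_increasing) auto
        then have "(n + 1) * 2 \<le> (n + 1) * 2 ^ E" by (intro mult_le_mono2) simp
        moreover have "(n + 1) * 2 = 2 * n + 2" by simp
        ultimately show False using *(2,3) by linarith
      qed
      then have "c' \<le> 300 + 200 * (n + 1) + 2 * (600 + 200 * (n + 1))" using *(4) v(6) by simp
      also have "\<dots> \<le> 600 * (N\<^sub>0 + 4)" using False by simp
      finally have "real c' \<le> real (600 * (N\<^sub>0 + 4))" by (simp only: of_nat_le_iff)
      then have "real c' \<le> query_const * 1" using q1 by simp
      also have "\<dots> \<le> query_const * (real \<tau> * lg (f 0 / \<tau>))"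
        using q1 \<tau>lg[of "f 0"] by (intro mult_left_mono) auto
      finally have "real c' \<le> query_const * (real \<tau> * lg (f 0 / \<tau>))" .
      with * fth show "vars (\<sigma>\<lparr>vars := f, clk := c'\<rparr>) 0 \<le> n \<and> arrs (\<sigma>\<lparr>vars := f, clk := c'\<rparr>) = arrs \<sigma> \<and>
        real (clk (\<sigma>\<lparr>vars := f, clk := c'\<rparr>)) \<le> query_const * (real \<tau> * lg (vars (\<sigma>\<lparr>vars := f, clk := c'\<rparr>) 0 / \<tau>)) \<and>
        ((N\<^sub>0 \<le> n \<longrightarrow> hashing.faithful T B q t) \<longrightarrow> vars (\<sigma>\<lparr>vars := f, clk := c'\<rparr>) 0 = lce T a b)" by simp
    qed (use False in auto)
  qed
qed

lemma rand_free_query: "rand_free (compile 8 (query N\<^sub>0))"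
  by (simp add: query_def fp_loop_def char_loop_def check_def prefix_hash_def)

definition good_table :: "nat \<Rightarrow> nat \<Rightarrow> (nat \<Rightarrow> nat \<Rightarrow> nat) \<Rightarrow> bool" where
  "good_table q t A \<longleftrightarrow> (N\<^sub>0 \<le> n \<longrightarrow> t \<le> \<tau> \<and> \<tau> < 2 * t \<and> 0 < q \<and> q \<le> 2 ^ (2 * c * L) \<and>
     hashing.hash_table T B q t A)"

abbreviation time :: "real \<Rightarrow> nat \<Rightarrow> nat" where
  "time C l \<equiv> nfloor (C * (real \<tau> * lg (l / \<tau>)))"

lemma time_mono: "0 \<le> C \<Longrightarrow> C \<le> C' \<Longrightarrow> l \<le> l' \<Longrightarrow> time C l \<le> time C' l'"
proof -
  assume C: "0 \<le> C" "C \<le> C'" and l: "l \<le> l'"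
  have "lg (l / \<tau>) \<le> lg (l' / \<tau>)"
  proof (cases "l = 0")
    case False
    then have "log 2 (l / \<tau>) \<le> log 2 (l' / \<tau>)"
      using l \<tau> by (intro log_mono) (auto intro: divide_right_mono)
    then show ?thesis by (simp add: lg_def)
  qed (simp add: lg_def log_def)
  moreover have "0 \<le> lg (l / \<tau>)" by (simp add: lg_def)
  ultimately have "C * (real \<tau> * lg (l / \<tau>)) \<le> C' * (real \<tau> * lg (l' / \<tau>))"
    using C by (intro mult_mono) auto
  then show ?thesis by (intro nat_mono floor_mono)
qed

text \<open>The time bound uses the larger of the returned value \<open>r\<close> and the true
  length, since an erroneous \<open>r\<close> may exceed the extension and the search time follows
  \<open>r\<close>. Under the faithfulness condition both agree.\<close>

lemma answers_query:
  assumes "good_table q t A" "1 \<le> i" "i \<le> n" "1 \<le> j" "j \<le> n"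
    and m: "8 * (2 * (n div \<tau>) + 5) \<le> m" and C: "query_const \<le> C"
  shows "\<exists>r\<le>n. answers w T \<tau> (compile 8 (query N\<^sub>0)) (layout 8 m A) i j (time C (max r (length (LCE T i j)))) r \<and>
     ((N\<^sub>0 \<le> n \<longrightarrow> hashing.faithful T B q t) \<longrightarrow> r = length (LCE T i j))"
proof -
  let ?S = "2 * (n div \<tau>) + 5"
  interpret machine w T 8 ?S by (rule machine[OF space])
  let ?\<sigma> = "init [n, \<tau>, i, j] A []"
  have "wp (query N\<^sub>0) (\<lambda>\<sigma>'. vars \<sigma>' 0 \<le> n \<and> arrs \<sigma>' = arrs ?\<sigma> \<and>
    real (clk \<sigma>') \<le> query_const * (real \<tau> * lg (vars \<sigma>' 0 / \<tau>)) \<and>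
    ((N\<^sub>0 \<le> n \<longrightarrow> hashing.faithful T B q t) \<longrightarrow> vars \<sigma>' 0 = lce T (i - 1) (j - 1))) ?\<sigma>"
    using assms by (intro wp_query_table) (auto simp: init_def good_table_def)
  then obtain \<sigma>' where *: "big (query N\<^sub>0) ?\<sigma> \<sigma>'" "vars \<sigma>' 0 \<le> n" "arrs \<sigma>' = A"
    "real (clk \<sigma>') \<le> query_const * (real \<tau> * lg (vars \<sigma>' 0 / \<tau>))"
    "(N\<^sub>0 \<le> n \<longrightarrow> hashing.faithful T B q t) \<longrightarrow> vars \<sigma>' 0 = lce T (i - 1) (j - 1)"
    unfolding wp_def by (auto simp: init_def)
  have "clk \<sigma>' \<le> time query_const (vars \<sigma>' 0)" using *(4) by linarith
  also have "\<dots> \<le> time C (max (vars \<sigma>' 0) (length (LCE T i j)))"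
    using C by (intro time_mono) (auto simp: query_const_def)
  finally have "clk \<sigma>' \<le> time C (max (vars \<sigma>' 0) (length (LCE T i j)))" .
  then have "answers w T \<tau> (compile 8 (query N\<^sub>0)) (layout 8 m A) i j
      (time C (max (vars \<sigma>' 0) (length (LCE T i j)))) (vars \<sigma>' 0)"
    using * m by (intro wp_answers rand_free_query) (auto simp: wp_def)
  then show ?thesis using *(2,5) by (auto simp: length_LCE)
qed

lemma faithful_if_collision_free:
  assumes "good_table q t A" "collision_free B T q"
  shows "N\<^sub>0 \<le> n \<longrightarrow> hashing.faithful T B q t"
proof
  assume "N\<^sub>0 \<le> n"
  then interpret hashing w T 8 "2 * (n div \<tau>) + 5" B q t
    using assms(1) \<tau> space div_sampling[of t] by (intro hashing) (auto simp: good_table_def)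
  show faithful
    using assms(2) unfolding faithful_def collision_free_def by blast
qed

text \<open>There are eight arrays of length \<open>2 * (n div \<tau>) + 5\<close>; as
  \<open>n / \<tau> \<ge> 1\<close>, the constant is \<open>8 * (2 + 5)\<close>.\<close>

lemma space_le:
  assumes "56 \<le> C"
  shows "8 * (2 * (n div \<tau>) + 5) \<le> nfloor (C * (n / \<tau>))"
proof -
  have 1: "1 \<le> real n / real \<tau>" using \<tau> by simp
  have "real (n div \<tau>) \<le> real n / real \<tau>" by (rule of_nat_div_le_of_nat)
  then have "real (8 * (2 * (n div \<tau>) + 5)) \<le> 56 * (real n / real \<tau>)" using 1 by simp
  also have "\<dots> \<le> C * (real n / real \<tau>)" using assms by (intro mult_right_mono) auto
  finally show ?thesis by linarith
qed

lemma monte_carlo_run: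
  fixes C :: real and A :: nat
  assumes A: "prime_cost L \<le> A * 2 ^ L"
    and C: "56 \<le> C" "1000 + real c * (100 + 2 * A) \<le> C" and us: "tries L * c \<le> length us"
  shows "\<exists>s' us' D t. (dstep w T ^^ nfloor (C * n))
      (start (compile 8 (monte_carlo s c N\<^sub>0)) [n, \<tau>] (replicate (nfloor (C * (n / \<tau>))) 0), us) = (([], s'), us') \<and>
    mem s' = layout 8 (nfloor (C * (n / \<tau>))) D \<and> good_table (fp_modulus (take (tries L * c) us)) t D"
proof -
  let ?us = "take (tries L * c) us" and ?ws = "drop (tries L * c) us"
  interpret machine w T 8 "2 * (n div \<tau>) + 5" by (rule machine[OF space])
  have ck: "clk \<sigma>' \<le> nfloor (C * n)"
    if "clk \<sigma>' \<le> 0 + 600 + 50 * L + 230 * n + c * (100 + prime_cost L)" for \<sigma>' :: st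
  proof -
    have "L \<le> 2 ^ L" using less_exp[of L] by simp
    then have L: "real L \<le> 2 * n" using n(3) by linarith
    have "prime_cost L \<le> A * (2 * n)" using A mult_le_mono2[OF n(3), of A] by linarith
    then have "c * (100 + prime_cost L) \<le> c * (100 * n + A * (2 * n))" using n(1) by (intro mult_le_mono2) linarith
    then have "real (c * (100 + prime_cost L)) \<le> real (c * (100 * n + A * (2 * n)))" by (simp only: of_nat_le_iff)
    also have "\<dots> = real c * (100 + 2 * A) * n" by (simp add: algebra_simps)
    finally have c: "real (c * (100 + prime_cost L)) \<le> real c * (100 + 2 * A) * n" .
    have "600 + 50 * L + 230 * n \<le> 1000 * n" using \<open>L \<le> 2 ^ L\<close> n by linarith
    then have "real (600 + 50 * L + 230 * n) \<le> real (1000 * n)" by (simp only: of_nat_le_iff)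
    moreover have "real (clk \<sigma>') \<le> real (600 + 50 * L + 230 * n) + real (c * (100 + prime_cost L))"
      unfolding of_nat_add[symmetric] of_nat_le_iff using that by simp
    moreover have "(1000 + real c * (100 + 2 * A)) * n = real (1000 * n) + real c * (100 + 2 * A) * n"
      by (simp add: distrib_right)
    ultimately have "real (clk \<sigma>') \<le> (1000 + real c * (100 + 2 * A)) * n"
      using c by linarith
    also have "\<dots> \<le> C * n" using C(2) by (intro mult_right_mono) auto
    finally show ?thesis by linarith
  qed
  have W: "wp (monte_carlo s c N\<^sub>0) (\<lambda>\<sigma>'. table_ok (fp_modulus ?us) (arrs \<sigma>') \<and>
    clk \<sigma>' \<le> 0 + 600 + 50 * L + 230 * n + c * (100 + prime_cost L)) (init [n, \<tau>] (\<lambda>_ _. 0) us)"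
    using us wp_monte_carlo[OF space order.refl, of "init [n, \<tau>] (\<lambda>_ _. 0) us" ?us ?ws] by (simp add: init_def)
  have "\<exists>(\<sigma>'::st) s'. (table_ok (fp_modulus ?us) (arrs \<sigma>') \<and>
      clk \<sigma>' \<le> 0 + 600 + 50 * L + 230 * n + c * (100 + prime_cost L)) \<and>
      (dstep w T ^^ nfloor (C * n)) (start (compile 8 (monte_carlo s c N\<^sub>0)) [n, \<tau>]
        (layout 8 (nfloor (C * (n / \<tau>))) (\<lambda>_ _. 0)), us) = (([], s'), tape \<sigma>') \<and>
      regs s' 0 = vars \<sigma>' 0 \<and> mem s' = layout 8 (nfloor (C * (n / \<tau>))) (arrs \<sigma>')"
    by (rule wp_start[OF W space_le[OF C(1)]]) (use ck in blast)
  then obtain \<sigma>' :: st and s' where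
    *: "table_ok (fp_modulus ?us) (arrs \<sigma>')"
      "(dstep w T ^^ nfloor (C * n)) (start (compile 8 (monte_carlo s c N\<^sub>0)) [n, \<tau>]
        (layout 8 (nfloor (C * (n / \<tau>))) (\<lambda>_ _. 0)), us) = (([], s'), tape \<sigma>')"
      "mem s' = layout 8 (nfloor (C * (n / \<tau>))) (arrs \<sigma>')"
    by blast
  obtain t where "good_table (fp_modulus ?us) t (arrs \<sigma>')"
    using *(1) fp_modulus[of ?us] unfolding table_ok_def good_table_def by (meson not_le)
  then show ?thesis using *(2,3) unfolding layout_zero by blast
qed

end

section \<open>Answers correct with high probability\<close>

lemma prob_take:
  "measure_pmf.prob (words w (m + k)) {us. P (take m us)} = measure_pmf.prob (words w m) {us. P us}"
proof -
  have "words w m = map_pmf (take m) (words w (m + k))"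
  proof -
    have "map_pmf (take m) (words w (m + k)) = bind_pmf (words w m) (\<lambda>xs. bind_pmf (words w k) (\<lambda>ys. return_pmf (take m (xs @ ys))))"
      by (simp add: replicate_pmf_distrib map_pmf_def bind_assoc_pmf bind_return_pmf)
    also have "\<dots> = bind_pmf (words w m) (\<lambda>xs. bind_pmf (words w k) (\<lambda>ys. return_pmf xs))"
      by (intro bind_pmf_cong refl) (auto simp: set_replicate_pmf)
    finally show ?thesis by (simp add: bind_return_pmf')
  qed
  then show ?thesis by (simp add: vimage_def)
qed

text \<open>\<open>N\<^sub>0\<close> turns the asymptotic estimate for one prime into one for all
  texts that are hashed: from this length on, the bit length lies in the range where the estimate
  holds. \<open>A\<close> is the constant in the linear cost of drawing a prime.\<close>

lemma hashing_constants:
  fixes \<gamma> :: real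
  obtains g N\<^sub>0 A :: nat where "\<gamma> \<le> g" "\<forall>L\<ge>1. prime_cost L \<le> A * 2 ^ L"
    "\<And>T. N\<^sub>0 \<le> length T \<Longrightarrow> 2 \<le> floorlog 2 (length T) \<and>
      miss \<sigma> (floorlog 2 (length T)) ^ 8 \<le> 1 / 2 ^ floorlog 2 (length (T::nat list))"
proof -
  obtain L\<^sub>0 where L\<^sub>0: "\<And>L. L\<^sub>0 \<le> L \<Longrightarrow> miss \<sigma> L ^ 8 \<le> 1 / 2 ^ L"
    using eventually_miss_le[of \<sigma>] unfolding eventually_sequentially by blast
  obtain A where A: "\<forall>L\<ge>1. prime_cost L \<le> A * 2 ^ L" using prime_cost_linear by blast
  have "max L\<^sub>0 2 \<le> floorlog 2 n" if "2 ^ max L\<^sub>0 2 \<le> n" for n :: nat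
  proof -
    have "(0::nat) < 2 ^ max L\<^sub>0 2" by simp
    then have "n \<noteq> 0" using that by linarith
    then have "n < 2 ^ floorlog 2 n" using floorlog_bounds[of n 2] by simp
    then have "(2::nat) ^ max L\<^sub>0 2 < 2 ^ floorlog 2 n" using that by linarith
    then show ?thesis by (simp add: power_strict_increasing_iff)
  qed
  then show ?thesis using L\<^sub>0 A
    by (intro that[of "nat \<lceil>\<gamma>\<rceil>" A "2 ^ max L\<^sub>0 2"]) (auto simp: real_nat_ceiling_ge)
qed

lemma monte_carlo_data_structure:
  fixes \<sigma> :: nat and \<gamma> :: real
  shows "\<exists>\<kappa> P Q (C::real). 0 < \<kappa> \<and> \<sigma> \<le> \<kappa> \<and>
        (\<forall>T n \<tau> w. T \<in> texts \<sigma> \<and> n = length T \<and> 1 \<le> \<tau> \<and> \<tau> \<le> n \<and> w = word_bits \<kappa> n \<longrightarrow>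
          (let time = (\<lambda>l::nat. nfloor (C * (\<tau> * lg (l / \<tau>))));
               result = preprocess w T \<tau> P (nfloor (C * (n / \<tau>))) (nfloor (C * n))
           in (\<forall>c \<in> set_pmf result. halted c \<and>
                 (\<forall>i\<in>{1..n}. \<forall>j\<in>{1..n}. \<exists>r\<le>n.
                    answers w T \<tau> Q (memory c) i j (time (max r (length (LCE T i j)))) r)) \<and>
              measure_pmf.prob result
                {c. \<forall>i\<in>{1..n}. \<forall>j\<in>{1..n}.
                   answers w T \<tau> Q (memory c) i j (time (length (LCE T i j))) (length (LCE T i j))}
                \<ge> 1 - 1 / n powr \<gamma>))"
proof -
  obtain g N\<^sub>0 A :: nat where g: "\<gamma> \<le> g" and A: "\<forall>L\<ge>1. prime_cost L \<le> A * 2 ^ L"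
    and N\<^sub>0: "\<And>T. N\<^sub>0 \<le> length T \<Longrightarrow> 2 \<le> floorlog 2 (length T) \<and>
      miss \<sigma> (floorlog 2 (length T)) ^ 8 \<le> 1 / 2 ^ floorlog 2 (length (T::nat list))"
    by (rule hashing_constants[of \<gamma> \<sigma>]) (rule that)
  define c where "c = 8 * (g + 4)"
  define \<kappa> where "\<kappa> = 4 * c + \<sigma> + N\<^sub>0 + 30"
  define P where "P = compile 8 (monte_carlo \<sigma> c N\<^sub>0)"
  define Q where "Q = compile 8 (query N\<^sub>0)"
  define C where "C = 8000 + 600 * (real N\<^sub>0 + 4) + real c * (100 + 2 * A)"
  have *: "(\<forall>x \<in> set_pmf result. halted x \<and>
        (\<forall>i\<in>{1..length T}. \<forall>j\<in>{1..length T}. \<exists>r\<le>length T. answers w T \<tau> Q (memory x) i j (time (max r (length (LCE T i j)))) r)) \<and>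
      measure_pmf.prob result {x. \<forall>i\<in>{1..length T}. \<forall>j\<in>{1..length T}.
        answers w T \<tau> Q (memory x) i j (time (length (LCE T i j))) (length (LCE T i j))} \<ge> 1 - 1 / length T powr \<gamma>"
    if "T \<in> texts \<sigma>" "1 \<le> \<tau>" "\<tau> \<le> length T" "w = word_bits \<kappa> (length T)"
      "time = (\<lambda>l::nat. nfloor (C * (\<tau> * lg (l / \<tau>))))"
      "result = preprocess w T \<tau> P (nfloor (C * (length T / \<tau>))) (nfloor (C * length T))" for T \<tau> w time result
  proof -
    interpret fp_params T \<tau> \<sigma> c N\<^sub>0 \<kappa> w "floorlog 2 (length T)"
      using that by unfold_locales (auto simp: word_bits_def \<kappa>_def)
    let ?L = "floorlog 2 (length T)"
    define R where "R = tries ?L * c"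
    define t where "t = nfloor (C * n)"
    define f where "f = (\<lambda>us. fst ((dstep w T ^^ t) (start P [n, \<tau>] (replicate (nfloor (C * (n / \<tau>))) 0), us)))"
    \<comment> \<open>The tape has \<open>R + t\<close> words: at least \<open>t\<close> to
      represent a run of \<open>t\<close> steps, and at least \<open>R\<close> to express the event
      about the modulus.\<close>
    have result: "result = map_pmf f (words w (R + t))"
      unfolding that(6) preprocess_def f_def t_def by (rule run_words) simp
    have C: "query_const \<le> C" "56 \<le> C" "1000 + real c * (100 + 2 * A) \<le> C"
      by (simp_all add: C_def query_const_def)
    have run: "halted (f us) \<and> (\<exists>t D. memory (f us) = layout 8 (nfloor (C * (n / \<tau>))) D \<and>
        good_table (fp_modulus (take R us)) t D)" if "us \<in> set_pmf (words w (R + t))" for us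
    proof -
      have "R \<le> length us" using that by (simp add: set_replicate_pmf)
      then obtain s' us' D u where "(dstep w T ^^ t) (start P [n, \<tau>] (replicate (nfloor (C * (n / \<tau>))) 0), us) = (([], s'), us')"
        "mem s' = layout 8 (nfloor (C * (n / \<tau>))) D" "good_table (fp_modulus (take R us)) u D"
        using monte_carlo_run[OF _ C(2,3), of us] A n(4) unfolding R_def t_def P_def by blast
      then show ?thesis by (auto simp: f_def halted_def memory_def)
    qed
    have q: "\<exists>r\<le>n. answers w T \<tau> Q (memory (f us)) i j (time (max r (length (LCE T i j)))) r \<and>
        ((N\<^sub>0 \<le> n \<longrightarrow> collision_free B T (fp_modulus (take R us))) \<longrightarrow> r = length (LCE T i j))"
      if us: "us \<in> set_pmf (words w (R + t))" and ij: "i \<in> {1..n}" "j \<in> {1..n}" for us i j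
    proof -
      obtain u D where D: "memory (f us) = layout 8 (nfloor (C * (n / \<tau>))) D" "good_table (fp_modulus (take R us)) u D"
        using run[OF us] by blast
      obtain r where "r \<le> n" "answers w T \<tau> Q (memory (f us)) i j (time (max r (length (LCE T i j)))) r"
        "(N\<^sub>0 \<le> n \<longrightarrow> hashing.faithful T B (fp_modulus (take R us)) u) \<longrightarrow> r = length (LCE T i j)"
        using answers_query[OF D(2) _ _ _ _ space_le[OF C(2)] C(1), of i j] ij
        unfolding D(1) Q_def \<open>time = _\<close> by auto
      then show ?thesis using faithful_if_collision_free[OF D(2)] by blast
    qed
    have "1 - 1 / n powr \<gamma> \<le> measure_pmf.prob (words w (R + t)) {us. N\<^sub>0 \<le> n \<longrightarrow> collision_free B T (fp_modulus (take R us))}"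
    proof (cases "N\<^sub>0 \<le> n")
      case True
      have "prime_bits ?L \<le> w"
        using root(3) mult_le_mono1[of 2 \<kappa> ?L] \<kappa> unfolding w(1) by linarith
      then have "1 - 1 / n powr \<gamma> \<le> measure_pmf.prob (words w R) {us. collision_free B T (fp_modulus us)}"
        using N\<^sub>0[OF True] collision_free_whp[OF g, of \<sigma> ?L T w] that(1)
        unfolding c_def[symmetric] fp_modulus_def[symmetric] R_def[symmetric] by (simp add: texts_def)
      also have "\<dots> = measure_pmf.prob (words w (R + t)) {us. collision_free B T (fp_modulus (take R us))}"
        by (rule prob_take[symmetric])
      finally show ?thesis using True by simp
    next
      case False
      then show ?thesis by simp
    qed
    also have "\<dots> \<le> measure_pmf.prob (words w (R + t)) {us. \<forall>i\<in>{1..n}. \<forall>j\<in>{1..n}.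
        answers w T \<tau> Q (memory (f us)) i j (time (length (LCE T i j))) (length (LCE T i j))}"
    proof (rule measure_pmf.finite_measure_mono_AE)
      show "AE us in measure_pmf (words w (R + t)). us \<in> {us. N\<^sub>0 \<le> n \<longrightarrow> collision_free B T (fp_modulus (take R us))} \<longrightarrow>
        us \<in> {us. \<forall>i\<in>{1..n}. \<forall>j\<in>{1..n}.
        answers w T \<tau> Q (memory (f us)) i j (time (length (LCE T i j))) (length (LCE T i j))}"
        unfolding AE_measure_pmf_iff
      proof (intro ballI impI CollectI)
        fix us i j assume "us \<in> set_pmf (words w (R + t))" "i \<in> {1..n}" "j \<in> {1..n}"
          "us \<in> {us. N\<^sub>0 \<le> n \<longrightarrow> collision_free B T (fp_modulus (take R us))}"
        then show "answers w T \<tau> Q (memory (f us)) i j (time (length (LCE T i j))) (length (LCE T i j))"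
          using q[of us i j] by (metis mem_Collect_eq max.idem)
      qed
    qed simp
    finally have pr: "1 - 1 / n powr \<gamma> \<le> measure_pmf.prob result {x. \<forall>i\<in>{1..n}. \<forall>j\<in>{1..n}.
        answers w T \<tau> Q (memory x) i j (time (length (LCE T i j))) (length (LCE T i j))}"
      unfolding result by (simp add: vimage_def)
    have "\<forall>x \<in> set_pmf result. halted x \<and>
        (\<forall>i\<in>{1..n}. \<forall>j\<in>{1..n}. \<exists>r\<le>n. answers w T \<tau> Q (memory x) i j (time (max r (length (LCE T i j)))) r)"
      using run q unfolding result set_map_pmf by blast
    with pr show ?thesis by blast
  qed
  have "0 < \<kappa>" "\<sigma> \<le> \<kappa>" by (simp_all add: \<kappa>_def)
  with * show ?thesis
    by (intro exI[of _ \<kappa>] exI[of _ P] exI[of _ Q] exI[of _ C]) (auto simp: Let_def)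
qed

section \<open>Answers always correct\<close>

lemma prob_no_chunk:
  "measure_pmf.prob (words w (R * m + k)) {us. \<forall>i<m. \<not> P (take R (drop (i * R) us))} \<le>
    (1 - measure_pmf.prob (words w R) {us. P us}) ^ m"
proof (induction m)
  case (Suc m)
  let ?P = "pair_pmf (words w R) (words w (R * m + k))"
  have "words w (R * Suc m + k) = words w (R + (R * m + k))" by (simp add: ac_simps)
  also have "\<dots> = map_pmf (\<lambda>(xs, ys). xs @ ys) ?P"
    unfolding replicate_pmf_distrib[of R]
    by (simp add: pair_pmf_def map_pmf_def bind_assoc_pmf bind_return_pmf)
  finally have r: "words w (R * Suc m + k) = map_pmf (\<lambda>(xs, ys). xs @ ys) ?P" .
  have "measure_pmf.prob (words w (R * Suc m + k)) {us. \<forall>i<Suc m. \<not> P (take R (drop (i * R) us))} =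
      measure_pmf.prob ?P {p. \<forall>i<Suc m. \<not> P (take R (drop (i * R) (fst p @ snd p)))}"
    unfolding r measure_map_pmf by (simp add: vimage_def case_prod_beta')
  also have "\<dots> \<le> measure_pmf.prob ?P ((UNIV - {xs. P xs}) \<times> {ys. \<forall>i<m. \<not> P (take R (drop (i * R) ys))})"
  proof (rule measure_pmf.finite_measure_mono_AE)
    show "AE p in ?P. p \<in> {p. \<forall>i<Suc m. \<not> P (take R (drop (i * R) (fst p @ snd p)))} \<longrightarrow>
        p \<in> (UNIV - {xs. P xs}) \<times> {ys. \<forall>i<m. \<not> P (take R (drop (i * R) ys))}"
      unfolding AE_measure_pmf_iff
    proof safe
      fix xs ys assume "(xs, ys) \<in> set_pmf ?P"
        and *: "\<forall>i<Suc m. \<not> P (take R (drop (i * R) (fst (xs, ys) @ snd (xs, ys))))"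
      then have l: "length xs = R" by (auto simp: set_replicate_pmf)
      { assume "P xs" with *[rule_format, of 0] l show False by simp }
      { fix i assume "i < m" "P (take R (drop (i * R) ys))"
        with *[rule_format, of "Suc i"] l show False by simp }
    qed auto
  qed auto
  also have "\<dots> = measure_pmf.prob (words w R) (UNIV - {xs. P xs}) *
      measure_pmf.prob (words w (R * m + k)) {ys. \<forall>i<m. \<not> P (take R (drop (i * R) ys))}"
    by (rule measure_pmf_prob_product) auto
  also have "\<dots> \<le> (1 - measure_pmf.prob (words w R) {us. P us}) * (1 - measure_pmf.prob (words w R) {us. P us}) ^ m"
    using Suc measure_pmf.prob_compl[of "{xs. P xs}" "words w R"]
    by (intro mult_mono) auto
  finally show ?case by simp
qed simp

context fp_params
begin

definition good_text_table :: "(nat \<Rightarrow> nat \<Rightarrow> nat) \<Rightarrow> bool" where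
  "good_text_table A \<longleftrightarrow> (\<exists>q t. good_table q t A \<and> (N\<^sub>0 \<le> n \<longrightarrow> hashing.faithful T B q t))"

lemma las_vegas_space: "8 * (2 * 2 ^ L + 5) < (2::nat) ^ w"
proof -
  have "1 \<le> (2::nat) ^ L" by simp
  then have "8 * (2 * 2 ^ L + 5) \<le> 56 * (2::nat) ^ L" by simp
  also have "\<dots> < 2 ^ w" by (rule fits_L) simp
  finally show ?thesis .
qed

lemma wp_las_vegas:
  assumes v: "vars \<sigma> 0 = n" "vars \<sigma> 1 = \<tau>" "tape \<sigma> = us" "m * (tries L * c) \<le> length us"
    and good: "N\<^sub>0 \<le> n \<Longrightarrow> \<exists>i<m. collision_free B T (fp_modulus (chunk i us))"
  shows "machine.wp w T 8 (2 * 2 ^ L + 5) (las_vegas s c N\<^sub>0) (\<lambda>\<sigma>'. good_text_table (arrs \<sigma>') \<and>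
    clk \<sigma>' \<le> clk \<sigma> + 500 + 50 * L + 30 * \<tau> + m * attempt_time) \<sigma>"
proof -
  note S = las_vegas_space
  interpret machine w T 8 "2 * 2 ^ L + 5" by (rule machine[OF S])
  have N: "N\<^sub>0 < 2 ^ w" using param_fits[of "N\<^sub>0"] \<kappa> by simp
  show ?thesis
  proof (cases "n < N\<^sub>0")
    case True
    then show ?thesis
      unfolding las_vegas_def using N by (simp add: wp_simps v good_text_table_def good_table_def)
  next
    case False
    show ?thesis
      unfolding las_vegas_def
      apply (simp add: wp_simps v N False)
      apply (rule wp_hash_setup[OF S])
      using v apply simp_all[2]
      subgoal premises p for f a c1
      proof -
        have "n div 2 ^ a \<le> n" by (rule div_le_dividend)
        moreover have "1 < (2::nat) ^ L" using n by linarith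
        ultimately have "n div 2 ^ a + 3 \<le> 2 * 2 ^ L + 5" using n(2) by linarith
        from wp_las_vegas_loop[OF S order.refl refl p(1) this _ _ v(3,4) good]
        have W: "wp (las_vegas_loop c) (\<lambda>\<sigma>'. verified (2 ^ a) (arrs \<sigma>') \<and> clk \<sigma>' \<le> clk \<sigma>0 + 50 + m * attempt_time) \<sigma>0"
          if "ready (2 ^ a) (vars \<sigma>0)" "vars \<sigma>0 44 = 0" "tape \<sigma>0 = us" for \<sigma>0 :: st
          using wp_las_vegas_loop[OF S order.refl refl p(1) \<open>n div 2 ^ a + 3 \<le> 2 * 2 ^ L + 5\<close> that v(4) good] False
          by simp
        show ?thesis
          apply (simp add: wp_simps)
          apply (rule wp_mono[OF W])
          using p v apply (simp_all add: ready_def)[3]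
          using p(1,2,4) unfolding verified_def good_text_table_def good_table_def
          apply (fastforce)
          done
      qed
      done
  qed
qed

text \<open>Drawing the primes and building the table is linear. Each of at most \<open>L\<close>
  verified levels costs a radix sort with constantly many digits, again linear because
  \<open>2 ^ L \<le> 2 * n\<close>; the factor \<open>L\<close> gives
  \<open>n * lg n\<close>.\<close>

lemma las_vegas_time:
  fixes A :: nat
  assumes A: "prime_cost L \<le> A * 2 ^ L" and C: "20000 + 15000 * real c + 2 * real c * A \<le> C"
  shows "500 + 50 * L + 30 * \<tau> + attempt_time \<le> nfloor (C * (n * lg n))"
proof -
  have lg1: "1 \<le> lg n" by (simp add: lg_def)
  have L: "real L \<le> 2 * lg n"
  proof -
    have "2 ^ L \<le> real (2 * n)" using n(3) by (metis of_nat_le_iff of_nat_numeral of_nat_power)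
    then have "log 2 (2 ^ L) \<le> log 2 (2 * real n)" using n by (intro log_mono) auto
    also have "\<dots> = 1 + log 2 n" using n by (subst log_mult) auto
    finally have "real L \<le> 1 + log 2 n" by simp
    also have "\<dots> \<le> 2 * lg n" by (simp add: lg_def)
    finally show ?thesis .
  qed
  define a where "a = 1200 + c * (100 + A * 2) + 330"
  have "500 + 30 * \<tau> + 700 + c * (100 + prime_cost L) + 300 * n \<le> a * n"
  proof -
    have "prime_cost L \<le> A * (2 * n)" using A mult_le_mono2[OF n(3), of A] by linarith
    then have "c * (100 + prime_cost L) \<le> c * (100 * n + A * (2 * n))" using n(1) by (intro mult_le_mono2) linarith
    moreover have "500 + 30 * \<tau> + 700 + 300 * n \<le> (1200 + 330) * n" using n(1) \<tau> by simp
    moreover have "a * n = (1200 + 330) * n + c * (100 * n + A * (2 * n))" by (simp add: a_def algebra_simps)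
    ultimately show ?thesis by linarith
  qed
  moreover have "50 * L + L * (2 * c + 3) * (1000 + 700 * 2 ^ L) \<le> L * ((4800 * c + 7300) * n)"
  proof -
    have "1000 + 700 * 2 ^ L \<le> 2400 * n" using n by linarith
    then have "(2 * c + 3) * (1000 + 700 * 2 ^ L) \<le> (2 * c + 3) * (2400 * n)" by (rule mult_le_mono2)
    then have "50 + (2 * c + 3) * (1000 + 700 * 2 ^ L) \<le> (4800 * c + 7300) * n"
      using n(1) by (simp add: algebra_simps)
    then have "L * (50 + (2 * c + 3) * (1000 + 700 * 2 ^ L)) \<le> L * ((4800 * c + 7300) * n)" by (rule mult_le_mono2)
    then show ?thesis by (simp add: algebra_simps)
  qed
  ultimately have "500 + 50 * L + 30 * \<tau> + attempt_time \<le> a * n + L * ((4800 * c + 7300) * n)"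
    unfolding attempt_time_def by linarith
  then have "real (500 + 50 * L + 30 * \<tau> + attempt_time) \<le> real (a * n + L * ((4800 * c + 7300) * n))"
    by (simp only: of_nat_le_iff)
  also have "\<dots> = real a * n * 1 + real (4800 * c + 7300) * n * L" by simp
  also have "\<dots> \<le> real a * n * lg n + real (4800 * c + 7300) * n * (2 * lg n)"
    using lg1 L by (intro add_mono mult_left_mono) auto
  also have "\<dots> = (real a + 2 * real (4800 * c + 7300)) * (n * lg n)" by (simp add: algebra_simps)
  also have "\<dots> \<le> C * (n * lg n)"
  proof (rule mult_right_mono)
    have "real a + 2 * real (4800 * c + 7300) = 16130 + 9700 * real c + 2 * real c * A"
      by (simp add: a_def algebra_simps)
    then show "real a + 2 * real (4800 * c + 7300) \<le> C" using C by linarith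
  qed (use lg1 in simp)
  finally show ?thesis by linarith
qed

lemma las_vegas_space_le:
  fixes C :: real
  assumes "100 \<le> C"
  shows "8 * (2 * 2 ^ L + 5) \<le> nfloor (C * n)"
proof -
  have "8 * (2 * 2 ^ L + 5) \<le> 72 * n" using n by simp
  then have "real (8 * (2 * 2 ^ L + 5)) \<le> real (72 * n)" by (simp only: of_nat_le_iff)
  also have "\<dots> \<le> C * n" unfolding of_nat_mult using assms by (intro mult_right_mono) auto
  finally show ?thesis by linarith
qed

definition las_vegas_start :: "real \<Rightarrow> config" where
  "las_vegas_start C = start (compile 8 (las_vegas s c N\<^sub>0)) [n, \<tau>] (replicate (nfloor (C * n)) 0)"

definition las_vegas_bound :: "nat \<Rightarrow> nat" where
  "las_vegas_bound m = 500 + 50 * L + 30 * \<tau> + m * attempt_time"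

definition lucky :: "nat \<Rightarrow> nat list \<Rightarrow> bool" where
  "lucky m us \<longleftrightarrow> (N\<^sub>0 \<le> n \<longrightarrow> (\<exists>i<m. collision_free B T (fp_modulus (chunk i us))))"

lemma las_vegas_run:
  assumes C: "100 \<le> C" and us: "m * (tries L * c) \<le> length us" "lucky m us" and t: "las_vegas_bound m \<le> t"
  shows "\<exists>s' us' D. (dstep w T ^^ t) (las_vegas_start C, us) = (([], s'), us') \<and>
    mem s' = layout 8 (nfloor (C * n)) D \<and> good_text_table D"
proof -
  interpret machine w T 8 "2 * 2 ^ L + 5" by (rule machine[OF las_vegas_space])
  have W: "wp (las_vegas s c N\<^sub>0) (\<lambda>\<sigma>'. good_text_table (arrs \<sigma>') \<and> clk \<sigma>' \<le> las_vegas_bound m)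
      (init [n, \<tau>] (\<lambda>_ _. 0) us)"
    using us wp_las_vegas[of "init [n, \<tau>] (\<lambda>_ _. 0) us" us m]
    by (simp add: init_def lucky_def las_vegas_bound_def)
  have "\<exists>(\<sigma>'::st) s'. (good_text_table (arrs \<sigma>') \<and> clk \<sigma>' \<le> las_vegas_bound m) \<and>
      (dstep w T ^^ t) (start (compile 8 (las_vegas s c N\<^sub>0)) [n, \<tau>]
        (layout 8 (nfloor (C * n)) (\<lambda>_ _. 0)), us) = (([], s'), tape \<sigma>') \<and>
      regs s' 0 = vars \<sigma>' 0 \<and> mem s' = layout 8 (nfloor (C * n)) (arrs \<sigma>')"
    by (rule wp_start[OF W las_vegas_space_le[OF C]]) (use t in simp)
  then show ?thesis unfolding las_vegas_start_def layout_zero by blast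
qed

text \<open>
  A halting run has read only finitely much of its tape. Prolonging the tape by one good attempt
  does not change its outcome, and for the prolonged tape total correctness applies.
\<close>

lemma las_vegas_halted_correct:
  assumes C: "100 \<le> C" and g: "N\<^sub>0 \<le> n \<Longrightarrow> length g = tries L * c \<and> 0 < tries L * c \<and> collision_free B T (fp_modulus g)"
    and us: "length us = t" and h: "halted (fst ((dstep w T ^^ t) (las_vegas_start C, us)))"
  shows "\<exists>D. memory (fst ((dstep w T ^^ t) (las_vegas_start C, us))) = layout 8 (nfloor (C * n)) D \<and> good_text_table D"
proof -
  let ?R = "tries L * c"
  \<comment> \<open>As a chunk has at least one word, \<open>length us\<close> chunks cover the
    given tape; zeros fill them up, and \<open>g\<close> becomes chunk number
    \<open>m\<close>.\<close>
  define m where "m = (if N\<^sub>0 \<le> n then length us else 0)"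
  define vs where "vs = us @ (if N\<^sub>0 \<le> n then replicate (m * ?R - length us) 0 @ g else [])"
  have len: "N\<^sub>0 \<le> n \<Longrightarrow> length us \<le> m * ?R" using g by (simp add: m_def)
  define M where "M = (if N\<^sub>0 \<le> n then Suc m else 0)"
  have l: "M * ?R \<le> length vs"
  proof (cases "N\<^sub>0 \<le> n")
    case True
    then show ?thesis using g len le_add_diff_inverse[OF len[OF True]] unfolding vs_def M_def by simp
  qed (simp add: M_def)
  have lucky: "lucky M vs"
    unfolding lucky_def
  proof
    assume N: "N\<^sub>0 \<le> n"
    have "chunk m vs = g" using g[OF N] len[OF N] N by (simp add: chunk_def vs_def drop_append)
    then show "\<exists>i<M. collision_free B T (fp_modulus (chunk i vs))"
      using g[OF N] N by (intro exI[of _ m]) (simp add: M_def)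
  qed
  \<comment> \<open>Late enough for the prolonged tape to lead to a halt with a good table, and not
    before \<open>t\<close>, so that this is the configuration already reached at time
    \<open>t\<close>.\<close>
  define t' where "t' = las_vegas_bound M + t"
  from las_vegas_run[OF C l lucky, of t'] obtain s' us' D where
    D: "(dstep w T ^^ t') (las_vegas_start C, vs) = (([], s'), us')" "mem s' = layout 8 (nfloor (C * n)) D"
      "good_text_table D" by (auto simp: t'_def)
  obtain st ws where r: "(dstep w T ^^ t) (las_vegas_start C, us) = (([], st), ws)"
    using h by (cases "(dstep w T ^^ t) (las_vegas_start C, us)") (auto simp: halted_def)
  have "(dstep w T ^^ t) (las_vegas_start C, vs) = (([], st), ws @ drop t vs)"
    using dstep_append_tape(1)[of t us w T "las_vegas_start C"] us r by (simp add: vs_def)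
  then have "(dstep w T ^^ t') (las_vegas_start C, vs) = (([], st), ws @ drop t vs)"
    by (simp add: t'_def funpow_add dstep_halted)
  with D r show ?thesis by (auto simp: memory_def)
qed

lemma las_vegas_halted_prob:
  assumes C: "100 \<le> C" and t: "las_vegas_bound m \<le> t"
  shows "measure_pmf.prob (words w (tries L * c * m + t)) {us. lucky m us} \<le>
    measure_pmf.prob (run w T t (las_vegas_start C)) {x. halted x}"
proof -
  have "run w T t (las_vegas_start C) =
      map_pmf (\<lambda>us. fst ((dstep w T ^^ t) (las_vegas_start C, us))) (words w (tries L * c * m + t))"
    by (rule run_words) simp
  moreover have "measure_pmf.prob (words w (tries L * c * m + t)) {us. lucky m us} \<le>
    measure_pmf.prob (words w (tries L * c * m + t)) {us. halted (fst ((dstep w T ^^ t) (las_vegas_start C, us)))}"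
  proof (rule measure_pmf.finite_measure_mono_AE)
    show "AE us in measure_pmf (words w (tries L * c * m + t)). us \<in> {us. lucky m us} \<longrightarrow>
        us \<in> {us. halted (fst ((dstep w T ^^ t) (las_vegas_start C, us)))}"
      unfolding AE_measure_pmf_iff
    proof (intro ballI impI CollectI)
      fix us assume "us \<in> set_pmf (words w (tries L * c * m + t))" "us \<in> {us. lucky m us}"
      then show "halted (fst ((dstep w T ^^ t) (las_vegas_start C, us)))"
        using las_vegas_run[OF C _ _ t, of us] by (auto simp: set_replicate_pmf halted_def mult.commute)
    qed
  qed simp
  ultimately show ?thesis by (simp add: vimage_def)
qed

end

text \<open>The high-probability time bound comes from the first attempt alone. Convergence of the
  halting probability to 1 uses that, on texts long enough to be hashed, every attempt is
  collision-free with probability at least 1/2, independently of the others.\<close>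

lemma las_vegas_data_structure:
  fixes \<sigma> :: nat and \<gamma> :: real
  shows "\<exists>\<kappa> P Q (C::real). 0 < \<kappa> \<and> \<sigma> \<le> \<kappa> \<and>
        (\<forall>T n \<tau> w. T \<in> texts \<sigma> \<and> n = length T \<and> 1 \<le> \<tau> \<and> \<tau> \<le> n \<and> w = word_bits \<kappa> n \<longrightarrow>
          (let time = (\<lambda>l::nat. nfloor (C * (\<tau> * lg (l / \<tau>))));
               result = (\<lambda>t. preprocess w T \<tau> P (nfloor (C * n)) t)
           in (\<forall>t. \<forall>c \<in> set_pmf (result t). halted c \<longrightarrow>
                 (\<forall>i\<in>{1..n}. \<forall>j\<in>{1..n}.
                    answers w T \<tau> Q (take (nfloor (C * (n / \<tau>))) (memory c)) i j
                      (time (length (LCE T i j))) (length (LCE T i j)))) \<and>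
              (\<lambda>t. measure_pmf.prob (result t) {c. halted c}) \<longlonglongrightarrow> 1 \<and>
              measure_pmf.prob (result (nfloor (C * (n * lg n)))) {c. halted c}
                \<ge> 1 - 1 / n powr \<gamma>))"
proof -
  obtain g N\<^sub>0 A :: nat where g: "\<gamma> \<le> g" and A: "\<forall>L\<ge>1. prime_cost L \<le> A * 2 ^ L"
    and N\<^sub>0: "\<And>T. N\<^sub>0 \<le> length T \<Longrightarrow> 2 \<le> floorlog 2 (length T) \<and>
      miss \<sigma> (floorlog 2 (length T)) ^ 8 \<le> 1 / 2 ^ floorlog 2 (length (T::nat list))"
    by (rule hashing_constants[of \<gamma> \<sigma>]) (rule that)
  define c where "c = 8 * (g + 4)"
  define \<kappa> where "\<kappa> = 4 * c + \<sigma> + N\<^sub>0 + 30"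
  define P where "P = compile 8 (las_vegas \<sigma> c N\<^sub>0)"
  define Q where "Q = compile 8 (query N\<^sub>0)"
  define C where "C = 27000 + 600 * (real N\<^sub>0 + 4) + 15000 * real c + 2 * real c * A"
  have *: "(\<forall>t. \<forall>x \<in> set_pmf (result t). halted x \<longrightarrow>
        (\<forall>i\<in>{1..length T}. \<forall>j\<in>{1..length T}. answers w T \<tau> Q (take (nfloor (C * (length T / \<tau>))) (memory x)) i j
          (time (length (LCE T i j))) (length (LCE T i j)))) \<and>
      (\<lambda>t. measure_pmf.prob (result t) {x. halted x}) \<longlonglongrightarrow> 1 \<and>
      measure_pmf.prob (result (nfloor (C * (length T * lg (length T))))) {x. halted x} \<ge> 1 - 1 / length T powr \<gamma>"
    if "T \<in> texts \<sigma>" "1 \<le> \<tau>" "\<tau> \<le> length T" "w = word_bits \<kappa> (length T)"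
      "time = (\<lambda>l::nat. nfloor (C * (\<tau> * lg (l / \<tau>))))"
      "result = (\<lambda>t. preprocess w T \<tau> P (nfloor (C * length T)) t)" for T \<tau> w time result
  proof -
    interpret fp_params T \<tau> \<sigma> c N\<^sub>0 \<kappa> w "floorlog 2 (length T)"
      using that by unfold_locales (auto simp: word_bits_def \<kappa>_def)
    let ?L = "floorlog 2 (length T)"
    define R where "R = tries ?L * c"
    have result: "result t = run w T t (las_vegas_start C)" for t
      unfolding that(6) preprocess_def las_vegas_start_def P_def ..
    have C: "query_const \<le> C" "56 \<le> C" "100 \<le> C" "20000 + 15000 * real c + 2 * real c * A \<le> C" "1 \<le> C"
      by (simp_all add: C_def query_const_def)
    have cf: "1 - 1 / n powr \<gamma> \<le> measure_pmf.prob (words w R) {us. collision_free B T (fp_modulus us)} \<and>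
        1 / 2 \<le> measure_pmf.prob (words w R) {us. collision_free B T (fp_modulus us)} \<and> 0 < R" if N: "N\<^sub>0 \<le> n"
    proof -
      have "prime_bits ?L \<le> w"
        using root(3) mult_le_mono1[of 2 \<kappa> ?L] \<kappa> unfolding w(1) by linarith
      moreover have "0 < R" using N\<^sub>0[OF N] by (simp add: R_def tries_def prime_bits_def c_def)
      ultimately show ?thesis
        using N\<^sub>0[OF N] collision_free_whp[OF g, of \<sigma> ?L T w] \<open>T \<in> texts \<sigma>\<close>
        unfolding c_def[symmetric] fp_modulus_def[symmetric] R_def[symmetric] by (simp add: texts_def)
    qed
    \<comment> \<open>An event of probability at least 1/2 is not empty; a tape in it serves to
      prolong any halted run.\<close>
    obtain gs where gs: "N\<^sub>0 \<le> n \<Longrightarrow> length gs = tries ?L * c \<and> 0 < tries ?L * c \<and> collision_free B T (fp_modulus gs)"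
    proof (cases "N\<^sub>0 \<le> n")
      case True
      have "\<exists>us \<in> set_pmf (words w R). collision_free B T (fp_modulus us)"
      proof (rule ccontr)
        assume "\<not> ?thesis"
        then have "measure_pmf.prob (words w R) {us. collision_free B T (fp_modulus us)} = 0"
          by (subst measure_pmf_zero_iff) auto
        then show False using cf[OF True] by simp
      qed
      then show ?thesis using that cf[OF True] by (auto simp: set_replicate_pmf R_def)
    qed (use that in blast)
    have correct: "answers w T \<tau> Q (take (nfloor (C * (n / \<tau>))) (memory x)) i j (time (length (LCE T i j))) (length (LCE T i j))"
      if x: "x \<in> set_pmf (result t)" "halted x" and ij: "i \<in> {1..n}" "j \<in> {1..n}" for t x i j
    proof -
      have "result t = map_pmf (\<lambda>us. fst ((dstep w T ^^ t) (las_vegas_start C, us))) (words w t)"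
        unfolding result by (rule run_words) simp
      with x obtain us where us: "length us = t" "x = fst ((dstep w T ^^ t) (las_vegas_start C, us))"
        by (auto simp: set_replicate_pmf)
      obtain D q u where D: "memory x = layout 8 (nfloor (C * n)) D" "good_table q u D"
          "N\<^sub>0 \<le> n \<longrightarrow> hashing.faithful T B q u"
        using las_vegas_halted_correct[OF C(3) gs us(1)] x(2) us(2) unfolding good_text_table_def by blast
      have "real n / real \<tau> \<le> real n / 1" using \<tau> by (intro divide_left_mono) auto
      then have "C * (real n / real \<tau>) \<le> C * real n" using C(5) by (intro mult_left_mono) auto
      then have "nfloor (C * (real n / real \<tau>)) \<le> nfloor (C * n)" by (intro nat_mono floor_mono)
      \<comment> \<open>Because the arrays are interleaved, a prefix of the memory contains a prefix
        of every array. Truncation therefore yields the same table with shorter arrays and discards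
        most of the working space of the verification.\<close>
      then have m: "take (nfloor (C * (n / \<tau>))) (memory x) = layout 8 (nfloor (C * (n / \<tau>))) D"
        unfolding D(1) by (rule take_layout)
      obtain r where r: "r \<le> n" "answers w T \<tau> Q (layout 8 (nfloor (C * (n / \<tau>))) D) i j (time (max r (length (LCE T i j)))) r"
        "r = length (LCE T i j)"
        using answers_query[OF D(2) _ _ _ _ space_le[OF C(2)] C(1), of i j] ij D(3)
        unfolding Q_def \<open>time = _\<close> by auto
      show ?thesis using r(2) unfolding m r(3) max.idem .
    qed
    have whp: "1 - 1 / n powr \<gamma> \<le> measure_pmf.prob (result (nfloor (C * (n * lg n)))) {x. halted x}"
    proof -
      let ?t = "nfloor (C * (n * lg n))"
      have "1 - 1 / n powr \<gamma> \<le> measure_pmf.prob (words w (R + ?t)) {us. lucky 1 us}"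
      proof (cases "N\<^sub>0 \<le> n")
        case True
        then have "1 - 1 / n powr \<gamma> \<le> measure_pmf.prob (words w R) {us. collision_free B T (fp_modulus us)}"
          using cf by blast
        also have "\<dots> = measure_pmf.prob (words w (R + ?t)) {us. collision_free B T (fp_modulus (take R us))}"
          by (rule prob_take[symmetric])
        finally show ?thesis using True by (simp add: lucky_def chunk_def R_def)
      next
        case False
        then show ?thesis by (simp add: lucky_def)
      qed
      also have "\<dots> \<le> measure_pmf.prob (result ?t) {x. halted x}"
        unfolding result using las_vegas_halted_prob[OF C(3), of 1 ?t] las_vegas_time[of A C] A n(4) C(4)
        by (simp add: R_def las_vegas_bound_def)
      finally show ?thesis .
    qed
    have lim: "(\<lambda>t. measure_pmf.prob (result t) {x. halted x}) \<longlonglongrightarrow> 1"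
    proof (rule order_tendstoI)
      fix a :: real assume "1 < a"
      then show "\<forall>\<^sub>F t in sequentially. measure_pmf.prob (result t) {x. halted x} < a"
        by (intro always_eventually allI) (meson le_less_trans measure_pmf.prob_le_1)
    next
      fix a :: real assume "a < 1"
      then obtain m where m: "(1 / 2) ^ m < 1 - a" using real_arch_pow_inv[of "1 - a" "1 / 2"] by auto
      have "a < measure_pmf.prob (result t) {x. halted x}" if t: "las_vegas_bound m \<le> t" for t
      proof -
        have "1 - (1 / 2) ^ m \<le> measure_pmf.prob (words w (R * m + t)) {us. lucky m us}"
        proof (cases "N\<^sub>0 \<le> n")
          case True
          let ?p = "measure_pmf.prob (words w R) {us. collision_free B T (fp_modulus us)}"
          have "measure_pmf.prob (words w (R * m + t)) {us. \<not> lucky m us} \<le> (1 - ?p) ^ m"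
            using prob_no_chunk[where w = w and R = R and m = m and k = t and P = "\<lambda>us. collision_free B T (fp_modulus us)"] True
            by (simp add: lucky_def chunk_def R_def)
          also have "\<dots> \<le> (1 / 2) ^ m" using cf[OF True] by (intro power_mono) auto
          finally have "measure_pmf.prob (words w (R * m + t)) {us. \<not> lucky m us} \<le> (1 / 2) ^ m" .
          moreover have "{us. \<not> lucky m us} = UNIV - {us. lucky m us}" by auto
          ultimately show ?thesis
            using measure_pmf.prob_compl[of "{us. lucky m us}" "words w (R * m + t)"] by simp
        qed (simp add: lucky_def)
        also have "\<dots> \<le> measure_pmf.prob (result t) {x. halted x}"
          unfolding result R_def by (rule las_vegas_halted_prob[OF C(3) t])
        finally show ?thesis using m by linarith
      qed
      then show "\<forall>\<^sub>F t in sequentially. a < measure_pmf.prob (result t) {x. halted x}"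
        unfolding eventually_sequentially by blast
    qed
    show ?thesis using correct whp lim by blast
  qed
  have "0 < \<kappa>" "\<sigma> \<le> \<kappa>" by (simp_all add: \<kappa>_def)
  with * show ?thesis
    by (intro exI[of _ \<kappa>] exI[of _ P] exI[of _ Q] exI[of _ C]) (auto simp: Let_def)
qed

section \<open>Sparse sets of suffixes\<close>

text \<open>
  The sampled positions form a difference cover: they contain a full interval of length \<open>s\<close> in
  each period \<open>s * s\<close> and all multiples of \<open>s\<close>, so any two positions are simultaneously
  shifted into the sample by some \<open>r < s * s\<close>.
\<close>

definition sampled :: "nat \<Rightarrow> nat \<Rightarrow> bool" where
  "sampled s p \<longleftrightarrow> p mod s = 0 \<or> p mod (s * s) < s"

text \<open>Even numbers for the multiples of \<open>s\<close>, odd numbers for the remaining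
  sampled positions, counted period by period. This compact numbering keeps the inverse suffix array
  at \<open>O(n / s + s)\<close> cells.\<close>

definition slot :: "nat \<Rightarrow> nat \<Rightarrow> nat" where
  "slot s p = (if p mod s = 0 then 2 * (p div s) else 2 * (p div (s * s) * s + p mod (s * s)) + 1)"

text \<open>\<open>r1\<close> moves \<open>a\<close> to a multiple of \<open>s * s\<close>. A
  further shift \<open>x' < s\<close> keeps it in the sampled interval at the start of the period
  and can be chosen so that the second position becomes a multiple of \<open>s\<close>. Reduction of
  the shift modulo \<open>s * s\<close> preserves both properties.\<close>

lemma sampled_shift:
  assumes "0 < s"
  obtains r where "r < s * s" "sampled s (a + r)" "sampled s (b + r)"
proof -
  define r1 where "r1 = s * s - a mod (s * s)"
  define x where "x = s - (b + r1) mod s"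
  define x' where "x' = (if x = s then 0 else x)"
  define r where "r = (r1 + x') mod (s * s)"
  have ss: "0 < s * s" using assms by simp
  have x': "x' < s" using assms by (simp add: x'_def x_def)
  have "a mod (s * s) < s * s" using ss by simp
  then have "a mod (s * s) + r1 = s * s" by (simp add: r1_def)
  moreover have "(a + r1) mod (s * s) = (a mod (s * s) + r1) mod (s * s)" by (simp only: mod_add_left_eq)
  ultimately have a: "(a + r1) mod (s * s) = 0" by simp
  have "(a + r) mod (s * s) = (a + r1 + x') mod (s * s)" by (simp add: r_def mod_add_right_eq add.assoc)
  also have "\<dots> = ((a + r1) mod (s * s) + x') mod (s * s)" by (simp add: mod_add_left_eq)
  also have "\<dots> = x'"
  proof -
    have "s * 1 \<le> s * s" using assms by (intro mult_le_mono2) simp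
    then have "x' < s * s" using x' by linarith
    then show ?thesis using a by simp
  qed
  finally have 1: "sampled s (a + r)" using x' by (simp add: sampled_def)
  have "(b + r1 + x') mod s = 0"
  proof (cases "(b + r1) mod s = 0")
    case True
    then show ?thesis by (simp add: x'_def x_def)
  next
    case False
    then have "x' = s - (b + r1) mod s" using assms by (auto simp: x'_def x_def)
    moreover have "(b + r1) mod s < s" using assms by simp
    ultimately have "(b + r1) mod s + x' = s" by simp
    then show ?thesis by (metis mod_add_left_eq mod_self)
  qed
  then have "(b + r) mod s = 0"
    by (metis r_def mod_add_right_eq mod_mod_cancel dvd_triv_left add.assoc)
  then have 2: "sampled s (b + r)" by (simp add: sampled_def)
  have "r < s * s" using ss by (simp add: r_def)
  with that 1 2 show ?thesis by blast
qed

lemma slot_inj: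
  assumes "0 < s" "sampled s p" "sampled s q" "slot s p = slot s q"
  shows "p = q"
proof (cases "p mod s = 0")
  case True
  have "q mod s = 0"
  proof (rule ccontr)
    assume "q mod s \<noteq> 0"
    with True assms(4) have "2 * (p div s) = 2 * (q div (s * s) * s + q mod (s * s)) + 1" by (simp add: slot_def)
    then show False by (metis Suc_eq_plus1 double_not_eq_Suc_double)
  qed
  with True assms(4) have "p div s = q div s" by (simp add: slot_def)
  with True \<open>q mod s = 0\<close> show ?thesis by (metis mult_div_mod_eq)
next
  case False
  have q: "q mod s \<noteq> 0"
  proof
    assume "q mod s = 0"
    with False assms(4) have "2 * (q div s) = 2 * (p div (s * s) * s + p mod (s * s)) + 1" by (simp add: slot_def)
    then show False by (metis Suc_eq_plus1 double_not_eq_Suc_double)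
  qed
  have lt: "p mod (s * s) < s" "q mod (s * s) < s" using False q assms by (auto simp: sampled_def)
  have "p div (s * s) * s + p mod (s * s) = q div (s * s) * s + q mod (s * s)"
    using assms(4) False q by (simp add: slot_def)
  then have "(p div (s * s) * s + p mod (s * s)) mod s = (q div (s * s) * s + q mod (s * s)) mod s"
    "(p div (s * s) * s + p mod (s * s)) div s = (q div (s * s) * s + q mod (s * s)) div s" by simp_all
  then have "p mod (s * s) = q mod (s * s)" "p div (s * s) = q div (s * s)" using lt by simp_all
  then show ?thesis by (metis mult_div_mod_eq)
qed

definition slots :: "nat \<Rightarrow> nat \<Rightarrow> nat" where
  "slots s n = 2 * (n div s + s) + 2"

lemma slot_less:
  assumes "0 < s" "sampled s p" "p < n"
  shows "slot s p < slots s n"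
proof (cases "p mod s = 0")
  case True
  have "p div s \<le> n div s" using assms by (intro div_le_mono) simp
  then show ?thesis using True by (simp add: slot_def slots_def)
next
  case False
  then have "p mod (s * s) < s" using assms by (simp add: sampled_def)
  moreover have "p div (s * s) * s \<le> p div s" by (simp add: div_mult2_eq)
  moreover have "p div s \<le> n div s" using assms by (intro div_le_mono) simp
  ultimately show ?thesis using False by (simp add: slot_def slots_def)
qed

lemma card_sampled: "0 < s \<Longrightarrow> card {p. p < n \<and> sampled s p} \<le> slots s n"
proof -
  assume s: "0 < s"
  have "card {p. p < n \<and> sampled s p} = card (slot s ` {p. p < n \<and> sampled s p})"
    using slot_inj[OF s] by (intro card_image[symmetric]) (auto simp: inj_on_def)
  also have "\<dots> \<le> card {..<slots s n}" using slot_less[OF s] by (intro card_mono) auto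
  finally show ?thesis by simp
qed


section \<open>The order of suffixes\<close>

text \<open>Letters are raised by one and 0 marks the end of the text, so a proper prefix precedes
  its extensions.\<close>

definition letter :: "nat list \<Rightarrow> nat \<Rightarrow> nat" where
  "letter T x = (if x < length T then T ! x + 1 else 0)"

definition sless :: "nat list \<Rightarrow> nat \<Rightarrow> nat \<Rightarrow> bool" where
  "sless T a b \<longleftrightarrow> letter T (a + lce T a b) < letter T (b + lce T a b)"

lemma matches_sym: "matches T a b l \<longleftrightarrow> matches T b a l"
  by (auto simp: matches_def)

lemma matches_trans: "matches T a b k \<Longrightarrow> matches T b c l \<Longrightarrow> m \<le> k \<Longrightarrow> m \<le> l \<Longrightarrow> matches T a c m"
  by (auto simp: matches_def)

lemma matches_lce: "a \<le> length T \<Longrightarrow> b \<le> length T \<Longrightarrow> matches T a b (lce T a b)"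
  by (simp add: matches_lce_iff)

lemma lce_sym: "a \<le> length T \<Longrightarrow> b \<le> length T \<Longrightarrow> lce T a b = lce T b a"
  by (metis matches_lce_iff matches_sym order_antisym order_refl)

lemma lce_letterI: "matches T a b l \<Longrightarrow> letter T (a + l) \<noteq> letter T (b + l) \<Longrightarrow> lce T a b = l"
  by (rule lce_eqI) (auto simp: letter_def)

lemma letter_lce:
  assumes "a \<le> length T" "b \<le> length T" "a \<noteq> b"
  shows "letter T (a + lce T a b) \<noteq> letter T (b + lce T a b)"
proof
  assume e: "letter T (a + lce T a b) = letter T (b + lce T a b)"
  note l = lce_le[OF assms(1,2)]
  have "a + lce T a b < length T \<and> b + lce T a b < length T"
    using e l assms(3) by (auto simp: letter_def split: if_splits)
  moreover from this e have "T ! (a + lce T a b) = T ! (b + lce T a b)" by (simp add: letter_def)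
  ultimately have "matches T a b (lce T a b + 1)"
    using matches_lce[OF assms(1,2)] by (auto simp: matches_add) (auto simp: matches_def)
  then show False using matches_lce_iff[OF assms(1,2), of "lce T a b + 1"] by simp
qed

lemma letter_matches: "matches T a b l \<Longrightarrow> u < l \<Longrightarrow> letter T (a + u) = letter T (b + u)"
  by (auto simp: matches_def letter_def)

lemma sless_cases:
  assumes "a \<le> length T" "b \<le> length T" "a \<noteq> b"
  shows "sless T a b \<or> sless T b a"
  using letter_lce[OF assms] unfolding sless_def lce_sym[OF assms(2,1)] by linarith

text \<open>At position \<open>min u v\<close> the earlier of the two differences decides, while the
  other pair still agrees there or differs in the same direction.\<close>

lemma sless_trans:
  assumes "a \<le> length T" "b \<le> length T" "c \<le> length T" "sless T a b" "sless T b c"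
  shows "sless T a c \<and> lce T a c = min (lce T a b) (lce T b c)"
proof -
  define u v where "u = lce T a b" and "v = lce T b c"
  note uv = u_def[symmetric] v_def[symmetric]
  note m = matches_lce[OF assms(1,2), unfolded uv] matches_lce[OF assms(2,3), unfolded uv]
  have m': "matches T a c (min u v)" by (rule matches_trans[OF m]) auto
  have s: "letter T (a + u) < letter T (b + u)" "letter T (b + v) < letter T (c + v)"
    using assms(4,5) by (simp_all add: sless_def uv)
  have l: "letter T (a + min u v) < letter T (c + min u v)"
  proof (cases u v rule: linorder_cases)
    case less
    then show ?thesis using letter_matches[OF m(2) less] s(1) by simp
  next
    case greater
    then show ?thesis using letter_matches[OF m(1) greater] s(2) by simp
  qed (use s in auto)
  then have "lce T a c = min u v" using lce_letterI[OF m'] by simp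
  with l show ?thesis unfolding sless_def uv by simp
qed

lemma sless_irrefl: "\<not> sless T a a"
  by (simp add: sless_def)

text \<open>The suffix at \<open>y\<close> agrees with that at \<open>a\<close> beyond the position
  where \<open>p\<close> becomes larger than \<open>a\<close>, so \<open>p\<close> exceeds
  \<open>y\<close> there as well. This is what allows the insertion scan to decide from LCP values
  alone.\<close>

lemma sless_by_longer:
  assumes "a \<le> length T" "y \<le> length T" "p \<le> length T" "sless T a p" "sless T a y" "lce T a p < lce T a y"
  shows "sless T y p \<and> lce T y p = lce T a p"
proof -
  have "y \<noteq> p" using assms by auto
  moreover have "\<not> sless T p y"
    using sless_trans[OF assms(1,3,2,4)] assms(6) by auto
  ultimately have "sless T y p" using sless_cases assms by blast
  with sless_trans[OF assms(1,2,3,5)] assms(6) show ?thesis by (auto simp: min_def split: if_splits)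
qed

lemma sless_by_shorter:
  assumes "a \<le> length T" "y \<le> length T" "p \<le> length T" "sless T a p" "sless T a y" "lce T a y < lce T a p"
  shows "sless T p y \<and> lce T p y = lce T a y"
  using sless_by_longer[of a T p y] assms by simp

definition is_min :: "(nat \<Rightarrow> nat) \<Rightarrow> nat \<Rightarrow> nat \<Rightarrow> nat \<Rightarrow> bool" where
  "is_min f l r x \<longleftrightarrow> (\<exists>u. l \<le> u \<and> u \<le> r \<and> f u = x) \<and> (\<forall>u. l \<le> u \<and> u \<le> r \<longrightarrow> x \<le> f u)"

lemma is_min_unique: "is_min f l r x \<Longrightarrow> is_min f l r y \<Longrightarrow> x = y"
  unfolding is_min_def by (meson order_antisym)

lemma is_min_join:
  assumes "is_min f l r x" "is_min f l' r' y" "l \<le> l'" "l' \<le> r + 1" "r \<le> r'"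
  shows "is_min f l r' (min x y)"
proof -
  have "min x y \<le> f u" if "l \<le> u" "u \<le> r'" for u
    using assms that unfolding is_min_def by (cases "u \<le> r") (auto simp: min.coboundedI1 min.coboundedI2)
  moreover have "\<exists>u. l \<le> u \<and> u \<le> r' \<and> f u = min x y"
    using assms unfolding is_min_def min_def by (metis order_trans)
  ultimately show ?thesis by (simp add: is_min_def)
qed

section \<open>Extensions as range minima of the LCP array\<close>

definition lcp_fun :: "nat list \<Rightarrow> nat list \<Rightarrow> nat \<Rightarrow> nat" where
  "lcp_fun T xs i = (if i = 0 then 0 else lce T (xs ! (i - 1)) (xs ! i))"

text \<open>The range begins at \<open>i + 1\<close> because \<open>lcp_fun\<close> at a rank refers
  to the preceding rank. Along the sorted list the extension of an outer pair is the minimum of the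
  extensions of neighbours, by \<open>sless_trans\<close>.\<close>

lemma lce_is_min:
  assumes "sorted_wrt (sless T) xs" "\<And>x. x \<in> set xs \<Longrightarrow> x < length T" "i < j" "j < length xs"
  shows "sless T (xs ! i) (xs ! j) \<and> is_min (lcp_fun T xs) (i + 1) j (lce T (xs ! i) (xs ! j))"
  using assms(3,4)
proof (induction j)
  case (Suc j)
  have s: "sless T (xs ! j) (xs ! Suc j)" using assms(1) Suc.prems by (auto simp: sorted_wrt_iff_nth_less)
  have n: "xs ! k \<le> length T" if "k < length xs" for k using assms(2)[OF nth_mem[OF that]] by simp
  have f: "lcp_fun T xs (Suc j) = lce T (xs ! j) (xs ! Suc j)" by (simp add: lcp_fun_def)
  have one: "is_min (lcp_fun T xs) (Suc j) (Suc j) (lcp_fun T xs (Suc j))"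
    by (auto simp: is_min_def intro: le_antisym)
  show ?case
  proof (cases "i = j")
    case True
    then show ?thesis using s one f by (simp flip: Suc_eq_plus1)
  next
    case False
    then have IH: "sless T (xs ! i) (xs ! j)" "is_min (lcp_fun T xs) (i + 1) j (lce T (xs ! i) (xs ! j))"
      using Suc by auto
    have "sless T (xs ! i) (xs ! Suc j) \<and>
        lce T (xs ! i) (xs ! Suc j) = min (lce T (xs ! i) (xs ! j)) (lce T (xs ! j) (xs ! Suc j))"
      using IH(1) s Suc.prems by (intro sless_trans n) auto
    then show ?thesis using is_min_join[OF IH(2) one] f Suc.prems False by simp
  qed
qed simp

lemma sorted_insert:
  assumes "sorted_wrt (sless T) xs" "\<And>x. x \<in> set xs \<Longrightarrow> x < length T" "p < length T" "k \<le> length xs"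
    and "0 < k \<Longrightarrow> sless T (xs ! (k - 1)) p" "k < length xs \<Longrightarrow> sless T p (xs ! k)"
  shows "sorted_wrt (sless T) (take k xs @ p # drop k xs)"
proof -
  have n: "xs ! k \<le> length T" if "k < length xs" for k using assms(2)[OF nth_mem[OF that]] by simp
  have lt: "sless T (xs ! i) p" if "i < k" for i
  proof (cases "i = k - 1")
    case False
    then have "sless T (xs ! i) (xs ! (k - 1))"
      using assms(1,4) that by (auto simp: sorted_wrt_iff_nth_less)
    then show ?thesis using assms(3,4,5) that sless_trans[of "xs ! i" T "xs ! (k - 1)" p] n by auto
  qed (use assms(5) that in auto)
  have gt: "sless T p (xs ! i)" if "k \<le> i" "i < length xs" for i
  proof (cases "i = k")
    case False
    then have "sless T (xs ! k) (xs ! i)"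
      using assms(1,4) that by (auto simp: sorted_wrt_iff_nth_less)
    then show ?thesis using assms(3,6) that sless_trans[of p T "xs ! k" "xs ! i"] n by auto
  qed (use assms(6) that in auto)
  have 1: "\<forall>x\<in>set (take k xs). sless T x p" using lt by (auto simp: in_set_conv_nth)
  have 2: "\<forall>x\<in>set (drop k xs). sless T p x" using gt by (auto simp: in_set_conv_nth)
  have 3: "sless T x y" if "x \<in> set (take k xs)" "y \<in> set (drop k xs)" for x y
    using sless_trans[of x T p y] 1 2 that assms(2,3) by (metis in_set_dropD in_set_takeD less_imp_le)
  show ?thesis using assms(1) 1 2 3 by (auto simp: sorted_wrt_append sorted_wrt_take sorted_wrt_drop)
qed

lemma lcp_fun_insert:
  assumes "k \<le> length xs" "i \<le> length xs"
  shows "lcp_fun T (take k xs @ p # drop k xs) i =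
    (if i < k then lcp_fun T xs i else if i = k then (if k = 0 then 0 else lce T (xs ! (k - 1)) p)
     else if i = k + 1 then lce T p (xs ! k) else lcp_fun T xs (i - 1))"
  using assms by (auto simp: lcp_fun_def nth_append nth_Cons' min_def)

lemma distinct_sless: "sorted_wrt (sless T) xs \<Longrightarrow> distinct xs"
  by (metis sless_irrefl sorted_wrt_iff_nth_less distinct_conv_nth nat_neq_iff)


section \<open>Range minima\<close>

text \<open>
  Bit \<open>d\<close> of the mask at \<open>r\<close> marks \<open>r - d\<close> as a minimum of the range from \<open>r - d\<close> to \<open>r\<close>;
  the farthest mark in a window ending at \<open>r\<close> is the minimum of the window.
\<close>

definition marked :: "(nat \<Rightarrow> nat) \<Rightarrow> nat \<Rightarrow> nat \<Rightarrow> bool" where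
  "marked f r d \<longleftrightarrow> (\<forall>u. r - d \<le> u \<and> u \<le> r \<longrightarrow> f (r - d) \<le> f u)"

primrec marks :: "(nat \<Rightarrow> nat) \<Rightarrow> nat \<Rightarrow> nat \<Rightarrow> nat" where
  "marks f r 0 = 0"
| "marks f r (Suc d) = marks f r d + (if marked f r d then 2 ^ d else 0)"

lemma marks_less: "marks f r d < 2 ^ d"
  by (induction d) auto

text \<open>Cutting a mask to its \<open>k\<close> low bits restricts it to a shorter window, so one
  stored word per right end answers all windows up to the stored length.\<close>

lemma marks_mod: "k \<le> d \<Longrightarrow> marks f r d mod 2 ^ k = marks f r k"
proof (induction d)
  case (Suc d)
  show ?case
  proof (cases "k = Suc d")
    case True
    then show ?thesis using marks_less[of f r "Suc d"] by simp
  next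
    case False
    then have k: "k \<le> d" using Suc by simp
    then have "(2::nat) ^ d mod 2 ^ k = 0" by (simp add: le_imp_power_dvd mod_0_imp_dvd)
    then have "marks f r (Suc d) mod 2 ^ k = marks f r d mod 2 ^ k"
      by (simp add: mod_add_eq[of "marks f r d", symmetric])
    then show ?thesis using Suc.IH[OF k] by simp
  qed
qed simp

lemma floorlog_bit: "x < 2 ^ d \<Longrightarrow> floorlog 2 (x + 2 ^ d) = Suc d"
  by (intro antisym floorlog_leI floorlog_ge_SucI) auto

lemma floorlog_marks:
  "\<exists>e<Suc d. marked f r e \<and> floorlog 2 (marks f r (Suc d)) = e + 1 \<and> (\<forall>x. e < x \<and> x < Suc d \<longrightarrow> \<not> marked f r x)"
proof (induction d)
  case 0
  then show ?case using floorlog_bit[of 0 0] by (auto simp: marked_def)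
next
  case (Suc d)
  show ?case
  proof (cases "marked f r (Suc d)")
    case True
    then show ?thesis using floorlog_bit[OF marks_less[of f r "Suc d"]]
      by (intro exI[of _ "Suc d"]) (simp, linarith)
  next
    case False
    from Suc obtain e where "e < Suc d" "marked f r e" "floorlog 2 (marks f r (Suc d)) = e + 1"
      "\<forall>x. e < x \<and> x < Suc d \<longrightarrow> \<not> marked f r x" by blast
    with False show ?thesis by (intro exI[of _ e]) (auto simp: less_Suc_eq)
  qed
qed

text \<open>\<open>floorlog\<close> is one more than the index \<open>e\<close> of the top bit. A
  minimiser of the range is itself marked, so its distance from \<open>r\<close> is at most
  \<open>e\<close>, inside the stretch over which the mark at distance \<open>e\<close> is minimal.
  The last two parts keep the index computation inside the window.\<close>

lemma is_min_marks:
  assumes "l \<le> r"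
  shows "is_min f l r (f (r + 1 - floorlog 2 (marks f r (r + 1 - l))))" (is ?A)
    and "floorlog 2 (marks f r (r + 1 - l)) \<le> r + 1 - l" (is ?B)
    and "1 \<le> floorlog 2 (marks f r (r + 1 - l))" (is ?C)
proof -
  have d: "r + 1 - l = Suc (r - l)" using assms by simp
  obtain e where e: "e < Suc (r - l)" "marked f r e" "floorlog 2 (marks f r (Suc (r - l))) = e + 1"
    "\<forall>x. e < x \<and> x < Suc (r - l) \<longrightarrow> \<not> marked f r x" using floorlog_marks by blast
  obtain u where u: "l \<le> u" "u \<le> r" "\<forall>v. l \<le> v \<and> v \<le> r \<longrightarrow> f u \<le> f v"
  proof -
    have "\<exists>u\<in>{l..r}. \<forall>v\<in>{l..r}. f u \<le> f v"
      using ex_is_arg_min_if_finite[of "{l..r}" f] assms by (force simp: is_arg_min_def not_less)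
    with that show ?thesis by auto
  qed
  have "marked f r (r - u)" using u by (auto simp: marked_def)
  then have "r - u \<le> e" using e(4) u by (metis diff_le_mono2 le_imp_less_Suc linorder_not_le)
  then have "f (r - e) \<le> f u" using e(2) u unfolding marked_def by (metis diff_le_mono2 diff_diff_cancel)
  then have "\<forall>v. l \<le> v \<and> v \<le> r \<longrightarrow> f (r - e) \<le> f v" using u(3) by (meson order_trans)
  then show ?A using e(1,3) assms unfolding d is_min_def by (auto intro!: exI[of _ "r - e"])
  show ?B ?C using e by (simp_all add: d)
qed

section \<open>Sorting the sampled suffixes\<close>

definition for_loop :: "nat \<Rightarrow> nat \<Rightarrow> hcom \<Rightarrow> hcom" where
  "for_loop x y c = (WHILE V x \<^bold>< V y DO (c;; x ::= V x \<^bold>+ N 1))"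

lemma rand_free_for_loop [simp]: "rand_free (compile K (for_loop x y c)) = rand_free (compile K c)"
  by (simp add: for_loop_def)

text \<open>
  Registers: 4 is the length of the text, 5 is \<open>s\<close>, 6 is \<open>s * s\<close>, 7 the position to be inserted, 8 the
  number of sorted suffixes. Arrays: 0 is the suffix array, 1 the LCP array, 2 the inverse of the suffix array, indexed by \<open>slot\<close>;
  3, 4, 5 serve range minima: logarithms, marks, minima of blocks; 6 stores the parameters.
\<close>

definition square_root :: hcom where
  "square_root = (5 ::= N 0;;
     WHILE (V 5 \<^bold>+ N 1) \<^bold>* (V 5 \<^bold>+ N 1) \<^bold>< V 1 \<^bold>+ N 1 DO 5 ::= V 5 \<^bold>+ N 1;;
     6 ::= V 5 \<^bold>* V 5)"

definition extend :: hcom where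
  "extend = (20 ::= N 1;;
     WHILE V 20 DO (
       20 ::= N 0;; 21 ::= V 15 \<^bold>+ V 16;; 22 ::= V 7 \<^bold>+ V 16;;
       IF V 21 \<^bold>< V 4 THEN IF V 22 \<^bold>< V 4 THEN 20 ::= (Inp (V 21) \<^bold>= Inp (V 22)) ELSE SKIP ELSE SKIP;;
       IF V 20 THEN 16 ::= V 16 \<^bold>+ N 1 ELSE SKIP))"

definition suffix_less :: hcom where
  "suffix_less = (19 ::= N 0;;
     IF V 22 \<^bold>< V 4 THEN
       IF V 21 \<^bold>< V 4 THEN 19 ::= (Inp (V 21) \<^bold>< Inp (V 22)) ELSE 19 ::= N 1
     ELSE SKIP)"

text \<open>
  The new suffix has \<open>V 13\<close> letters in common with the suffix at rank \<open>V 12 - 1\<close>, which is smaller. Unless the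
  LCP value at the next rank is the same number, it decides the next comparison; otherwise letters are
  compared from this offset on. So a scan reads \<open>O(n)\<close> letters.
\<close>

definition scan :: hcom where
  "scan = (12 ::= N 0;; 13 ::= N 0;; 18 ::= N 0;; 17 ::= (V 12 \<^bold>< V 8);;
     WHILE V 17 DO (
       14 ::= Ld 1 (V 12);;
       IF V 14 \<^bold>< V 13 THEN (17 ::= N 0;; 18 ::= V 14)
       ELSE (
         IF V 13 \<^bold>< V 14 THEN SKIP
         ELSE (15 ::= Ld 0 (V 12);; 16 ::= V 13;; extend;; suffix_less;;
           IF V 19 THEN 13 ::= V 16 ELSE (17 ::= N 0;; 18 ::= V 16));;
         IF V 17 THEN (12 ::= V 12 \<^bold>+ N 1;; 17 ::= (V 12 \<^bold>< V 8)) ELSE SKIP)))"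

definition shift :: hcom where
  "shift = (14 ::= V 8;;
     WHILE V 12 \<^bold>< V 14 DO (
       Sto 0 (V 14) (Ld 0 (V 14 \<^bold>- N 1));; Sto 1 (V 14) (Ld 1 (V 14 \<^bold>- N 1));;
       14 ::= V 14 \<^bold>- N 1);;
     Sto 0 (V 12) (V 7);; Sto 1 (V 12) (V 13);;
     IF V 12 \<^bold>< V 8 THEN Sto 1 (V 12 \<^bold>+ N 1) (V 18) ELSE SKIP;;
     8 ::= V 8 \<^bold>+ N 1)"

definition sampled_exp :: "nat \<Rightarrow> exp" where
  "sampled_exp x = (V x \<^bold>% V 5 \<^bold>= N 0) \<^bold>| (V x \<^bold>% V 6 \<^bold>< V 5)"

definition sort_samples :: hcom where
  "sort_samples = (8 ::= N 0;; 7 ::= N 0;;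
     for_loop 7 4 (IF sampled_exp 7 THEN (scan;; shift) ELSE SKIP))"

section \<open>Inserting a suffix into the sorted list\<close>

definition left_of :: "nat list \<Rightarrow> nat list \<Rightarrow> nat \<Rightarrow> nat \<Rightarrow> nat \<Rightarrow> bool" where
  "left_of T xs p k h \<longleftrightarrow> k \<le> length xs \<and> (if k = 0 then h = 0 else sless T (xs ! (k - 1)) p \<and> h = lce T (xs ! (k - 1)) p)"

definition right_of :: "nat list \<Rightarrow> nat list \<Rightarrow> nat \<Rightarrow> nat \<Rightarrow> nat \<Rightarrow> bool" where
  "right_of T xs p k h \<longleftrightarrow> (k < length xs \<longrightarrow> sless T p (xs ! k) \<and> h = lce T p (xs ! k))"

definition insertable :: "nat list \<Rightarrow> nat list \<Rightarrow> nat \<Rightarrow> bool" where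
  "insertable T xs p \<longleftrightarrow> sorted_wrt (sless T) xs \<and> (\<forall>x\<in>set xs. x < length T \<and> x \<noteq> p) \<and> p < length T"

text \<open>The candidate shares more letters with the left neighbour than the new suffix does, so
  it lies on the same side of the new suffix as this neighbour, with the same common prefix.\<close>

lemma scan_longer:
  assumes "insertable T xs p" "left_of T xs p k h" "k < length xs" "h < lcp_fun T xs k"
  shows "left_of T xs p (k + 1) h"
proof -
  have "k \<noteq> 0" using assms(4) by (cases "k = 0") (auto simp: lcp_fun_def)
  moreover have "sless T (xs ! (k - 1)) (xs ! k)"
    using assms(1,3) \<open>k \<noteq> 0\<close> by (auto simp: insertable_def sorted_wrt_iff_nth_less)
  ultimately show ?thesis
    using sless_by_longer[of "xs ! (k - 1)" T "xs ! k" p] assms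
    by (auto simp: left_of_def lcp_fun_def insertable_def less_imp_le)
qed

lemma scan_shorter:
  assumes "insertable T xs p" "left_of T xs p k h" "k < length xs" "lcp_fun T xs k < h"
  shows "right_of T xs p k (lcp_fun T xs k)"
proof -
  have "k \<noteq> 0" using assms(2,4) by (cases "k = 0") (auto simp: left_of_def)
  moreover have "sless T (xs ! (k - 1)) (xs ! k)"
    using assms(1,3) \<open>k \<noteq> 0\<close> by (auto simp: insertable_def sorted_wrt_iff_nth_less)
  ultimately show ?thesis
    using sless_by_shorter[of "xs ! (k - 1)" T "xs ! k" p] assms
    by (auto simp: left_of_def right_of_def lcp_fun_def insertable_def less_imp_le)
qed

text \<open>Both suffixes share \<open>h\<close> letters with the left neighbour, hence with each
  other; so letter comparison may start at offset \<open>h\<close>. Rank 0 has no left neighbour,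
  and there \<open>h = 0\<close>.\<close>

lemma scan_equal:
  assumes "insertable T xs p" "left_of T xs p k h" "k < length xs" "lcp_fun T xs k = h"
  shows "matches T (xs ! k) p h"
    and "sless T (xs ! k) p \<Longrightarrow> left_of T xs p (k + 1) (lce T (xs ! k) p)"
    and "\<not> sless T (xs ! k) p \<Longrightarrow> right_of T xs p k (lce T (xs ! k) p)"
proof -
  have n: "xs ! i \<le> length T" "xs ! i \<noteq> p" if "i < length xs" for i
    using assms(1) nth_mem[OF that] by (auto simp: insertable_def)
  have p: "p \<le> length T" using assms(1) by (simp add: insertable_def)
  show "matches T (xs ! k) p h"
  proof (cases "k = 0")
    case True
    then show ?thesis using n[OF assms(3)] p assms(2) by (simp add: left_of_def matches_def)
  next
    case False
    let ?a = "xs ! (k - 1)"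
    have "h = lce T ?a p" "h = lce T ?a (xs ! k)" "?a \<le> length T"
      using False assms(2-4) n[of "k - 1"] by (auto simp: left_of_def lcp_fun_def)
    then have "matches T ?a p h" "matches T (xs ! k) ?a h"
      using p n[OF assms(3)] matches_lce matches_sym by metis+
    then show ?thesis using matches_trans by blast
  qed
  show "left_of T xs p (k + 1) (lce T (xs ! k) p)" if "sless T (xs ! k) p"
    using that assms(3) by (simp add: left_of_def)
  show "right_of T xs p k (lce T (xs ! k) p)" if "\<not> sless T (xs ! k) p"
    using that sless_cases[OF n(1)[OF assms(3)] p n(2)[OF assms(3)]] lce_sym[OF p n(1)[OF assms(3)]]
    by (simp add: right_of_def)
qed

lemma Collect_less_Suc:
  "{i. i < k + 1 \<and> P i} = (if P k then insert k {i. i < k \<and> P i} else {i. i < (k::nat) \<and> P i})"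
  by (auto simp: less_Suc_eq simp flip: Suc_eq_plus1)

definition suffix_table :: "nat list \<Rightarrow> nat list \<Rightarrow> (nat \<Rightarrow> nat \<Rightarrow> nat) \<Rightarrow> bool" where
  "suffix_table T xs A \<longleftrightarrow> (\<forall>i<length xs. A 0 i = xs ! i \<and> A 1 i = lcp_fun T xs i)"

context machine
begin

text \<open>The invariant \<open>J\<close> depends on the counter, registers and arrays only; frame
  conditions, the tape and the summation of the costs \<open>D k\<close> are dealt with once
  here.\<close>

lemma wp_for_loop:
  assumes x: "x \<in> X" "y \<notin> X" "x < TMP" "y < TMP" "vars \<sigma> x \<le> M" "vars \<sigma> y = M" "M < 2 ^ w"
    and init: "J (vars \<sigma> x) (vars \<sigma>) (arrs \<sigma>)"
    and step: "\<And>k f A c0. vars \<sigma> x \<le> k \<Longrightarrow> k < M \<Longrightarrow> agree X (vars \<sigma>) f \<Longrightarrow> agree Y (arrs \<sigma>) A \<Longrightarrow> f x = k \<Longrightarrow>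
      J k f A \<Longrightarrow> wp c (\<lambda>s. agree X (vars \<sigma>) (vars s) \<and> agree Y (arrs \<sigma>) (arrs s) \<and> tape s = tape \<sigma> \<and>
        vars s x = k \<and> J (k + 1) ((vars s)(x := k + 1)) (arrs s) \<and> clk s \<le> c0 + D k)
       (\<sigma>\<lparr>vars := f, arrs := A, clk := c0\<rparr>)"
    and Q: "\<And>f A c'. agree X (vars \<sigma>) f \<Longrightarrow> agree Y (arrs \<sigma>) A \<Longrightarrow> f x = M \<Longrightarrow> J M f A \<Longrightarrow>
      c' \<le> clk \<sigma> + 10 + (\<Sum>i=vars \<sigma> x..<M. D i + 20) \<Longrightarrow> Q (\<sigma>\<lparr>vars := f, arrs := A, clk := c'\<rparr>)"
  shows "wp (for_loop x y c) Q \<sigma>"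
proof -
  define I where "I = (\<lambda>s::st. agree X (vars \<sigma>) (vars s) \<and> agree Y (arrs \<sigma>) (arrs s) \<and> tape s = tape \<sigma> \<and>
    vars \<sigma> x \<le> vars s x \<and> vars s x \<le> M \<and> J (vars s x) (vars s) (arrs s) \<and>
    clk s \<le> clk \<sigma> + (\<Sum>i=vars \<sigma> x..<vars s x. D i + 20))"
  show ?thesis
    unfolding for_loop_def
    apply (rule wp_while[where I = I and m = "\<lambda>s. M - vars s x"])
    subgoal using x init by (simp add: I_def)
    subgoal using x by (simp add: I_def)
    subgoal premises p for s
    proof -
      define k where "k = vars s x"
      note I = p(1)[unfolded I_def]
      have y: "vars s y = M" using agreeD[OF I[THEN conjunct1] x(2)] x by simp
      have k: "k < M" "vars \<sigma> x \<le> k" using p(2) y I by (simp_all add: k_def)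
      have s: "s\<lparr>clk := c0\<rparr> = \<sigma>\<lparr>vars := vars s, arrs := arrs s, clk := c0\<rparr>" for c0
        using I by (cases s; cases \<sigma>) simp
      have "(\<Sum>i=vars \<sigma> x..<k + 1. D i + 20) = (\<Sum>i=vars \<sigma> x..<k. D i + 20) + (D k + 20)"
        using k(2) by (simp only: Suc_eq_plus1[symmetric] sum.atLeastLessThan_Suc)
      then have clk: "clk s + (D k + 20) \<le> clk \<sigma> + (\<Sum>i=vars \<sigma> x..<k + 1. D i + 20)"
        using I unfolding k_def by linarith
      have "k + 1 < 2 ^ w" using k x by simp
      then show ?thesis
        apply (simp add: wp_simps s)
        apply (rule wp_mono[OF step[of k "vars s" "arrs s"]])
        using I k apply (simp_all add: k_def[symmetric])[6]
        subgoal for s'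
          using k x clk by (auto simp add: wp_simps I_def k_def[symmetric])
        done
    qed
    subgoal premises p for s
    proof -
      note I = p(1)[unfolded I_def]
      have "vars s y = M" using agreeD[OF I[THEN conjunct1] x(2)] x by simp
      then have k: "vars s x = M" using p(2) I by simp
      have e: "s\<lparr>clk := c0\<rparr> = \<sigma>\<lparr>vars := vars s, arrs := arrs s, clk := c0\<rparr>" for c0
        using I by (cases s; cases \<sigma>) simp
      show ?thesis using Q[of "vars s" "arrs s" "clk s + 7"] I k by (simp add: e)
    qed
    done
qed

lemma wp_square_root:
  assumes "vars \<sigma> 1 = \<tau>" "(\<tau> + 2) * (\<tau> + 2) < 2 ^ w"
    and Q: "\<And>s c. s * s \<le> \<tau> \<Longrightarrow> \<tau> < (s + 1) * (s + 1) \<Longrightarrow> c \<le> clk \<sigma> + 50 + 50 * \<tau> \<Longrightarrow>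
      Q (\<sigma>\<lparr>vars := (vars \<sigma>)(5 := s, 6 := s * s), clk := c\<rparr>)"
  shows "wp square_root Q \<sigma>"
proof -
  define I where "I = (\<lambda>s::st. agree {5} (vars \<sigma>) (vars s) \<and> arrs s = arrs \<sigma> \<and> tape s = tape \<sigma> \<and>
    vars s 5 * vars s 5 \<le> \<tau> \<and> clk s \<le> clk \<sigma> + 20 + 50 * vars s 5)"
  have sq: "x \<le> \<tau>" if "x * x \<le> \<tau>" for x
  proof (cases x)
    case (Suc y)
    then have "x * 1 \<le> x * x" by (intro mult_le_mono2) simp
    then show ?thesis using that by linarith
  qed simp
  have fit: "(x + 1) * (x + 1) < 2 ^ w \<and> x + 1 < 2 ^ w" if "x \<le> \<tau>" for x
  proof -
    have "(x + 1) * (x + 1) \<le> (\<tau> + 2) * (\<tau> + 2)" using that by (intro mult_le_mono) auto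
    note le_less_trans[OF this assms(2)]
    moreover have "x + 1 \<le> (x + 1) * (x + 1)" by simp
    ultimately show ?thesis by (meson le_less_trans)
  qed
  have t: "\<tau> + 1 < 2 ^ w" using fit[of \<tau>] by simp
  show ?thesis
    unfolding square_root_def
    apply (simp add: wp_simps)
    apply (rule wp_while[where I = I and m = "\<lambda>s. \<tau> - vars s 5"])
    subgoal by (simp add: I_def)
    subgoal premises p for s
    proof -
      note I = p[unfolded I_def]
      have "vars s 1 = \<tau>" using agreeD[OF I[THEN conjunct1], of 1] assms by simp
      then show ?thesis using fit[OF sq[of "vars s 5"]] I t by simp
    qed
    subgoal premises p for s
    proof -
      note I = p(1)[unfolded I_def]
      have "vars s 1 = \<tau>" using agreeD[OF I[THEN conjunct1], of 1] assms by simp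
      then have 1: "(vars s 5 + 1) * (vars s 5 + 1) \<le> \<tau>" using p(2) by simp
      note sq[OF this]
      with 1 fit[OF sq[of "vars s 5"]] I show ?thesis
        by (simp add: wp_simps I_def)
    qed
    subgoal premises p for s
    proof -
      note I = p(1)[unfolded I_def]
      have "vars s 1 = \<tau>" using agreeD[OF I[THEN conjunct1], of 1] assms by simp
      then have 1: "\<tau> < (vars s 5 + 1) * (vars s 5 + 1)" using p(2) by simp
      have "vars s = (vars \<sigma>)(5 := vars s 5)" using I by (auto simp: agree_def)
      then have s: "s\<lparr>vars := (vars s)(6 := z), clk := c0\<rparr> = \<sigma>\<lparr>vars := (vars \<sigma>)(5 := vars s 5, 6 := z), clk := c0\<rparr>" for c0 z
        using I by (cases s; cases \<sigma>) simp
      have "vars s 5 * vars s 5 < 2 ^ w" using I t by linarith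
      then show ?thesis
        apply (simp add: wp_simps s)
        apply (rule Q)
        using I 1 sq[of "vars s 5"] by auto
    qed
    done
qed

text \<open>The bound on the time charges only for letters beyond the \<open>e\<close> already known
  to agree, which makes an amortised analysis of the scan possible.\<close>

lemma wp_extend:
  assumes v: "vars \<sigma> 4 = length T" "vars \<sigma> 7 = p" "vars \<sigma> 15 = y" "vars \<sigma> 16 = e"
    and m: "matches T y p e" and w: "2 * length T + 2 < 2 ^ w"
    and Q: "\<And>f c. agree {16, 20, 21, 22} (vars \<sigma>) f \<Longrightarrow> f 16 = lce T y p \<Longrightarrow>
      f 21 = y + lce T y p \<Longrightarrow> f 22 = p + lce T y p \<Longrightarrow>
      c + 100 * e \<le> clk \<sigma> + 150 + 100 * lce T y p \<Longrightarrow> Q (\<sigma>\<lparr>vars := f, clk := c\<rparr>)"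
  shows "wp extend Q \<sigma>"
proof -
  define I where "I = (\<lambda>s::st. agree {16, 20, 21, 22} (vars \<sigma>) (vars s) \<and> arrs s = arrs \<sigma> \<and> tape s = tape \<sigma> \<and>
    matches T y p (vars s 16) \<and> (vars s 20 = 0 \<longrightarrow> vars s 16 = lce T y p \<and>
      vars s 21 = y + lce T y p \<and> vars s 22 = p + lce T y p) \<and>
    clk s + 100 * e \<le> clk \<sigma> + 10 + 100 * vars s 16 + (if vars s 20 = 0 then 100 else 0))"
  have yp: "y \<le> length T" "p \<le> length T" using m by (auto simp: matches_def)
  show ?thesis
    unfolding extend_def
    apply (simp add: wp_simps)
    apply (rule wp_while[where I = I and m = "\<lambda>s. length T - vars s 16 + (if vars s 20 = 0 then 0 else 1)"])
    subgoal using v m by (simp add: I_def)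
    subgoal by (simp add: I_def)
    subgoal premises q for s
    proof -
      note I = q(1)[unfolded I_def]
      note ag = agreeD[OF I[THEN conjunct1]]
      define x where "x = vars s 16"
      have x: "matches T y p x" "y + x \<le> length T" "p + x \<le> length T" "clk s + 100 * e \<le> clk \<sigma> + 10 + 100 * x"
        "y + x < 2 ^ w" "p + x < 2 ^ w" "x + 1 < 2 ^ w" "vars s 20 \<noteq> 0" "x \<le> length T"
        using I q(2) w by (auto simp: x_def matches_def)
      have I2: "agree {16, 20, 21, 22} (vars \<sigma>) (vars s)" "arrs s = arrs \<sigma>" "tape s = tape \<sigma>" using I by auto
      show ?thesis
      proof (cases "y + x < length T \<and> p + x < length T \<and> T ! (y + x) = T ! (p + x)")
        case True
        then have "matches T y p (x + 1)" using x(1) by (auto simp: matches_add) (auto simp: matches_def)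
        with True x I2 show ?thesis
          by (simp add: wp_simps I_def x_def[symmetric] ag v) linarith
      next
        case False
        then have "x = lce T y p" using x(1) lce_eqI by metis
        with False x I2 show ?thesis
          by (auto simp add: wp_simps I_def x_def[symmetric] ag v)
      qed
    qed
    subgoal premises q for s
      using Q[of "vars s" "clk s + 3"] q[unfolded I_def] by (cases s; cases \<sigma>) simp
    done
qed

lemma wp_suffix_less:
  assumes v: "vars \<sigma> 4 = length T" "vars \<sigma> 21 = y + lce T y p" "vars \<sigma> 22 = p + lce T y p"
    and yp: "y \<le> length T" "p \<le> length T"
    and Q: "\<And>c. c \<le> clk \<sigma> + 70 \<Longrightarrow> Q (\<sigma>\<lparr>vars := (vars \<sigma>)(19 := if sless T y p then 1 else 0), clk := c\<rparr>)"
  shows "wp suffix_less Q \<sigma>"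
  unfolding suffix_less_def sless_def letter_def
  using Q[unfolded sless_def letter_def] v by (auto simp add: wp_simps)

lemma wp_scan:
  assumes v: "vars \<sigma> 4 = length T" "vars \<sigma> 7 = p" "vars \<sigma> 8 = length xs"
    and xs: "insertable T xs p" "suffix_table T xs (arrs \<sigma>)"
    and fits: "length xs \<le> S" "1 < K" "2 * length T + 2 < 2 ^ w"
    and Q: "\<And>f c. agree {12..22} (vars \<sigma>) f \<Longrightarrow> left_of T xs p (f 12) (f 13) \<Longrightarrow> right_of T xs p (f 12) (f 18) \<Longrightarrow>
      c \<le> clk \<sigma> + 1000 + 400 * length xs + 200 * length T \<Longrightarrow> Q (\<sigma>\<lparr>vars := f, clk := c\<rparr>)"
  shows "wp scan Q \<sigma>"
proof -
  \<comment> \<open>The term \<open>100 * vars s 13\<close> is an amortised account: letters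
    compared in a successful step raise register 13 by as much. The comparison that stops the scan
    is charged separately, with at most \<open>length T\<close> letters.\<close>
  define I where "I = (\<lambda>s::st. agree {12..22} (vars \<sigma>) (vars s) \<and> arrs s = arrs \<sigma> \<and> tape s = tape \<sigma> \<and>
    left_of T xs p (vars s 12) (vars s 13) \<and>
    (if vars s 17 = 0 then right_of T xs p (vars s 12) (vars s 18) else vars s 12 < length xs) \<and>
    clk s \<le> clk \<sigma> + 100 + 400 * vars s 12 + 100 * vars s 13 + (if vars s 17 = 0 then 400 + 100 * length T else 0))"
  define \<mu> where "\<mu> = (\<lambda>s::st. length xs - vars s 12 + (if vars s 17 = 0 then 0 else 1))"
  have n: "xs ! k < length T" "xs ! k \<le> length T" "xs ! k \<noteq> p" if "k < length xs" for k
    using xs(1) nth_mem[OF that] by (auto simp: insertable_def)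
  have p: "p \<le> length T" using xs(1) by (simp add: insertable_def)
  have h: "h \<le> length T" if "left_of T xs p k h" for k h
  proof (cases "k = 0")
    case False
    then have "k - 1 < length xs" using that by (auto simp: left_of_def)
    with lce_le[OF n(2)[OF this] p] False that show ?thesis by (auto simp: left_of_def)
  qed (use that in \<open>simp add: left_of_def\<close>)
  have W: "length xs < 2 ^ w" "length xs + 1 < 2 ^ w"
  proof -
    have "distinct xs" using xs(1) by (auto simp: insertable_def intro: distinct_sless)
    then have "length xs = card (set xs)" by (simp add: distinct_card)
    also have "\<dots> \<le> card {..<length T}" using xs(1) by (intro card_mono) (auto simp: insertable_def)
    finally have "length xs \<le> length T" by simp
    then show "length xs < 2 ^ w" "length xs + 1 < 2 ^ w" using fits(3) by linarith+
  qed
  have K: "0 < K" using fits by simp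
  show ?thesis
    unfolding scan_def
    apply (simp add: wp_simps v split del: if_split)
    apply (rule wp_while[where I = I and m = \<mu>])
    subgoal by (simp add: I_def left_of_def right_of_def)
    subgoal by (simp add: I_def)
    subgoal premises q for s
    proof -
      note I = q(1)[unfolded I_def]
      note ag = agreeD[OF I[THEN conjunct1]]
      define k where "k = vars s 12"
      define h where "h = vars s 13"
      have I2: "agree {12..22} (vars \<sigma>) (vars s)" "arrs s = arrs \<sigma>" "tape s = tape \<sigma>" "left_of T xs p k h"
        "k < length xs" "clk s \<le> clk \<sigma> + 100 + 400 * k + 100 * h" "vars s 17 \<noteq> 0"
        using I q(2) by (auto simp: k_def h_def)
      have A: "arrs \<sigma> 0 k = xs ! k" "arrs \<sigma> 1 k = lcp_fun T xs k"
        using xs(2) I2 by (auto simp: suffix_table_def)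
      have S: "k < S" "k + 1 < 2 ^ w" using I2 fits W by linarith+
      note kn = n[OF I2(5)]
      have cont: "I \<sigma>' \<and> \<mu> \<sigma>' < \<mu> s"
        if "agree {12..22} (vars \<sigma>) (vars \<sigma>')" "arrs \<sigma>' = arrs \<sigma>" "tape \<sigma>' = tape \<sigma>"
          "left_of T xs p (k + 1) (vars \<sigma>' 13)" "vars \<sigma>' 12 = k + 1" "vars \<sigma>' 17 = (if k + 1 < length xs then 1 else 0)"
          "clk \<sigma>' \<le> clk \<sigma> + 500 + 400 * k + 100 * vars \<sigma>' 13" for \<sigma>'
        using that I2(5,7) by (auto simp: I_def right_of_def \<mu>_def k_def)
      have stop: "I \<sigma>' \<and> \<mu> \<sigma>' < \<mu> s"
        if "agree {12..22} (vars \<sigma>) (vars \<sigma>')" "arrs \<sigma>' = arrs \<sigma>" "tape \<sigma>' = tape \<sigma>"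
          "vars \<sigma>' 12 = k" "vars \<sigma>' 13 = h" "vars \<sigma>' 17 = 0" "right_of T xs p k (vars \<sigma>' 18)"
          "clk \<sigma>' + 100 * h \<le> clk s + 400 + 100 * h + 100 * length T" for \<sigma>'
        using that I2 by (auto simp: I_def \<mu>_def k_def)
      show ?thesis
      proof (cases "lcp_fun T xs k" h rule: linorder_cases)
        case less
        have "right_of T xs p k (lcp_fun T xs k)" by (rule scan_shorter[OF xs(1) I2(4,5) less])
        then show ?thesis
          using I2 S K fits(2) less
          by (simp add: wp_simps k_def[symmetric] h_def[symmetric] A) (rule stop; simp add: k_def[symmetric] h_def[symmetric])
      next
        case greater
        have "left_of T xs p (k + 1) h" by (rule scan_longer[OF xs(1) I2(4,5) greater])
        then show ?thesis
          using I2 S K fits(2) greater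
          by (simp add: wp_simps k_def[symmetric] h_def[symmetric] A ag v split del: if_split) (rule cont; simp add: k_def[symmetric] h_def[symmetric])
      next
        case equal
        note eq = scan_equal[OF xs(1) I2(4,5) equal]
        define l where "l = lce T (xs ! k) p"
        have l: "h \<le> l" "l \<le> length T"
          using eq(1) kn p lce_le[OF kn(2) p] by (auto simp: l_def matches_lce_iff)
        show ?thesis
          apply (simp add: wp_simps k_def[symmetric] h_def[symmetric] A I2 S K fits(2) equal)
          apply (rule wp_extend[where p = p and y = "xs ! k" and e = h])
                using v eq(1) fits(3) apply (simp_all add: ag)[6]
          subgoal premises r for f c
          proof -
            have agf: "agree {12..22} (vars \<sigma>) f"
              using r(1) I2(1) by (auto simp: agree_def)
            note ag' = agreeD[OF agf]
            have f: "f 12 = k" "f 13 = h" "f 17 \<noteq> 0" using r(1) I2(7) by (auto simp: agree_def k_def h_def)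
            show ?thesis
              apply (simp add: wp_simps)
              apply (rule wp_suffix_less[where y = "xs ! k" and p = p])
              using r v kn p apply (simp_all add: ag')[5]
              subgoal for c'
                using I2 S K eq l r agf f v
                apply (cases "sless T (xs ! k) p")
                 apply (simp_all add: wp_simps ag' l_def[symmetric] split del: if_split)
                 apply (rule cont; simp add: l_def)
                apply (rule stop; simp add: l_def)
                done
              done
          qed
          done
      qed
    qed
    subgoal premises q for s
    proof -
      note I = q(1)[unfolded I_def]
      have "vars s 12 \<le> length xs" using I by (auto simp: left_of_def)
      moreover have "vars s 13 \<le> length T" using I h by blast
      ultimately show ?thesis
        using Q[of "vars s" "clk s + 3"] q(2) I by (cases s; cases \<sigma>) simp
    qed
    done
qed

lemma wp_shift:
  assumes v: "vars \<sigma> 7 = p" "vars \<sigma> 8 = length xs" "vars \<sigma> 12 = k" "left_of T xs p k (vars \<sigma> 13)"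
      "right_of T xs p k (vars \<sigma> 18)"
    and xs: "suffix_table T xs (arrs \<sigma>)"
    and fits: "length xs < S" "1 < K" "length xs + 1 < 2 ^ w"
    and Q: "\<And>f A c. agree {8, 14} (vars \<sigma>) f \<Longrightarrow> f 8 = length xs + 1 \<Longrightarrow> agree {0, 1} (arrs \<sigma>) A \<Longrightarrow>
      suffix_table T (take k xs @ p # drop k xs) A \<Longrightarrow>
      c \<le> clk \<sigma> + 200 + 100 * length xs \<Longrightarrow> Q (\<sigma>\<lparr>vars := f, arrs := A, clk := c\<rparr>)"
  shows "wp shift Q \<sigma>"
proof -
  define I where "I = (\<lambda>s::st. agree {14} (vars \<sigma>) (vars s) \<and> agree {0, 1} (arrs \<sigma>) (arrs s) \<and> tape s = tape \<sigma> \<and>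
    k \<le> vars s 14 \<and> vars s 14 \<le> length xs \<and>
    (\<forall>j\<le>vars s 14. j < length xs \<longrightarrow> arrs s 0 j = xs ! j \<and> arrs s 1 j = lcp_fun T xs j) \<and>
    (\<forall>j\<le>length xs. vars s 14 < j \<longrightarrow> arrs s 0 j = xs ! (j - 1) \<and> arrs s 1 j = lcp_fun T xs (j - 1)) \<and>
    clk s + 100 * vars s 14 \<le> clk \<sigma> + 20 + 100 * length xs)"
  have k: "k \<le> length xs" using v(4) by (simp add: left_of_def)
  have K: "0 < K" using fits by simp
  have w: "length xs < 2 ^ w" using fits by simp
  show ?thesis
    unfolding shift_def
    apply (simp add: wp_simps v)
    apply (rule wp_while[where I = I and m = "\<lambda>s. vars s 14"])
    subgoal using v k xs by (simp add: I_def suffix_table_def)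
    subgoal by (simp add: I_def)
    subgoal premises q for s
    proof -
      note I = q(1)[unfolded I_def]
      have "vars s 12 = k" using agreeD[OF I[THEN conjunct1], of 12] v by simp
      then obtain i where i: "vars s 14 = Suc i" "k \<le> i" using q(2) by (cases "vars s 14") auto
      have *: "\<forall>j\<le>i. arrs s 0 j = xs ! j \<and> arrs s 1 j = lcp_fun T xs j" "i < length xs" "Suc i < S" "i < S"
        "Suc i < 2 ^ w"
        "\<forall>j\<le>length xs. Suc i < j \<longrightarrow> arrs s 0 j = xs ! (j - 1) \<and> arrs s 1 j = lcp_fun T xs (j - 1)"
        using I i fits w by auto
      have 1: "agree {14} (vars \<sigma>) (vars s)" "agree {0, 1} (arrs \<sigma>) (arrs s)" "tape s = tape \<sigma>"
        "clk s + 100 * Suc i \<le> clk \<sigma> + 20 + 100 * length xs" using I i(1) by auto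
      have Ii: "I s'" if "agree {14} (vars \<sigma>) (vars s')" "agree {0, 1} (arrs \<sigma>) (arrs s')" "tape s' = tape \<sigma>"
        "vars s' 14 = i" "arrs s' 0 = (arrs s 0)(Suc i := xs ! i)" "arrs s' 1 = (arrs s 1)(Suc i := lcp_fun T xs i)"
        "clk s' \<le> clk s + 95" for s'
        using that * 1 i(2) unfolding I_def by (auto simp: less_Suc_eq)
      show ?thesis
        using fits K
        apply (simp add: wp_simps i * 1)
        apply (rule Ii)
        using * 1 by simp_all
    qed
    subgoal premises q for s
    proof -
      note I = q(1)[unfolded I_def]
      note ag = agreeD[OF I[THEN conjunct1]]
      have i: "vars s 14 = k" using q(2) I v by (simp add: ag)
      define A where "A = (arrs s)(0 := (arrs s 0)(k := p), 1 := (arrs s 1)(k := vars \<sigma> 13))"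
      define A' where "A' = (if k < length xs then A(1 := (A 1)(k + 1 := vars \<sigma> 18)) else A)"
      have st: "suffix_table T (take k xs @ p # drop k xs) A'"
        unfolding suffix_table_def
      proof (intro allI impI)
        fix j assume "j < length (take k xs @ p # drop k xs)"
        then have j: "j \<le> length xs" using k by simp
        have "arrs s 0 j = xs ! j" "arrs s 1 j = lcp_fun T xs j" if "j < k" using I i that k by auto
        moreover have "arrs s 0 j = xs ! (j - 1)" "arrs s 1 j = lcp_fun T xs (j - 1)" if "k < j" using I i that j by auto
        ultimately show "A' 0 j = (take k xs @ p # drop k xs) ! j \<and> A' 1 j = lcp_fun T (take k xs @ p # drop k xs) j"
          using v(4,5) j k unfolding lcp_fun_insert[OF k j]
          by (cases j k rule: linorder_cases) (auto simp: A'_def A_def left_of_def right_of_def nth_append nth_Cons')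
      qed
      have ag0: "agree {0, 1} (arrs \<sigma>) A'" "agree {8, 14} (vars \<sigma>) ((vars s)(8 := length xs + 1))"
        using I by (auto simp: A'_def A_def agree_def)
      have fin: "Q s'" if "vars s' = (vars s)(8 := length xs + 1)" "arrs s' = A'" "tape s' = tape \<sigma>"
        "clk s' \<le> clk s + 100" for s'
      proof -
        have "clk s' \<le> clk \<sigma> + 200 + 100 * length xs" using I that by linarith
        from Q[OF ag0(2) _ ag0(1) st this] show ?thesis using that by (cases s'; cases \<sigma>) simp
      qed
      have t: "tape s = tape \<sigma>" using I by blast
      show ?thesis
        using fits K k w
        by (auto simp add: wp_simps ag v t A'_def A_def intro!: fin)
    qed
    done
qed

lemma ecost_sampled_exp [simp]: "ecost (sampled_exp x) = 21"
  by (simp add: sampled_exp_def)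

lemma ev_sampled_exp:
  assumes "vars \<sigma> 5 = s" "vars \<sigma> 6 = s * s" "x < TMP"
  shows "ev (sampled_exp x) \<sigma> = (if sampled s (vars \<sigma> x) then 1 else 0)" "ok (sampled_exp x) \<sigma>"
  using assms by (simp_all add: sampled_exp_def sampled_def)

lemma wp_sort_samples:
  assumes v: "vars \<sigma> 4 = length T" "vars \<sigma> 5 = s" "vars \<sigma> 6 = s * s" "0 < s"
    and fits: "slots s (length T) \<le> S" "1 < K" "2 * length T + 2 < 2 ^ w"
    and Q: "\<And>f A c xs. agree ({7, 8} \<union> {12..22}) (vars \<sigma>) f \<Longrightarrow> f 8 = length xs \<Longrightarrow> agree {0, 1} (arrs \<sigma>) A \<Longrightarrow>
      suffix_table T xs A \<Longrightarrow> sorted_wrt (sless T) xs \<Longrightarrow> set xs = {p. p < length T \<and> sampled s p} \<Longrightarrow>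
      c \<le> clk \<sigma> + 100 + 100 * length T + length xs * (2000 + 700 * length T) \<Longrightarrow>
      Q (\<sigma>\<lparr>vars := f, arrs := A, clk := c\<rparr>)"
  shows "wp sort_samples Q \<sigma>"
proof -
  define J where "J = (\<lambda>k (f :: nat \<Rightarrow> nat) (A :: nat \<Rightarrow> nat \<Rightarrow> nat). \<exists>xs. suffix_table T xs A \<and> sorted_wrt (sless T) xs \<and>
    set xs = {p. p < k \<and> sampled s p} \<and> f 8 = length xs)"
  \<comment> \<open>An insertion costs \<open>O(n)\<close> and is charged to sampled positions only;
    any other position costs just the test.\<close>
  define D where "D = (\<lambda>k. 70 + (if sampled s k then 1300 + 700 * length T else 0))"
  have len: "length xs = card {p. p < k \<and> sampled s p}" if "sorted_wrt (sless T) xs" "set xs = {p. p < k \<and> sampled s p}" for xs k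
    using distinct_card[OF distinct_sless[OF that(1)]] that(2) by simp
  have fin: "finite {p. p < k \<and> sampled s p}" for k by simp
  have w: "length T < 2 ^ w" using fits by simp
  show ?thesis
    unfolding sort_samples_def
    apply (simp add: wp_simps)
    apply (rule wp_for_loop[where X = "{7, 8} \<union> {12..22}" and Y = "{0, 1}" and M = "length T" and J = J and D = D])
    using v w apply simp_all[7]
    subgoal by (auto simp: J_def suffix_table_def)
    subgoal premises p for k f A c0
    proof -
      obtain xs where xs: "suffix_table T xs A" "sorted_wrt (sless T) xs" "set xs = {p. p < k \<and> sampled s p}" "f 8 = length xs"
        using p(6) by (auto simp: J_def)
      have ag0: "agree ({7, 8} \<union> {12..22}) (vars \<sigma>) f" "agree {0, 1} (arrs \<sigma>) A"
        using p(3,4) by (simp_all add: agree_def)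
      note ag = agreeD[OF ag0(1)]
      have f7: "f 7 = k" using p(5) by simp
      have ins: "insertable T xs k" using xs p(2) by (auto simp: insertable_def)
      have lenT: "length xs \<le> length T"
      proof -
        have "set xs \<subseteq> {..<length T}" unfolding xs(3) using p(2) by (simp add: subset_eq)
        from card_mono[OF finite_lessThan this] show ?thesis using distinct_card[OF distinct_sless[OF xs(2)]] by simp
      qed
      show ?thesis
      proof (cases "sampled s k")
        case True
        have "length xs + 1 = card (insert k {p. p < k \<and> sampled s p})"
          using len[OF xs(2,3)] by (subst card_insert_disjoint) auto
        also have "\<dots> \<le> card {p. p < length T \<and> sampled s p}"
          using True p(2) by (intro card_mono) auto
        also have "\<dots> \<le> slots s (length T)" using card_sampled v(4) by blast
        finally have lenS: "length xs < S" using fits by simp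
        show ?thesis
          apply (simp add: wp_simps ev_sampled_exp[where s = s] True v ag f7)
          apply (rule wp_scan[where p = k and xs = xs])
          using xs f7 v ins lenS fits apply (simp_all add: ag)[8]
          subgoal premises q for g c1
          proof -
            have g: "g 7 = k" "g 8 = length xs" "g 4 = length T" "g 5 = s"
              using q(1) f7 xs(4) v by (simp_all add: agree_def ag)
            have kx: "g 12 \<le> length xs" using q(2) by (simp add: left_of_def)
            show ?thesis
              apply (rule wp_shift[where p = k and xs = xs and k = "g 12"])
              using g q xs lenS fits lenT apply simp_all[9]
              subgoal premises r for g' A' c2
              proof -
                let ?ys = "take (g 12) xs @ k # drop (g 12) xs"
                have lr: "g 12 < length xs \<Longrightarrow> sless T k (xs ! g 12)" "0 < g 12 \<Longrightarrow> sless T (xs ! (g 12 - 1)) k"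
                  using q(2,3) by (auto simp: left_of_def right_of_def)
                have so: "sorted_wrt (sless T) ?ys"
                  using xs p(2) kx lr by (intro sorted_insert) auto
                have "set ?ys = insert k (set xs)"
                  by (metis append_take_drop_id list.set(2) set_append Un_insert_right)
                then have se: "set ?ys = {p. p < k + 1 \<and> sampled s p}"
                  using True by (simp only: Collect_less_Suc xs(3) if_True)
                have "J (k + 1) (g'(7 := k + 1)) A'"
                  using so se r(2,4) kx unfolding J_def by (intro exI[of _ ?ys]) simp
                moreover have "agree ({7, 8} \<union> {12..22}) (vars \<sigma>) g'" "agree {0, 1} (arrs \<sigma>) A'"
                  using r(1,3) q(1) ag0 by (auto simp: agree_def)
                moreover have "g' 7 = k" using r(1) g by (simp add: agree_def)
                moreover have "c2 \<le> c0 + D k" using r(5) q(4) lenT True by (simp add: D_def)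
                ultimately show ?thesis by (simp add: agree_def)
              qed
              done
          qed
          done
      next
        case False
        have "{p. p < k + 1 \<and> sampled s p} = {p. p < k \<and> sampled s p}"
          using False by (simp only: Collect_less_Suc if_False)
        then have "J (k + 1) (f(7 := k + 1)) A" unfolding J_def using xs by auto
        with False v show ?thesis
          using p(3,4) by (simp add: wp_simps ev_sampled_exp[where s = s] ag f7 D_def)
      qed
    qed
    subgoal premises p for f A c'
    proof -
      obtain xs where xs: "suffix_table T xs A" "sorted_wrt (sless T) xs"
          "set xs = {p. p < length T \<and> sampled s p}" "f 8 = length xs"
        using p(4) by (auto simp: J_def)
      have "(\<Sum>i<length T. (if sampled s i then z else 0)) = card {p. p < length T \<and> sampled s p} * z" for z :: nat
        by (simp add: sum.If_cases Collect_conj_eq lessThan_def)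
      then have "(\<Sum>i=0..<length T. D i + 20) = 90 * length T + length xs * (1300 + 700 * length T)"
        unfolding len[OF xs(2,3)] D_def by (simp add: sum.distrib atLeast0LessThan)
      then have "c' \<le> clk \<sigma> + 100 + 100 * length T + length xs * (2000 + 700 * length T)"
        using p(5) by (simp add: algebra_simps)
      moreover have "agree ({7, 8} \<union> {12..22}) (vars \<sigma>) f" "agree {0, 1} (arrs \<sigma>) A"
        using p(1,2) by (simp_all add: agree_def)
      ultimately show ?thesis using Q[of f xs A c'] xs by (cases \<sigma>) simp
    qed
    done
qed

end

section \<open>Range minimum tables\<close>

definition slot_number :: hcom where
  "slot_number = (IF V 15 \<^bold>% V 5 \<^bold>= N 0 THEN 16 ::= N 2 \<^bold>* (V 15 \<^bold>/ V 5)
     ELSE 16 ::= N 2 \<^bold>* (V 15 \<^bold>/ V 6 \<^bold>* V 5 \<^bold>+ V 15 \<^bold>% V 6) \<^bold>+ N 1)"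

definition fill_inverse :: hcom where
  "fill_inverse = (7 ::= N 0;; for_loop 7 8 (15 ::= Ld 0 (V 7);; slot_number;; Sto 2 (V 16) (V 7)))"

text \<open>Blocks have logarithmic length. The sparse table then has
  \<open>b * (m div b + 1) \<le> 2 * m\<close> entries, and masks of \<open>b\<close> bits index a
  table of logarithms of size \<open>2 ^ b \<le> 2 * m\<close>.\<close>

definition block_size :: hcom where
  "block_size = (10 ::= V 8;; bitlength;; 9 ::= V 11;; 23 ::= V 8 \<^bold>/ V 9 \<^bold>+ N 1;; 24 ::= Bop Shl (N 1) (V 9))"

definition fill_logs :: hcom where
  "fill_logs = (Sto 3 (N 0) (N 0);; 7 ::= N 1;; for_loop 7 24 (Sto 3 (V 7) (Ld 3 (V 7 \<^bold>/ N 2) \<^bold>+ N 1)))"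

text \<open>Register 27 is the running minimum over the distances seen so far. It starts with the
  text length, an upper bound on all LCP values, so distance 0 is always marked.\<close>

definition fill_marks :: hcom where
  "fill_marks = (7 ::= N 0;; for_loop 7 8 (
     25 ::= V 9;; IF V 7 \<^bold>+ N 1 \<^bold>< V 25 THEN 25 ::= V 7 \<^bold>+ N 1 ELSE SKIP;;
     26 ::= N 0;; 27 ::= V 4;; 10 ::= N 0;;
     for_loop 10 25 (28 ::= Ld 1 (V 7 \<^bold>- V 10);;
       IF V 28 \<^bold>< V 27 \<^bold>+ N 1 THEN (26 ::= V 26 \<^bold>+ Bop Shl (N 1) (V 10);; 27 ::= V 28) ELSE SKIP);;
     Sto 4 (V 7) (V 26)))"

text \<open>Entry \<open>e * V 23 + x\<close> belongs to the \<open>2 ^ e\<close> blocks from block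
  \<open>x\<close> on. Each entry is computed by a direct pass over its range; the total is
  quadratic in the number of samples, which is within the time available.\<close>

definition fill_sparse :: hcom where
  "fill_sparse = (24 ::= V 9 \<^bold>* V 23;; 7 ::= N 0;; for_loop 7 24 (
     25 ::= V 7 \<^bold>/ V 23;; 26 ::= V 7 \<^bold>% V 23;; 27 ::= V 4;; 10 ::= V 26 \<^bold>* V 9;;
     28 ::= (V 26 \<^bold>+ Bop Shl (N 1) (V 25)) \<^bold>* V 9;; IF V 8 \<^bold>< V 28 THEN 28 ::= V 8 ELSE SKIP;;
     for_loop 10 28 (29 ::= Ld 1 (V 10);; IF V 29 \<^bold>< V 27 THEN 27 ::= V 29 ELSE SKIP);;
     Sto 5 (V 7) (V 27)))"

text \<open>Ranges reaching beyond the last rank carry no requirement; queries read only entries for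
  complete blocks.\<close>

definition sparse_ok :: "(nat \<Rightarrow> nat) \<Rightarrow> nat \<Rightarrow> nat \<Rightarrow> nat \<Rightarrow> nat \<Rightarrow> nat \<Rightarrow> bool" where
  "sparse_ok g m b e x y \<longleftrightarrow> ((x + 2 ^ e) * b \<le> m \<longrightarrow> is_min g (x * b) ((x + 2 ^ e) * b - 1) y)"

definition rmq_table :: "(nat \<Rightarrow> nat) \<Rightarrow> nat \<Rightarrow> nat \<Rightarrow> (nat \<Rightarrow> nat \<Rightarrow> nat) \<Rightarrow> bool" where
  "rmq_table g m b A \<longleftrightarrow> (\<forall>x<2 ^ b. A 3 x = floorlog 2 x) \<and>
     (\<forall>r<m. A 4 r = marks g r (min b (r + 1))) \<and>
     (\<forall>i<b * (m div b + 1). sparse_ok g m b (i div (m div b + 1)) (i mod (m div b + 1)) (A 5 i))"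

lemma block_facts:
  assumes "1 \<le> m" "b = floorlog 2 m"
  shows "1 \<le> b" "m < 2 ^ b" "2 ^ b \<le> 2 * m" "b \<le> m" "b * (m div b + 1) \<le> 2 * m"
proof -
  have m: "m \<noteq> 0" using assms by linarith
  have "b \<noteq> 0" using m assms by (simp add: floorlog_eq_zero_iff)
  then show b: "1 \<le> b" by linarith
  have B: "2 ^ (b - 1) \<le> m" "m < 2 ^ b" using floorlog_bounds[of m 2] m assms by auto
  then show "m < 2 ^ b" by simp
  have "(2::nat) ^ b = 2 * 2 ^ (b - 1)" using \<open>b \<noteq> 0\<close> by (simp add: power_eq_if)
  then show "2 ^ b \<le> 2 * m" using B by linarith
  show bm: "b \<le> m" using floorlog_le_self[of m] assms by simp
  have "b * (m div b) \<le> m" by simp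
  then show "b * (m div b + 1) \<le> 2 * m" using bm unfolding add_mult_distrib2 by linarith
qed

text \<open>\<open>x\<close> plays the minimum of the last \<open>d\<close> values, described by its
  lower bounds up to \<open>n\<close>. This form also covers the empty window \<open>d = 0\<close>,
  for which it says \<open>n \<le> x\<close>. The last two parts tell which value takes that role
  for \<open>d + 1\<close>.\<close>

lemma marked_iff:
  assumes "d \<le> r" "\<And>v. v \<le> n \<Longrightarrow> v \<le> x \<longleftrightarrow> (\<forall>u. r < u + d \<and> u \<le> r \<longrightarrow> v \<le> g u)" "g (r - d) \<le> n"
  shows "marked g r d \<longleftrightarrow> g (r - d) \<le> x"
    and "marked g r d \<Longrightarrow> v \<le> n \<Longrightarrow> v \<le> g (r - d) \<longleftrightarrow> (\<forall>u. r < u + (d + 1) \<and> u \<le> r \<longrightarrow> v \<le> g u)"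
    and "\<not> marked g r d \<Longrightarrow> v \<le> n \<Longrightarrow> v \<le> x \<longleftrightarrow> (\<forall>u. r < u + (d + 1) \<and> u \<le> r \<longrightarrow> v \<le> g u)"
proof -
  have split: "(\<forall>u. r - d \<le> u \<and> u \<le> r \<longrightarrow> P u) \<longleftrightarrow> P (r - d) \<and> (\<forall>u. r < u + d \<and> u \<le> r \<longrightarrow> P u)" for P
  proof (intro iffI conjI allI impI)
    fix u assume *: "P (r - d) \<and> (\<forall>u. r < u + d \<and> u \<le> r \<longrightarrow> P u)" "r - d \<le> u \<and> u \<le> r"
    show "P u"
    proof (cases "u = r - d")
      case False
      then have "r < u + d" using *(2) by linarith
      then show ?thesis using * by blast
    qed (use * in blast)
  qed auto
  have split': "(\<forall>u. r < u + (d + 1) \<and> u \<le> r \<longrightarrow> P u) \<longleftrightarrow> P (r - d) \<and> (\<forall>u. r < u + d \<and> u \<le> r \<longrightarrow> P u)" for P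
    unfolding split[symmetric] using assms(1) by (metis less_diff_conv2 Suc_eq_plus1 add_Suc_right diff_le_self le_diff_conv less_Suc_eq_le)
  show m: "marked g r d \<longleftrightarrow> g (r - d) \<le> x"
    unfolding marked_def split using assms(2,3) by simp
  show "v \<le> g (r - d) \<longleftrightarrow> (\<forall>u. r < u + (d + 1) \<and> u \<le> r \<longrightarrow> v \<le> g u)" if "marked g r d" "v \<le> n"
    unfolding split' using m that assms(2)[OF that(2)] by (meson order_trans)
  show "v \<le> x \<longleftrightarrow> (\<forall>u. r < u + (d + 1) \<and> u \<le> r \<longrightarrow> v \<le> g u)" if "\<not> marked g r d" "v \<le> n"
    unfolding split' using m that assms(2)[OF that(2)] by (meson order_trans nat_le_linear)
qed

context machine
begin

lemma wp_slot_number: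
  assumes v: "vars \<sigma> 5 = s" "vars \<sigma> 6 = s * s" "vars \<sigma> 15 = p" "sampled s p" "0 < s" "slots s (p + 1) < 2 ^ w"
    and Q: "\<And>c. c \<le> clk \<sigma> + 70 \<Longrightarrow> Q (\<sigma>\<lparr>vars := (vars \<sigma>)(16 := slot s p), clk := c\<rparr>)"
  shows "wp slot_number Q \<sigma>"
proof -
  have lt: "slot s p < 2 ^ w" using slot_less[OF v(5,4), of "p + 1"] v(6) by simp
  show ?thesis
  proof (cases "p mod s = 0")
    case True
    then have "slot s p = 2 * (p div s)" by (simp add: slot_def)
    with True lt show ?thesis
      unfolding slot_number_def using Q v by (simp add: wp_simps)
  next
    case False
    then have *: "slot s p = 2 * (p div (s * s) * s + p mod (s * s)) + 1" by (simp add: slot_def)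
    define X Y where "X = p div (s * s) * s + p mod (s * s)" and "Y = p div (s * s) * s"
    have "Y \<le> X" by (simp add: X_def Y_def)
    with lt * have "2 * X < 2 ^ w" "X < 2 ^ w" "Y < 2 ^ w" "2 * X + 1 < 2 ^ w"
      unfolding X_def[symmetric] by linarith+
    then have "2 * (p div (s * s) * s + p mod (s * s)) < 2 ^ w" "p div (s * s) * s + p mod (s * s) < 2 ^ w"
      "p div (s * s) * s < 2 ^ w" "2 * (p div (s * s) * s + p mod (s * s)) + 1 < 2 ^ w" unfolding X_def Y_def .
    with False show ?thesis
      unfolding slot_number_def using Q v * by (simp add: wp_simps)
  qed
qed

lemma wp_fill_inverse:
  assumes v: "vars \<sigma> 5 = s" "vars \<sigma> 6 = s * s" "vars \<sigma> 8 = length xs" "0 < s"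
    and xs: "\<And>i. i < length xs \<Longrightarrow> arrs \<sigma> 0 i = xs ! i" "distinct xs" "\<And>x. x \<in> set xs \<Longrightarrow> x < n \<and> sampled s x"
    and fits: "slots s n \<le> S" "slots s n < 2 ^ w" "length xs \<le> S" "length xs < 2 ^ w" "2 < K"
    and Q: "\<And>f A c. agree {7, 15, 16} (vars \<sigma>) f \<Longrightarrow> agree {2} (arrs \<sigma>) A \<Longrightarrow>
      (\<And>i. i < length xs \<Longrightarrow> A 2 (slot s (xs ! i)) = i) \<Longrightarrow> c \<le> clk \<sigma> + 50 + 200 * length xs \<Longrightarrow>
      Q (\<sigma>\<lparr>vars := f, arrs := A, clk := c\<rparr>)"
  shows "wp fill_inverse Q \<sigma>"
proof -
  define J where "J = (\<lambda>k (f :: nat \<Rightarrow> nat) (A :: nat \<Rightarrow> nat \<Rightarrow> nat). \<forall>i<k. A 2 (slot s (xs ! i)) = i)"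
  have K: "0 < K" using fits by simp
  show ?thesis
    unfolding fill_inverse_def
    apply (simp add: wp_simps)
    apply (rule wp_for_loop[where X = "{7, 15, 16}" and Y = "{2}" and M = "length xs" and J = J and D = "\<lambda>_. 150"])
    using v fits apply simp_all[7]
    subgoal by (simp add: J_def)
    subgoal premises p for k f A c0
    proof -
      have ag0: "agree {7, 15, 16} (vars \<sigma>) f" "agree {2} (arrs \<sigma>) A"
        using p(3,4) by (simp_all add: agree_def)
      note ag = agreeD[OF ag0(1)] agreeD[OF ag0(2)]
      have k: "k < length xs" "k < S" "f 7 = k" using p fits by simp_all
      note x = xs(3)[OF nth_mem[OF k(1)]]
      have sl: "slot s (xs ! k) < slots s n" using slot_less v(4) x by blast
      have sl2: "slots s (xs ! k + 1) < 2 ^ w"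
      proof -
        have "(xs ! k + 1) div s \<le> n div s" using x by (intro div_le_mono) simp
        then have "slots s (xs ! k + 1) \<le> slots s n" by (simp add: slots_def)
        then show ?thesis using fits by linarith
      qed
      have J: "J (k + 1) g A'" if "A' 2 = (A 2)(slot s (xs ! k) := k)" for g A'
        unfolding J_def
      proof (intro allI impI)
        fix i assume i: "i < k + 1"
        show "A' 2 (slot s (xs ! i)) = i"
        proof (cases "i = k")
          case False
          then have "i < k" using i by simp
          moreover from this have "xs ! i \<noteq> xs ! k" using xs(2) k(1) by (simp add: nth_eq_iff_index_eq)
          then have "slot s (xs ! i) \<noteq> slot s (xs ! k)"
            using slot_inj[OF v(4)] xs(3) k(1) \<open>i < k\<close> by (metis nth_mem order_less_trans)
          ultimately show ?thesis using p(6) that by (simp add: J_def)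
        qed (use that in simp)
      qed
      show ?thesis
        apply (simp add: wp_simps k K ag xs(1))
        apply (rule wp_slot_number[where s = s and p = "xs ! k"])
        using v x sl2 apply (simp_all add: ag)[6]
        subgoal for c
          using p(3,4) sl fits k by (simp add: wp_simps J)
        done
    qed
    subgoal premises p for f A c'
    proof -
      have "agree {7, 15, 16} (vars \<sigma>) f" "agree {2} (arrs \<sigma>) A"
        using p(1,2) by (simp_all add: agree_def)
      then show ?thesis using Q[of f A c'] p(4,5) by (cases \<sigma>) (simp add: J_def)
    qed
    done
qed

lemma wp_block_size:
  assumes v: "vars \<sigma> 8 = m" "1 \<le> m" "2 * m + 1 < 2 ^ w" "b = floorlog 2 m"
    and Q: "\<And>f c. agree {9, 10, 11, 23, 24} (vars \<sigma>) f \<Longrightarrow> f 9 = b \<Longrightarrow> f 23 = m div b + 1 \<Longrightarrow> f 24 = 2 ^ b \<Longrightarrow>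
      c \<le> clk \<sigma> + 100 + 50 * m \<Longrightarrow> Q (\<sigma>\<lparr>vars := f, clk := c\<rparr>)"
  shows "wp block_size Q \<sigma>"
proof -
  note b = block_facts[OF v(2,4)]
  have "m div b \<le> m" by simp
  then have "m div b + 1 < 2 ^ w" "2 ^ b < (2::nat) ^ w" "m < 2 ^ w" using v b(3) by linarith+
  then show ?thesis
    unfolding block_size_def
    apply (simp add: wp_simps v(1))
    apply (rule wp_bitlength)
    subgoal by simp
    subgoal for c
      apply (simp add: wp_simps v(1) v(4)[symmetric])
      apply (rule Q)
      using b(4) by (simp_all add: v(4)[symmetric])
    done
qed

lemma wp_fill_logs:
  assumes v: "vars \<sigma> 24 = M" "1 \<le> M" "M \<le> S" "M < 2 ^ w" "3 < K"
    and Q: "\<And>f A c. agree {7} (vars \<sigma>) f \<Longrightarrow> agree {3} (arrs \<sigma>) A \<Longrightarrow> (\<And>x. x < M \<Longrightarrow> A 3 x = floorlog 2 x) \<Longrightarrow>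
      c \<le> clk \<sigma> + 100 + 100 * M \<Longrightarrow> Q (\<sigma>\<lparr>vars := f, arrs := A, clk := c\<rparr>)"
  shows "wp fill_logs Q \<sigma>"
proof -
  define J where "J = (\<lambda>k (f :: nat \<Rightarrow> nat) (A :: nat \<Rightarrow> nat \<Rightarrow> nat). \<forall>x<k. A 3 x = floorlog 2 x)"
  have S0: "0 < S" using v by linarith
  show ?thesis
    unfolding fill_logs_def
    apply (simp add: wp_simps v S0)
    apply (rule wp_for_loop[where X = "{7}" and Y = "{3}" and M = M and J = J and D = "\<lambda>_. 80"])
    using v apply simp_all[7]
    subgoal by (simp add: J_def floorlog_eq_zero_iff)
    subgoal premises p for k f A c0
    proof -
      have k: "k < M" "k < S" "1 \<le> k" "k div 2 < k" "k div 2 < S" "f 7 = k" using p v by auto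
      have fl: "floorlog 2 k = floorlog 2 (k div 2) + 1" using k by (intro floorlog_half) linarith
      have "floorlog 2 k < 2 ^ w" using floorlog_le_self[of k] k v(4) by linarith
      moreover have "A 3 (k div 2) = floorlog 2 (k div 2)" using p(6) k by (simp add: J_def)
      moreover have "J (k + 1) (f(7 := k + 1)) (A(3 := (A 3)(k := floorlog 2 (k div 2) + 1)))"
        using p(6) fl by (auto simp: J_def less_Suc_eq simp flip: Suc_eq_plus1)
      ultimately show ?thesis
        using p(3,4) k v fl by (simp add: wp_simps)
    qed
    subgoal premises p for f A c'
    proof -
      have "agree {7} (vars \<sigma>) f" "agree {3} (arrs \<sigma>) A"
        using p(1,2) by (simp_all add: agree_def)
      then show ?thesis using Q[of f A c'] p(4,5) by (cases \<sigma>) (simp add: J_def)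
    qed
    done
qed

lemma wp_fill_marks:
  assumes v: "vars \<sigma> 4 = n" "vars \<sigma> 8 = m" "vars \<sigma> 9 = b" "1 \<le> m" "b = floorlog 2 m"
    and g: "\<And>i. i < m \<Longrightarrow> arrs \<sigma> 1 i = g i" "\<And>i. i < m \<Longrightarrow> g i \<le> n"
    and fits: "m \<le> S" "2 * m + 1 < 2 ^ w" "n + 1 < 2 ^ w" "4 < K"
    and Q: "\<And>f A c. agree {7, 10, 25, 26, 27, 28} (vars \<sigma>) f \<Longrightarrow> agree {4} (arrs \<sigma>) A \<Longrightarrow>
      (\<And>r. r < m \<Longrightarrow> A 4 r = marks g r (min b (r + 1))) \<Longrightarrow>
      c \<le> clk \<sigma> + 50 + m * (150 + 100 * m) \<Longrightarrow> Q (\<sigma>\<lparr>vars := f, arrs := A, clk := c\<rparr>)"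
  shows "wp fill_marks Q \<sigma>"
proof -
  define J where "J = (\<lambda>k (f :: nat \<Rightarrow> nat) (A :: nat \<Rightarrow> nat \<Rightarrow> nat). \<forall>r<k. A 4 r = marks g r (min b (r + 1)))"
  define I where "I = (\<lambda>r d (f :: nat \<Rightarrow> nat) (A :: nat \<Rightarrow> nat \<Rightarrow> nat). f 26 = marks g r d \<and> f 27 \<le> n \<and>
    (\<forall>v\<le>n. v \<le> f 27 \<longleftrightarrow> (\<forall>u. r < u + d \<and> u \<le> r \<longrightarrow> v \<le> g u)))"
  note b = block_facts[OF v(4,5)]
  have K: "1 < K" using fits by simp
  let ?X = "{7, 10, 25, 26, 27, 28}"
  show ?thesis
    unfolding fill_marks_def
    apply (simp add: wp_simps)
    apply (rule wp_for_loop[where X = ?X and Y = "{4}" and M = m and J = J and D = "\<lambda>_. 120 + 100 * m"])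
    using v fits apply simp_all[7]
    subgoal by (simp add: J_def)
    subgoal premises p for r f A c0
    proof -
      have ag0: "agree ?X (vars \<sigma>) f" "agree {4} (arrs \<sigma>) A"
        using p(3,4) by (simp_all add: agree_def)
      note ag = agreeD[OF ag0(1)] agreeD[OF ag0(2)]
      have r: "r < m" "r < S" "r + 1 < 2 ^ w" "f 7 = r" "b < 2 ^ w" using p fits b by simp_all
      define d where "d = min b (r + 1)"
      have d: "d \<le> b" "d \<le> r + 1" "d < 2 ^ w" "d \<le> m" using r b by (auto simp: d_def)
      have body: "wp (for_loop 10 25 (28 ::= Ld 1 (V 7 \<^bold>- V 10);;
          IF V 28 \<^bold>< V 27 \<^bold>+ N 1 THEN (26 ::= V 26 \<^bold>+ Bop Shl (N 1) (V 10);; 27 ::= V 28) ELSE SKIP))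
          R s'" if s': "agree ?X (vars \<sigma>) (vars s')" "arrs s' = A" "vars s' 7 = r" "vars s' 25 = d" "vars s' 26 = 0" "vars s' 27 = n"
            "vars s' 10 = 0"
          and R: "\<And>f' c'. agree ?X (vars \<sigma>) f' \<Longrightarrow> f' 7 = r \<Longrightarrow> f' 26 = marks g r d \<Longrightarrow>
            c' \<le> clk s' + 10 + 95 * m \<Longrightarrow> R (s'\<lparr>vars := f', clk := c'\<rparr>)" for R s'
      proof (rule wp_for_loop[where X = "{10, 26, 27, 28}" and Y = "{}" and M = d and J = "I r" and D = "\<lambda>_. 75"])
        show "I r (vars s' 10) (vars s') (arrs s')" using s' by (auto simp: I_def)
        fix k f2 A2 c2
        assume q: "vars s' 10 \<le> k" "k < d" "agree {10, 26, 27, 28} (vars s') f2" "agree {} (arrs s') A2" "f2 10 = k" "I r k f2 A2"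
        have A2: "A2 = A" using q(4) s' by (auto simp: agree_def)
        have kr: "k \<le> r" "r - k < m" "r - k < S" "k < b" using q(2) d r fits by linarith+
        have f2: "f2 7 = r" "f2 10 = k" using q(3,5) s' by (simp_all add: agree_def)
        have Iq: "f2 26 = marks g r k" "f2 27 \<le> n" "\<And>v. v \<le> n \<Longrightarrow> v \<le> f2 27 \<longleftrightarrow> (\<forall>u. r < u + k \<and> u \<le> r \<longrightarrow> v \<le> g u)"
          using q(6) by (auto simp: I_def)
        have mk: "marked g r k \<longleftrightarrow> g (r - k) \<le> f2 27"
          "\<And>v. marked g r k \<Longrightarrow> v \<le> n \<Longrightarrow> v \<le> g (r - k) \<longleftrightarrow> (\<forall>u. r < u + (k + 1) \<and> u \<le> r \<longrightarrow> v \<le> g u)"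
          "\<And>v. \<not> marked g r k \<Longrightarrow> v \<le> n \<Longrightarrow> v \<le> f2 27 \<longleftrightarrow> (\<forall>u. r < u + (k + 1) \<and> u \<le> r \<longrightarrow> v \<le> g u)"
          using marked_iff[OF kr(1), of n "f2 27" g] Iq(3) g(2)[OF kr(2)] by blast+
        have "(2::nat) ^ k < 2 ^ b" using kr by simp
        then have W: "(2::nat) ^ k < 2 ^ w" "f2 27 + 1 < 2 ^ w" "r < 2 ^ w" using b fits Iq r by linarith+
        have "marks g r k + 2 ^ k < 2 ^ Suc k" using marks_less[of g r k] by simp
        moreover have "(2::nat) ^ Suc k \<le> 2 ^ b" using kr by (intro power_increasing) auto
        ultimately have W2: "marks g r k + 2 ^ k < 2 ^ w" using b fits by linarith
        have Ik: "I r (k + 1) f3 A2" if "f3 26 = marks g r k + (if marked g r k then 2 ^ k else 0)"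
            "f3 27 = (if marked g r k then g (r - k) else f2 27)" for f3
          unfolding I_def
        proof (intro conjI allI impI)
          show "f3 26 = marks g r (k + 1)" using that by (simp flip: Suc_eq_plus1)
          show "f3 27 \<le> n" using that g(2)[OF kr(2)] Iq(2) by simp
          show "v \<le> f3 27 \<longleftrightarrow> (\<forall>u. r < u + (k + 1) \<and> u \<le> r \<longrightarrow> v \<le> g u)" if "v \<le> n" for v
            using mk(2,3)[OF _ that] \<open>f3 27 = _\<close> by simp
        qed
        have A1: "A 1 (r - k) = g (r - k)" using g(1)[OF kr(2)] by (simp add: ag)
        have s'2: "agree {} (arrs s') A" using s'(2) by simp
        show "wp (28 ::= Ld 1 (V 7 \<^bold>- V 10);;
          IF V 28 \<^bold>< V 27 \<^bold>+ N 1 THEN (26 ::= V 26 \<^bold>+ Bop Shl (N 1) (V 10);; 27 ::= V 28) ELSE SKIP)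
          (\<lambda>s. agree {10, 26, 27, 28} (vars s') (vars s) \<and> agree {} (arrs s') (arrs s) \<and> tape s = tape s' \<and>
            vars s 10 = k \<and> I r (k + 1) ((vars s)(10 := k + 1)) (arrs s) \<and> clk s \<le> c2 + 75)
          (s'\<lparr>vars := f2, arrs := A2, clk := c2\<rparr>)"
          using Ik[unfolded A2]
          by (simp add: wp_simps f2 A2 kr K W W2 A1 Iq(1) q(3) s'2 mk(1) less_Suc_eq_le[unfolded Suc_eq_plus1])
      next
        fix f2 A2 c2
        assume q: "agree {10, 26, 27, 28} (vars s') f2" "agree {} (arrs s') A2" "f2 10 = d" "I r d f2 A2"
          "c2 \<le> clk s' + 10 + (\<Sum>i=vars s' 10..<d. 75 + 20)"
        have "A2 = arrs s'" using q(2) by (auto simp: agree_def)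
        then have e: "s'\<lparr>vars := f2, arrs := A2, clk := c2\<rparr> = s'\<lparr>vars := f2, clk := c2\<rparr>" by (cases s') simp
        have "agree ?X (vars \<sigma>) f2" "f2 7 = r" using q(1) s' by (auto simp: agree_def)
        moreover have "c2 \<le> clk s' + 10 + 95 * m" using q(5) d(4) s'(7) by simp
        ultimately show "R (s'\<lparr>vars := f2, arrs := A2, clk := c2\<rparr>)"
          unfolding e using q(4) by (intro R) (simp_all add: I_def)
      qed (use s' d in simp_all)
      have fin: "agree ?X ((vars \<sigma>)(7 := 0)) (vars s) \<and> agree {4} (arrs \<sigma>) (arrs s) \<and> tape s = tape \<sigma> \<and>
         vars s 7 = r \<and> J (r + 1) ((vars s)(7 := r + 1)) (arrs s) \<and> clk s \<le> c0 + (120 + 100 * m)"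
        if "agree ?X (vars \<sigma>) (vars s)" "arrs s = A(4 := (A 4)(r := marks g r d))" "vars s 7 = r" "tape s = tape \<sigma>"
          "clk s \<le> c0 + 120 + 95 * m" for s :: st
        using that ag0 p(6) unfolding J_def d_def by (auto simp: agree_def less_Suc_eq simp flip: Suc_eq_plus1)
      have tail: "wp (for_loop 10 25 (28 ::= Ld 1 (V 7 \<^bold>- V 10);;
          IF V 28 \<^bold>< V 27 \<^bold>+ N 1 THEN (26 ::= V 26 \<^bold>+ Bop Shl (N 1) (V 10);; 27 ::= V 28) ELSE SKIP))
          (wp (Sto 4 (V 7) (V 26)) (\<lambda>s. agree ?X ((vars \<sigma>)(7 := 0)) (vars s) \<and> agree {4} (arrs \<sigma>) (arrs s) \<and>
            tape s = tape \<sigma> \<and> vars s 7 = r \<and> J (r + 1) ((vars s)(7 := r + 1)) (arrs s) \<and> clk s \<le> c0 + (120 + 100 * m))) s'"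
        if s': "agree ?X (vars \<sigma>) (vars s')" "arrs s' = A" "vars s' 7 = r" "vars s' 25 = d" "vars s' 26 = 0" "vars s' 27 = n"
            "vars s' 10 = 0" "tape s' = tape \<sigma>" "clk s' \<le> c0 + 80" for s'
        apply (rule body[OF s'(1-7)])
        subgoal for f' c'
          apply (rule wp_mono[where Q = "\<lambda>s. agree ?X (vars \<sigma>) (vars s) \<and> arrs s = A(4 := (A 4)(r := marks g r d)) \<and>
            vars s 7 = r \<and> tape s = tape \<sigma> \<and> clk s \<le> c0 + 120 + 95 * m"])
          subgoal using s' r fits by (simp add: wp_simps)
          subgoal using fin by blast
          done
        done
      have "d = (if r + 1 < b then r + 1 else b)" by (auto simp: d_def)
      then show ?thesis
        using ag0 by (cases "r + 1 < b") (simp_all add: wp_simps r v(1-3) ag tail)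
    qed
    subgoal premises p for f A c'
    proof -
      have "agree ?X (vars \<sigma>) f" "agree {4} (arrs \<sigma>) A"
        using p(1,2) by (simp_all add: agree_def)
      moreover have "c' \<le> clk \<sigma> + 50 + m * (150 + 100 * m)" using p(5) by (simp add: algebra_simps)
      ultimately show ?thesis using Q[of f A c'] p(4) by (cases \<sigma>) (simp add: J_def)
    qed
    done
qed

lemma wp_fill_sparse:
  assumes v: "vars \<sigma> 4 = n" "vars \<sigma> 8 = m" "vars \<sigma> 9 = b" "vars \<sigma> 23 = m div b + 1" "1 \<le> m" "b = floorlog 2 m"
    and g: "\<And>i. i < m \<Longrightarrow> arrs \<sigma> 1 i = g i" "\<And>i. i < m \<Longrightarrow> g i \<le> n"
    and fits: "2 * m \<le> S" "4 * (m + 2) * (m + 2) < 2 ^ w" "5 < K"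
    and Q: "\<And>f A c. agree {7, 10, 24, 25, 26, 27, 28, 29} (vars \<sigma>) f \<Longrightarrow> agree {5} (arrs \<sigma>) A \<Longrightarrow>
      (\<And>i. i < b * (m div b + 1) \<Longrightarrow> sparse_ok g m b (i div (m div b + 1)) (i mod (m div b + 1)) (A 5 i)) \<Longrightarrow>
      c \<le> clk \<sigma> + 50 + 2 * m * (250 + 100 * m) \<Longrightarrow> Q (\<sigma>\<lparr>vars := f, arrs := A, clk := c\<rparr>)"
  shows "wp fill_sparse Q \<sigma>"
proof -
  define nb where "nb = m div b + 1"
  define J where "J = (\<lambda>k (f :: nat \<Rightarrow> nat) (A :: nat \<Rightarrow> nat \<Rightarrow> nat). \<forall>i<k. sparse_ok g m b (i div nb) (i mod nb) (A 5 i))"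
  \<comment> \<open>The text length \<open>n\<close> stands for the minimum of the empty range. As
    it bounds all entries, the first iteration replaces it by the true value.\<close>
  define I where "I = (\<lambda>l i (f :: nat \<Rightarrow> nat) (A :: nat \<Rightarrow> nat \<Rightarrow> nat).
    f 27 = n \<and> i = l \<or> l < i \<and> is_min g l (i - 1) (f 27))"
  note b = block_facts[OF v(5,6), folded nb_def]
  have K: "1 < K" using fits by simp
  have nb0: "0 < nb" by (simp add: nb_def)
  have sq: "2 * m * (m + 2) + 2 * m < 2 ^ w"
  proof -
    have "2 * m * (m + 2) + 2 * m \<le> 4 * (m + 2) * (m + 2)" by (simp add: algebra_simps)
    then show ?thesis using fits(2) by linarith
  qed
  then have mw: "2 * m < 2 ^ w" by linarith
  let ?X = "{7, 10, 25, 26, 27, 28, 29}" and ?v = "(vars \<sigma>)(24 := b * nb)"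
  have bnb: "b * nb < 2 ^ w" using b mw by linarith
  have nw: "m < 2 ^ w" using mw by linarith
  show ?thesis
    unfolding fill_sparse_def
    apply (simp add: wp_simps v(1-4) nb_def[symmetric] bnb)
    apply (rule wp_for_loop[where X = ?X and Y = "{5}" and M = "b * nb" and J = J and D = "\<lambda>_. 200 + 100 * m"])
    using bnb apply simp_all[7]
    subgoal by (simp add: J_def)
    subgoal premises p for k f A c0
    proof -
      have ag0: "agree ?X ?v f" "agree {5} (arrs \<sigma>) A"
        using p(3,4) by (simp_all add: agree_def)
      note ag = agreeD[OF ag0(1)] agreeD[OF ag0(2)]
      have k: "k < b * nb" "k < S" "f 7 = k" using p fits b by simp_all
      define e x where "e = k div nb" and "x = k mod nb"
      have e: "e < b" using k nb0 by (simp add: e_def less_mult_imp_div_less)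
      have "x < nb" using nb0 by (simp add: x_def)
      then have x: "x \<le> m div b" by (simp add: nb_def)
      have "x * b \<le> m div b * b" using x by (rule mult_le_mono1)
      also have "\<dots> \<le> m" by simp
      finally have xb: "x * b \<le> m" .
      have "(2::nat) ^ e \<le> 2 ^ b" using e by (intro power_increasing) auto
      then have e2: "2 ^ e \<le> 2 * m" using b by linarith
      then have "2 ^ e * b \<le> 2 * m * m" using b by (intro mult_le_mono) auto
      then have "(x + 2 ^ e) * b \<le> 2 * m * (m + 2)" using xb by (simp add: algebra_simps)
      moreover have "x + 2 ^ e \<le> (x + 2 ^ e) * b" using b by simp
      ultimately have W: "(x + 2 ^ e) * b < 2 ^ w" "x + 2 ^ e < 2 ^ w" "2 ^ e < (2::nat) ^ w" "x * b < 2 ^ w"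
        using sq xb nw by linarith+
      define z where "z = min m ((x + 2 ^ e) * b)"
      have z: "x * b \<le> z" "z \<le> m" "z < 2 ^ w" using xb W by (auto simp: z_def)
      have body: "wp (for_loop 10 28 (29 ::= Ld 1 (V 10);; IF V 29 \<^bold>< V 27 THEN 27 ::= V 29 ELSE SKIP)) R s'"
        if s': "agree ?X ?v (vars s')" "arrs s' = A" "vars s' 7 = k" "vars s' 28 = z" "vars s' 27 = n" "vars s' 10 = x * b"
          and R: "\<And>f' c'. agree ?X ?v f' \<Longrightarrow> f' 7 = k \<Longrightarrow> sparse_ok g m b e x (f' 27) \<Longrightarrow>
            c' \<le> clk s' + 10 + 70 * m \<Longrightarrow> R (s'\<lparr>vars := f', clk := c'\<rparr>)" for R s'
      proof (rule wp_for_loop[where X = "{10, 27, 29}" and Y = "{}" and M = z and J = "I (x * b)" and D = "\<lambda>_. 50"])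
        show "I (x * b) (vars s' 10) (vars s') (arrs s')" using s' by (auto simp: I_def)
        fix i f2 A2 c2
        assume q: "vars s' 10 \<le> i" "i < z" "agree {10, 27, 29} (vars s') f2" "agree {} (arrs s') A2" "f2 10 = i" "I (x * b) i f2 A2"
        have A2: "A2 = A" using q(4) s' by (auto simp: agree_def)
        have i: "i < m" "i < S" "x * b \<le> i" using q(1,2) s' z fits by linarith+
        have A1: "A 1 i = g i" using g(1)[OF i(1)] by (simp add: ag)
        have one: "is_min g i i (g i)" by (auto simp: is_min_def intro: le_antisym)
        have Ii: "I (x * b) (i + 1) f3 A" if "f3 27 = (if g i < f2 27 then g i else f2 27)" for f3
        proof (cases "i = x * b")
          case True
          have "f2 27 = n" using q(6) True by (auto simp: I_def)
          then have "f3 27 = g i" using that g(2)[OF i(1)] by (auto split: if_splits)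
          then show ?thesis using one True by (simp add: I_def)
        next
          case False
          then have "is_min g (x * b) (i - 1) (f2 27)" "x * b < i" using q(6) by (auto simp: I_def)
          from is_min_join[OF this(1) one] this(2) have "is_min g (x * b) i (min (f2 27) (g i))" by simp
          moreover have "f3 27 = min (f2 27) (g i)" using that by auto
          ultimately show ?thesis using \<open>x * b < i\<close> by (simp add: I_def)
        qed
        have s'2: "agree {} (arrs s') A" using s'(2) by simp
        show "wp (29 ::= Ld 1 (V 10);; IF V 29 \<^bold>< V 27 THEN 27 ::= V 29 ELSE SKIP)
          (\<lambda>s. agree {10, 27, 29} (vars s') (vars s) \<and> agree {} (arrs s') (arrs s) \<and> tape s = tape s' \<and>
            vars s 10 = i \<and> I (x * b) (i + 1) ((vars s)(10 := i + 1)) (arrs s) \<and> clk s \<le> c2 + 50)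
          (s'\<lparr>vars := f2, arrs := A2, clk := c2\<rparr>)"
          using Ii q(3) s'2 by (simp add: wp_simps q(5) A2 i K A1)
      next
        fix f2 A2 c2
        assume q: "agree {10, 27, 29} (vars s') f2" "agree {} (arrs s') A2" "f2 10 = z" "I (x * b) z f2 A2"
          "c2 \<le> clk s' + 10 + (\<Sum>i=vars s' 10..<z. 50 + 20)"
        have "A2 = arrs s'" using q(2) by (auto simp: agree_def)
        then have eq: "s'\<lparr>vars := f2, arrs := A2, clk := c2\<rparr> = s'\<lparr>vars := f2, clk := c2\<rparr>" by (cases s') simp
        have "agree ?X ?v f2" "f2 7 = k" using q(1) s' by (auto simp: agree_def)
        moreover have "c2 \<le> clk s' + 10 + 70 * m" using q(5) z by simp
        moreover have "sparse_ok g m b e x (f2 27)"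
          unfolding sparse_ok_def
        proof
          assume "(x + 2 ^ e) * b \<le> m"
          then have "z = (x + 2 ^ e) * b" by (simp add: z_def)
          moreover have "x * b < (x + 2 ^ e) * b" using b by simp
          ultimately show "is_min g (x * b) ((x + 2 ^ e) * b - 1) (f2 27)" using q(4) by (auto simp: I_def)
        qed
        ultimately show "R (s'\<lparr>vars := f2, arrs := A2, clk := c2\<rparr>)"
          unfolding eq by (intro R)
      qed (use s' z in simp_all)
      have fin: "agree ?X ((vars \<sigma>)(24 := b * nb, 7 := 0)) (vars s) \<and> agree {5} (arrs \<sigma>) (arrs s) \<and> tape s = tape \<sigma> \<and>
         vars s 7 = k \<and> J (k + 1) ((vars s)(7 := k + 1)) (arrs s) \<and> clk s \<le> c0 + (200 + 100 * m)"
        if "agree ?X ?v (vars s)" "arrs s = A(5 := (A 5)(k := y))" "sparse_ok g m b e x y" "vars s 7 = k" "tape s = tape \<sigma>"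
          "clk s \<le> c0 + 200 + 70 * m" for s :: st and y
        using that ag0 p(6) unfolding J_def e_def x_def by (auto simp: agree_def less_Suc_eq simp flip: Suc_eq_plus1)
      have tail: "wp (for_loop 10 28 (29 ::= Ld 1 (V 10);; IF V 29 \<^bold>< V 27 THEN 27 ::= V 29 ELSE SKIP))
          (wp (Sto 5 (V 7) (V 27)) (\<lambda>s. agree ?X ((vars \<sigma>)(24 := b * nb, 7 := 0)) (vars s) \<and> agree {5} (arrs \<sigma>) (arrs s) \<and>
            tape s = tape \<sigma> \<and> vars s 7 = k \<and> J (k + 1) ((vars s)(7 := k + 1)) (arrs s) \<and> clk s \<le> c0 + (200 + 100 * m))) s'"
        if s': "agree ?X ?v (vars s')" "arrs s' = A" "vars s' 7 = k" "vars s' 28 = z" "vars s' 27 = n"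
            "vars s' 10 = x * b" "tape s' = tape \<sigma>" "clk s' \<le> c0 + 150" for s'
        apply (rule body[OF s'(1-6)])
        subgoal for f' c'
          apply (rule wp_mono[where Q = "\<lambda>s. agree ?X ?v (vars s) \<and> arrs s = A(5 := (A 5)(k := f' 27)) \<and>
            vars s 7 = k \<and> tape s = tape \<sigma> \<and> clk s \<le> c0 + 200 + 70 * m"])
          subgoal using s' k fits by (simp add: wp_simps)
          subgoal using fin by blast
          done
        done
      have "z = (if m < (x + 2 ^ e) * b then m else (x + 2 ^ e) * b)" by (auto simp: z_def)
      then show ?thesis
        using ag0 W by (cases "m < (x + 2 ^ e) * b")
          (simp_all add: wp_simps k v(1-4) nb_def[symmetric] e_def[symmetric] x_def[symmetric] ag tail)
    qed
    subgoal premises p for f A c'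
    proof -
      have "agree {7, 10, 24, 25, 26, 27, 28, 29} (vars \<sigma>) f" "agree {5} (arrs \<sigma>) A"
        using p(1,2) by (simp_all add: agree_def)
      moreover have "c' \<le> clk \<sigma> + 50 + 2 * m * (250 + 100 * m)"
      proof -
        have "b * nb * (220 + 100 * m) \<le> 2 * m * (250 + 100 * m)" by (rule mult_le_mono[OF b(5)]) simp
        then show ?thesis using p(5) by (simp add: algebra_simps)
      qed
      ultimately show ?thesis using Q[of f A c'] p(4) by (cases \<sigma>) (simp add: J_def nb_def)
    qed
    done
qed

end

section \<open>The deterministic data structure\<close>

text \<open>The mask at the right end is cut to the window by a remainder, and the table in array 3
  locates its top bit, which marks the position of the minimum.\<close>

definition look :: "exp \<Rightarrow> exp \<Rightarrow> exp" where
  "look a b = Ld 1 (b \<^bold>+ N 1 \<^bold>- Ld 3 (Ld 4 b \<^bold>% Bop Shl (N 1) (b \<^bold>+ N 1 \<^bold>- a)))"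

text \<open>Register 7 is the block length and 8 the number of entries per level. A short range is
  one window. A longer one is covered by a window at either end and, for the complete blocks
  between, two overlapping entries of the sparse table; overlaps do not affect a minimum.\<close>

definition range_min :: hcom where
  "range_min = (IF V 14 \<^bold>< V 13 \<^bold>+ V 7 THEN 15 ::= look (V 13) (V 14)
     ELSE (15 ::= look (V 13) (V 13 \<^bold>+ V 7 \<^bold>- N 1);;
       16 ::= look (V 14 \<^bold>+ N 1 \<^bold>- V 7) (V 14);; IF V 16 \<^bold>< V 15 THEN 15 ::= V 16 ELSE SKIP;;
       17 ::= V 13 \<^bold>/ V 7 \<^bold>+ N 1;; 18 ::= (V 14 \<^bold>+ N 1) \<^bold>/ V 7;;
       IF V 17 \<^bold>< V 18 THEN (19 ::= Ld 3 (V 18 \<^bold>- V 17) \<^bold>- N 1;;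
         16 ::= Ld 5 (V 19 \<^bold>* V 8 \<^bold>+ V 17);; IF V 16 \<^bold>< V 15 THEN 15 ::= V 16 ELSE SKIP;;
         16 ::= Ld 5 (V 19 \<^bold>* V 8 \<^bold>+ V 18 \<^bold>- Bop Shl (N 1) (V 19));; IF V 16 \<^bold>< V 15 THEN 15 ::= V 16 ELSE SKIP)
       ELSE SKIP))"

text \<open>Register 18 becomes 1 if the loop stops at a common shift into the sample; otherwise it
  stopped at a mismatch or at the end of the text, and register 12 is already the answer. Letters
  are compared first, so a stop at the sample lies inside the text.\<close>

definition shift_loop :: hcom where
  "shift_loop = (12 ::= N 0;; 17 ::= N 1;; 18 ::= N 0;;
     WHILE V 17 DO (
       13 ::= V 10 \<^bold>+ V 12;; 14 ::= V 11 \<^bold>+ V 12;; 17 ::= N 0;;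
       IF V 13 \<^bold>< V 4 THEN IF V 14 \<^bold>< V 4 THEN 17 ::= (Inp (V 13) \<^bold>= Inp (V 14)) ELSE SKIP ELSE SKIP;;
       IF V 17 THEN
         IF sampled_exp 13 \<^bold>& sampled_exp 14 THEN (17 ::= N 0;; 18 ::= N 1) ELSE 12 ::= V 12 \<^bold>+ N 1
       ELSE SKIP))"

text \<open>Equal positions are treated apart: they have the same rank, for which the range of LCP
  values would be empty.\<close>

definition sampled_query :: hcom where
  "sampled_query = (4 ::= V 0;; 10 ::= V 2 \<^bold>- N 1;; 11 ::= V 3 \<^bold>- N 1;;
     IF V 10 \<^bold>= V 11 THEN 0 ::= V 4 \<^bold>- V 10
     ELSE (5 ::= Ld 6 (N 0);; 6 ::= V 5 \<^bold>* V 5;; 7 ::= Ld 6 (N 1);; 8 ::= Ld 6 (N 2);;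
       shift_loop;;
       IF V 18 THEN (15 ::= V 13;; slot_number;; 13 ::= Ld 2 (V 16);;
         15 ::= V 14;; slot_number;; 14 ::= Ld 2 (V 16);;
         IF V 14 \<^bold>< V 13 THEN (16 ::= V 13;; 13 ::= V 14;; 14 ::= V 16) ELSE SKIP;;
         13 ::= V 13 \<^bold>+ N 1;; range_min;; 0 ::= V 12 \<^bold>+ V 15)
       ELSE 0 ::= V 12))"

definition build_index :: hcom where
  "build_index = (4 ::= V 0;; square_root;; sort_samples;; fill_inverse;; block_size;; fill_logs;; fill_marks;;
     fill_sparse;; Sto 6 (N 0) (V 5);; Sto 6 (N 1) (V 9);; Sto 6 (N 2) (V 23))"

definition window_min :: "(nat \<Rightarrow> nat) \<Rightarrow> nat \<Rightarrow> nat \<Rightarrow> nat" where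
  "window_min g l r = g (r + 1 - floorlog 2 (marks g r (r + 1 - l)))"

lemma is_min_if:
  "is_min f l r x \<Longrightarrow> is_min f l' r' y \<Longrightarrow> l \<le> l' \<Longrightarrow> l' \<le> r + 1 \<Longrightarrow> r \<le> r' \<Longrightarrow>
    is_min f l r' (if y < x then y else x)"
  using is_min_join[of f l r x l' r' y] by (simp add: min_def split: if_splits)

context machine
begin

lemma ecost_look [simp]: "ecost (look a b) = 3 * ecost b + ecost a + 51"
  by (simp add: look_def)

lemma look:
  assumes t: "rmq_table g m b (arrs \<sigma>)" "\<And>i. i < m \<Longrightarrow> arrs \<sigma> 1 i = g i" "1 \<le> m" "b = floorlog 2 m"
    and ab: "ok x \<sigma>" "ok y \<sigma>" "ev x \<sigma> = l" "ev y \<sigma> = r" "l \<le> r" "r < m" "r + 1 \<le> l + b"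
    and fits: "2 * m \<le> S" "2 * m + 1 < 2 ^ w" "4 < K"
  shows "ok (look x y) \<sigma>" "ev (look x y) \<sigma> = window_min g l r"
proof -
  note bf = block_facts[OF t(3,4)]
  define d where "d = r + 1 - l"
  have d: "d \<le> b" "d \<le> min b (r + 1)" "r + 1 - l = d" using ab by (auto simp: d_def)
  have M: "arrs \<sigma> 4 r mod 2 ^ d = marks g r d"
    using t(1) ab(6) marks_mod[OF d(2), of g r] by (simp add: rmq_table_def)
  have "marks g r d < 2 ^ d" by (rule marks_less)
  also have "(2::nat) ^ d \<le> 2 ^ b" using d by (intro power_increasing) auto
  finally have mb: "marks g r d < 2 ^ b" .
  then have F: "arrs \<sigma> 3 (marks g r d) = floorlog 2 (marks g r d)" using t(1) by (simp add: rmq_table_def)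
  note fl = is_min_marks[OF ab(5), of g, unfolded d(3)]
  have "(2::nat) ^ d \<le> 2 * m" using \<open>2 ^ d \<le> 2 ^ b\<close> bf(3) by linarith
  then have W: "(2::nat) ^ d < 2 ^ w" "r + 1 < 2 ^ w" "marks g r d < S" "r < S" "1 < K" "3 < K"
    "r + 1 - floorlog 2 (marks g r d) < S"
    using fits ab mb bf fl(3) by linarith+
  have i: "r + 1 - floorlog 2 (marks g r d) < m" using fl(3) ab by linarith
  have le: "floorlog 2 (marks g r d) \<le> r + 1" using fl(2) unfolding d_def by linarith
  show "ev (look x y) \<sigma> = window_min g l r"
    using ab i by (simp add: look_def d M F t(2) window_min_def)
  show "ok (look x y) \<sigma>"
    using ab W fits le by (simp add: look_def d M F)
qed

lemma wp_range_min:
  assumes t: "rmq_table g m b (arrs \<sigma>)" "\<And>i. i < m \<Longrightarrow> arrs \<sigma> 1 i = g i" "1 \<le> m" "b = floorlog 2 m"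
    and v: "vars \<sigma> 7 = b" "vars \<sigma> 8 = m div b + 1" "vars \<sigma> 13 = l" "vars \<sigma> 14 = r" "l \<le> r" "r < m"
    and fits: "2 * m \<le> S" "4 * m + 2 < 2 ^ w" "5 < K"
    and Q: "\<And>f c. agree {15..19} (vars \<sigma>) f \<Longrightarrow> is_min g l r (f 15) \<Longrightarrow> c \<le> clk \<sigma> + 600 \<Longrightarrow>
      Q (\<sigma>\<lparr>vars := f, clk := c\<rparr>)"
  shows "wp range_min Q \<sigma>"
proof -
  note bf = block_facts[OF t(3,4)]
  have fits': "2 * m + 1 < 2 ^ w" "4 < K" "3 < K" "m < 2 ^ w" using fits by linarith+
  have win: "is_min g i j (window_min g i j)" if "i \<le> j" for i j
    unfolding window_min_def by (rule is_min_marks(1)[OF that])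
  have lk: "ok (look x y) \<sigma>'" "ev (look x y) \<sigma>' = window_min g i j"
    if "arrs \<sigma>' = arrs \<sigma>" "ok x \<sigma>'" "ok y \<sigma>'" "ev x \<sigma>' = i" "ev y \<sigma>' = j" "i \<le> j" "j < m" "j + 1 \<le> i + b" for x y \<sigma>' i j
    using look[of g m b \<sigma>' x y i j] that t fits(1) fits'(1,2) by auto
  have lb: "l + b < 2 ^ w" "r + 1 < 2 ^ w" "l < 2 ^ w" "r < 2 ^ w" using v bf fits by linarith+
  show ?thesis
  proof (cases "r < l + b")
    case True
    show ?thesis
      unfolding range_min_def
      using True v lb
      by (auto simp add: wp_simps lk[where x = "V 13" and y = "V 14" and i = l and j = r] intro!: Q win)
  next
    case False
    define nb where "nb = m div b + 1"
    \<comment> \<open>\<open>x1\<close> is the first block starting after \<open>l\<close>, and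
      \<open>x2\<close> the number of blocks that end by rank \<open>r\<close>; so the complete
      blocks to be covered are \<open>x1\<close> to \<open>x2 - 1\<close>.\<close>
    define x1 x2 where "x1 = l div b + 1" and "x2 = (r + 1) div b"
    have b0: "0 < b" using bf by linarith
    have x1: "l < x1 * b" "x1 * b \<le> l + b"
      using b0 dividend_less_div_times[of b l] by (simp_all add: x1_def algebra_simps)
    have x2: "x2 * b \<le> r + 1" "r + 1 < x2 * b + b"
      using b0 dividend_less_div_times[of b "r + 1"] by (simp_all add: x2_def algebra_simps)
    define u1 where "u1 = window_min g l (l + b - 1)"
    define u2 where "u2 = window_min g (r + 1 - b) r"
    have u: "is_min g l (l + b - 1) u1" "is_min g (r + 1 - b) r u2"
      using b0 False unfolding u1_def u2_def by (auto intro!: win)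
    define y where "y = (if u2 < u1 then u2 else u1)"
    have le: "x2 \<le> m" "x1 \<le> m" using div_le_dividend[of "r + 1" b] div_le_dividend[of l b] v
      unfolding x1_def x2_def by linarith+
    note simps = lk[where x = "V 13" and y = "Bop Sub (Bop Add (V 13) (V 7)) (N 1)" and i = l and j = "l + b - 1"]
      lk[where x = "Bop Sub (Bop Add (V 14) (N 1)) (V 7)" and y = "V 14" and i = "r + 1 - b" and j = r]
    have len: "l + b - 1 < m" "Suc 0 \<le> l + b" "b \<le> r + 1" "l \<le> l + b - 1" "r + 1 - b \<le> r" "l + b - 1 + 1 \<le> l + b"
      "1 \<le> l + b" "r + 1 \<le> r + 1 - b + b"
      using False v b0 by auto
    have W: "x1 < 2 ^ w" "x2 < 2 ^ w" "l div b + 1 < 2 ^ w" using le fits'(4) x1_def by auto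
    show ?thesis
    proof (cases "x1 < x2")
      case mid: False
      \<comment> \<open>With \<open>x2 \<le> x1\<close> the range has fewer than
        \<open>2 * b\<close> ranks, so the two windows at its ends overlap.\<close>
      have "is_min g l r y"
        unfolding y_def
      proof (rule is_min_if[OF u])
        have "x2 * b \<le> x1 * b" using mid by simp
        then have "r + 1 < l + b + b" using x1(2) x2(2) by linarith
        then show "r + 1 - b \<le> l + b - 1 + 1" using b0 by linarith
      qed (use False v in auto)
      then show ?thesis
        unfolding range_min_def
        using False v lb len W mid
        by (auto simp add: wp_simps simps y_def u1_def[symmetric] u2_def[symmetric] x1_def[symmetric] x2_def[symmetric]
            intro!: Q)
    next
      case mid: True
      \<comment> \<open>The largest \<open>e\<close> for which \<open>2 ^ e\<close> of the complete
        blocks exist; two such groups, aligned at either end, cover all of them.\<close>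
      define e where "e = floorlog 2 (x2 - x1) - 1"
      have "x2 - x1 \<noteq> 0" using mid by simp
      then have fl: "floorlog 2 (x2 - x1) = e + 1" "2 ^ e \<le> x2 - x1" "x2 - x1 < 2 * 2 ^ e"
      proof -
        have "floorlog 2 (x2 - x1) \<noteq> 0" using mid by (simp add: floorlog_eq_zero_iff)
        then show *: "floorlog 2 (x2 - x1) = e + 1" by (simp add: e_def)
        have "2 ^ (floorlog 2 (x2 - x1) - 1) \<le> x2 - x1 \<and> x2 - x1 < 2 ^ floorlog 2 (x2 - x1)"
          using floorlog_bounds[of "x2 - x1" 2] mid by simp
        then show "2 ^ e \<le> x2 - x1" "x2 - x1 < 2 * 2 ^ e" unfolding * by (simp_all add: power_add)
      qed
      have x2m: "x2 * b \<le> m" using x2(1) v by linarith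
      have x2nb: "x2 < nb"
      proof -
        have "x2 \<le> m div b" unfolding x2_def using v by (intro div_le_mono) simp
        then show ?thesis by (simp add: nb_def)
      qed
      have eb: "e < b"
      proof -
        have "(2::nat) ^ e < 2 ^ b" using fl(2) le bf(2) by linarith
        then show ?thesis by simp
      qed
      have sp: "is_min g (x * b) ((x + 2 ^ e) * b - 1) (arrs \<sigma> 5 (e * nb + x))" "e * nb + x < b * nb"
        if "x + 2 ^ e \<le> x2" for x
      proof -
        have "x < nb" using that x2nb by linarith
        then have dm: "(e * nb + x) div nb = e" "(e * nb + x) mod nb = x" by simp_all
        have "e * nb + nb = (e + 1) * nb" by (simp add: algebra_simps)
        also have "\<dots> \<le> b * nb" using eb by (intro mult_le_mono1) simp
        finally show lt: "e * nb + x < b * nb" using \<open>x < nb\<close> by linarith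
        have "(x + 2 ^ e) * b \<le> x2 * b" using that by (rule mult_le_mono1)
        then have "(x + 2 ^ e) * b \<le> m" using x2m by linarith
        then show "is_min g (x * b) ((x + 2 ^ e) * b - 1) (arrs \<sigma> 5 (e * nb + x))"
          using t(1) lt dm unfolding rmq_table_def nb_def[symmetric] sparse_ok_def by metis
      qed
      define w1 w2 where "w1 = arrs \<sigma> 5 (e * nb + x1)" and "w2 = arrs \<sigma> 5 (e * nb + x2 - 2 ^ e)"
      have xe: "x1 + 2 ^ e \<le> x2" "x2 - 2 ^ e + 2 ^ e \<le> x2" "e * nb + x2 - 2 ^ e = e * nb + (x2 - 2 ^ e)"
        "2 ^ e \<le> e * nb + x2" "x2 - 2 ^ e \<le> x1 + 2 ^ e" "x1 \<le> x2 - 2 ^ e" "2 ^ e \<le> x2"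
        using fl(2,3) mid by linarith+
      have w: "is_min g (x1 * b) ((x1 + 2 ^ e) * b - 1) w1" "is_min g ((x2 - 2 ^ e) * b) (x2 * b - 1) w2"
        using sp(1)[OF xe(1)] sp(1)[OF xe(2)] unfolding w1_def w2_def xe(3) le_add_diff_inverse2[OF xe(7)] .
      have mul: "(x2 - 2 ^ e) * b \<le> (x1 + 2 ^ e) * b" "(x1 + 2 ^ e) * b \<le> x2 * b" "x1 * b + 1 * b \<le> (x1 + 2 ^ e) * b"
        "x1 * b \<le> (x2 - 2 ^ e) * b"
        unfolding add_mult_distrib[symmetric] using xe by (auto intro!: mult_le_mono1)
      have "is_min g l (x2 * b - 1) (min (min u1 w1) w2)"
        apply (rule is_min_join[OF is_min_join[OF u(1) w(1)] w(2)])
        using x1 mul b0 by linarith+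
      then have "is_min g l r (min (min (min u1 w1) w2) u2)"
        by (rule is_min_join[OF _ u(2)]) (use x1 x2 mul b0 False in linarith)+
      \<comment> \<open>\<open>is_min_join\<close> proceeds through neighbouring ranges from left to
        right, whereas the program compares the two end windows first.\<close>
      moreover have "(if w2 < (if w1 < y then w1 else y) then w2 else (if w1 < y then w1 else y)) = min (min (min u1 w1) w2) u2"
        by (auto simp: y_def min_def)
      ultimately have res: "is_min g l r (if w2 < (if w1 < y then w1 else y) then w2 else (if w1 < y then w1 else y))"
        by simp
      have F: "arrs \<sigma> 3 (x2 - x1) = e + 1" "x2 - x1 < S"
        using t(1) le bf fl(1) fits(1) mid by (auto simp: rmq_table_def)
      have "b * nb \<le> 2 * m" using bf by (simp add: nb_def)
      then have W2: "e * nb + x1 < S" "e * nb + x2 - 2 ^ e < S" "e * nb + x1 < 2 ^ w" "e * nb < 2 ^ w"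
        "e * nb + x2 < 2 ^ w" "2 ^ e < (2::nat) ^ w" "5 < K" "e + 1 < 2 ^ w"
        using sp(2)[OF xe(1)] sp(2)[OF xe(2)] xe fits le bf eb by linarith+
      have vb: "vars \<sigma> 7 = b" "vars \<sigma> 8 = nb" "vars \<sigma> 13 = l" "vars \<sigma> 14 = r" using v by (simp_all add: nb_def)
      show ?thesis
        unfolding range_min_def
        using False v(5,6) lb len W mid W2 fits' xe(4) res
        by (auto simp add: wp_simps simps vb F y_def u1_def[symmetric] u2_def[symmetric] x1_def[symmetric] x2_def[symmetric]
            w1_def[symmetric] w2_def[symmetric] intro!: Q split: if_splits)
    qed
  qed
qed

lemma wp_shift_loop:
  assumes v: "vars \<sigma> 4 = length T" "vars \<sigma> 5 = s" "vars \<sigma> 6 = s * s" "vars \<sigma> 10 = a" "vars \<sigma> 11 = b"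
    and ab: "a < length T" "b < length T" "0 < s" "2 * length T + 2 < 2 ^ w"
    and Q: "\<And>f c. agree {12, 13, 14, 17, 18} (vars \<sigma>) f \<Longrightarrow>
      (if f 18 = 0 then f 12 = lce T a b
       else matches T a b (f 12) \<and> f 13 = a + f 12 \<and> f 14 = b + f 12 \<and> f 13 < length T \<and> f 14 < length T \<and>
         sampled s (f 13) \<and> sampled s (f 14)) \<Longrightarrow>
      c \<le> clk \<sigma> + 300 + 200 * (s * s) \<Longrightarrow> Q (\<sigma>\<lparr>vars := f, clk := c\<rparr>)"
  shows "wp shift_loop Q \<sigma>"
proof -
  obtain r\<^sub>0 where r0: "r\<^sub>0 < s * s" "sampled s (a + r\<^sub>0)" "sampled s (b + r\<^sub>0)"
    using sampled_shift[OF ab(3), of a b] by blast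
  define good where "good = (\<lambda>f :: nat \<Rightarrow> nat. if f 18 = 0 then f 12 = lce T a b
       else matches T a b (f 12) \<and> f 13 = a + f 12 \<and> f 14 = b + f 12 \<and> f 13 < length T \<and> f 14 < length T \<and>
         sampled s (f 13) \<and> sampled s (f 14))"
  define I where "I = (\<lambda>s'::st. agree {12, 13, 14, 17, 18} (vars \<sigma>) (vars s') \<and> arrs s' = arrs \<sigma> \<and> tape s' = tape \<sigma> \<and>
    vars s' 12 \<le> r\<^sub>0 \<and> (if vars s' 17 = 0 then good (vars s') else matches T a b (vars s' 12) \<and> vars s' 18 = 0) \<and>
    clk s' \<le> clk \<sigma> + 30 + 180 * vars s' 12 + (if vars s' 17 = 0 then 180 else 0))"
  define \<mu> where "\<mu> = (\<lambda>s'::st. r\<^sub>0 - vars s' 12 + (if vars s' 17 = 0 then 0 else 1))"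
  show ?thesis
    unfolding shift_loop_def
    apply (simp add: wp_simps)
    apply (rule wp_while[where I = I and m = \<mu>])
    subgoal using ab by (simp add: I_def matches_def)
    subgoal by (simp add: I_def)
    subgoal premises p for s'
    proof -
      note I = p(1)[unfolded I_def]
      note ag = agreeD[OF I[THEN conjunct1]]
      define r where "r = vars s' 12"
      have I2: "agree {12, 13, 14, 17, 18} (vars \<sigma>) (vars s')" "arrs s' = arrs \<sigma>" "tape s' = tape \<sigma>" "r \<le> r\<^sub>0"
        "matches T a b r" "vars s' 18 = 0" "clk s' \<le> clk \<sigma> + 30 + 180 * r" "vars s' 17 \<noteq> 0"
        using I p(2) by (auto simp: r_def)
      have W: "a + r < 2 ^ w" "b + r < 2 ^ w" "r + 1 < 2 ^ w"
        using I2(5) ab unfolding matches_def by linarith+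
      have fin: "I s2 \<and> \<mu> s2 < \<mu> s'" if "agree {12, 13, 14, 17, 18} (vars \<sigma>) (vars s2)" "arrs s2 = arrs \<sigma>" "tape s2 = tape \<sigma>"
        "vars s2 12 = r" "vars s2 17 = 0" "good (vars s2)" "clk s2 \<le> clk s' + 180" for s2
        using that I2 by (auto simp: I_def \<mu>_def r_def)
      have cont: "I s2 \<and> \<mu> s2 < \<mu> s'" if "agree {12, 13, 14, 17, 18} (vars \<sigma>) (vars s2)" "arrs s2 = arrs \<sigma>" "tape s2 = tape \<sigma>"
        "vars s2 12 = r + 1" "vars s2 17 = 1" "vars s2 18 = 0" "matches T a b (r + 1)" "r < r\<^sub>0" "clk s2 \<le> clk s' + 180" for s2
        using that I2 by (auto simp: I_def \<mu>_def r_def)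
      show ?thesis
      proof (cases "a + r < length T \<and> b + r < length T \<and> T ! (a + r) = T ! (b + r)")
        case True
        then have m: "matches T a b (r + 1)" using I2(5) by (auto simp: matches_add) (auto simp: matches_def)
        show ?thesis
        proof (cases "sampled s (a + r) \<and> sampled s (b + r)")
          case both: True
          then show ?thesis
            using True I2 W
            apply (simp add: wp_simps r_def[symmetric] ag v ev_sampled_exp[where s = s])
            apply (rule fin)
                  apply (simp_all add: good_def r_def[symmetric])
            done
        next
          case False
          then have "r \<noteq> r\<^sub>0" using r0 by auto
          then have "r < r\<^sub>0" using I2 by simp
          with False show ?thesis
            using True I2 W m
            by (auto simp add: wp_simps r_def[symmetric] ag v ev_sampled_exp[where s = s]
                intro!: cont[THEN conjunct1] cont[THEN conjunct2])
        qed
      next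
        case False
        then have "r = lce T a b" using I2(5) lce_eqI by metis
        then have g: "good f" if "f 12 = r" "f 18 = 0" for f using that by (simp add: good_def)
        show ?thesis
          using False I2 W
          by (auto simp add: wp_simps r_def[symmetric] ag v intro!: fin[THEN conjunct1] fin[THEN conjunct2] g)
      qed
    qed
    subgoal premises p for s'
    proof -
      note I = p(1)[unfolded I_def]
      have "vars s' 12 < s * s" using I r0 by linarith
      then have c: "clk s' + 3 \<le> clk \<sigma> + 300 + 200 * (s * s)" using I p(2) by simp
      have g: "good (vars s')" using I p(2) by simp
      have e: "s'\<lparr>clk := c0\<rparr> = \<sigma>\<lparr>vars := vars s', clk := c0\<rparr>" for c0
        using I by (cases s'; cases \<sigma>) simp
      show ?thesis
        using Q[OF I[THEN conjunct1] g[unfolded good_def] c] by (simp add: e)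
    qed
    done
qed

section \<open>Queries and construction of the deterministic index\<close>

definition index_table :: "nat \<Rightarrow> nat list \<Rightarrow> (nat \<Rightarrow> nat \<Rightarrow> nat) \<Rightarrow> bool" where
  "index_table s xs A \<longleftrightarrow> sorted_wrt (sless T) xs \<and> set xs = {p. p < length T \<and> sampled s p} \<and> suffix_table T xs A \<and>
     (\<forall>i<length xs. A 2 (slot s (xs ! i)) = i) \<and>
     rmq_table (lcp_fun T xs) (length xs) (floorlog 2 (length xs)) A \<and>
     A 6 0 = s \<and> A 6 1 = floorlog 2 (length xs) \<and> A 6 2 = length xs div floorlog 2 (length xs) + 1"

lemma sample_bounds:
  assumes t: "sorted_wrt (sless T) xs" "set xs = {p. p < length T \<and> sampled s p}" and s: "0 < s"
  shows "length xs \<le> slots s (length T)" "length xs \<le> length T" "T \<noteq> [] \<Longrightarrow> 1 \<le> length xs" "distinct xs"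
    "\<And>i. i < length xs \<Longrightarrow> lcp_fun T xs i \<le> length T"
proof -
  show d: "distinct xs" using t(1) by (rule distinct_sless)
  have len: "length xs = card {p. p < length T \<and> sampled s p}" using distinct_card[OF d] t(2) by simp
  then show "length xs \<le> slots s (length T)" using card_sampled[OF s] by simp
  have "{p. p < length T \<and> sampled s p} \<subseteq> {..<length T}" by blast
  from card_mono[OF finite_lessThan this] show "length xs \<le> length T" by (simp add: len)
  show "1 \<le> length xs" if "T \<noteq> []"
  proof -
    have "0 \<in> set xs" using that unfolding t(2) by (simp add: sampled_def)
    then have "xs \<noteq> []" by auto
    then have "length xs \<noteq> 0" by simp
    then show ?thesis by linarith
  qed
  show "lcp_fun T xs i \<le> length T" if "i < length xs" for i
  proof (cases "i = 0")
    case False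
    have n: "xs ! j \<le> length T" if "j < length xs" for j using nth_mem[OF that] unfolding t(2) by simp
    have "i - 1 < length xs" using that by linarith
    from lce_le[OF n[OF this] n[OF that]] False show ?thesis by (simp add: lcp_fun_def)
  qed (simp add: lcp_fun_def)
qed

lemma lce_add:
  assumes "matches T a b r"
  shows "lce T a b = r + lce T (a + r) (b + r)"
proof (rule antisym)
  have l: "a \<le> length T" "b \<le> length T" "a + r \<le> length T" "b + r \<le> length T"
    using assms by (auto simp: matches_def)
  have "r \<le> lce T a b" using assms l by (simp add: matches_lce_iff)
  then obtain k where k: "lce T a b = r + k" using le_Suc_ex by blast
  then have "matches T (a + r) (b + r) k" using matches_lce[OF l(1,2)] by (simp add: matches_add)
  then show "lce T a b \<le> r + lce T (a + r) (b + r)" using l k by (simp add: matches_lce_iff)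
  have "matches T a b (r + lce T (a + r) (b + r))" using assms l by (simp add: matches_add matches_lce)
  then show "r + lce T (a + r) (b + r) \<le> lce T a b" using l by (simp add: matches_lce_iff)
qed

text \<open>After the common shift \<open>r\<close> both positions are sampled, and the extension is
  \<open>r\<close> plus that of the sampled suffixes, a range minimum between their ranks. The ranks
  are ordered first: the extension is symmetric in the two positions, but the range is not.\<close>

lemma wp_sampled_query:
  assumes t: "index_table s xs (arrs \<sigma>)"
    and v: "vars \<sigma> 0 = length T" "vars \<sigma> 2 = a + 1" "vars \<sigma> 3 = b + 1" "a < length T" "b < length T" "0 < s" "s * s \<le> length T"
    and fits: "2 * slots s (length T) \<le> S" "6 < K" "2 * S + 2 < 2 ^ w" "4 * length T + 4 < 2 ^ w"
  shows "wp sampled_query (\<lambda>\<sigma>'. vars \<sigma>' 0 = lce T a b \<and> arrs \<sigma>' = arrs \<sigma> \<and>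
    clk \<sigma>' \<le> clk \<sigma> + 3000 + 200 * (s * s)) \<sigma>"
proof (cases "a = b")
  case True
  have "lce T b b = length T - b" using v(5) by (intro lce_eqI) (auto simp: matches_def)
  then show ?thesis
    unfolding sampled_query_def using True v fits by (simp add: wp_simps)
next
  case False
  define m where "m = length xs"
  define bs where "bs = floorlog 2 m"
  define g where "g = lcp_fun T xs"
  have tt: "sorted_wrt (sless T) xs" "set xs = {p. p < length T \<and> sampled s p}" "suffix_table T xs (arrs \<sigma>)"
    "\<And>i. i < m \<Longrightarrow> arrs \<sigma> 2 (slot s (xs ! i)) = i" "rmq_table g m bs (arrs \<sigma>)"
    "arrs \<sigma> 6 0 = s" "arrs \<sigma> 6 1 = bs" "arrs \<sigma> 6 2 = m div bs + 1"
    using t by (simp_all add: index_table_def m_def bs_def g_def)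
  have Tn: "T \<noteq> []" using v(4) by auto
  note sb = sample_bounds[OF tt(1,2) v(6), folded m_def g_def]
  have ss: "s * s < 2 ^ w" using v fits by linarith
  have ab: "a + 1 < 2 ^ w" "b + 1 < 2 ^ w" using v fits by linarith+
  have S2: "2 < S"
    using fits(1) by (simp add: slots_def)
  have fits2: "2 * m \<le> S" "4 * m + 2 < 2 ^ w" "5 < K" "0 < S" "1 < S" "2 < K"
    using fits sb(1) S2 by linarith+
  have A1: "arrs \<sigma> 1 i = g i" if "i < m" for i using tt(3) that by (simp add: suffix_table_def m_def g_def)
  have slp: "slots s (p + 1) < 2 ^ w" "slot s p < S" if "p < length T" "sampled s p" for p
  proof -
    have "(p + 1) div s \<le> length T div s" using that by (intro div_le_mono) simp
    then have "slots s (p + 1) \<le> slots s (length T)" by (simp add: slots_def)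
    then show "slots s (p + 1) < 2 ^ w" using fits by linarith
    show "slot s p < S" using slot_less[OF v(6) that(2,1)] fits by linarith
  qed
  show ?thesis
    unfolding sampled_query_def
    apply (simp add: wp_simps v False tt(6-8) fits(2) S2 fits2 ss ab)
    apply (rule wp_shift_loop[where s = s and a = a and b = b])
    using v fits apply simp_all[9]
    subgoal premises p for f c
    proof (cases "f 18 = 0")
      case True
      then show ?thesis using p by (simp add: wp_simps)
    next
      case f18: False
      define r where "r = f 12"
      have f: "matches T a b r" "f 13 = a + r" "f 14 = b + r" "a + r < length T" "b + r < length T"
        "sampled s (a + r)" "sampled s (b + r)" "f 12 = r"
        using p(2) f18 by (auto simp: r_def)
      have fv: "f 5 = s" "f 6 = s * s" "f 7 = bs" "f 8 = m div bs + 1" "f 4 = length T"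
        using p(1) v by (simp_all add: agree_def)
      obtain i j where i: "i < m" "xs ! i = a + r" and j: "j < m" "xs ! j = b + r"
        using f tt(2) unfolding m_def by (metis (mono_tags, lifting) in_set_conv_nth mem_Collect_eq)
      have A2: "arrs \<sigma> 2 (slot s (a + r)) = i" "arrs \<sigma> 2 (slot s (b + r)) = j"
        using tt(4)[OF i(1)] tt(4)[OF j(1)] i(2) j(2) by simp_all
      have ij: "i \<noteq> j" using i j False by auto
      have W: "i + 1 < 2 ^ w" "j + 1 < 2 ^ w" using i j fits2 by linarith+
      have rm: "x = lce T (a + r) (b + r)" if "is_min g (min i j + 1) (max i j) x" for x
      proof -
        have "is_min g (min i j + 1) (max i j) (lce T (xs ! min i j) (xs ! max i j))"
          using lce_is_min[OF tt(1), of "min i j" "max i j"] tt(2) i j ij unfolding g_def m_def by auto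
        with that have "x = lce T (xs ! min i j) (xs ! max i j)" by (rule is_min_unique)
        also have "\<dots> = lce T (a + r) (b + r)"
          using i j f lce_sym[of "a + r" T "b + r"] by (simp add: min_def max_def)
        finally show ?thesis .
      qed
      have le: "lce T a b = r + lce T (a + r) (b + r)" by (rule lce_add[OF f(1)])
      have sum: "r + lce T (a + r) (b + r) < 2 ^ w" using lce_le[of a T b] v fits unfolding le by linarith
      have tail: "wp range_min (wp (0 ::= V 12 \<^bold>+ V 15) (\<lambda>\<sigma>'. vars \<sigma>' 0 = lce T a b \<and> arrs \<sigma>' = arrs \<sigma> \<and>
          clk \<sigma>' \<le> clk \<sigma> + 3000 + 200 * (s * s))) \<sigma>'"
        if "vars \<sigma>' 7 = bs" "vars \<sigma>' 8 = m div bs + 1" "vars \<sigma>' 12 = r" "vars \<sigma>' 13 = min i j + 1" "vars \<sigma>' 14 = max i j"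
          "arrs \<sigma>' = arrs \<sigma>" "clk \<sigma>' \<le> clk \<sigma> + 2000 + 200 * (s * s)" for \<sigma>'
      proof (rule wp_range_min[where g = g and m = m and b = bs])
        fix f' c'
        assume q: "agree {15..19} (vars \<sigma>') f'" "is_min g (min i j + 1) (max i j) (f' 15)" "c' \<le> clk \<sigma>' + 600"
        have "f' 12 = r" using q(1) that by (simp add: agree_def)
        then show "wp (0 ::= V 12 \<^bold>+ V 15) (\<lambda>\<sigma>'. vars \<sigma>' 0 = lce T a b \<and> arrs \<sigma>' = arrs \<sigma> \<and>
          clk \<sigma>' \<le> clk \<sigma> + 3000 + 200 * (s * s)) (\<sigma>'\<lparr>vars := f', clk := c'\<rparr>)"
          using that q(3) sum by (simp add: wp_simps rm[OF q(2)] le)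
      qed (use that tt(5) A1 sb(3)[OF Tn] bs_def fits2 i j ij in auto)
      have ps: "c \<le> clk \<sigma> + 500 + 200 * (s * s)" using p(3) by simp
      show ?thesis
        apply (simp add: wp_simps f18)
        apply (rule wp_slot_number[where s = s and p = "a + r"])
        using f fv v slp apply simp_all[6]
        subgoal for c1
          apply (simp add: wp_simps A2 slp f fits2)
          apply (rule wp_slot_number[where s = s and p = "b + r"])
          using f fv v slp apply simp_all[6]
          subgoal for c2
            using ij W ps
            apply (cases "j < i")
             apply (simp_all add: wp_simps A2 slp f fits2)
             apply (rule tail; simp add: fv f)
            apply (rule tail; simp add: fv f)
            done
          done
        done
    qed
    done
qed

text \<open>The number \<open>m\<close> of samples is at most \<open>slots s (length T)\<close> and
  at most \<open>length T\<close>. Hence the insertions, of order \<open>m * length T\<close>, and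
  the tables, of order \<open>m * m\<close>, both stay within the product of these two
  bounds.\<close>

lemma wp_build_index:
  assumes v: "vars \<sigma> 0 = length T" "vars \<sigma> 1 = \<tau>" "1 \<le> \<tau>" "\<tau> \<le> length T"
    and s: "s * s \<le> \<tau>" "\<tau> < (s + 1) * (s + 1)"
    and fits: "2 * slots s (length T) \<le> S" "6 < K" "4 * (length T + 2) * (length T + 2) < 2 ^ w" "2 * S + 2 < 2 ^ w"
  shows "wp build_index (\<lambda>\<sigma>'. \<exists>xs. index_table s xs (arrs \<sigma>') \<and>
    clk \<sigma>' \<le> clk \<sigma> + 2000 * length T + 9000 * (slots s (length T) * length T)) \<sigma>"
proof -
  let ?n = "length T"
  have s0: "0 < s" using s(2) v(3) by (cases s) auto
  have Tn: "T \<noteq> []" using v by auto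
  have n1: "1 \<le> ?n" using v by linarith
  have n4: "4 * ?n + 4 < 2 ^ w"
  proof -
    have "4 * ?n + 4 \<le> 4 * (?n + 2) * (?n + 2)" by (simp add: algebra_simps)
    then show ?thesis using fits by linarith
  qed
  have W: "(\<tau> + 2) * (\<tau> + 2) < 2 ^ w"
  proof -
    have "(\<tau> + 2) * (\<tau> + 2) \<le> (?n + 2) * (?n + 2)" using v by (intro mult_le_mono) auto
    also have "\<dots> \<le> 4 * (?n + 2) * (?n + 2)" by simp
    finally show ?thesis using fits by linarith
  qed
  have sq: "s' = s" if "s' * s' \<le> \<tau>" "\<tau> < (s' + 1) * (s' + 1)" for s'
  proof -
    have "x \<le> y" if "x * x \<le> \<tau>" "\<tau> < (y + 1) * (y + 1)" for x y
    proof (rule ccontr)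
      assume "\<not> x \<le> y"
      then have "(y + 1) * (y + 1) \<le> x * x" by (intro mult_le_mono) auto
      with that show False by linarith
    qed
    then show ?thesis using that s by (metis order_antisym)
  qed
  have S: "slots s ?n \<le> S" "slots s ?n < 2 ^ w" "2 < S" "0 < S" "1 < S"
    using fits by (auto simp: slots_def)
  have K: "1 < K" "2 < K" "3 < K" "4 < K" "5 < K" using fits by linarith+
  show ?thesis
    unfolding build_index_def
    apply (simp add: wp_simps v(1))
    apply (rule wp_square_root[where \<tau> = \<tau>])
    using v W apply simp_all[2]
    subgoal premises p for s' c1
    proof -
      have s': "s' = s" using p by (intro sq)
      show ?thesis
        unfolding s'
        apply (simp add: wp_simps)
        apply (rule wp_sort_samples[where s = s])
        using s0 S K n4 apply simp_all[7]
        subgoal premises q for f A c2 xs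
        proof -
          note sb = sample_bounds[OF q(5,6) s0]
          define m where "m = length xs"
          define b where "b = floorlog 2 m"
          define g where "g = lcp_fun T xs"
          have m: "m \<le> slots s ?n" "m \<le> ?n" "1 \<le> m" "\<And>i. i < m \<Longrightarrow> g i \<le> ?n"
            using sb Tn by (auto simp: m_def g_def)
          note bf = block_facts[OF m(3) b_def]
          have st: "A 0 i = xs ! i" "A 1 i = g i" if "i < m" for i
            using q(4) that by (simp_all add: suffix_table_def m_def g_def)
          have f: "f 4 = ?n" "f 5 = s" "f 6 = s * s" "f 8 = m"
            using q(1,2) by (simp_all add: agree_def m_def)
          have mm: "2 * m \<le> S" "m \<le> S" "m < 2 ^ w" "2 * m + 1 < 2 ^ w" "?n + 1 < 2 ^ w"
            using m fits n4 by linarith+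
          have mw: "4 * (m + 2) * (m + 2) < 2 ^ w"
          proof -
            have "4 * (m + 2) * (m + 2) \<le> 4 * (?n + 2) * (?n + 2)" using m by (intro mult_le_mono) auto
            then show ?thesis using fits by linarith
          qed
          have b2: "2 ^ b \<le> S" "2 ^ b < (2::nat) ^ w" using bf mm by linarith+
          show ?thesis
            apply (simp add: wp_simps)
            apply (rule wp_fill_inverse[where s = s and xs = xs and n = ?n])
            using f q(6) sb(4) s0 S K mm st apply (simp_all add: m_def)[12]
            subgoal premises r for f3 A3 c3
            proof -
              have a3: "agree {7, 15, 16} f f3" "agree {2} A A3" using r(1,2) by simp_all
              show ?thesis
                apply (simp add: wp_simps)
                apply (rule wp_block_size[where m = m and b = b])
                using a3 f m mm apply (simp_all add: agree_def b_def)[4]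
                subgoal premises r4 for f4 c4
                proof -
                  have a4: "agree {9, 10, 11, 23, 24} f3 f4" using r4(1) by simp
                  show ?thesis
                    apply (simp add: wp_simps)
                    apply (rule wp_fill_logs[where M = "2 ^ b"])
                    using r4 b2 K apply simp_all[5]
                    subgoal premises r5 for f5 A5 c5
                    proof -
                      have a5: "agree {7} f4 f5" "agree {3} A3 A5" using r5(1,2) by simp_all
                      have f5: "f5 4 = ?n" "f5 8 = m" "f5 9 = b" "f5 23 = m div b + 1" "f5 5 = s"
                        using a3 a4 a5 f r4 by (simp_all add: agree_def)
                      have A5: "A5 1 i = g i" if "i < m" for i using a3 a5 st that by (simp add: agree_def)
                      show ?thesis
                        apply (simp add: wp_simps)
                        apply (rule wp_fill_marks[where n = ?n and m = m and b = b and g = g])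
                        using f5 m mm K A5 b_def apply simp_all[11]
                        subgoal premises r6 for f6 A6 c6
                        proof -
                          have a6: "agree {7, 10, 25, 26, 27, 28} f5 f6" "agree {4} A5 A6" using r6(1,2) by simp_all
                          have f6: "f6 4 = ?n" "f6 8 = m" "f6 9 = b" "f6 23 = m div b + 1" "f6 5 = s"
                            using a6 f5 by (simp_all add: agree_def)
                          have A6: "A6 1 i = g i" if "i < m" for i using a6 A5 that by (simp add: agree_def)
                          show ?thesis
                            apply (simp add: wp_simps)
                            apply (rule wp_fill_sparse[where n = ?n and m = m and b = b and g = g])
                            using f6 m mm mw K A6 b_def apply simp_all[11]
                            subgoal premises r7 for f7 A7 c7
                            proof -
                              have a7: "agree {7, 10, 24, 25, 26, 27, 28, 29} f6 f7" "agree {5} A6 A7" using r7(1,2) by simp_all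
                              have f7: "f7 5 = s" "f7 9 = b" "f7 23 = m div b + 1"
                                using a7 f6 by (simp_all add: agree_def)
                              have it: "index_table s xs A8" if "agree {6} A7 A8" "A8 6 0 = s" "A8 6 1 = b" "A8 6 2 = m div b + 1" for A8
                              proof -
                                have "A8 0 = A 0" "A8 1 = A 1" "A8 2 = A3 2" "A8 3 = A5 3" "A8 4 = A6 4" "A8 5 = A7 5"
                                  using that(1) a3(2) a5(2) a6(2) a7(2) by (simp_all add: agree_def)
                                then show ?thesis
                                  using that q(4-6) r(3) r5(3) r6(3) r7(3)
                                  by (simp add: index_table_def rmq_table_def suffix_table_def m_def[symmetric] b_def[symmetric] g_def[symmetric])
                              qed
                              have "m * ?n \<le> slots s ?n * ?n" "m * m \<le> slots s ?n * ?n" "m * 1 \<le> slots s ?n * ?n"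
                                using mult_le_mono[OF m(1,2)] mult_le_mono[OF m(1) n1] mult_le_mono[OF m(1), of ?n ?n] by simp_all
                              moreover have "c7 \<le> clk \<sigma> + 1500 + 200 * ?n + 5000 * m + 700 * (m * ?n) + 400 * (m * m)"
                                using p(3) q(7) r(4) r4(5) r5(4) r6(4) r7(4) bf(3) v(4)
                                unfolding m_def[symmetric] by (simp add: algebra_simps)
                              ultimately have "c7 + 100 \<le> clk \<sigma> + 2000 * ?n + 9000 * (slots s ?n * ?n)"
                                using n1 by linarith
                              then show ?thesis
                                using S fits by (auto simp add: wp_simps f7 intro!: exI[of _ xs] it)
                            qed
                            done
                        qed
                        done
                    qed
                    done
                qed
                done
            qed
            done
        qed
        done
    qed
    done
qed

end

section \<open>Bounds in terms of the square root of the parameter\<close>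

lemma rand_free_build_index: "rand_free (compile 8 build_index)"
  by (simp add: build_index_def square_root_def sort_samples_def scan_def shift_def extend_def suffix_less_def
      fill_inverse_def slot_number_def block_size_def bitlength_def fill_logs_def fill_marks_def fill_sparse_def)

lemma rand_free_sampled_query: "rand_free (compile 8 sampled_query)"
  by (simp add: sampled_query_def shift_loop_def slot_number_def range_min_def)

text \<open>As \<open>sqrt \<tau> < s + 1\<close> and \<open>s \<ge> 1\<close>, \<open>s\<close> is
  at least half of \<open>sqrt \<tau>\<close>; and
  \<open>s \<le> sqrt \<tau> \<le> n / sqrt \<tau>\<close> absorbs the summand \<open>s\<close> of
  \<open>slots\<close>. The three summands contribute 4, 2 and 2 to the constant.\<close>

lemma sample_size_bounds:
  fixes s \<tau> n :: nat
  assumes s: "s * s \<le> \<tau>" "\<tau> < (s + 1) * (s + 1)" and \<tau>: "1 \<le> \<tau>" "\<tau> \<le> n"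
  shows "real (slots s n) \<le> 8 * (n / sqrt \<tau>)" "1 \<le> n / sqrt \<tau>"
proof -
  have s1: "1 \<le> s" using s(2) \<tau>(1) by (cases s) auto
  have sq: "sqrt \<tau> * sqrt \<tau> = \<tau>" "1 \<le> sqrt \<tau>" using \<tau> by simp_all
  have "real s * real s \<le> sqrt \<tau> * sqrt \<tau>" unfolding sq using s(1) by (metis of_nat_le_iff of_nat_mult)
  then have ss: "real s \<le> sqrt \<tau>" by (simp add: real_le_rsqrt power2_eq_square)
  have "real \<tau> < real ((s + 1) * (s + 1))" using s(2) by (simp only: of_nat_less_iff)
  then have "sqrt \<tau> < real s + 1" by (intro real_less_lsqrt) (simp_all add: power2_eq_square algebra_simps)
  then have s2: "sqrt \<tau> \<le> 2 * real s" using s1 by simp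
  have "real \<tau> \<le> real n" using \<tau> by simp
  then have q: "sqrt \<tau> \<le> n / sqrt \<tau>" using sq by (simp add: field_simps)
  then show q1: "1 \<le> n / sqrt \<tau>" using sq by linarith
  have "real (n div s) \<le> n / s" by (rule of_nat_div_le_of_nat)
  also have "\<dots> \<le> 2 * (n / sqrt \<tau>)"
  proof -
    have "n * sqrt \<tau> \<le> n * (2 * real s)" using s2 by (intro mult_left_mono) auto
    then show ?thesis using s1 sq(2) by (simp add: field_simps)
  qed
  finally show "real (slots s n) \<le> 8 * (n / sqrt \<tau>)"
    using q q1 ss unfolding slots_def of_nat_add of_nat_mult by simp
qed

lemma floor_square_root: "\<exists>s. s * s \<le> \<tau> \<and> \<tau> < (s + 1) * (s + (1::nat))"
proof (induction \<tau>)
  case (Suc \<tau>)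
  then obtain s where s: "s * s \<le> \<tau>" "\<tau> < (s + 1) * (s + 1)" by blast
  show ?case
  proof (cases "Suc \<tau> < (s + 1) * (s + 1)")
    case True
    then show ?thesis using s by (intro exI[of _ s]) auto
  next
    case False
    then have "Suc \<tau> = (s + 1) * (s + 1)" using s by linarith
    then show ?thesis by (intro exI[of _ "s + 1"]) (simp add: algebra_simps)
  qed
qed (auto intro: exI[of _ 0])

lemma deterministic_data_structure:
  fixes \<sigma> :: nat
  shows "\<exists>\<kappa> P Q (C::real). 0 < \<kappa> \<and> \<sigma> \<le> \<kappa> \<and> rand_free P \<and> rand_free Q \<and>
        (\<forall>T n \<tau> w. T \<in> texts \<sigma> \<and> n = length T \<and> 1 \<le> \<tau> \<and> \<tau> \<le> n \<and> w = word_bits \<kappa> n \<longrightarrow>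
          (\<forall>c \<in> set_pmf (preprocess w T \<tau> P (nfloor (C * (n / sqrt \<tau>))) (nfloor (C * (n\<^sup>2 / sqrt \<tau>)))).
            halted c \<and>
            (\<forall>i\<in>{1..n}. \<forall>j\<in>{1..n}.
              answers w T \<tau> Q (memory c) i j (nfloor (C * \<tau>)) (length (LCE T i j)))))"
proof -
  define \<kappa> where "\<kappa> = \<sigma> + 40"
  define P where "P = compile 8 build_index"
  define Q where "Q = compile 8 sampled_query"
  \<comment> \<open>Space needs the factor \<open>16 * 8\<close>, construction
    \<open>2000 + 9000 * 8\<close>, and a query 3200.\<close>
  define C :: real where "C = 80000"
  have *: "\<forall>x \<in> set_pmf (preprocess w T \<tau> P (nfloor (C * (length T / sqrt \<tau>))) (nfloor (C * ((length T)\<^sup>2 / sqrt \<tau>)))).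
      halted x \<and> (\<forall>i\<in>{1..length T}. \<forall>j\<in>{1..length T}.
        answers w T \<tau> Q (memory x) i j (nfloor (C * \<tau>)) (length (LCE T i j)))"
    if \<tau>: "1 \<le> \<tau>" "\<tau> \<le> length T" and w: "w = word_bits \<kappa> (length T)" for T \<tau> w
  proof -
    let ?n = "length T"
    define L where "L = floorlog 2 ?n"
    define X :: nat where "X = 2 ^ L"
    have n0: "?n \<noteq> 0" using \<tau> by linarith
    then have "L \<noteq> 0" by (simp add: L_def floorlog_eq_zero_iff)
    then have L1: "1 \<le> L" by linarith
    have nX: "?n < X" using floorlog_bounds[of ?n 2] n0 by (simp add: X_def L_def)
    have "(2::nat) ^ 1 \<le> 2 ^ L" using L1 by (intro power_increasing) auto
    then have X2: "2 \<le> X" by (simp add: X_def)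
    have "40 * L \<le> w" unfolding w word_bits_def L_def[symmetric] \<kappa>_def by (intro mult_le_mono1) simp
    then have w40: "10 * L \<le> w" "10 \<le> w" using L1 by linarith+
    \<comment> \<open>From \<open>X \<ge> 2\<close>, eight of the ten factors \<open>X\<close>
      available below \<open>2 ^ w\<close> pay for the constant 256.\<close>
    have big: "256 * (X * X) \<le> 2 ^ w"
    proof -
      have "(2::nat) ^ 8 \<le> X ^ 8" using X2 by (intro power_mono) auto
      then have "2 ^ 8 * X\<^sup>2 \<le> X ^ 8 * X\<^sup>2" by (rule mult_le_mono1)
      also have "\<dots> = 2 ^ (10 * L)" by (simp add: X_def mult.commute flip: power_add power_mult)
      also have "\<dots> \<le> 2 ^ w" using w40 by (intro power_increasing) auto
      finally show ?thesis by (simp add: power2_eq_square)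
    qed
    have XX: "X \<le> X * X" "0 < X * X" using X2 by auto
    obtain s where s: "s * s \<le> \<tau>" "\<tau> < (s + 1) * (s + 1)" using floor_square_root by blast
    have s1: "0 < s" using s(2) \<tau>(1) by (cases s) auto
    have sn: "s \<le> ?n"
    proof -
      have "s * 1 \<le> s * s" using s1 by (intro mult_le_mono2) simp
      then show ?thesis using s \<tau> by linarith
    qed
    \<comment> \<open>Twice the number of slots, since the sparse table and the table of logarithms
      may need two cells per sample.\<close>
    define S where "S = 2 * slots s ?n"
    have "2 * (2 * (x + s) + 2) \<le> 8 * y + 4" if "x \<le> y" "s \<le> y" for x y :: nat
      using that by simp
    from this[OF div_le_dividend sn] have "S \<le> 8 * ?n + 4" unfolding S_def slots_def .
    then have Sw: "8 * S < 2 ^ w" "2 * S + 2 < 2 ^ w" "?n < 2 ^ w" "4 * ?n + 4 < 2 ^ w" using nX X2 big XX by linarith+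
    have nn: "4 * (?n + 2) * (?n + 2) < 2 ^ w"
    proof -
      have "4 * (?n + 2) * (?n + 2) \<le> 4 * (2 * X) * (2 * X)" using nX X2 by (intro mult_le_mono) auto
      also have "\<dots> = 16 * (X * X)" by simp
      finally show ?thesis using big XX by linarith
    qed
    interpret machine w T 8 S by unfold_locales (use Sw w40 in auto)
    note sb = sample_size_bounds[OF s \<tau>]
    define M where "M = nfloor (C * (?n / sqrt \<tau>))"
    define t where "t = nfloor (C * (?n\<^sup>2 / sqrt \<tau>))"
    have SM: "8 * S \<le> M"
    proof -
      have "real (8 * S) \<le> C * (?n / sqrt \<tau>)" unfolding S_def using sb by (simp add: C_def)
      then show ?thesis unfolding M_def by linarith
    qed
    have time: "2000 * ?n + 9000 * (slots s ?n * ?n) \<le> t"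
    proof -
      have "real (2000 * ?n + 9000 * (slots s ?n * ?n)) = 2000 * (real ?n * 1) + 9000 * (real ?n * real (slots s ?n))" by simp
      also have "\<dots> \<le> 2000 * (real ?n * (?n / sqrt \<tau>)) + 9000 * (real ?n * (8 * (?n / sqrt \<tau>)))"
      proof -
        have "real ?n * 1 \<le> real ?n * (?n / sqrt \<tau>)" by (rule mult_left_mono[OF sb(2)]) simp
        moreover have "real ?n * real (slots s ?n) \<le> real ?n * (8 * (?n / sqrt \<tau>))" by (rule mult_left_mono[OF sb(1)]) simp
        ultimately show ?thesis by linarith
      qed
      also have "\<dots> = 74000 * (?n\<^sup>2 / sqrt \<tau>)" by (simp add: power2_eq_square)
      also have "\<dots> \<le> C * (?n\<^sup>2 / sqrt \<tau>)" by (intro mult_right_mono) (auto simp: C_def)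
      finally show ?thesis unfolding t_def by linarith
    qed
    have W: "wp build_index (\<lambda>\<sigma>'. (\<exists>xs. index_table s xs (arrs \<sigma>')) \<and> clk \<sigma>' \<le> t) (init [?n, \<tau>] (\<lambda>_ _. 0) [])"
      apply (rule wp_mono[OF wp_build_index[where \<tau> = \<tau> and s = s]])
      using \<tau> s Sw nn time by (auto simp: init_def S_def)
    have "\<exists>(\<sigma>'::st) s'. ((\<exists>xs. index_table s xs (arrs \<sigma>')) \<and> clk \<sigma>' \<le> t) \<and>
        (dstep w T ^^ t) (start P [?n, \<tau>] (layout 8 M (\<lambda>_ _. 0)), []) = (([], s'), tape \<sigma>') \<and>
        regs s' 0 = vars \<sigma>' 0 \<and> mem s' = layout 8 M (arrs \<sigma>')"
      unfolding P_def by (rule wp_start[OF W SM]) simp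
    then obtain A xs s' us where A: "index_table s xs A" "mem s' = layout 8 M A"
      "(dstep w T ^^ t) (start P [?n, \<tau>] (replicate M 0), []) = (([], s'), us)"
      unfolding layout_zero by blast
    have pre: "preprocess w T \<tau> P M t = return_pmf ([], s')"
      unfolding preprocess_def
      by (subst run_rand_free) (simp add: start_def P_def rand_free_build_index, simp add: A(3))
    have "answers w T \<tau> Q (layout 8 M A) i j (nfloor (C * \<tau>)) (length (LCE T i j))"
      if ij: "i \<in> {1..?n}" "j \<in> {1..?n}" for i j
      unfolding Q_def
    proof (rule wp_answers[OF _ SM rand_free_sampled_query])
      have "real (3000 + 200 * (s * s)) \<le> real (3200 * \<tau>)" using s(1) \<tau>(1) by (subst of_nat_le_iff) linarith
      also have "\<dots> \<le> C * \<tau>" by (simp add: C_def)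
      finally have "3000 + 200 * (s * s) \<le> nfloor (C * \<tau>)" by linarith
      then show "wp sampled_query (\<lambda>\<sigma>'. vars \<sigma>' 0 = length (LCE T i j) \<and> arrs \<sigma>' = A \<and> clk \<sigma>' \<le> nfloor (C * \<tau>))
          (init [?n, \<tau>, i, j] A [])"
        apply (intro wp_mono[OF wp_sampled_query[where s = s and xs = xs and a = "i - 1" and b = "j - 1"]])
        using A(1) ij s \<tau> s1 Sw by (auto simp: init_def S_def length_LCE)
    qed
    then show ?thesis
      unfolding M_def[symmetric] t_def[symmetric] pre using A(2) by (simp add: halted_def memory_def)
  qed
  have "0 < \<kappa>" "\<sigma> \<le> \<kappa>" by (simp_all add: \<kappa>_def)
  moreover have "rand_free P" "rand_free Q"
    unfolding P_def Q_def by (rule rand_free_build_index rand_free_sampled_query)+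
  ultimately show ?thesis using *
    by (intro exI[of _ \<kappa>] exI[of _ P] exI[of _ Q] exI[of _ C]) auto
qed

theorem theorem1:
  fixes \<sigma> :: nat
  shows
    "(\<exists>\<kappa> P Q (C::real). 0 < \<kappa> \<and> \<sigma> \<le> \<kappa> \<and> rand_free P \<and> rand_free Q \<and>
        (\<forall>T n \<tau> w. T \<in> texts \<sigma> \<and> n = length T \<and> 1 \<le> \<tau> \<and> \<tau> \<le> n \<and> w = word_bits \<kappa> n \<longrightarrow>
          (\<forall>c \<in> set_pmf (preprocess w T \<tau> P (nfloor (C * (n / sqrt \<tau>))) (nfloor (C * (n\<^sup>2 / sqrt \<tau>)))).
            halted c \<and>
            (\<forall>i\<in>{1..n}. \<forall>j\<in>{1..n}.
              answers w T \<tau> Q (memory c) i j (nfloor (C * \<tau>)) (length (LCE T i j))))))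
     \<and>
     (\<forall>\<gamma>::real. \<exists>\<kappa> P Q (C::real). 0 < \<kappa> \<and> \<sigma> \<le> \<kappa> \<and>
        (\<forall>T n \<tau> w. T \<in> texts \<sigma> \<and> n = length T \<and> 1 \<le> \<tau> \<and> \<tau> \<le> n \<and> w = word_bits \<kappa> n \<longrightarrow>
          (let time = (\<lambda>l::nat. nfloor (C * (\<tau> * lg (l / \<tau>))));
               result = preprocess w T \<tau> P (nfloor (C * (n / \<tau>))) (nfloor (C * n))
           in (\<forall>c \<in> set_pmf result. halted c \<and>
                 (\<forall>i\<in>{1..n}. \<forall>j\<in>{1..n}. \<exists>r\<le>n.
                    answers w T \<tau> Q (memory c) i j (time (max r (length (LCE T i j)))) r)) \<and>
              measure_pmf.prob result
                {c. \<forall>i\<in>{1..n}. \<forall>j\<in>{1..n}.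
                   answers w T \<tau> Q (memory c) i j (time (length (LCE T i j))) (length (LCE T i j))}
                \<ge> 1 - 1 / n powr \<gamma>)))
     \<and>
     (\<forall>\<gamma>::real. \<exists>\<kappa> P Q (C::real). 0 < \<kappa> \<and> \<sigma> \<le> \<kappa> \<and>
        (\<forall>T n \<tau> w. T \<in> texts \<sigma> \<and> n = length T \<and> 1 \<le> \<tau> \<and> \<tau> \<le> n \<and> w = word_bits \<kappa> n \<longrightarrow>
          (let time = (\<lambda>l::nat. nfloor (C * (\<tau> * lg (l / \<tau>))));
               result = (\<lambda>t. preprocess w T \<tau> P (nfloor (C * n)) t)
           in (\<forall>t. \<forall>c \<in> set_pmf (result t). halted c \<longrightarrow>
                 (\<forall>i\<in>{1..n}. \<forall>j\<in>{1..n}.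
                    answers w T \<tau> Q (take (nfloor (C * (n / \<tau>))) (memory c)) i j
                      (time (length (LCE T i j))) (length (LCE T i j)))) \<and>
              (\<lambda>t. measure_pmf.prob (result t) {c. halted c}) \<longlonglongrightarrow> 1 \<and>
              measure_pmf.prob (result (nfloor (C * (n * lg n)))) {c. halted c}
                \<ge> 1 - 1 / n powr \<gamma>)))"
  by (intro conjI allI deterministic_data_structure monte_carlo_data_structure las_vegas_data_structure)

end
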